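(* Let $q_1$ have the form $$q_1(x)=\frac{\Delta\sqrt{D_0+D_1(x)}}{\sqrt{D_0+D_1(x)}}.$$ Then, as $\varepsilon\to0$, $$\sum_{|j|=0}^{d+1}\frac{\varepsilon^{|j|}}{j!}\partial^jV(x_0)\big(Q_{0j}+Q_{0j}^0\big)=\mathcal O(\varepsilon^{d+2}),\qquad \sum_{|i|=0}^{d+1}\frac{\varepsilon^{|i|}}{i!}\partial^iN(x_0,y)\big(Q_{i0}+Q_{i0}^0\big)=\mathcal O(\varepsilon^{d+2}),$$ where the index $0$ of the tensors is the vector of $\mathbb N^d$ with all components equal to zero. Moreover, the polarization tensor $M$ of the diffusion problem and the polarization tensor $\tilde M:=\sqrt{D_0}\,(Q+Q^0)$ of the Helmholtz problem are related by $$M_{ij}=\tilde M_{ij}\qquad\text{for }|i|=|j|=1,$$ $$\sum_{|j|=1}^{d+1}\sum_{|i|=1}^{d+1}\frac{\varepsilon^{|i|+|j|}}{i!\,j!}\partial^iN(x_0,y)\,\partial^jV(x_0)\big(M_{ij}-\tilde M_{ij}\big)=\mathcal O(\varepsilon^{d+2}).$$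
   Context: Multi-index notation: for $i\in\mathbb N^d$ ($\mathbb N\ni0$), $|i|=i_1+\dots+i_d$, $i!=i_1!\cdots i_d!$, $x^i=x_1^{i_1}\cdots x_d^{i_d}$, $\partial^i=\partial_1^{i_1}\cdots\partial_d^{i_d}$; $\sum_{|i|=a}^b$ sums over all $i\in\mathbb N^d$ with $a\le|i|\le b$; $\partial^iN(x_0,y)$ differentiates the first variable. Setting. $2\le d\le5$; $\Omega\subset\mathbb R^d$ is a bounded Lipschitz domain, $x_0\in\Omega$, $B$ is a bounded Lipschitz domain with $\operatorname{dist}(\partial\Omega,x_0+\varepsilon B)>d_0>0$ ($d_0$ independent of $\varepsilon$). $D_0>0$ is a constant, $D_1$ is a $C^2$ function with support included in $B$, and $D_0+D_1$ is strictly positive. $V$ is the solution of $\Delta V=0$ in $\Omega$, $\frac{\partial V}{\partial n}=g$ on $\partial\Omega$, $\int_{\partial\Omega}V\,d\sigma=0$, with $g\in L^2(\partial\Omega)$, $\int_{\partial\Omega}g\,d\sigma=0$. $N$ is the Green function: for $y\in\Omega$, $\Delta_xN(x,y)=-\delta(x-y)$ in $\Omega$, $\frac{\partial N}{\partial n_x}=-\frac1{|\partial\Omega|}$ on $\partial\Omega$, $\int_{\partial\Omega}N(x,y)\,d\sigma(x)=0$ (its derivatives at $x_0$ have traces in $y$ in $L^2(\partial\Omega)$). The relations involving $N(x_0,y)$ are for $y\in\partial\Omega$, with $\mathcal O(\varepsilon^{d+2})$ denoting a term bounded in $L^2(\partial\Omega)$ by $C\varepsilon^{d+2}$. $\Gamma$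 is the fundamental solution with $-\Delta\Gamma=\delta$: $\Gamma(x)=-\frac1{2\pi}\log|x|$ if $d=2$, $\frac1{(d-2)|S_{d-1}|}|x|^{2-d}$ if $d\ge3$ ($|S_{d-1}|$ = measure of the unit sphere). $T:L^2(B)\to L^2(B)$, $T\varphi(y)=\int_Bq_1(x)\varphi(x)\Gamma(x-y)\,dx$; for this $q_1$, $-1$ is not an eigenvalue of $T$. $\phi_j\in H^1(B)$ is the unique solution of $\phi_j+T\phi_j=-Tx^j$ in $B$. Tensors of the Helmholtz problem $-\Delta v^\varepsilon+\varepsilon^{-2}q_1(\frac{x-x_0}\varepsilon)v^\varepsilon=0$ in $\Omega$, $\frac{\partial v^\varepsilon}{\partial n}=g$ on $\partial\Omega$: $Q_{ij}=\int_Bq_1(x)x^jx^i\,dx$, $Q^0_{ij}=\int_Bq_1(x)\phi_j(x)x^i\,dx$, $i,j\in\mathbb N^d$. Polarization tensor of the diffusion problem $\nabla\cdot(D_0+D_1(\frac{x-x_0}\varepsilon))\nabla u^\varepsilon=0$: $M_{ij}=\int_BD_1(x)\nabla(x^j+\phi_{j0}^0(x))\cdot\nabla x^i\,dx$, where $\phi_{j0}^0$ is the unique weak solution in $H^1_{\rm loc}(\mathbb R^d)\cap C^\infty(\mathbb R^d\setminus\overline B)$ of $\nabla\cdot(D_0+D_1)\nabla\phi_{j0}^0=-\nabla\cdot(D_1\nabla x^j)$ in $\mathbb R^d$, $\phi_{j0}^0(x)=\mathcal O(|x|^{1-d})$ as $|x|\to\infty$.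
   Formalization: The polarization tensor of the Helmholtz problem is taken as D_0(Q+Q^0) instead of sqrt(D_0)(Q+Q^0): scaling (D_0,D_1) by c multiplies M by c but leaves Q+Q^0 unchanged, so the printed relation fails unless D_0=1 (where both agree) or M vanishes. *)

theory Defs
  imports "HOL-Analysis.Analysis" "HOL-Library.Landau_Symbols"
begin

section \<open>Multi-indices, partial derivatives, smoothness\<close>

type_synonym 'n mindex = "'n \<Rightarrow> nat"

definition msize :: "'n::finite mindex \<Rightarrow> nat" where
  "msize i = (\<Sum>k\<in>UNIV. i k)"

definition mfact :: "'n::finite mindex \<Rightarrow> real" where
  "mfact i = (\<Prod>k\<in>UNIV. fact (i k))"

definition mpow :: "'n::finite mindex \<Rightarrow> real ^ 'n \<Rightarrow> real" where
  "mpow i x = (\<Prod>k\<in>UNIV. (x $ k) ^ i k)"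

definition mzero :: "'n::finite mindex" where
  "mzero = (\<lambda>_. 0)"

definition partial :: "'n::finite \<Rightarrow> (real ^ 'n \<Rightarrow> real) \<Rightarrow> real ^ 'n \<Rightarrow> real" where
  "partial k f x = deriv (\<lambda>t. f (x + t *\<^sub>R axis k 1)) 0"

text \<open>An arbitrary but fixed enumeration of the coordinates, only used to fix the order of the
  differentiations in \<open>mpartial\<close>; for smooth functions this order is immaterial.\<close>

definition coords :: "'n::finite list" where
  "coords = (SOME ks. distinct ks \<and> set ks = UNIV)"

definition mpartial :: "'n::finite mindex \<Rightarrow> (real ^ 'n \<Rightarrow> real) \<Rightarrow> real ^ 'n \<Rightarrow> real" where
  "mpartial i f = foldr (\<lambda>k. partial k ^^ i k) coords f"

definition grad :: "(real ^ 'n::finite \<Rightarrow> real) \<Rightarrow> real ^ 'n \<Rightarrow> real ^ 'n" where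
  "grad f x = (\<chi> k. partial k f x)"

definition laplacian :: "(real ^ 'n::finite \<Rightarrow> real) \<Rightarrow> real ^ 'n \<Rightarrow> real" where
  "laplacian f x = (\<Sum>k\<in>UNIV. partial k (partial k f) x)"

text \<open>\<open>C\<^sup>m\<close> and \<open>C\<^sup>\<infinity>\<close> functions on an open set.\<close>

primrec Ck_on :: "nat \<Rightarrow> (real ^ 'n::finite) set \<Rightarrow> (real ^ 'n \<Rightarrow> real) \<Rightarrow> bool" where
  "Ck_on 0 S f \<longleftrightarrow> continuous_on S f"
| "Ck_on (Suc m) S f \<longleftrightarrow> f differentiable_on S \<and> (\<forall>k. Ck_on m S (partial k f))"

definition smooth_on :: "(real ^ 'n::finite) set \<Rightarrow> (real ^ 'n \<Rightarrow> real) \<Rightarrow> bool" where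
  "smooth_on S f \<longleftrightarrow> (\<forall>m. Ck_on m S f)"

definition supp :: "('a::topological_space \<Rightarrow> real) \<Rightarrow> 'a set" where
  "supp f = closure {x. f x \<noteq> 0}"

definition test_function :: "(real ^ 'n::finite) set \<Rightarrow> (real ^ 'n \<Rightarrow> real) \<Rightarrow> bool" where
  "test_function S \<psi> \<longleftrightarrow> smooth_on UNIV \<psi> \<and> compact (supp \<psi>) \<and> supp \<psi> \<subseteq> S"

section \<open>Lipschitz domains and surface measure\<close>

text \<open>Near every boundary point, and after a choice of a ``vertical'' unit direction \<open>\<nu>\<close>, the
  domain is the part of a ball lying above the graph of a Lipschitz function \<open>\<gamma>\<close> defined on the
  hyperplane orthogonal to \<open>\<nu>\<close>.\<close>

definition bounded_lipschitz_domain :: "'a::euclidean_space set \<Rightarrow> bool" where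
  "bounded_lipschitz_domain S \<longleftrightarrow>
     open S \<and> connected S \<and> bounded S \<and> S \<noteq> {} \<and>
     (\<forall>p\<in>frontier S. \<exists>\<nu> r L \<gamma>. norm \<nu> = 1 \<and> r > 0 \<and> L-lipschitz_on {v. v \<bullet> \<nu> = 0} \<gamma> \<and>
        S \<inter> ball p r = {x \<in> ball p r. \<gamma> (x - (x \<bullet> \<nu>) *\<^sub>R \<nu>) < x \<bullet> \<nu>})"

text \<open>The \<open>s\<close>-dimensional Hausdorff measure, normalised so that the \<open>n\<close>-dimensional one agrees with
  Lebesgue measure on \<open>n\<close>-dimensional subspaces. The boundedness condition is needed because
  \<open>diameter\<close> of an unbounded set is \<open>0\<close>.\<close>

definition hausdorff_outer :: "real \<Rightarrow> 'a::metric_space set \<Rightarrow> ennreal" where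
  "hausdorff_outer s A =
     (SUP \<delta>\<in>{0::real<..}.
        INF U\<in>{U :: nat \<Rightarrow> 'a set. A \<subseteq> (\<Union>n. U n) \<and> (\<forall>n. bounded (U n) \<and> diameter (U n) \<le> \<delta>)}.
          (\<Sum>n. ennreal (unit_ball_vol s * (diameter (U n) / 2) powr s)))"

definition hausdorff_measure :: "real \<Rightarrow> 'a::metric_space measure" where
  "hausdorff_measure s = measure_of UNIV (sets borel) (hausdorff_outer s)"

definition surface_measure :: "(real ^ 'n::finite) set \<Rightarrow> (real ^ 'n) measure" where
  "surface_measure S =
     restrict_space (hausdorff_measure (real CARD('n) - 1)) (frontier S)"

section \<open>Function spaces and traces\<close>

definition L2 :: "'a measure \<Rightarrow> ('a \<Rightarrow> 'b::euclidean_space) \<Rightarrow> bool" where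
  "L2 M f \<longleftrightarrow> f \<in> borel_measurable M \<and> integrable M (\<lambda>x. (norm (f x))\<^sup>2)"

definition L2_norm :: "'a measure \<Rightarrow> ('a \<Rightarrow> 'b::euclidean_space) \<Rightarrow> real" where
  "L2_norm M f = sqrt (\<integral>x. (norm (f x))\<^sup>2 \<partial>M)"

definition loc_integrable :: "(real ^ 'n::finite) set \<Rightarrow> (real ^ 'n \<Rightarrow> 'b::euclidean_space) \<Rightarrow> bool" where
  "loc_integrable S f \<longleftrightarrow> (\<forall>K. compact K \<and> K \<subseteq> S \<longrightarrow> integrable (lebesgue_on K) f)"

definition is_weak_grad ::
    "(real ^ 'n::finite) set \<Rightarrow> (real ^ 'n \<Rightarrow> real) \<Rightarrow> (real ^ 'n \<Rightarrow> real ^ 'n) \<Rightarrow> bool" where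
  "is_weak_grad S u G \<longleftrightarrow> loc_integrable S u \<and> loc_integrable S G \<and>
     (\<forall>\<psi> k. test_function S \<psi> \<longrightarrow>
        (\<integral>x. u x * partial k \<psi> x \<partial>lebesgue_on S) = - (\<integral>x. G x $ k * \<psi> x \<partial>lebesgue_on S))"

definition weakly_diff :: "(real ^ 'n::finite) set \<Rightarrow> (real ^ 'n \<Rightarrow> real) \<Rightarrow> bool" where
  "weakly_diff S u \<longleftrightarrow> (\<exists>G. is_weak_grad S u G)"

text \<open>A choice of the weak gradient, which is unique up to null sets.\<close>

definition wgrad :: "(real ^ 'n::finite) set \<Rightarrow> (real ^ 'n \<Rightarrow> real) \<Rightarrow> real ^ 'n \<Rightarrow> real ^ 'n" where
  "wgrad S u = (SOME G. is_weak_grad S u G)"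

definition H1 :: "(real ^ 'n::finite) set \<Rightarrow> (real ^ 'n \<Rightarrow> real) \<Rightarrow> bool" where
  "H1 S u \<longleftrightarrow> weakly_diff S u \<and> L2 (lebesgue_on S) u \<and> L2 (lebesgue_on S) (wgrad S u)"

definition W11 :: "(real ^ 'n::finite) set \<Rightarrow> (real ^ 'n \<Rightarrow> real) \<Rightarrow> bool" where
  "W11 S u \<longleftrightarrow>
     weakly_diff S u \<and> integrable (lebesgue_on S) u \<and> integrable (lebesgue_on S) (wgrad S u)"

definition H1_loc :: "(real ^ 'n::finite) set \<Rightarrow> (real ^ 'n \<Rightarrow> real) \<Rightarrow> bool" where
  "H1_loc S u \<longleftrightarrow> weakly_diff S u \<and>
     (\<forall>K. compact K \<and> K \<subseteq> S \<longrightarrow> L2 (lebesgue_on K) u \<and> L2 (lebesgue_on K) (wgrad S u))"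

text \<open>\<open>h\<close> is the trace on \<open>\<partial>\<Omega>\<close> of the \<open>H\<^sup>1(\<Omega>)\<close> function \<open>u\<close>: the boundary trace is the continuous
  extension to \<open>H\<^sup>1(\<Omega>)\<close> of the restriction of functions smooth up to the boundary.\<close>

definition has_trace ::
    "(real ^ 'n::finite) set \<Rightarrow> (real ^ 'n \<Rightarrow> real) \<Rightarrow> (real ^ 'n \<Rightarrow> real) \<Rightarrow> bool" where
  "has_trace \<Omega> u h \<longleftrightarrow> H1 \<Omega> u \<and> L2 (surface_measure \<Omega>) h \<and>
     (\<exists>v :: nat \<Rightarrow> real ^ 'n \<Rightarrow> real. (\<forall>n. smooth_on UNIV (v n)) \<and>
        (\<lambda>n. L2_norm (lebesgue_on \<Omega>) (\<lambda>x. v n x - u x)) \<longlonglongrightarrow> 0 \<and>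
        (\<lambda>n. L2_norm (lebesgue_on \<Omega>) (\<lambda>x. grad (v n) x - wgrad \<Omega> u x)) \<longlonglongrightarrow> 0 \<and>
        (\<lambda>n. L2_norm (surface_measure \<Omega>) (\<lambda>x. v n x - h x)) \<longlonglongrightarrow> 0)"

text \<open>The same for functions which are only \<open>H\<^sup>1\<close> near \<open>\<partial>\<Omega>\<close>, such as functions with a
  singularity in the interior of \<open>\<Omega>\<close>.\<close>

definition has_boundary_trace ::
    "(real ^ 'n::finite) set \<Rightarrow> (real ^ 'n \<Rightarrow> real) \<Rightarrow> (real ^ 'n \<Rightarrow> real) \<Rightarrow> bool" where
  "has_boundary_trace \<Omega> f h \<longleftrightarrow>
     (\<exists>u K. compact K \<and> K \<subseteq> \<Omega> \<and> (AE x in lebesgue_on (\<Omega> - K). f x = u x) \<and> has_trace \<Omega> u h)"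

text \<open>\<open>F \<epsilon> = O(\<epsilon>\<^sup>n)\<close> in \<open>L\<^sup>2(M)\<close>, as \<open>\<epsilon> \<rightarrow> 0+\<close>.\<close>

definition bigO_L2 :: "'a measure \<Rightarrow> (real \<Rightarrow> 'a \<Rightarrow> real) \<Rightarrow> nat \<Rightarrow> bool" where
  "bigO_L2 M F n \<longleftrightarrow>
     (\<exists>C. \<forall>\<^sub>F \<epsilon> in at_right 0. L2 M (F \<epsilon>) \<and> L2_norm M (F \<epsilon>) \<le> C * \<epsilon> ^ n)"

section \<open>Background potential, Neumann function, fundamental solution\<close>

text \<open>Variational solution of \<open>\<Delta>V = 0\<close> in \<open>\<Omega>\<close>, \<open>\<partial>V/\<partial>n = g\<close> on \<open>\<partial>\<Omega>\<close>, with zero boundary mean.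
  \<open>V\<close> is the representative that is smooth in \<open>\<Omega>\<close>.\<close>

definition neumann_solution ::
    "(real ^ 'n::finite) set \<Rightarrow> (real ^ 'n \<Rightarrow> real) \<Rightarrow> (real ^ 'n \<Rightarrow> real) \<Rightarrow> bool" where
  "neumann_solution \<Omega> g V \<longleftrightarrow> smooth_on \<Omega> V \<and> H1 \<Omega> V \<and>
     (\<forall>w h. has_trace \<Omega> w h \<longrightarrow>
        (\<integral>x. wgrad \<Omega> V x \<bullet> wgrad \<Omega> w x \<partial>lebesgue_on \<Omega>) = (\<integral>x. g x * h x \<partial>surface_measure \<Omega>)) \<and>
     (\<exists>h. has_trace \<Omega> V h \<and> (\<integral>x. h x \<partial>surface_measure \<Omega>) = 0)"

text \<open>Variational form of \<open>\<Delta>\<^sub>x N(x,y) = - \<delta>(x - y)\<close> in \<open>\<Omega>\<close>, \<open>\<partial>N/\<partial>n\<^sub>x = - 1/|\<partial>\<Omega>|\<close> and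
  \<open>\<integral>\<^sub>\<partial>\<^sub>\<Omega> N(x,y) d\<sigma>(x) = 0\<close>, tested with functions smooth up to the boundary. \<open>N(\<cdot>,y)\<close> is \<open>H\<^sup>1\<close> near
  \<open>\<partial>\<Omega>\<close> (being contained in the existence of the trace), which makes it unique.\<close>

definition neumann_function ::
    "(real ^ 'n::finite) set \<Rightarrow> (real ^ 'n \<Rightarrow> real ^ 'n \<Rightarrow> real) \<Rightarrow> bool" where
  "neumann_function \<Omega> N \<longleftrightarrow>
     (\<forall>y\<in>\<Omega>. smooth_on (\<Omega> - {y}) (\<lambda>x. N x y) \<and> W11 \<Omega> (\<lambda>x. N x y) \<and>
        (\<forall>w. smooth_on UNIV w \<longrightarrow>
           (\<integral>x. wgrad \<Omega> (\<lambda>x. N x y) x \<bullet> grad w x \<partial>lebesgue_on \<Omega>) =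
             w y - (\<integral>x. w x \<partial>surface_measure \<Omega>) / measure (surface_measure \<Omega>) (frontier \<Omega>)) \<and>
        (\<exists>h. has_boundary_trace \<Omega> (\<lambda>x. N x y) h \<and> (\<integral>x. h x \<partial>surface_measure \<Omega>) = 0))"

text \<open>The surface area of the unit sphere of an \<open>n\<close>-dimensional space is \<open>n\<close> times the volume of
  the unit ball.\<close>

definition fundamental_solution :: "real ^ 'n::finite \<Rightarrow> real" where
  "fundamental_solution x =
     (if CARD('n) = 2 then - ln (norm x) / (2 * pi)
      else norm x powr (2 - real CARD('n)) /
             ((real CARD('n) - 2) * (real CARD('n) * unit_ball_vol (real CARD('n)))))"

section \<open>Helmholtz and diffusion tensors\<close>

definition liouville_potential ::
    "real \<Rightarrow> (real ^ 'n::finite \<Rightarrow> real) \<Rightarrow> real ^ 'n \<Rightarrow> real" where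
  "liouville_potential D0 D1 x = laplacian (\<lambda>z. sqrt (D0 + D1 z)) x / sqrt (D0 + D1 x)"

definition T_op :: "(real ^ 'n::finite) set \<Rightarrow> (real ^ 'n \<Rightarrow> real) \<Rightarrow>
    (real ^ 'n \<Rightarrow> real) \<Rightarrow> real ^ 'n \<Rightarrow> real" where
  "T_op B q \<phi> y = (\<integral>x. q x * \<phi> x * fundamental_solution (x - y) \<partial>lebesgue_on B)"

definition eigenvalue_T ::
    "(real ^ 'n::finite) set \<Rightarrow> (real ^ 'n \<Rightarrow> real) \<Rightarrow> real \<Rightarrow> bool" where
  "eigenvalue_T B q c \<longleftrightarrow>
     (\<exists>\<phi>. L2 (lebesgue_on B) \<phi> \<and> \<not> (AE y in lebesgue_on B. \<phi> y = 0) \<and>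
        (AE y in lebesgue_on B. T_op B q \<phi> y = c * \<phi> y))"

definition helmholtz_corrector :: "(real ^ 'n::finite) set \<Rightarrow> (real ^ 'n \<Rightarrow> real) \<Rightarrow>
    'n mindex \<Rightarrow> (real ^ 'n \<Rightarrow> real) \<Rightarrow> bool" where
  "helmholtz_corrector B q j \<phi> \<longleftrightarrow> H1 B \<phi> \<and>
     (AE y in lebesgue_on B. \<phi> y + T_op B q \<phi> y = - T_op B q (mpow j) y)"

definition Q_tensor :: "(real ^ 'n::finite) set \<Rightarrow> (real ^ 'n \<Rightarrow> real) \<Rightarrow>
    'n mindex \<Rightarrow> 'n mindex \<Rightarrow> real" where
  "Q_tensor B q i j = (\<integral>x. q x * mpow j x * mpow i x \<partial>lebesgue_on B)"

definition Q0_tensor :: "(real ^ 'n::finite) set \<Rightarrow> (real ^ 'n \<Rightarrow> real) \<Rightarrow>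
    ('n mindex \<Rightarrow> real ^ 'n \<Rightarrow> real) \<Rightarrow> 'n mindex \<Rightarrow> 'n mindex \<Rightarrow> real" where
  "Q0_tensor B q \<phi> i j = (\<integral>x. q x * \<phi> j x * mpow i x \<partial>lebesgue_on B)"

text \<open>Normalisation: the factor is \<open>D\<^sub>0\<close>. The factor \<open>\<surd>D\<^sub>0\<close> found in the source is correct only if
  \<open>D\<^sub>0 = 1\<close> (where both agree) or in degenerate cases: replacing \<open>(D\<^sub>0, D\<^sub>1)\<close> by \<open>(c D\<^sub>0, c D\<^sub>1)\<close>
  leaves the potential, both correctors and \<open>Q + Q\<^sup>0\<close> unchanged and multiplies \<open>M\<close> by \<open>c\<close>, so a
  relation \<open>M = \<surd>D\<^sub>0 (Q + Q\<^sup>0)\<close> for all \<open>D\<^sub>0\<close> would force \<open>M = 0\<close>.\<close>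

definition M_helmholtz :: "real \<Rightarrow> (real ^ 'n::finite) set \<Rightarrow> (real ^ 'n \<Rightarrow> real) \<Rightarrow>
    ('n mindex \<Rightarrow> real ^ 'n \<Rightarrow> real) \<Rightarrow> 'n mindex \<Rightarrow> 'n mindex \<Rightarrow> real" where
  "M_helmholtz D0 B q \<phi> i j = D0 * (Q_tensor B q i j + Q0_tensor B q \<phi> i j)"

definition diffusion_corrector :: "(real ^ 'n::finite) set \<Rightarrow> real \<Rightarrow> (real ^ 'n \<Rightarrow> real) \<Rightarrow>
    'n mindex \<Rightarrow> (real ^ 'n \<Rightarrow> real) \<Rightarrow> bool" where
  "diffusion_corrector B D0 D1 j \<phi> \<longleftrightarrow> H1_loc UNIV \<phi> \<and> smooth_on (- closure B) \<phi> \<and>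
     (\<forall>\<psi>. test_function UNIV \<psi> \<longrightarrow>
        (\<integral>x. (D0 + D1 x) * (wgrad UNIV \<phi> x \<bullet> grad \<psi> x) \<partial>lebesgue) =
          - (\<integral>x. D1 x * (grad (mpow j) x \<bullet> grad \<psi> x) \<partial>lebesgue)) \<and>
     \<phi> \<in> O[at_infinity](\<lambda>x. norm x powr (1 - real CARD('n)))"

definition M_diffusion :: "(real ^ 'n::finite) set \<Rightarrow> (real ^ 'n \<Rightarrow> real) \<Rightarrow>
    ('n mindex \<Rightarrow> real ^ 'n \<Rightarrow> real) \<Rightarrow> 'n mindex \<Rightarrow> 'n mindex \<Rightarrow> real" where
  "M_diffusion B D1 \<phi>0 i j =
     (\<integral>x. D1 x * ((grad (mpow j) x + wgrad UNIV (\<phi>0 j) x) \<bullet> grad (mpow i) x) \<partial>lebesgue_on B)"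

end

theory Submission
  imports Defs "HOL-Real_Asymp.Real_Asymp"
begin

text \<open>All the sums in the theorem vanish: the first for every \<open>\<epsilon>\<close>, and the two that depend on \<open>y\<close> at
  almost every boundary point. The reason is an identity between the two tensors, regarded as bilinear
  forms on polynomials: they agree on pairs of harmonic polynomials
  (\<open>polarization_tensors_agree\<close>).

  Put \<open>s = \<surd>(D\<^sub>0 + D\<^sub>1)\<close> and \<open>s\<^sub>0 = \<surd>D\<^sub>0\<close>, so that \<open>q\<^sub>1 = \<Delta>s / s\<close>. By Liouville's substitution
  (\<open>liouville_identity\<close>), a solution \<open>U\<close> of the diffusion equation gives a solution \<open>s U\<close> of the Helmholtz
  equation. Let \<open>v\<close> be harmonic, \<open>\<phi>\<^sub>0\<close> its diffusion corrector and \<open>U = v + \<phi>\<^sub>0\<close>. Then \<open>\<Phi> = (s / s\<^sub>0) U - v\<close>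
  satisfies \<open>\<Delta>\<Phi> = q\<^sub>1 (v + \<Phi>)\<close> and equals \<open>\<phi>\<^sub>0\<close> away from \<open>B\<close>, so it decays at infinity. Hence it is the
  Newtonian potential \<open>- T (v + \<Phi>)\<close> (\<open>newtonian_potential\<close>, \<open>corrector_potential\<close>) and, as \<open>-1\<close> is not an
  eigenvalue of \<open>T\<close>, it is the Helmholtz corrector of \<open>v\<close>. For harmonic \<open>n\<close>, testing the diffusion
  equation with \<open>n (s\<^sub>0 / s - 1)\<close> gives
  \<open>\<integral> D\<^sub>1 \<nabla>U \<bullet> \<nabla>n = s\<^sub>0 \<integral> U n \<Delta>s = D\<^sub>0 \<integral> q\<^sub>1 (v + \<Phi>) n\<close> (\<open>diffusion_tensor_identity\<close>), which is the identity.

  The Taylor polynomials of a harmonic function are harmonic, because the relations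
  \<open>\<Sum>\<^sub>k \<partial>\<^bsup>i + 2 e\<^sub>k\<^esup>f(x\<^sub>0) = 0\<close> hold for its derivatives and imply that the Laplacian of the polynomial is zero
  (\<open>mpartial_harmonic\<close>, \<open>harmonic_taylor_polynomial\<close>). For \<open>V\<close> this is immediate. The derivatives of \<open>N\<close> at
  \<open>x\<^sub>0\<close> are given at the boundary only as traces in \<open>y\<close>; the relations hold for \<open>y\<close> in \<open>\<Omega>\<close> away from \<open>x\<^sub>0\<close>
  and pass to the traces because the trace of a function that vanishes near the boundary is zero
  (\<open>trace_of_zero\<close>, \<open>boundary_trace_sum_zero\<close>). Inserting Taylor polynomials for \<open>v\<close> and \<open>n\<close> gives the
  last estimate, inserting monomials of degree one gives \<open>M\<^sub>i\<^sub>j\<close>, and inserting the constant \<open>1\<close> for one of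
  them gives the first two, since the diffusion side is then zero.

  The representation by Newtonian potentials is proved by replacing \<open>|x|\<^sup>2\<close> with \<open>|x|\<^sup>2 + \<delta>\<^sup>2\<close> in the
  fundamental solution. This makes it smooth, and minus its Laplacian becomes an explicit approximate
  identity (\<open>regularised_identity\<close>); the limit \<open>\<delta> \<rightarrow> 0\<close> is taken after integration over a box
  (\<open>newtonian_potential_box\<close>).\<close>

section \<open>Calculus of partial derivatives\<close>

lemma DERIV_along_axis:
  fixes f :: "real ^ 'n::finite \<Rightarrow> real"
  assumes "f differentiable (at (a + t *\<^sub>R axis k 1))"
  shows "((\<lambda>t. f (a + t *\<^sub>R axis k 1)) has_real_derivative partial k f (a + t *\<^sub>R axis k 1)) (at t)"
proof -
  obtain f' where f': "(f has_derivative f') (at (a + t *\<^sub>R axis k 1))"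
    using assms by (auto simp: differentiable_def)
  have *: "((\<lambda>\<tau>. f (b + \<tau> *\<^sub>R axis k 1)) has_real_derivative f' (axis k 1)) (at \<sigma>)"
    if b: "b + \<sigma> *\<^sub>R axis k 1 = a + t *\<^sub>R axis k 1" for b \<sigma>
  proof -
    have "((\<lambda>\<tau>. b + \<tau> *\<^sub>R axis k 1) has_derivative (\<lambda>\<tau>. \<tau> *\<^sub>R axis k 1)) (at \<sigma>)"
      by (auto intro!: derivative_eq_intros)
    from has_derivative_compose[OF this] f' b
    have "((\<lambda>\<tau>. f (b + \<tau> *\<^sub>R axis k 1)) has_derivative (\<lambda>\<tau>. f' (\<tau> *\<^sub>R axis k 1))) (at \<sigma>)"
      by auto
    moreover have "f' (\<tau> *\<^sub>R axis k 1) = f' (axis k 1) * \<tau>" for \<tau>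
      using has_derivative_linear[OF f'] by (simp add: linear_cmul)
    ultimately show ?thesis by (simp add: has_field_derivative_def)
  qed
  have "partial k f (a + t *\<^sub>R axis k 1) = f' (axis k 1)"
    unfolding partial_def by (rule DERIV_imp_deriv, rule *) simp
  with *[of a t] show ?thesis by simp
qed

lemma partial_eqI:
  assumes "((\<lambda>t. f (x + t *\<^sub>R axis k 1)) has_real_derivative D) (at 0)"
  shows "partial k f x = D"
  unfolding partial_def by (rule DERIV_imp_deriv) fact

lemma has_derivative_imp_partial:
  assumes "(f has_derivative f') (at x)"
  shows "partial k f x = f' (axis k 1)"
proof (rule partial_eqI)
  have "((\<lambda>\<tau>. x + \<tau> *\<^sub>R axis k 1) has_derivative (\<lambda>\<tau>. \<tau> *\<^sub>R axis k 1)) (at 0)"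
    by (auto intro!: derivative_eq_intros)
  from has_derivative_compose[OF this, of f f'] assms
  have "((\<lambda>\<tau>. f (x + \<tau> *\<^sub>R axis k 1)) has_derivative (\<lambda>\<tau>. f' (\<tau> *\<^sub>R axis k 1))) (at 0)"
    by simp
  moreover have "f' (\<tau> *\<^sub>R axis k 1) = f' (axis k 1) * \<tau>" for \<tau>
    using has_derivative_linear[OF assms] by (simp add: linear_cmul)
  ultimately show "((\<lambda>t. f (x + t *\<^sub>R axis k 1)) has_real_derivative f' (axis k 1)) (at 0)"
    by (simp add: has_field_derivative_def)
qed

lemma DERIV_axis0:
  assumes "f differentiable (at x)"
  shows "((\<lambda>t. f (x + t *\<^sub>R axis k 1)) has_real_derivative partial k f x) (at 0)"
  using DERIV_along_axis[of f x 0 k] assms by simp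

lemma partial_cong_open:
  assumes "open S" "x \<in> S" "\<And>y. y \<in> S \<Longrightarrow> f y = g y"
  shows "partial k f x = partial k g x"
  unfolding partial_def
proof (rule deriv_cong_ev)
  have "((\<lambda>t. x + t *\<^sub>R axis k 1) \<longlongrightarrow> x + 0 *\<^sub>R axis k 1) (nhds (0::real))"
    by (intro tendsto_intros filterlim_ident)
  then have "eventually (\<lambda>t. x + t *\<^sub>R axis k 1 \<in> S) (nhds (0::real))"
    by (rule topological_tendstoD) (use assms in auto)
  then show "\<forall>\<^sub>F t in nhds 0. f (x + t *\<^sub>R axis k 1) = g (x + t *\<^sub>R axis k 1)"
    by eventually_elim (use assms in auto)
qed simp

lemma partial_add:
  assumes "f differentiable (at x)" "g differentiable (at x)"
  shows "partial k (\<lambda>x. f x + g x) x = partial k f x + partial k g x"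
  by (rule partial_eqI) (intro derivative_intros DERIV_axis0 assms)

lemma partial_diff:
  assumes "f differentiable (at x)" "g differentiable (at x)"
  shows "partial k (\<lambda>x. f x - g x) x = partial k f x - partial k g x"
  by (rule partial_eqI) (intro derivative_intros DERIV_axis0 assms)

lemma partial_mult:
  assumes "f differentiable (at x)" "g differentiable (at x)"
  shows "partial k (\<lambda>x. f x * g x) x = partial k f x * g x + f x * partial k g x"
  by (rule partial_eqI)
    (auto intro!: derivative_eq_intros DERIV_axis0 assms)

lemma partial_const [simp]: "partial k (\<lambda>x. c) x = 0"
  by (rule partial_eqI) auto

lemma partial_cmult:
  assumes "f differentiable (at x)"
  shows "partial k (\<lambda>x. c * f x) x = c * partial k f x"
  by (rule partial_eqI) (auto intro!: derivative_eq_intros DERIV_axis0 assms)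

lemma partial_sum:
  assumes "finite I" "\<And>i. i \<in> I \<Longrightarrow> f i differentiable (at x)"
  shows "partial k (\<lambda>x. \<Sum>i\<in>I. f i x) x = (\<Sum>i\<in>I. partial k (f i) x)"
  using assms
proof (induction I rule: finite_induct)
  case (insert a F)
  have "(\<lambda>x. \<Sum>i\<in>F. f i x) differentiable (at x)"
    using insert by (intro derivative_intros) auto
  with insert show ?case by (simp add: partial_add)
qed simp

lemma partial_comp:
  assumes "f differentiable (at x)" "(h has_real_derivative D) (at (f x))"
  shows "partial k (\<lambda>x. h (f x)) x = D * partial k f x"
  by (rule partial_eqI) (rule DERIV_chain2[OF _ DERIV_axis0], use assms in auto)

lemma partial_shift: "partial k (\<lambda>x. f (x - y)) x = partial k f (x - y)"
  by (simp add: partial_def algebra_simps)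

lemma partial_coord [simp]: "partial k (\<lambda>x. x $ l) x = (if k = l then 1 else 0)"
proof (rule has_derivative_imp_partial[THEN trans])
  show "((\<lambda>x. x $ l) has_derivative (\<lambda>x. x $ l)) (at x)"
    by (rule bounded_linear_imp_has_derivative) (rule bounded_linear_vec_nth)
qed (simp add: axis_def)

section \<open>Functions of class $C^m$\<close>

lemma differentiable_on_open:
  "open S \<Longrightarrow> f differentiable_on S \<longleftrightarrow> (\<forall>x\<in>S. f differentiable (at x))"
  by (rule differentiable_on_eq_differentiable_at)

lemma Ck_on_SucD: "Ck_on (Suc m) S f \<Longrightarrow> Ck_on m S f"
  by (induction m arbitrary: f) (auto intro: differentiable_imp_continuous_on)

lemma Ck_on_mono: "Ck_on m S f \<Longrightarrow> l \<le> m \<Longrightarrow> Ck_on l S f"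
proof (induction m)
  case (Suc m)
  then show ?case using Ck_on_SucD[of m S f] by (cases "l = Suc m") auto
qed simp

lemma Ck_on_subset: "Ck_on m S f \<Longrightarrow> T \<subseteq> S \<Longrightarrow> Ck_on m T f"
  by (induction m arbitrary: f) (auto intro: continuous_on_subset differentiable_on_subset)

lemma Ck_on_imp_continuous: "Ck_on m S f \<Longrightarrow> continuous_on S f"
  using Ck_on_mono[of m S f 0] by simp

lemma Ck_on_differentiable: "Ck_on m S f \<Longrightarrow> m \<ge> 1 \<Longrightarrow> open S \<Longrightarrow> x \<in> S \<Longrightarrow> f differentiable (at x)"
  by (cases m) (auto simp: differentiable_on_open)

lemma Ck_on_partial: "Ck_on (Suc m) S f \<Longrightarrow> Ck_on m S (partial k f)"
  by simp

lemma Ck_on_cong: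
  assumes "open S" "\<And>x. x \<in> S \<Longrightarrow> f x = g x"
  shows "Ck_on m S f \<longleftrightarrow> Ck_on m S g"
  using assms(2)
proof (induction m arbitrary: f g)
  case 0
  then show ?case by (auto cong: continuous_on_cong)
next
  case (Suc m)
  have "f differentiable_on S \<longleftrightarrow> g differentiable_on S"
    using Suc.prems unfolding differentiable_on_def
    by (auto elim!: differentiable_transform_within[where d = 1])
  moreover have "Ck_on m S (partial k f) \<longleftrightarrow> Ck_on m S (partial k g)" for k
    by (rule Suc.IH) (rule partial_cong_open[OF assms(1)], use Suc.prems in auto)
  ultimately show ?case by simp
qed

lemma Ck_on_SucI:
  assumes "open S" "\<And>x. x \<in> S \<Longrightarrow> f differentiable (at x)"
    and "\<And>k x. x \<in> S \<Longrightarrow> partial k f x = g k x" "\<And>k. Ck_on m S (g k)"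
  shows "Ck_on (Suc m) S f"
  using assms Ck_on_cong[OF assms(1), of "partial _ f" "g _"]
  by (auto simp: differentiable_on_open)

lemma Ck_on_const: "Ck_on m (S :: (real ^ 'n::finite) set) (\<lambda>x. c)"
proof (induction m arbitrary: c)
  case (Suc m)
  have "partial k (\<lambda>x. c) = (\<lambda>x::real^'n. 0)" for k by auto
  then show ?case using Suc by simp
qed simp

lemma Ck_on_add:
  assumes "open S" "Ck_on m S f" "Ck_on m S g" shows "Ck_on m S (\<lambda>x. f x + g x)"
  using assms(2,3)
proof (induction m arbitrary: f g)
  case (Suc m)
  show ?case
    by (rule Ck_on_SucI[where g = "\<lambda>k x. partial k f x + partial k g x"])
      (use Suc assms(1) in \<open>auto intro!: partial_add derivative_intros simp: differentiable_on_open\<close>)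
qed (auto intro: continuous_intros)

lemma Ck_on_mult:
  assumes "open S" "Ck_on m S f" "Ck_on m S g" shows "Ck_on m S (\<lambda>x. f x * g x)"
  using assms(2,3)
proof (induction m arbitrary: f g)
  case (Suc m)
  have "Ck_on m S f" "Ck_on m S g" using Suc.prems Ck_on_SucD by blast+
  then show ?case
    by (intro Ck_on_SucI[where g = "\<lambda>k x. partial k f x * g x + f x * partial k g x"] Ck_on_add)
      (use Suc assms(1) in \<open>auto intro!: partial_mult derivative_intros simp: differentiable_on_open\<close>)
qed (auto intro: continuous_intros)

lemma Ck_on_cmult: "open S \<Longrightarrow> Ck_on m S f \<Longrightarrow> Ck_on m S (\<lambda>x. c * f x)"
  by (intro Ck_on_mult Ck_on_const)

lemma Ck_on_diff:
  assumes "open S" "Ck_on m S f" "Ck_on m S g" shows "Ck_on m S (\<lambda>x. f x - g x)"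
  using Ck_on_add[OF assms(1,2) Ck_on_cmult[OF assms(1,3), of "-1"]] by simp

lemma Ck_on_sum:
  assumes "open S" "\<And>i. i \<in> I \<Longrightarrow> Ck_on m S (f i)" shows "Ck_on m S (\<lambda>x. \<Sum>i\<in>I. f i x)"
  using assms(2) by (induction I rule: infinite_finite_induct) (auto intro: Ck_on_const Ck_on_add[OF assms(1)])

lemma Ck_on_prod:
  assumes "open S" "\<And>i. i \<in> I \<Longrightarrow> Ck_on m S (f i)" shows "Ck_on m S (\<lambda>x. \<Prod>i\<in>I. f i x)"
  using assms(2) by (induction I rule: infinite_finite_induct) (auto intro: Ck_on_const Ck_on_mult[OF assms(1)])

lemma Ck_on_power:
  assumes "open S" "Ck_on m S f" shows "Ck_on m S (\<lambda>x. f x ^ n)"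
  by (induction n) (auto intro: Ck_on_const Ck_on_mult assms)

lemma Ck_on_coord: "Ck_on m (S :: (real^'n::finite) set) (\<lambda>x. x $ l)"
proof (cases m)
  case (Suc l')
  have *: "partial k (\<lambda>x. x $ l) = (\<lambda>x::real^'n. if k = l then 1 else 0)" for k by (rule ext) simp
  have "(\<lambda>x::real^'n. x $ l) differentiable_on S"
    by (auto simp: differentiable_on_def intro!: bounded_linear_imp_differentiable bounded_linear_vec_nth)
  then show ?thesis unfolding Suc Ck_on.simps * by (simp add: Ck_on_const)
qed (auto intro: continuous_intros)

text \<open>The chain rule for a function of one variable with iterated derivatives \<open>h 0, h 1, \<dots>\<close>.\<close>

lemma Ck_on_comp:
  assumes "open S" "Ck_on m S f" "\<And>x. x \<in> S \<Longrightarrow> f x \<in> T"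
    and "\<And>i t. t \<in> T \<Longrightarrow> (h i has_real_derivative h (Suc i) t) (at t)"
  shows "Ck_on m S (\<lambda>x. h i (f x))"
  using assms(2)
proof (induction m arbitrary: i)
  case 0
  have "continuous_on T (h i)"
    by (rule DERIV_continuous_on[where D = "h (Suc i)"])
      (use assms(4) has_field_derivative_at_within in blast)
  then show ?case using 0 assms(3)
    by (auto intro!: continuous_on_compose2[of T "h i" S f])
next
  case (Suc m)
  show ?case
  proof (rule Ck_on_SucI[where g = "\<lambda>k x. h (Suc i) (f x) * partial k f x"])
    fix x assume x: "x \<in> S"
    then have fx: "f differentiable (at x)" using Suc.prems assms(1) Ck_on_differentiable by fastforce
    have "h i differentiable at (f x)" using assms(4)[OF assms(3)[OF x]]
      using real_differentiable_def by blast
    then show "(\<lambda>x. h i (f x)) differentiable at x"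
      using differentiable_chain_at[OF fx] by (simp add: o_def)
    show "partial k (\<lambda>x. h i (f x)) x = h (Suc i) (f x) * partial k f x" for k
      by (rule partial_comp[OF fx]) (use assms(3,4) x in auto)
  next
    have "Ck_on m S f" using Suc.prems by (rule Ck_on_SucD)
    then show "Ck_on m S (\<lambda>x. h (Suc i) (f x) * partial k f x)" for k
      using Suc.prems assms(1) by (intro Ck_on_mult Suc.IH) auto
  qed (rule assms(1))
qed

lemma DERIV_powr_chain:
  fixes a t :: real
  assumes "t > 0"
  shows "((\<lambda>t. (\<Prod>l<i. a - real l) * t powr (a - real i)) has_real_derivative
           (\<Prod>l<Suc i. a - real l) * t powr (a - real (Suc i))) (at t)"
proof -
  have "((\<lambda>t. t powr (a - real i)) has_real_derivative (a - real i) * t powr (a - real i - 1)) (at t)"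
    using has_real_derivative_powr[OF assms] .
  from DERIV_cmult[OF this, of "\<Prod>l<i. a - real l"] show ?thesis
    by (simp add: mult_ac diff_diff_eq add_ac)
qed

lemma Ck_on_powr:
  assumes "open S" "Ck_on m S f" "\<And>x. x \<in> S \<Longrightarrow> f x > 0"
  shows "Ck_on m S (\<lambda>x. f x powr a)"
proof -
  have "Ck_on m S (\<lambda>x. (\<Prod>l<(0::nat). a - real l) * f x powr (a - real 0))"
    by (rule Ck_on_comp[OF assms(1,2), where T = "{0<..}" and h = "\<lambda>i t. (\<Prod>l<i. a - real l) * t powr (a - real i)"])
      (use assms(3) in simp, rule DERIV_powr_chain, simp)
  then show ?thesis by simp
qed

lemma Ck_on_ln:
  assumes "open S" "Ck_on m S f" "\<And>x. x \<in> S \<Longrightarrow> f x > 0"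
  shows "Ck_on m S (\<lambda>x. ln (f x))"
proof (cases m)
  case 0
  then have "continuous_on S f" using assms(2) by simp
  then have "continuous_on S (\<lambda>x. ln (f x))" by (rule continuous_on_ln) (use assms(3) in fastforce)
  then show ?thesis using 0 by simp
next
  case (Suc l)
  have "Ck_on l S f" using assms Suc Ck_on_SucD by auto
  show ?thesis unfolding Suc
  proof (rule Ck_on_SucI[where g = "\<lambda>k x. f x powr (-1) * partial k f x"])
    fix x assume x: "x \<in> S"
    then have fx: "f differentiable (at x)" using Ck_on_differentiable[OF assms(2)] Suc assms(1) by auto
    have d: "(ln has_real_derivative f x powr (-1)) (at (f x))"
      using DERIV_ln[OF assms(3)[OF x]] assms(3)[OF x] by (simp add: powr_minus)
    then have "ln differentiable at (f x)" using real_differentiable_def by blast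
    then show "(\<lambda>x. ln (f x)) differentiable at x"
      using differentiable_chain_at[OF fx] by (simp add: o_def)
    show "partial k (\<lambda>x. ln (f x)) x = f x powr (-1) * partial k f x" for k
      by (rule partial_comp[OF fx d])
  next
    show "Ck_on l S (\<lambda>x. f x powr - 1 * partial k f x)" for k
      using assms \<open>Ck_on l S f\<close> Suc by (intro Ck_on_mult Ck_on_powr) auto
  qed (use assms in auto)
qed

lemma Ck_on_shift:
  assumes "Ck_on m UNIV f" shows "Ck_on m UNIV (\<lambda>x. f (x - y))"
  using assms
proof (induction m arbitrary: f)
  case 0
  then show ?case by (auto intro!: continuous_intros continuous_on_compose2[of UNIV f])
next
  case (Suc m)
  have "(\<lambda>x. f (x - y)) differentiable at x" for x
    using differentiable_chain_at[of "\<lambda>x. x - y" x f] Suc.prems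
    by (auto simp: o_def differentiable_on_open)
  moreover have "partial k (\<lambda>x. f (x - y)) = (\<lambda>x. partial k f (x - y))" for k
    by (rule ext) (rule partial_shift)
  ultimately show ?case using Suc by (auto simp: differentiable_on_open)
qed

lemma norm_power2_eq_sum: "(norm x)\<^sup>2 = (\<Sum>k\<in>UNIV. (x $ k)\<^sup>2)" for x :: "real^'n::finite"
  by (simp add: norm_vec_def L2_set_def sum_nonneg)

lemma Ck_on_norm_power2: "Ck_on m (S :: (real^'n::finite) set) (\<lambda>x. (norm x)\<^sup>2)"
proof -
  have "Ck_on m (UNIV :: (real^'n) set) (\<lambda>x. (norm x)\<^sup>2)"
    unfolding norm_power2_eq_sum by (intro Ck_on_sum Ck_on_power Ck_on_coord) auto
  then show ?thesis by (rule Ck_on_subset) simp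
qed

lemma Ck_on_mpow: "Ck_on m S (mpow i)"
proof -
  have "Ck_on m UNIV (mpow i)"
    unfolding mpow_def[abs_def] by (intro Ck_on_prod Ck_on_power Ck_on_coord) auto
  then show ?thesis by (rule Ck_on_subset) simp
qed

lemma smooth_onD: "smooth_on S f \<Longrightarrow> Ck_on m S f"
  by (simp add: smooth_on_def)

lemma smooth_on_partial: "smooth_on S f \<Longrightarrow> smooth_on S (partial k f)"
  unfolding smooth_on_def by (metis Ck_on_partial)

lemma smooth_on_differentiable: "smooth_on S f \<Longrightarrow> open S \<Longrightarrow> x \<in> S \<Longrightarrow> f differentiable (at x)"
  by (meson Ck_on_differentiable le_refl smooth_onD)

lemma smooth_on_imp_continuous: "smooth_on S f \<Longrightarrow> continuous_on S f"
  by (meson Ck_on_imp_continuous smooth_onD)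

lemma smooth_on_subset: "smooth_on S f \<Longrightarrow> T \<subseteq> S \<Longrightarrow> smooth_on T f"
  by (meson Ck_on_subset smooth_on_def)

text \<open>Two applications of the mean value theorem. The second difference is symmetric in \<open>k\<close> and \<open>l\<close>,
  while the right-hand side is not; letting \<open>t\<close> tend to \<open>0\<close> gives the equality of the mixed partial
  derivatives.\<close>

lemma partial_second_difference:
  fixes f :: "real ^ 'n::finite \<Rightarrow> real"
  assumes f: "Ck_on 2 (ball x r) f" and t: "0 < t" "2 * t < r"
  shows "\<exists>p. dist p x \<le> 2 * t \<and>
    f (x + t *\<^sub>R axis k 1 + t *\<^sub>R axis l 1) - f (x + t *\<^sub>R axis k 1) - f (x + t *\<^sub>R axis l 1) + f x
      = t * t * partial l (partial k f) p"
proof -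
  let ?k = "axis k 1 :: real^'n" and ?l = "axis l 1 :: real^'n"
  have near: "dist (x + \<sigma> *\<^sub>R ?k + \<tau> *\<^sub>R ?l) x \<le> 2 * t" if "0 \<le> \<sigma>" "\<sigma> \<le> t" "0 \<le> \<tau>" "\<tau> \<le> t" for \<sigma> \<tau>
  proof -
    have "dist (x + \<sigma> *\<^sub>R ?k + \<tau> *\<^sub>R ?l) x = norm (\<sigma> *\<^sub>R ?k + \<tau> *\<^sub>R ?l)"
      by (simp add: dist_norm algebra_simps)
    also have "\<dots> \<le> \<sigma> + \<tau>"
      using norm_triangle_ineq[of "\<sigma> *\<^sub>R ?k" "\<tau> *\<^sub>R ?l"] that by simp
    finally show ?thesis using that by simp
  qed
  have nb: "x + \<sigma> *\<^sub>R ?k + \<tau> *\<^sub>R ?l \<in> ball x r" if "0 \<le> \<sigma>" "\<sigma> \<le> t" "0 \<le> \<tau>" "\<tau> \<le> t" for \<sigma> \<tau>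
    using near[OF that] t by (simp add: dist_commute)
  have f2: "Ck_on (Suc (Suc 0)) (ball x r) f" using f by (simp add: numeral_2_eq_2)
  have df: "f differentiable (at y)" if "y \<in> ball x r" for y
    by (rule Ck_on_differentiable[OF f _ open_ball that]) simp
  have dkf: "partial k f differentiable (at y)" if "y \<in> ball x r" for y
    by (rule Ck_on_differentiable[OF Ck_on_partial[OF f2] _ open_ball that]) simp
  define u where "u \<sigma> = f (x + t *\<^sub>R ?l + \<sigma> *\<^sub>R ?k) - f (x + \<sigma> *\<^sub>R ?k)" for \<sigma>
  have "\<exists>\<sigma>. 0 < \<sigma> \<and> \<sigma> < t \<and> u t - u 0 = (t - 0) * (partial k f (x + t *\<^sub>R ?l + \<sigma> *\<^sub>R ?k) - partial k f (x + \<sigma> *\<^sub>R ?k))"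
  proof (rule MVT2)
    fix \<sigma> assume "0 \<le> \<sigma>" "\<sigma> \<le> t"
    then show "(u has_real_derivative partial k f (x + t *\<^sub>R ?l + \<sigma> *\<^sub>R ?k) - partial k f (x + \<sigma> *\<^sub>R ?k)) (at \<sigma>)"
      unfolding u_def using nb[of \<sigma> t] nb[of \<sigma> 0] t
      by (intro derivative_intros DERIV_along_axis df) (simp_all add: add_ac)
  qed fact
  then obtain \<sigma> where \<sigma>: "0 < \<sigma>" "\<sigma> < t"
    "u t - u 0 = t * (partial k f (x + t *\<^sub>R ?l + \<sigma> *\<^sub>R ?k) - partial k f (x + \<sigma> *\<^sub>R ?k))" by auto
  define w where "w \<tau> = partial k f (x + \<sigma> *\<^sub>R ?k + \<tau> *\<^sub>R ?l)" for \<tau>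
  have "\<exists>\<tau>. 0 < \<tau> \<and> \<tau> < t \<and> w t - w 0 = (t - 0) * partial l (partial k f) (x + \<sigma> *\<^sub>R ?k + \<tau> *\<^sub>R ?l)"
  proof (rule MVT2)
    fix \<tau> assume "0 \<le> \<tau>" "\<tau> \<le> t"
    then show "(w has_real_derivative partial l (partial k f) (x + \<sigma> *\<^sub>R ?k + \<tau> *\<^sub>R ?l)) (at \<tau>)"
      unfolding w_def using \<sigma> nb[of \<sigma> \<tau>] by (intro DERIV_along_axis dkf) simp_all
  qed fact
  then obtain \<tau> where \<tau>: "0 < \<tau>" "\<tau> < t" "w t - w 0 = t * partial l (partial k f) (x + \<sigma> *\<^sub>R ?k + \<tau> *\<^sub>R ?l)"
    by auto
  show ?thesis
  proof (intro exI[of _ "x + \<sigma> *\<^sub>R ?k + \<tau> *\<^sub>R ?l"] conjI)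
    show "dist (x + \<sigma> *\<^sub>R ?k + \<tau> *\<^sub>R ?l) x \<le> 2 * t" using near \<sigma> \<tau> by auto
    have "u t - u 0 = t * (w t - w 0)" using \<sigma>(3) by (simp add: w_def algebra_simps)
    then show "f (x + t *\<^sub>R ?k + t *\<^sub>R ?l) - f (x + t *\<^sub>R ?k) - f (x + t *\<^sub>R ?l) + f x
      = t * t * partial l (partial k f) (x + \<sigma> *\<^sub>R ?k + \<tau> *\<^sub>R ?l)"
      using \<tau>(3) by (simp add: u_def algebra_simps)
  qed
qed

lemma partial_commute:
  fixes f :: "real ^ 'n::finite \<Rightarrow> real"
  assumes "open S" "x \<in> S" "Ck_on 2 S f"
  shows "partial k (partial l f) x = partial l (partial k f) x"
proof -
  obtain r where r: "r > 0" "ball x r \<subseteq> S" using assms by (meson open_contains_ball)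
  have f: "Ck_on 2 (ball x r) f" using assms(3) r(2) by (rule Ck_on_subset)
  define t where "t n = r / 3 * inverse (real (Suc n))" for n
  have t: "0 < t n" "2 * t n < r" for n
  proof -
    have "0 < inverse (real (Suc n))" "inverse (real (Suc n)) \<le> 1"
      by (simp_all add: inverse_le_1_iff del: of_nat_Suc)
    then have "0 < t n" "t n \<le> r / 3 * 1" unfolding t_def using r(1)
      by (intro mult_pos_pos mult_left_mono; simp)+
    then show "0 < t n" "2 * t n < r" using r(1) by linarith+
  qed
  have "(\<lambda>n. 2 * (r / 3 * inverse (real (Suc n)))) \<longlonglongrightarrow> 2 * (r / 3 * 0)"
    by (intro tendsto_intros LIMSEQ_inverse_real_of_nat)
  then have t0: "(\<lambda>n. 2 * t n) \<longlonglongrightarrow> 0" unfolding t_def by simp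
  define A where "A k l n p \<longleftrightarrow> dist p x \<le> 2 * t n \<and>
      f (x + t n *\<^sub>R axis k 1 + t n *\<^sub>R axis l 1) - f (x + t n *\<^sub>R axis k 1) - f (x + t n *\<^sub>R axis l 1) + f x
      = t n * t n * partial l (partial k f) p" for k l n p
  have A: "\<exists>p. A k l n p" for k l n
    unfolding A_def by (rule partial_second_difference[OF f t(1)[of n] t(2)[of n]])
  define p q where "p n = (SOME p. A k l n p)" and "q n = (SOME p. A l k n p)" for n
  have "A k l n (p n)" "A l k n (q n)" for n
    unfolding p_def q_def by (rule someI_ex, rule A)+
  then have p: "dist (p n) x \<le> 2 * t n"
    "f (x + t n *\<^sub>R axis k 1 + t n *\<^sub>R axis l 1) - f (x + t n *\<^sub>R axis k 1) - f (x + t n *\<^sub>R axis l 1) + f x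
      = t n * t n * partial l (partial k f) (p n)"
    and q: "dist (q n) x \<le> 2 * t n"
    "f (x + t n *\<^sub>R axis l 1 + t n *\<^sub>R axis k 1) - f (x + t n *\<^sub>R axis l 1) - f (x + t n *\<^sub>R axis k 1) + f x
      = t n * t n * partial k (partial l f) (q n)" for n
    unfolding A_def by simp_all
  have eq: "partial l (partial k f) (p n) = partial k (partial l f) (q n)" for n
  proof -
    have "t n * t n * partial l (partial k f) (p n) = t n * t n * partial k (partial l f) (q n)"
      unfolding p(2)[symmetric] q(2)[symmetric] by (simp add: add_ac)
    then show ?thesis using t(1)[of n] by simp
  qed
  have lim: "(\<lambda>n. g (s n)) \<longlonglongrightarrow> g x" if "continuous_on (ball x r) g" "\<And>n. dist (s n) x \<le> 2 * t n"
    for g :: "real^'n \<Rightarrow> real" and s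
  proof (rule continuous_on_tendsto_compose[OF that(1)])
    have "\<forall>\<^sub>F n in sequentially. norm (dist (s n) x) \<le> 2 * t n"
      using that(2) by (intro always_eventually allI) simp
    then have "(\<lambda>n. dist (s n) x) \<longlonglongrightarrow> 0"
      using t0 by (rule Lim_null_comparison)
    then show "s \<longlonglongrightarrow> x" by (rule iffD2[OF tendsto_dist_iff])
    show "\<forall>\<^sub>F n in sequentially. s n \<in> ball x r"
    proof (rule always_eventually, rule allI)
      show "s n \<in> ball x r" for n using that(2)[of n] t(2)[of n] by (simp add: dist_commute)
    qed
  qed (use r in auto)
  have c: "continuous_on (ball x r) (partial l (partial k f))" for k l
    using f by (simp add: numeral_2_eq_2)
  show ?thesis
    using LIMSEQ_unique[OF lim[OF c[of l k] p(1)], of "partial k (partial l f) x"]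
      lim[OF c[of k l] q(1)] by (simp add: eq)
qed

section \<open>Smooth bump functions\<close>

text \<open>The recursion comes from differentiating \<open>p (1 / t) exp (- 1 / t)\<close>.\<close>

fun bump_poly :: "nat \<Rightarrow> real poly" where
  "bump_poly 0 = 1"
| "bump_poly (Suc n) = [:0, 0, 1:] * (bump_poly n - pderiv (bump_poly n))"

text \<open>\<open>bump_fn 0\<close> is the function \<open>exp (-1/t)\<close>, cut off at \<open>0\<close>, and \<open>bump_fn n\<close> its \<open>n\<close>-th derivative.\<close>

definition bump_fn :: "nat \<Rightarrow> real \<Rightarrow> real" where
  "bump_fn n t = (if t > 0 then poly (bump_poly n) (1 / t) * exp (- (1 / t)) else 0)"

lemma tendsto_poly_exp_minus: "((\<lambda>x. poly p x * exp (- x)) \<longlongrightarrow> 0) (at_top :: real filter)"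
proof -
  have "((\<lambda>x. \<Sum>i\<le>degree p. coeff p i * (x ^ i / exp x)) \<longlongrightarrow> (\<Sum>i\<le>degree p. coeff p i * 0)) (at_top :: real filter)"
    by (intro tendsto_intros tendsto_power_div_exp_0)
  moreover have "(\<Sum>i\<le>degree p. coeff p i * (x ^ i / exp x)) = poly p x * exp (- x)" for x :: real
    by (simp add: poly_altdef sum_distrib_right exp_minus divide_inverse mult.assoc)
  ultimately show ?thesis by simp
qed

lemma DERIV_bump_fn: "(bump_fn n has_real_derivative bump_fn (Suc n) t) (at t)"
proof -
  consider "t > 0" | "t < 0" | "t = 0" by linarith
  then show ?thesis
  proof cases
    case 1
    have "((\<lambda>t. poly (bump_poly n) (1 / t) * exp (- (1 / t))) has_real_derivative bump_fn (Suc n) t) (at t)"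
      by (rule derivative_eq_intros refl | use 1 in \<open>simp; fail\<close>)+
        (use 1 in \<open>simp add: bump_fn_def field_simps power2_eq_square\<close>)
    then show ?thesis
      by (rule has_field_derivative_transform_within_open[of _ _ _ "{0<..}"])
        (use 1 in \<open>auto simp: bump_fn_def\<close>)
  next
    case 2
    have "((\<lambda>t. 0) has_real_derivative bump_fn (Suc n) t) (at t)"
      using 2 by (simp add: bump_fn_def)
    then show ?thesis
      by (rule has_field_derivative_transform_within_open[of _ _ _ "{..<0}"])
        (use 2 in \<open>auto simp: bump_fn_def\<close>)
  next
    case 3
    have "((\<lambda>h. bump_fn n h / h) \<longlongrightarrow> 0) (at_left 0)"
    proof (rule Lim_transform_eventually[OF tendsto_const])
      show "\<forall>\<^sub>F h in at_left 0. 0 = bump_fn n h / h"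
        by (auto simp: eventually_at_filter bump_fn_def)
    qed
    moreover have "((\<lambda>h. bump_fn n h / h) \<longlongrightarrow> 0) (at_right 0)"
    proof (rule Lim_transform_eventually)
      show "((\<lambda>h. poly (pCons 0 (bump_poly n)) (inverse h) * exp (- inverse h)) \<longlongrightarrow> 0) (at_right 0)"
        by (rule filterlim_compose[OF tendsto_poly_exp_minus filterlim_inverse_at_top_right])
      show "\<forall>\<^sub>F h in at_right 0. poly (pCons 0 (bump_poly n)) (inverse h) * exp (- inverse h) = bump_fn n h / h"
        by (auto simp: eventually_at_filter bump_fn_def inverse_eq_divide)
    qed
    ultimately have "((\<lambda>h. bump_fn n h / h) \<longlongrightarrow> 0) (at 0)"
      by (simp add: filterlim_at_split)
    then show ?thesis using 3 by (simp add: has_field_derivative_iff bump_fn_def)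
  qed
qed

lemma bump_fn_0: "bump_fn 0 t = (if t > 0 then exp (- (1 / t)) else 0)"
  by (simp add: bump_fn_def)

lemma bump_fn_bounds: "0 \<le> bump_fn 0 t" "bump_fn 0 t \<le> 1"
  by (auto simp: bump_fn_0)

lemma Ck_on_bump_fn: "open S \<Longrightarrow> Ck_on m S f \<Longrightarrow> Ck_on m S (\<lambda>x. bump_fn i (f x))"
  by (rule Ck_on_comp[where T = UNIV]) (auto intro: DERIV_bump_fn)

lemma tendsto_bump_fn_scaled:
  "(\<lambda>n. bump_fn 0 (real (Suc n) * t)) \<longlonglongrightarrow> (if t > 0 then 1 else 0)"
proof (cases "t > 0")
  case True
  have "(\<lambda>n. exp (- (1 / t * inverse (real (Suc n))))) \<longlonglongrightarrow> exp (- (1 / t * 0))"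
    by (intro tendsto_intros LIMSEQ_inverse_real_of_nat)
  moreover have "exp (- (1 / t * inverse (real (Suc n)))) = bump_fn 0 (real (Suc n) * t)" for n
    using True zero_less_mult_iff[of "real (Suc n)" t] by (simp add: bump_fn_0 divide_inverse mult_ac)
  ultimately show ?thesis using True by simp
next
  case False
  then have "bump_fn 0 (real (Suc n) * t) = 0" for n
    by (simp add: bump_fn_0 mult_le_0_iff not_less zero_less_mult_iff)
  then show ?thesis using False by simp
qed

text \<open>As \<open>n\<close> grows these functions, smooth and supported in the closed box, increase to the indicator
  function of the open box.\<close>

definition box_bump :: "real ^ 'n::finite \<Rightarrow> real ^ 'n \<Rightarrow> nat \<Rightarrow> real ^ 'n \<Rightarrow> real" where
  "box_bump a b n x = (\<Prod>k\<in>UNIV. bump_fn 0 (real (Suc n) * (x $ k - a $ k)) *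
                              bump_fn 0 (real (Suc n) * (b $ k - x $ k)))"

lemma smooth_box_bump: "smooth_on S (box_bump a b n)"
proof -
  have "smooth_on UNIV (box_bump a b n)"
    unfolding smooth_on_def box_bump_def[abs_def]
    by (intro allI Ck_on_prod Ck_on_mult Ck_on_bump_fn Ck_on_cmult Ck_on_diff Ck_on_coord Ck_on_const open_UNIV)
  then show ?thesis by (rule smooth_on_subset) simp
qed

lemma box_bump_bounds: "0 \<le> box_bump a b n x" "box_bump a b n x \<le> 1"
  unfolding box_bump_def
  by (intro prod_nonneg prod_le_1 ballI conjI mult_nonneg_nonneg mult_le_one bump_fn_bounds)+

lemma box_bump_eq_0_iff: "box_bump a b n x = 0 \<longleftrightarrow> x \<notin> box a b"
  by (auto simp: box_bump_def mem_box_cart bump_fn_0 zero_less_mult_iff)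

lemma tendsto_box_bump: "(\<lambda>n. box_bump a b n x) \<longlonglongrightarrow> indicator (box a b) x"
proof -
  have "(\<lambda>n. box_bump a b n x) \<longlonglongrightarrow>
    (\<Prod>k\<in>UNIV. (if x $ k - a $ k > 0 then 1 else 0) * (if b $ k - x $ k > 0 then 1 else 0))"
    unfolding box_bump_def by (intro tendsto_intros tendsto_bump_fn_scaled)
  moreover have "(\<Prod>k\<in>UNIV. (if x $ k - a $ k > 0 then 1 else 0) * (if b $ k - x $ k > 0 then 1 else 0))
     = (indicator (box a b) x :: real)"
  proof (cases "x \<in> box a b")
    case False
    then obtain k where "\<not> (a $ k < x $ k \<and> x $ k < b $ k)" by (auto simp: mem_box_cart)
    then show ?thesis using False by (auto intro!: prod_zero bexI[of _ k] simp: indicator_def)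
  qed (simp add: mem_box_cart)
  ultimately show ?thesis by simp
qed

section \<open>Supports and test functions\<close>

lemma supp_subset_closed: "closed K \<Longrightarrow> (\<And>x. x \<notin> K \<Longrightarrow> f x = 0) \<Longrightarrow> supp f \<subseteq> K"
  unfolding supp_def by (rule closure_minimal) auto

lemma compact_suppI:
  fixes f :: "'a::t2_space \<Rightarrow> real"
  shows "compact K \<Longrightarrow> (\<And>x. x \<notin> K \<Longrightarrow> f x = 0) \<Longrightarrow> compact (supp f)"
  using supp_subset_closed[OF compact_imp_closed, of K f] closed_Int_compact[of "supp f" K]
  by (simp add: supp_def Int_absorb2)

lemma not_in_supp: "x \<notin> supp f \<Longrightarrow> f x = 0"
  unfolding supp_def using closure_subset[of "{x. f x \<noteq> 0}"] by blast

lemma closed_supp [simp]: "closed (supp f)" by (simp add: supp_def)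

lemma partial_not_in_supp:
  assumes "x \<notin> supp f" shows "partial k f x = 0"
proof -
  have "partial k f x = partial k (\<lambda>_. 0) x"
    by (rule partial_cong_open[of "- supp f"]) (use assms not_in_supp in auto)
  then show ?thesis by simp
qed

lemma supp_partial: "supp (partial k f) \<subseteq> supp f"
  by (rule supp_subset_closed) (auto intro: partial_not_in_supp)

lemma supp_mult_left: "supp (\<lambda>x. f x * g x) \<subseteq> supp f"
  by (rule supp_subset_closed) (auto dest: not_in_supp)

lemma supp_mult_right: "supp (\<lambda>x. f x * g x) \<subseteq> supp g"
  by (rule supp_subset_closed) (auto dest: not_in_supp)

lemma compact_subset_supp: "compact (supp g) \<Longrightarrow> supp f \<subseteq> supp g \<Longrightarrow> compact (supp f)"
  by (metis closed_supp closed_Int_compact inf.absorb_iff1)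

lemma test_functionD:
  assumes "test_function S \<psi>"
  shows "Ck_on m UNIV \<psi>" "compact (supp \<psi>)" "supp \<psi> \<subseteq> S" "smooth_on UNIV \<psi>"
  using assms by (auto simp: test_function_def smooth_on_def)

lemma test_function_mono: "test_function S \<psi> \<Longrightarrow> S \<subseteq> T \<Longrightarrow> test_function T \<psi>"
  by (auto simp: test_function_def)

lemma test_function_partial: "test_function S \<psi> \<Longrightarrow> test_function S (partial k \<psi>)"
  unfolding test_function_def
  using supp_partial compact_subset_supp smooth_on_partial by (metis subset_trans)

lemma test_function_box_bump:
  assumes "closure (box a b) \<subseteq> S" shows "test_function S (box_bump a b n)"
proof -
  have "supp (box_bump a b n) \<subseteq> closure (box a b)"
    by (rule supp_subset_closed) (use box_bump_eq_0_iff closure_subset in blast)+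
  moreover have "compact (closure (box a b))" by (simp add: bounded_box)
  ultimately show ?thesis using assms
    unfolding test_function_def
    by (meson closed_supp compact_eq_bounded_closed bounded_subset smooth_box_bump subset_trans)
qed

section \<open>The fundamental lemma of the calculus of variations\<close>

lemma exhausting_boxes: "(\<Union>n. box (\<chi> i. - real n) (\<chi> i. real n)) = (UNIV :: (real ^ 'n::finite) set)"
proof (intro set_eqI iffI UNIV_I UN_iff[THEN iffD2])
  fix x :: "real^'n"
  obtain n where n: "norm x < real n" using reals_Archimedean2 by blast
  have "\<bar>x $ i\<bar> < real n" for i using component_le_norm_cart[of x i] n by simp
  then have "- real n < x $ i" "x $ i < real n" for i by (simp_all add: abs_less_iff minus_less_iff)
  then show "\<exists>n\<in>UNIV. x \<in> box (\<chi> i. - real n) (\<chi> i. real n)"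
    by (intro bexI[of _ n]) (simp_all add: mem_box_cart)
qed

text \<open>Boxes generate the Borel sets and are stable under intersection, so the positive and the negative
  part of \<open>f\<close> define the same measure. The measure \<open>M\<close> is arbitrary, so that this serves for Lebesgue
  and for Hausdorff measure.\<close>

lemma AE_zero_if_box_integrals_zero:
  fixes f :: "real ^ 'n::finite \<Rightarrow> real"
  assumes M: "sets M = sets borel" and f: "integrable M f"
    and box: "\<And>a b. (\<integral>x. indicator (box a b) x * f x \<partial>M) = 0"
  shows "AE x in M. f x = 0"
proof -
  have sp: "space M = UNIV" using M by (metis sets_eq_imp_space_eq space_borel)
  have [measurable]: "f \<in> borel_measurable M" using f by simp
  define p where "p x = ennreal (f x)" for x
  define q where "q x = ennreal (- f x)" for x
  have [measurable]: "p \<in> borel_measurable M" "q \<in> borel_measurable M"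
    unfolding p_def q_def by measurable
  have fin: "(\<integral>\<^sup>+x. p x \<partial>M) \<noteq> \<infinity>" "(\<integral>\<^sup>+x. q x \<partial>M) \<noteq> \<infinity>"
    using f unfolding real_integrable_def p_def q_def by auto
  have dens: "emeasure (density M p) (box a b) = emeasure (density M q) (box a b)" for a b
  proof -
    have bM: "box a b \<in> sets M" by (simp add: M)
    let ?g = "\<lambda>x. indicator (box a b) x * f x"
    have g: "integrable M ?g"
      using integrable_mult_indicator[OF bM f] by simp
    have e: "p x * indicator (box a b) x = ennreal (?g x)" "q x * indicator (box a b) x = ennreal (- ?g x)" for x
      by (auto simp: p_def q_def indicator_def)
    have fin': "(\<integral>\<^sup>+x. ennreal (?g x) \<partial>M) \<noteq> \<infinity>" "(\<integral>\<^sup>+x. ennreal (- ?g x) \<partial>M) \<noteq> \<infinity>"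
      using g unfolding real_integrable_def by auto
    have "enn2real (\<integral>\<^sup>+x. ennreal (?g x) \<partial>M) = enn2real (\<integral>\<^sup>+x. ennreal (- ?g x) \<partial>M)"
      using real_lebesgue_integral_def[OF g] box[of a b] by simp
    moreover have "J \<noteq> \<infinity> \<Longrightarrow> J' \<noteq> \<infinity> \<Longrightarrow> enn2real J = enn2real J' \<Longrightarrow> J = J'" for J J' :: ennreal
      by (cases J; cases J') auto
    ultimately have "(\<integral>\<^sup>+x. ennreal (?g x) \<partial>M) = (\<integral>\<^sup>+x. ennreal (- ?g x) \<partial>M)"
      using fin' by blast
    then show ?thesis by (simp add: emeasure_density bM e)
  qed
  have "density M p = density M q"
  proof (rule measure_eqI_generator_eq[where E = "range (\<lambda>(a, b). box a b)" and \<Omega> = UNIV and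
        A = "\<lambda>n. box (\<chi> i. - real n) (\<chi> i. real n)"])
    show "Int_stable (range (\<lambda>(a, b). box a b :: (real^'n) set))"
      by (auto simp: Int_stable_def box_Int_box)
    show "sets (density M p) = sigma_sets UNIV (range (\<lambda>(a, b). box a b))"
      "sets (density M q) = sigma_sets UNIV (range (\<lambda>(a, b). box a b))"
      by (simp_all add: M borel_eq_box)
    show "(\<Union>n. box (\<chi> i. - real n) (\<chi> i. real n)) = (UNIV :: (real^'n) set)"
      by (rule exhausting_boxes)
    show "emeasure (density M p) (box (\<chi> i. - real n) (\<chi> i. real n)) \<noteq> \<infinity>" for n
    proof -
      have "emeasure (density M p) (box (\<chi> i. - real n) (\<chi> i. real n)) \<le> (\<integral>\<^sup>+x. p x \<partial>M)"
        by (subst emeasure_density) (auto simp: M intro!: nn_integral_mono simp: indicator_def)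
      then show ?thesis using fin(1) by (metis infinity_ennreal_def neq_top_trans)
    qed
  qed (use dens in auto)
  then have "AE x in M. p x = q x"
    by (subst (asm) finite_density_unique) (use fin in auto)
  then show ?thesis
  proof eventually_elim
    case (elim x)
    then show "f x = 0" unfolding p_def q_def
      by (cases "f x \<ge> 0") (auto simp: ennreal_neg)
  qed
qed

text \<open>Indicator functions of boxes are bounded limits of test functions.\<close>

lemma AE_zero_if_test_integrals_zero_borel:
  fixes f :: "real ^ 'n::finite \<Rightarrow> real"
  assumes M: "sets M = sets borel" and S: "open S"
    and f: "\<And>K. compact K \<Longrightarrow> K \<subseteq> S \<Longrightarrow> integrable M (\<lambda>x. indicator K x * f x)"
    and test: "\<And>\<psi>. test_function S \<psi> \<Longrightarrow> (\<integral>x. f x * \<psi> x \<partial>M) = 0"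
  shows "AE x in M. x \<in> S \<longrightarrow> f x = 0"
proof -
  define F where "F = {box c d | c d. closure (box c d) \<subseteq> S}"
  have "\<And>X. X \<in> F \<Longrightarrow> open X" by (auto simp: F_def)
  then obtain F' where F': "F' \<subseteq> F" "countable F'" "\<Union>F' = \<Union>F" using Lindelof by metis
  have US: "\<Union>F = S"
  proof
    show "\<Union>F \<subseteq> S" using closure_subset by (auto simp: F_def)
    show "S \<subseteq> \<Union>F"
    proof
      fix x assume "x \<in> S"
      then obtain e where e: "e > 0" "cball x e \<subseteq> S" using S by (meson open_contains_cball)
      obtain a b where ab: "x \<in> box a b" "box a b \<subseteq> ball x e" using rational_boxes[OF e(1)] by metis
      have "closure (box a b) \<subseteq> cball x e" by (rule closure_minimal) (use ab(2) ball_subset_cball in blast)+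
      with e ab show "x \<in> \<Union>F" unfolding F_def by blast
    qed
  qed
  have key: "AE x in M. x \<in> box c d \<longrightarrow> f x = 0" if cd: "closure (box c d) \<subseteq> S" for c d
  proof -
    have K: "compact (closure (box c d))" by (simp add: bounded_box)
    have fK: "integrable M (\<lambda>x. indicator (closure (box c d)) x * f x)" by (rule f[OF K cd])
    define g where "g x = indicator (box c d) x * f x" for x
    have g_eq: "g x = indicator (box c d) x * (indicator (closure (box c d)) x * f x)" for x
      using closure_subset[of "box c d"] by (auto simp: g_def indicator_def)
    have g: "integrable M g"
      unfolding g_eq using integrable_mult_indicator[OF _ fK, of "box c d"] M by simp
    have "AE x in M. g x = 0"
    proof (rule AE_zero_if_box_integrals_zero[OF M g])
      fix a b
      define a' b' where "a' = (\<chi> k. max (a $ k) (c $ k))" and "b' = (\<chi> k. min (b $ k) (d $ k))"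
      have box': "box a b \<inter> box c d = box a' b'"
        by (auto simp: mem_box_cart a'_def b'_def)
      have cl: "closure (box a' b') \<subseteq> closure (box c d)"
        unfolding box'[symmetric] by (rule closure_mono) auto
      have "(\<lambda>n. \<integral>x. f x * box_bump a' b' n x \<partial>M) \<longlonglongrightarrow> (\<integral>x. indicator (box a b) x * g x \<partial>M)"
      proof (rule integral_dominated_convergence[where w = "\<lambda>x. \<bar>indicator (closure (box c d)) x * f x\<bar>"])
        have meas: "box_bump a' b' n \<in> borel_measurable M" for n
          using smooth_on_imp_continuous[OF smooth_box_bump[of UNIV a' b' n]]
          by (simp add: measurable_cong_sets[OF M refl] borel_measurable_continuous_onI)
        have eq: "f x * box_bump a' b' n x = (indicator (closure (box c d)) x * f x) * box_bump a' b' n x" for x n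
          using box_bump_eq_0_iff[of a' b' n x] box' closure_subset[of "box c d"] by (auto simp: indicator_def)
        show "(\<lambda>x. f x * box_bump a' b' n x) \<in> borel_measurable M" for n
          unfolding eq by (rule borel_measurable_times[OF borel_measurable_integrable[OF fK] meas])
        show "AE x in M. norm (f x * box_bump a' b' n x) \<le> \<bar>indicator (closure (box c d)) x * f x\<bar>" for n
          unfolding eq by (intro AE_I2) (simp only: real_norm_def abs_mult[of _ "box_bump a' b' n _"]
              mult_right_le_one_le[OF abs_ge_zero] abs_of_nonneg[OF box_bump_bounds(1)] box_bump_bounds)
        have "(\<lambda>n. f x * box_bump a' b' n x) \<longlonglongrightarrow> f x * indicator (box a' b') x" for x
          by (intro tendsto_intros tendsto_box_bump)
        moreover have "f x * indicator (box a' b') x = indicator (box a b) x * g x" for x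
          unfolding box'[symmetric] g_def by (auto simp: indicator_def)
        ultimately show "AE x in M. (\<lambda>n. f x * box_bump a' b' n x) \<longlonglongrightarrow> indicator (box a b) x * g x" by simp
        show "(\<lambda>x. indicator (box a b) x * g x) \<in> borel_measurable M"
          using integrable_mult_indicator[OF _ g, of "box a b"] M by auto
      qed (use fK in auto)
      moreover have "(\<integral>x. f x * box_bump a' b' n x \<partial>M) = 0" for n
        by (rule test, rule test_function_box_bump) (use cl cd in blast)
      ultimately show "(\<integral>x. indicator (box a b) x * g x \<partial>M) = 0"
        by (simp add: LIMSEQ_const_iff)
    qed
    then show ?thesis by eventually_elim (auto simp: g_def)
  qed
  have "AE x in M. \<forall>X\<in>F'. x \<in> X \<longrightarrow> f x = 0"
    unfolding AE_ball_countable[OF F'(2)] using F'(1) key by (auto simp: F_def)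
  then show ?thesis
  proof eventually_elim
    case (elim x)
    then show "x \<in> S \<longrightarrow> f x = 0" using US F'(3) by blast
  qed
qed

section \<open>Integration by parts\<close>

lemma integral_lborel_affine:
  fixes f :: "'a::euclidean_space \<Rightarrow> real"
  assumes [measurable]: "f \<in> borel_measurable borel" and c: "c \<noteq> 0"
  shows "(\<integral>x. f x \<partial>lborel) = \<bar>c\<bar> ^ DIM('a) * (\<integral>x. f (t + c *\<^sub>R x) \<partial>lborel)"
proof -
  have "(\<integral>x. f x \<partial>lborel) = (\<integral>x. f x \<partial>density (distr lborel borel (\<lambda>x. t + c *\<^sub>R x)) (\<lambda>_. ennreal (\<bar>c\<bar> ^ DIM('a))))"
    using lborel_affine[OF c, of t] by (simp add: ennreal_power)
  also have "\<dots> = (\<integral>x. \<bar>c\<bar> ^ DIM('a) *\<^sub>R f x \<partial>distr lborel borel (\<lambda>x. t + c *\<^sub>R x))"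
    by (subst integral_density) auto
  also have "\<dots> = \<bar>c\<bar> ^ DIM('a) * (\<integral>x. f (t + c *\<^sub>R x) \<partial>lborel)"
    by (subst integral_distr) auto
  finally show ?thesis .
qed

lemma integrable_lborel_affine:
  fixes f :: "'a::euclidean_space \<Rightarrow> real"
  assumes [measurable]: "f \<in> borel_measurable borel" and c: "c \<noteq> 0"
  shows "integrable lborel (\<lambda>x. f (t + c *\<^sub>R x)) \<longleftrightarrow> integrable lborel f"
proof -
  have "integrable lborel f \<longleftrightarrow> integrable (density (distr lborel borel (\<lambda>x. t + c *\<^sub>R x)) (\<lambda>_. ennreal (\<bar>c\<bar> ^ DIM('a)))) f"
    using lborel_affine[OF c, of t] by (simp add: ennreal_power)
  also have "\<dots> \<longleftrightarrow> integrable (distr lborel borel (\<lambda>x. t + c *\<^sub>R x)) (\<lambda>x. \<bar>c\<bar> ^ DIM('a) *\<^sub>R f x)"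
    by (subst integrable_density) auto
  also have "\<dots> \<longleftrightarrow> integrable lborel (\<lambda>x. f (t + c *\<^sub>R x))"
    using c by (subst integrable_distr_eq) auto
  finally show ?thesis by simp
qed

lemma integrable_continuous_compact_supp:
  fixes f :: "'a::euclidean_space \<Rightarrow> real"
  assumes "continuous_on UNIV f" "compact K" "\<And>x. x \<notin> K \<Longrightarrow> f x = 0"
  shows "integrable lborel f"
proof -
  have "integrable lborel (\<lambda>x. indicator K x *\<^sub>R f x)"
    by (rule borel_integrable_compact) (use assms continuous_on_subset in blast)+
  moreover have "indicator K x *\<^sub>R f x = f x" for x using assms(3)[of x] by (cases "x \<in> K") auto
  ultimately show ?thesis by (simp only: )
qed

lemma bounded_continuous_compact_supp:
  fixes f :: "'a::euclidean_space \<Rightarrow> real"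
  assumes "continuous_on UNIV f" "compact K" "\<And>x. x \<notin> K \<Longrightarrow> f x = 0"
  obtains C where "C \<ge> 0" "\<And>x. \<bar>f x\<bar> \<le> C"
proof -
  have "compact (f ` K)" using assms by (meson compact_continuous_image continuous_on_subset subset_UNIV)
  then obtain C where C: "\<And>x. x \<in> K \<Longrightarrow> \<bar>f x\<bar> \<le> C"
    by (metis bounded_iff compact_imp_bounded imageI real_norm_def)
  have "\<bar>f x\<bar> \<le> max C 0" for x using C[of x] assms(3)[of x] by (cases "x \<in> K") auto
  then show ?thesis using that[of "max C 0"] by simp
qed

text \<open>The integral of a difference quotient vanishes by translation invariance.\<close>

lemma integral_partial_eq_0:
  fixes f :: "real ^ 'n::finite \<Rightarrow> real"
  assumes f: "Ck_on 1 UNIV f" and K: "compact (supp f)"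
  shows "(\<integral>x. partial k f x \<partial>lborel) = 0"
proof -
  have cf: "continuous_on UNIV f" and cpf: "continuous_on UNIV (partial k f)"
    using f Ck_on_imp_continuous[of 1 UNIV f] by simp_all
  have df: "f differentiable (at x)" for x using f by (simp add: differentiable_on_open)
  have [measurable]: "f \<in> borel_measurable borel"
    using cf by (rule borel_measurable_continuous_onI)
  have fint: "integrable lborel f"
    using integrable_continuous_compact_supp[OF cf K] not_in_supp by blast
  obtain C where C: "C \<ge> 0" "\<And>x. \<bar>partial k f x\<bar> \<le> C"
    using bounded_continuous_compact_supp[OF cpf K] partial_not_in_supp by blast
  obtain R where R: "supp f \<subseteq> cball 0 R" using compact_imp_bounded[OF K] unfolding bounded_pos by (auto simp: subset_eq)
  define t where "t n = inverse (real (Suc n))" for n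
  have t: "0 < t n" "t n \<le> 1" for n
    by (simp_all add: t_def inverse_le_1_iff del: of_nat_Suc)
  have t0: "t \<longlonglongrightarrow> 0" unfolding t_def[abs_def] by (rule LIMSEQ_inverse_real_of_nat)
  define D where "D n x = (f (x + t n *\<^sub>R axis k 1) - f x) / t n" for n x
  have "(\<lambda>n. \<integral>x. D n x \<partial>lborel) \<longlonglongrightarrow> (\<integral>x. partial k f x \<partial>lborel)"
  proof (rule integral_dominated_convergence[where w = "\<lambda>x. indicator (cball 0 (R + 1)) x *\<^sub>R C"])
    show "partial k f \<in> borel_measurable lborel"
      using borel_measurable_continuous_onI[OF cpf] by simp
    show "D n \<in> borel_measurable lborel" for n unfolding D_def[abs_def] by measurable
    show "integrable lborel (\<lambda>x. indicator (cball 0 (R + 1)) x *\<^sub>R C :: real)"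
      by (rule borel_integrable_compact) auto
    show "AE x in lborel. (\<lambda>n. D n x) \<longlonglongrightarrow> partial k f x"
    proof (rule AE_I2)
      fix x
      have "((\<lambda>h. (f (x + h *\<^sub>R axis k 1) - f x) / h) \<longlongrightarrow> partial k f x) (at 0)"
        using DERIV_axis0[OF df, of x k] by (simp add: has_field_derivative_iff)
      moreover have "filterlim t (at 0) sequentially"
        unfolding filterlim_at using t0 t(1) by (auto intro!: always_eventually simp: less_imp_neq[symmetric])
      ultimately show "(\<lambda>n. D n x) \<longlonglongrightarrow> partial k f x"
        unfolding D_def by (rule filterlim_compose)
    qed
    show "AE x in lborel. norm (D n x) \<le> indicator (cball 0 (R + 1)) x *\<^sub>R C" for n
    proof (rule AE_I2)
      fix x
      show "norm (D n x) \<le> indicator (cball 0 (R + 1)) x *\<^sub>R C"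
      proof (cases "x \<in> cball 0 (R + 1)")
        case True
        have "\<exists>\<sigma>. 0 < \<sigma> \<and> \<sigma> < t n \<and> f (x + t n *\<^sub>R axis k 1) - f (x + 0 *\<^sub>R axis k 1) = (t n - 0) * partial k f (x + \<sigma> *\<^sub>R axis k 1)"
          by (rule MVT2[OF t(1)]) (rule DERIV_along_axis[OF df])
        then obtain \<sigma> where "f (x + t n *\<^sub>R axis k 1) - f x = t n * partial k f (x + \<sigma> *\<^sub>R axis k 1)" by auto
        then have "D n x = partial k f (x + \<sigma> *\<^sub>R axis k 1)" using t(1)[of n] by (simp add: D_def)
        then show ?thesis using True C by simp
      next
        case False
        have "x \<notin> supp f" "x + t n *\<^sub>R axis k 1 \<notin> supp f"
        proof -
          have "norm x > R + 1" using False by simp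
          moreover have "norm (t n *\<^sub>R axis k 1 :: real^'n) \<le> 1" using t[of n] by simp
          moreover have "norm x \<le> norm (x + t n *\<^sub>R axis k 1) + norm (t n *\<^sub>R axis k 1 :: real^'n)"
            using norm_triangle_ineq4[of "x + t n *\<^sub>R axis k 1" "t n *\<^sub>R axis k 1"] by simp
          ultimately have "x \<notin> cball 0 R" "x + t n *\<^sub>R axis k 1 \<notin> cball 0 R" by auto
          then show "x \<notin> supp f" "x + t n *\<^sub>R axis k 1 \<notin> supp f" using R by blast+
        qed
        then have "D n x = 0" by (simp add: D_def not_in_supp[of _ f])
        then show ?thesis using False by simp
      qed
    qed
  qed
  moreover have "(\<integral>x. D n x \<partial>lborel) = 0" for n
  proof -
    have 1: "integrable lborel (\<lambda>x. f (x + t n *\<^sub>R axis k 1))"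
      using integrable_lborel_affine[of f 1 "t n *\<^sub>R axis k 1"] fint by (simp add: add.commute)
    have "(\<integral>x. f (x + t n *\<^sub>R axis k 1) \<partial>lborel) = (\<integral>x. f x \<partial>lborel)"
      using integral_lborel_affine[of f 1 "t n *\<^sub>R axis k 1"] by (simp add: add.commute)
    then show ?thesis unfolding D_def using 1 fint by simp
  qed
  ultimately show ?thesis by (simp add: LIMSEQ_const_iff)
qed

lemma Ck_on_Un: "open S \<Longrightarrow> open T \<Longrightarrow> Ck_on m S f \<Longrightarrow> Ck_on m T f \<Longrightarrow> Ck_on m (S \<union> T) f"
  by (induction m arbitrary: f) (auto simp: continuous_on_open_Un differentiable_on_open open_Un)

lemma Ck_on_mult_supp:
  fixes f \<psi> :: "real ^ 'n::finite \<Rightarrow> real"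
  assumes "open S" "Ck_on m S f" "Ck_on m UNIV \<psi>" "supp \<psi> \<subseteq> S"
  shows "Ck_on m UNIV (\<lambda>x. f x * \<psi> x)"
proof -
  have "Ck_on m S \<psi>" using assms(3) by (rule Ck_on_subset) simp
  then have 1: "Ck_on m S (\<lambda>x. f x * \<psi> x)" using assms by (intro Ck_on_mult)
  have o: "open (- supp \<psi>)" by (simp add: open_Compl)
  have 2: "Ck_on m (- supp \<psi>) (\<lambda>x. f x * \<psi> x)"
    by (rule iffD2[OF Ck_on_cong[OF o] Ck_on_const[of m _ 0]]) (simp add: not_in_supp[of _ \<psi>])
  have "Ck_on m (S \<union> - supp \<psi>) (\<lambda>x. f x * \<psi> x)"
    by (rule Ck_on_Un[OF assms(1) o 1 2])
  moreover have "S \<union> - supp \<psi> = UNIV" using assms(4) by auto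
  ultimately show ?thesis by simp
qed

lemma integral_lebesgue_lborel:
  fixes f :: "'a::euclidean_space \<Rightarrow> real"
  shows "continuous_on UNIV f \<Longrightarrow> (\<integral>x. f x \<partial>lebesgue) = (\<integral>x. f x \<partial>lborel)"
  by (rule integral_completion) (simp add: borel_measurable_continuous_onI)

lemma integrable_lebesgue_lborel:
  fixes f :: "'a::euclidean_space \<Rightarrow> real"
  shows "continuous_on UNIV f \<Longrightarrow> integrable lebesgue f \<longleftrightarrow> integrable lborel f"
  by (rule integrable_completion) (simp add: borel_measurable_continuous_onI)

text \<open>The product \<open>f \<psi>\<close>, extended by \<open>0\<close>, is a $C^1$ function on the whole space even though \<open>f\<close> is
  one only on \<open>S\<close>.\<close>

lemma integration_by_parts:
  fixes f \<psi> :: "real ^ 'n::finite \<Rightarrow> real"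
  assumes S: "open S" and f: "Ck_on 1 S f" and \<psi>: "Ck_on 1 UNIV \<psi>" "compact (supp \<psi>)" "supp \<psi> \<subseteq> S"
  shows "(\<integral>x. f x * partial k \<psi> x \<partial>lebesgue) = - (\<integral>x. partial k f x * \<psi> x \<partial>lebesgue)"
    and "integrable lebesgue (\<lambda>x. f x * partial k \<psi> x)" "integrable lebesgue (\<lambda>x. partial k f x * \<psi> x)"
proof -
  have p: "Ck_on 1 UNIV (\<lambda>x. f x * \<psi> x)" using Ck_on_mult_supp[OF S f \<psi>(1,3)] .
  have c1: "continuous_on UNIV (\<lambda>x. partial k f x * \<psi> x)"
    using Ck_on_mult_supp[OF S, of 0 "partial k f" \<psi>] f \<psi>(3) Ck_on_imp_continuous[OF \<psi>(1)] by simp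
  have c2: "continuous_on UNIV (\<lambda>x. f x * partial k \<psi> x)"
    using Ck_on_mult_supp[OF S, of 0 f "partial k \<psi>"] Ck_on_imp_continuous[OF f] \<psi>(1)
      subset_trans[OF supp_partial \<psi>(3)] by simp
  have i1: "integrable lborel (\<lambda>x. partial k f x * \<psi> x)"
    by (rule integrable_continuous_compact_supp[OF c1 \<psi>(2)]) (simp add: not_in_supp)
  have i2: "integrable lborel (\<lambda>x. f x * partial k \<psi> x)"
    by (rule integrable_continuous_compact_supp[OF c2 \<psi>(2)]) (simp add: partial_not_in_supp)
  have eq: "partial k (\<lambda>x. f x * \<psi> x) x = partial k f x * \<psi> x + f x * partial k \<psi> x" for x
  proof (cases "x \<in> S")
    case True
    then show ?thesis
      using Ck_on_differentiable[OF f _ S True] Ck_on_differentiable[OF \<psi>(1) _ open_UNIV] by (intro partial_mult) auto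
  next
    case False
    then have "x \<notin> supp \<psi>" using \<psi>(3) by blast
    moreover from this have "x \<notin> supp (\<lambda>x. f x * \<psi> x)" using supp_mult_right by blast
    ultimately show ?thesis by (simp add: partial_not_in_supp not_in_supp)
  qed
  have "compact (supp (\<lambda>x. f x * \<psi> x))" by (rule compact_subset_supp[OF \<psi>(2) supp_mult_right])
  from integral_partial_eq_0[OF p this, of k] have "(\<integral>x. partial k f x * \<psi> x \<partial>lborel) + (\<integral>x. f x * partial k \<psi> x \<partial>lborel) = 0"
    unfolding eq using i1 i2 by simp
  then show "(\<integral>x. f x * partial k \<psi> x \<partial>lebesgue) = - (\<integral>x. partial k f x * \<psi> x \<partial>lebesgue)"
    using integral_lebesgue_lborel[OF c1] integral_lebesgue_lborel[OF c2] by simp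
  show "integrable lebesgue (\<lambda>x. f x * partial k \<psi> x)" "integrable lebesgue (\<lambda>x. partial k f x * \<psi> x)"
    using integrable_lebesgue_lborel[OF c1] integrable_lebesgue_lborel[OF c2] i1 i2 by simp_all
qed

section \<open>Mollification\<close>

lemma has_derivative_partials:
  fixes f :: "real ^ 'n::finite \<Rightarrow> real"
  assumes "f differentiable (at x)"
  shows "(f has_derivative (\<lambda>h. \<Sum>k\<in>UNIV. partial k f x * h $ k)) (at x)"
proof -
  obtain f' where f': "(f has_derivative f') (at x)" using assms by (auto simp: differentiable_def)
  have "f' h = (\<Sum>k\<in>UNIV. partial k f x * h $ k)" for h
  proof -
    have "f' h = f' (\<Sum>k\<in>UNIV. h $ k *\<^sub>R axis k 1)"
      using basis_expansion[of h] by (simp add: scalar_mult_eq_scaleR)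
    also have "\<dots> = (\<Sum>k\<in>UNIV. h $ k * f' (axis k 1))"
      using has_derivative_linear[OF f'] by (simp add: linear_sum linear_cmul)
    finally show ?thesis by (simp add: has_derivative_imp_partial[OF f'] mult.commute)
  qed
  then have "f' = (\<lambda>h. \<Sum>k\<in>UNIV. partial k f x * h $ k)" by auto
  with f' show ?thesis by simp
qed

definition conv :: "(real ^ 'n::finite \<Rightarrow> real) \<Rightarrow> (real ^ 'n \<Rightarrow> real) \<Rightarrow> real ^ 'n \<Rightarrow> real" where
  "conv \<rho> u x = (\<integral>z. \<rho> (x - z) * u z \<partial>lborel)"

lemma conv_integrable:
  fixes \<rho> u :: "real ^ 'n::finite \<Rightarrow> real"
  assumes "continuous_on UNIV \<rho>" "continuous_on UNIV u" "compact K" "\<And>z. z \<notin> K \<Longrightarrow> u z = 0"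
  shows "integrable lborel (\<lambda>z. \<rho> (x - z) * u z)"
  by (rule integrable_continuous_compact_supp[OF _ assms(3)])
    (auto intro!: continuous_intros continuous_on_compose2[OF assms(1)] continuous_on_compose2[OF assms(2)] simp: assms(4))

lemma conv_eq_integral:
  fixes \<rho> u :: "real ^ 'n::finite \<Rightarrow> real"
  assumes "continuous_on UNIV \<rho>" "continuous_on UNIV u" "\<And>z. z \<notin> cbox a b \<Longrightarrow> u z = 0"
  shows "conv \<rho> u x = integral (cbox a b) (\<lambda>z. \<rho> (x - z) * u z)"
proof -
  have "conv \<rho> u x = integral UNIV (\<lambda>z. \<rho> (x - z) * u z)"
    unfolding conv_def by (rule integral_lborel[symmetric, OF conv_integrable[OF assms(1,2) compact_cbox assms(3)]])
  also have "\<dots> = integral UNIV (\<lambda>z. if z \<in> cbox a b then \<rho> (x - z) * u z else 0)"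
    by (rule arg_cong[where f = "integral UNIV"]) (auto simp: assms(3))
  finally show ?thesis by (simp add: integral_restrict_UNIV)
qed

lemma conv_has_derivative:
  fixes \<rho> u :: "real ^ 'n::finite \<Rightarrow> real"
  assumes \<rho>: "Ck_on 1 UNIV \<rho>" and u: "continuous_on UNIV u" "\<And>z. z \<notin> cbox a b \<Longrightarrow> u z = 0"
  shows "conv \<rho> u differentiable (at x)" "partial k (conv \<rho> u) x = conv (partial k \<rho>) u x"
proof -
  have cp: "continuous_on UNIV (partial k \<rho>)" for k using \<rho> by simp
  have c\<rho>: "continuous_on UNIV \<rho>" using \<rho> by (rule Ck_on_imp_continuous)
  define fx :: "real^'n \<Rightarrow> real^'n \<Rightarrow> ((real^'n) \<Rightarrow>\<^sub>L real)" where "fx x t = (\<Sum>k\<in>UNIV. (partial k \<rho> (x - t) * u t) *\<^sub>R Blinfun (\<lambda>h. h $ k))" for x t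
  have bl: "bounded_linear (\<lambda>h::real^'n. h $ k)" for k by (rule bounded_linear_vec_nth)
  have fx_apply: "blinfun_apply (fx x t) h = (\<Sum>k\<in>UNIV. partial k \<rho> (x - t) * u t * h $ k)" for x t h
    by (simp add: fx_def blinfun.sum_left blinfun.scaleR_left bounded_linear_Blinfun_apply[OF bl])
  have cfx: "continuous_on (UNIV \<times> cbox a b) (\<lambda>(x, t). fx x t)"
    unfolding fx_def split_beta
    by (intro continuous_intros continuous_on_compose2[OF cp] continuous_on_compose2[OF u(1)]) auto
  have d: "((\<lambda>x. integral (cbox a b) (\<lambda>t. \<rho> (x - t) * u t)) has_derivative integral (cbox a b) (fx x)) (at x within UNIV)" for x
  proof (rule leibniz_rule[OF _ _ cfx])
    fix x t
    have "\<rho> differentiable (at (x - t))" using \<rho> by (simp add: differentiable_on_open)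
    then have "((\<lambda>x. \<rho> (x - t)) has_derivative (\<lambda>h. \<Sum>k\<in>UNIV. partial k \<rho> (x - t) * h $ k)) (at x)"
      by (intro has_derivative_compose[of "\<lambda>x. x - t" "\<lambda>h. h" x UNIV \<rho>, OF _ has_derivative_partials])
        (auto intro!: derivative_eq_intros)
    from has_derivative_mult_left[OF this, of "u t"]
    show "((\<lambda>x. \<rho> (x - t) * u t) has_derivative blinfun_apply (fx x t)) (at x within UNIV)"
      unfolding fx_apply[abs_def] by (simp add: sum_distrib_left sum_distrib_right mult_ac)
  next
    fix x
    show "(\<lambda>t. \<rho> (x - t) * u t) integrable_on cbox a b"
      by (rule integrable_continuous)
        (auto intro!: continuous_intros continuous_on_compose2[OF c\<rho>] continuous_on_compose2[OF u(1)])
  qed auto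
  have e: "conv \<rho> u = (\<lambda>x. integral (cbox a b) (\<lambda>t. \<rho> (x - t) * u t))"
    using conv_eq_integral[OF c\<rho> u] by (intro ext)
  show "conv \<rho> u differentiable (at x)" using d[of x] unfolding e differentiable_def by auto
  have "partial k (conv \<rho> u) x = blinfun_apply (integral (cbox a b) (fx x)) (axis k 1)"
    unfolding e by (rule has_derivative_imp_partial) (use d[of x] in simp)
  also have "\<dots> = integral (cbox a b) (\<lambda>t. blinfun_apply (fx x t) (axis k 1))"
  proof (rule blinfun_apply_integral)
    show "fx x integrable_on cbox a b"
      by (rule integrable_continuous)
        (use continuous_on_compose2[OF cfx, of "cbox a b" "\<lambda>t. (x, t)"] in \<open>simp add: continuous_on_Pair image_subset_iff\<close>)
  qed
  also have "\<dots> = integral (cbox a b) (\<lambda>t. partial k \<rho> (x - t) * u t)"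
    by (simp add: fx_apply axis_def if_distrib[of "(*) _"] cong: if_cong)
  also have "\<dots> = conv (partial k \<rho>) u x" by (rule conv_eq_integral[symmetric, OF cp u])
  finally show "partial k (conv \<rho> u) x = conv (partial k \<rho>) u x" .
qed

lemma smooth_conv:
  fixes \<rho> u :: "real ^ 'n::finite \<Rightarrow> real"
  assumes \<rho>: "smooth_on UNIV \<rho>" and u: "continuous_on UNIV u" "\<And>z. z \<notin> cbox a b \<Longrightarrow> u z = 0"
  shows "smooth_on UNIV (conv \<rho> u)"
  unfolding smooth_on_def
proof
  fix m
  show "Ck_on m UNIV (conv \<rho> u)"
    using \<rho>
  proof (induction m arbitrary: \<rho>)
    case 0
    have "continuous (at x) (conv \<rho> u)" for x
      using conv_has_derivative(1)[OF smooth_onD[OF 0] u] differentiable_imp_continuous_within by blast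
    then show ?case by (simp add: continuous_on_eq_continuous_at)
  next
    case (Suc m)
    show ?case
      by (rule Ck_on_SucI[where g = "\<lambda>k. conv (partial k \<rho>) u"])
        (use conv_has_derivative[OF smooth_onD[OF Suc.prems] u] Suc.IH smooth_on_partial[OF Suc.prems] in auto)
  qed
qed

lemma partial_reflect:
  assumes "f differentiable (at (x - z))"
  shows "partial k (\<lambda>z. f (x - z)) z = - partial k f (x - z)"
proof -
  have "((\<lambda>z. x - z) has_derivative (\<lambda>h. - h)) (at z)" by (auto intro!: derivative_eq_intros)
  from has_derivative_compose[OF this has_derivative_partials[OF assms]]
  have "partial k (\<lambda>z. f (x - z)) z = (\<Sum>l\<in>UNIV. partial l f (x - z) * (- axis k 1) $ l)"
    by (rule has_derivative_imp_partial)
  also have "\<dots> = (\<Sum>l\<in>UNIV. if l = k then - partial l f (x - z) else 0)"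
    by (rule sum.cong) (auto simp: axis_def)
  finally show ?thesis by simp
qed

lemma continuous_on_reflect:
  fixes f :: "'a::real_normed_vector \<Rightarrow> real"
  shows "continuous_on UNIV f \<Longrightarrow> continuous_on UNIV (\<lambda>z. f (x - z))"
  by (rule continuous_on_compose2[of UNIV f]) (auto intro: continuous_intros)

lemma conv_partial_eq:
  fixes \<rho> u :: "real ^ 'n::finite \<Rightarrow> real"
  assumes \<rho>: "Ck_on 1 UNIV \<rho>" and u: "Ck_on 1 UNIV u" "compact (supp u)"
  shows "conv (partial k \<rho>) u x = conv \<rho> (partial k u) x"
proof -
  have d\<rho>: "\<rho> differentiable (at y)" for y using \<rho> by (simp add: differentiable_on_open)
  have "Ck_on 1 UNIV (\<lambda>z. \<rho> (x - z))"
    unfolding One_nat_def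
  proof (rule Ck_on_SucI[where g = "\<lambda>k z. - partial k \<rho> (x - z)"])
    show "(\<lambda>z. \<rho> (x - z)) differentiable at z" for z
      using differentiable_chain_at[of "\<lambda>z. x - z" z \<rho>] d\<rho>[of "x - z"]
      by (simp add: o_def differentiable_diff)
    have "continuous_on UNIV (partial k \<rho>)" for k using \<rho> by simp
    then show "Ck_on 0 UNIV (\<lambda>z. - partial k \<rho> (x - z))" for k
      unfolding Ck_on.simps by (intro continuous_on_minus continuous_on_reflect)
  qed (auto intro: partial_reflect d\<rho>)
  from integration_by_parts(1)[OF open_UNIV this u, of k]
  have "(\<integral>z. \<rho> (x - z) * partial k u z \<partial>lebesgue) = (\<integral>z. partial k \<rho> (x - z) * u z \<partial>lebesgue)"
    by (simp add: partial_reflect[OF d\<rho>])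
  moreover have "(\<integral>z. \<rho> (x - z) * partial k u z \<partial>lebesgue) = conv \<rho> (partial k u) x"
    unfolding conv_def using u Ck_on_imp_continuous[OF \<rho>]
    by (intro integral_lebesgue_lborel continuous_on_mult continuous_on_reflect) simp_all
  moreover have "(\<integral>z. partial k \<rho> (x - z) * u z \<partial>lebesgue) = conv (partial k \<rho>) u x"
    unfolding conv_def using \<rho> Ck_on_imp_continuous[OF u(1)]
    by (intro integral_lebesgue_lborel continuous_on_mult continuous_on_reflect) simp_all
  ultimately show ?thesis by simp
qed

lemma box_bump_integral_pos:
  assumes "box a b \<noteq> {}"
  shows "(\<integral>x. box_bump a b n x \<partial>lborel) > 0"
proof -
  have c: "continuous_on UNIV (box_bump a b n)" by (rule smooth_on_imp_continuous[OF smooth_box_bump])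
  have i: "integrable lborel (box_bump a b n)"
    by (rule integrable_continuous_compact_supp[OF c compact_cbox[of a b]])
      (use box_bump_eq_0_iff box_subset_cbox in blast)
  have "(\<integral>x. box_bump a b n x \<partial>lborel) \<noteq> 0"
  proof
    assume "(\<integral>x. box_bump a b n x \<partial>lborel) = 0"
    then have "AE x in lborel. box_bump a b n x = 0"
      using integral_nonneg_eq_0_iff_AE[OF i] by (simp add: box_bump_bounds)
    then have "AE x in lborel. x \<notin> box a b" by (simp add: box_bump_eq_0_iff)
    then have "emeasure lborel (box a b) = 0"
      using AE_iff_measurable[of "box a b" lborel "\<lambda>x. x \<notin> box a b"] by simp
    then show False using assms by (auto simp: emeasure_lborel_box_eq box_ne_empty prod_nonneg ennreal_eq_0_iff
          split: if_splits intro: prod_pos) (metis box_ne_empty(2) inner_diff_left diff_gt_0_iff_gt less_irrefl linorder_not_le prod_pos)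
  qed
  moreover have "(\<integral>x. box_bump a b n x \<partial>lborel) \<ge> 0" by (simp add: box_bump_bounds)
  ultimately show ?thesis by linarith
qed

definition mollifier :: "nat \<Rightarrow> real ^ 'n::finite \<Rightarrow> real" where
  "mollifier n x = (let \<epsilon> = inverse (real (Suc n)); \<beta> = box_bump (\<chi> k. - \<epsilon>) (\<chi> k. \<epsilon>) 0
     in \<beta> x / (\<integral>z. \<beta> z \<partial>lborel))"

lemma mollifier:
  fixes x y :: "real ^ 'n::finite"
  shows smooth_mollifier: "smooth_on UNIV (mollifier n :: real ^ 'n \<Rightarrow> real)"
    and mollifier_nonneg: "mollifier n x \<ge> 0"
    and mollifier_integral: "(\<integral>x. mollifier n (y - x) \<partial>lborel) = 1"
    and mollifier_integrable: "integrable lborel (\<lambda>x. mollifier n (y - x))"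
    and mollifier_eq_0: "norm x \<ge> real CARD('n) / real (Suc n) \<Longrightarrow> mollifier n x = 0"
proof -
  define \<epsilon> where "\<epsilon> = inverse (real (Suc n))"
  have \<epsilon>: "\<epsilon> > 0" unfolding \<epsilon>_def by simp
  define \<beta> :: "real^'n \<Rightarrow> real" where "\<beta> = box_bump (\<chi> k. - \<epsilon>) (\<chi> k. \<epsilon>) 0"
  define I where "I = (\<integral>z. \<beta> z \<partial>lborel)"
  have m: "mollifier n = (\<lambda>x. inverse I * \<beta> x)"
    by (rule ext) (simp add: mollifier_def Let_def \<epsilon>_def \<beta>_def I_def divide_inverse mult.commute)
  have "0 \<in> box (\<chi> k. - \<epsilon>) (\<chi> k. \<epsilon>)" using \<epsilon> by (simp add: mem_box_cart)
  then have I: "I > 0" unfolding I_def \<beta>_def by (intro box_bump_integral_pos) auto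
  show "smooth_on UNIV (mollifier n :: real^'n \<Rightarrow> real)"
    using smooth_box_bump[of UNIV "\<chi> k. - \<epsilon>" "\<chi> k. \<epsilon>" 0] unfolding m smooth_on_def \<beta>_def by (intro allI Ck_on_cmult) auto
  show "mollifier n x \<ge> 0" using I by (simp add: m \<beta>_def box_bump_bounds)
  have c: "continuous_on UNIV \<beta>" unfolding \<beta>_def by (rule smooth_on_imp_continuous[OF smooth_box_bump])
  have i: "integrable lborel \<beta>" unfolding \<beta>_def
    by (rule integrable_continuous_compact_supp[OF c[unfolded \<beta>_def] compact_cbox])
      (use box_bump_eq_0_iff box_subset_cbox in blast)
  have [measurable]: "\<beta> \<in> borel_measurable borel" using c by (rule borel_measurable_continuous_onI)
  have "(\<integral>x. \<beta> (y - x) \<partial>lborel) = I"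
    unfolding I_def using integral_lborel_affine[of \<beta> "-1" y] by simp
  then show "(\<integral>x. mollifier n (y - x) \<partial>lborel) = 1" using I unfolding m by simp
  have "integrable lborel (\<lambda>x. \<beta> (y - x))" using integrable_lborel_affine[of \<beta> "-1" y] i by simp
  then show "integrable lborel (\<lambda>x. mollifier n (y - x))" unfolding m by simp
  show "mollifier n x = 0" if "norm x \<ge> real CARD('n) / real (Suc n)"
  proof (rule ccontr)
    assume "mollifier n x \<noteq> 0"
    then have "x \<in> box (\<chi> k. - \<epsilon>) (\<chi> k. \<epsilon>)" by (auto simp: m \<beta>_def box_bump_eq_0_iff)
    then have "\<bar>x $ k\<bar> < \<epsilon>" for k by (auto simp: mem_box_cart abs_less_iff minus_less_iff)
    then have "(\<Sum>k\<in>UNIV. \<bar>x $ k\<bar>) < (\<Sum>k\<in>(UNIV::'n set). \<epsilon>)" by (intro sum_strict_mono) auto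
    moreover have "norm x \<le> (\<Sum>k\<in>UNIV. \<bar>x $ k\<bar>)" by (rule norm_le_l1_cart)
    ultimately show False using that by (simp add: \<epsilon>_def divide_inverse)
  qed
qed

lemma integral_abs_le:
  fixes f g :: "'a \<Rightarrow> real"
  assumes "integrable M f" "integrable M g" "\<And>x. \<bar>f x\<bar> \<le> g x"
  shows "\<bar>\<integral>x. f x \<partial>M\<bar> \<le> (\<integral>x. g x \<partial>M)"
proof -
  have "\<bar>\<integral>x. f x \<partial>M\<bar> \<le> (\<integral>x. \<bar>f x\<bar> \<partial>M)" by (rule integral_abs_bound)
  also have "\<dots> \<le> (\<integral>x. g x \<partial>M)" by (rule integral_mono) (use assms in auto)
  finally show ?thesis .
qed

lemma conv_mollifier_bound:
  fixes u :: "real ^ 'n::finite \<Rightarrow> real"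
  assumes u: "continuous_on UNIV u" "compact (supp u)" and C: "\<And>x. \<bar>u x\<bar> \<le> C"
  shows "\<bar>conv (mollifier n) u x\<bar> \<le> C"
proof -
  have cm: "continuous_on UNIV (mollifier n :: real^'n \<Rightarrow> real)" by (rule smooth_on_imp_continuous[OF smooth_mollifier])
  have "\<bar>conv (mollifier n) u x\<bar> \<le> (\<integral>z. mollifier n (x - z) * C \<partial>lborel)"
    unfolding conv_def
  proof (rule integral_abs_le)
    show "integrable lborel (\<lambda>z. mollifier n (x - z) * u z)"
      by (rule conv_integrable[OF cm u]) (rule not_in_supp)
    show "integrable lborel (\<lambda>z. mollifier n (x - z) * C)" using mollifier_integrable[of n x] by simp
  qed (auto simp: abs_mult mollifier_nonneg intro!: mult_left_mono C)
  then show ?thesis using mollifier_integral[of n x] mollifier_integrable[of n x] by simp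
qed

lemma conv_mollifier_tendsto:
  fixes u :: "real ^ 'n::finite \<Rightarrow> real"
  assumes u: "continuous_on UNIV u" "compact (supp u)"
  shows "(\<lambda>n. conv (mollifier n) u x) \<longlonglongrightarrow> u x"
proof (rule LIMSEQ_I)
  fix r :: real assume r: "r > 0"
  have cm: "continuous_on UNIV (mollifier n :: real^'n \<Rightarrow> real)" for n by (rule smooth_on_imp_continuous[OF smooth_mollifier])
  have "continuous (at x) u" using u(1) by (simp add: continuous_on_eq_continuous_at)
  then obtain \<delta> where \<delta>: "\<delta> > 0" "\<And>z. dist z x < \<delta> \<Longrightarrow> \<bar>u z - u x\<bar> < r / 2"
    unfolding continuous_at_eps_delta dist_real_def using r half_gt_zero by metis
  obtain n0 :: nat where n0: "real CARD('n) / \<delta> < real n0" using reals_Archimedean2 by blast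
  have "\<bar>conv (mollifier n) u x - u x\<bar> < r" if n: "n \<ge> n0" for n
  proof -
    have "real CARD('n) / real (Suc n) \<le> \<delta>"
    proof -
      have "real CARD('n) / \<delta> \<le> real (Suc n)" using n0 n by linarith
      then show ?thesis using \<delta>(1) by (simp add: field_simps)
    qed
    then have near: "mollifier n (x - z) * \<bar>u z - u x\<bar> \<le> mollifier n (x - z) * (r / 2)" for z
    proof (cases "dist z x < \<delta>")
      case True
      then show ?thesis
        by (intro mult_left_mono mollifier_nonneg less_imp_le[OF \<delta>(2)])
    next
      case False
      with \<open>real CARD('n) / real (Suc n) \<le> \<delta>\<close> have "mollifier n (x - z) = 0"
        by (intro mollifier_eq_0) (simp add: dist_norm norm_minus_commute)
      then show ?thesis by simp
    qed
    have i1: "integrable lborel (\<lambda>z. mollifier n (x - z) * u z)"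
      by (rule conv_integrable[OF cm u]) (rule not_in_supp)
    have i2: "integrable lborel (\<lambda>z. mollifier n (x - z) * u x)" using mollifier_integrable[of n x] by simp
    have "conv (mollifier n) u x - u x = (\<integral>z. mollifier n (x - z) * (u z - u x) \<partial>lborel)"
      unfolding conv_def right_diff_distrib using i1 i2 mollifier_integral[of n x] mollifier_integrable[of n x] by simp
    also have "\<bar>\<dots>\<bar> \<le> (\<integral>z. mollifier n (x - z) * (r / 2) \<partial>lborel)"
    proof (rule integral_abs_le)
      show "integrable lborel (\<lambda>z. mollifier n (x - z) * (u z - u x))"
        unfolding right_diff_distrib using i1 i2 by simp
      show "integrable lborel (\<lambda>z. mollifier n (x - z) * (r / 2))" using mollifier_integrable[of n x] by simp
    qed (use near in \<open>auto simp: abs_mult mollifier_nonneg\<close>)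
    also have "\<dots> = r / 2" using mollifier_integral[of n x] mollifier_integrable[of n x] by simp
    finally show ?thesis using r by simp
  qed
  then show "\<exists>no. \<forall>n\<ge>no. norm (conv (mollifier n) u x - u x) < r" by auto
qed

text \<open>By mollification. Bounds and supports are kept uniform for the sake of dominated convergence.\<close>

lemma test_function_approximation:
  fixes \<psi> :: "real ^ 'n::finite \<Rightarrow> real"
  assumes \<psi>: "Ck_on 1 UNIV \<psi>" "compact (supp \<psi>)"
  obtains \<Psi> R C where "\<And>n. test_function UNIV (\<Psi> n)" "\<And>n x. x \<notin> cball 0 R \<Longrightarrow> \<Psi> n x = 0"
    "\<And>n x. \<bar>\<Psi> n x\<bar> \<le> C" "\<And>n k x. \<bar>partial k (\<Psi> n) x\<bar> \<le> C"
    "\<And>x. (\<lambda>n. \<Psi> n x) \<longlonglongrightarrow> \<psi> x" "\<And>k x. (\<lambda>n. partial k (\<Psi> n) x) \<longlonglongrightarrow> partial k \<psi> x"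
proof -
  have c: "continuous_on UNIV \<psi>" and cp: "continuous_on UNIV (partial k \<psi>)" for k
    using \<psi> Ck_on_imp_continuous[OF \<psi>(1)] by simp_all
  have cs: "compact (supp (partial k \<psi>))" for k by (rule compact_subset_supp[OF \<psi>(2) supp_partial])
  have m1: "Ck_on 1 UNIV (mollifier n)" for n by (rule smooth_onD[OF smooth_mollifier])
  obtain a b where ab: "supp \<psi> \<subseteq> cbox a b" using bounded_subset_cbox_symmetric[OF compact_imp_bounded[OF \<psi>(2)]] by metis
  then have z: "\<And>z. z \<notin> cbox a b \<Longrightarrow> \<psi> z = 0" using not_in_supp[of _ \<psi>] by blast
  obtain r where r: "r > 0" "\<And>x. x \<in> supp \<psi> \<Longrightarrow> norm x \<le> r"
    using compact_imp_bounded[OF \<psi>(2)] unfolding bounded_pos by auto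
  obtain C0 where C0: "\<And>x. \<bar>\<psi> x\<bar> \<le> C0"
    using bounded_continuous_compact_supp[OF c \<psi>(2)] not_in_supp[of _ \<psi>] by metis
  have "\<exists>C. \<forall>x. \<bar>partial k \<psi> x\<bar> \<le> C" for k
    using bounded_continuous_compact_supp[OF cp \<psi>(2)] partial_not_in_supp[of _ \<psi>] by metis
  then obtain C1 where C1: "\<And>k x. \<bar>partial k \<psi> x\<bar> \<le> C1 k" by metis
  define C where "C = max C0 (Max (range C1))"
  have CC: "\<bar>\<psi> x\<bar> \<le> C" "\<bar>partial k \<psi> x\<bar> \<le> C" for x k
  proof -
    have "C1 k \<le> Max (range C1)" by (rule Max_ge) auto
    then have "C0 \<le> C" "C1 k \<le> C" unfolding C_def by linarith+
    then show "\<bar>\<psi> x\<bar> \<le> C" "\<bar>partial k \<psi> x\<bar> \<le> C"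
      using C0[of x] C1[of k x] by linarith+
  qed
  define \<Psi> where "\<Psi> n = conv (mollifier n) \<psi>" for n
  have p: "partial k (\<Psi> n) x = conv (mollifier n) (partial k \<psi>) x" for k n x
    unfolding \<Psi>_def using conv_has_derivative(2)[OF m1 c z] conv_partial_eq[OF m1 \<psi>] by simp
  define R where "R = r + real CARD('n)"
  have far: "\<Psi> n x = 0" if "x \<notin> cball 0 R" for n x
  proof -
    have "mollifier n (x - z) * \<psi> z = 0" for z
    proof (cases "z \<in> supp \<psi>")
      case True
      have "norm x \<le> norm (x - z) + norm z" by (metis diff_add_cancel norm_triangle_ineq)
      then have "norm (x - z) \<ge> real CARD('n)" using r(2)[OF True] that by (simp add: R_def)
      moreover have "real CARD('n) / real (Suc n) \<le> real CARD('n) / 1"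
        by (rule divide_left_mono) auto
      ultimately have "mollifier n (x - z) = 0" by (intro mollifier_eq_0) linarith
      then show ?thesis by simp
    qed (simp add: not_in_supp[of _ \<psi>])
    then show ?thesis unfolding \<Psi>_def conv_def by (simp only: integral_zero)
  qed
  show ?thesis
  proof (rule that[of \<Psi> R C])
    show "test_function UNIV (\<Psi> n)" for n
      unfolding test_function_def
      using smooth_conv[OF smooth_mollifier[of n] c z, folded \<Psi>_def] compact_suppI[OF compact_cball, of 0 R "\<Psi> n"] far
      by blast
    show "\<bar>\<Psi> n x\<bar> \<le> C" for n x
      unfolding \<Psi>_def by (rule conv_mollifier_bound[OF c \<psi>(2) CC(1)])
    show "\<bar>partial k (\<Psi> n) x\<bar> \<le> C" for n k x
      unfolding p by (rule conv_mollifier_bound[OF cp cs CC(2)])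
    show "(\<lambda>n. \<Psi> n x) \<longlonglongrightarrow> \<psi> x" for x
      unfolding \<Psi>_def by (rule conv_mollifier_tendsto[OF c \<psi>(2)])
    show "(\<lambda>n. partial k (\<Psi> n) x) \<longlonglongrightarrow> partial k \<psi> x" for k x
      unfolding p by (rule conv_mollifier_tendsto[OF cp cs])
  qed (rule far)
qed

section \<open>Weak gradients\<close>

lemma loc_integrable_iff:
  fixes f :: "real ^ 'n::finite \<Rightarrow> real"
  shows "loc_integrable S f \<longleftrightarrow> (\<forall>K. compact K \<and> K \<subseteq> S \<longrightarrow> integrable lebesgue (\<lambda>x. indicator K x * f x))"
  unfolding loc_integrable_def
  by (intro all_cong) (simp add: integrable_restrict_space lmeasurable_compact fmeasurableD)

lemma loc_integrable_subset: "loc_integrable S f \<Longrightarrow> T \<subseteq> S \<Longrightarrow> loc_integrable T f"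
  unfolding loc_integrable_def by blast

lemma loc_integrable_add:
  "loc_integrable S f \<Longrightarrow> loc_integrable S g \<Longrightarrow> loc_integrable S (\<lambda>x. f x + g x)"
  unfolding loc_integrable_def by simp

lemma loc_integrable_diff:
  "loc_integrable S f \<Longrightarrow> loc_integrable S g \<Longrightarrow> loc_integrable S (\<lambda>x. f x - g x)"
  unfolding loc_integrable_def by simp

lemma loc_integrable_sum:
  "(\<And>i. i \<in> I \<Longrightarrow> loc_integrable S (f i)) \<Longrightarrow> loc_integrable S (\<lambda>x. \<Sum>i\<in>I. f i x)"
  unfolding loc_integrable_def by (auto intro!: Bochner_Integration.integrable_sum)

lemma loc_integrable_nth:
  fixes G :: "real ^ 'n::finite \<Rightarrow> real ^ 'n"
  shows "loc_integrable S G \<Longrightarrow> loc_integrable S (\<lambda>x. G x $ k)"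
  unfolding loc_integrable_def using integrable_bounded_linear[OF bounded_linear_vec_nth] by blast

lemma loc_integrable_vec:
  fixes G :: "real ^ 'n::finite \<Rightarrow> real ^ 'n"
  assumes "\<And>k. loc_integrable S (\<lambda>x. G x $ k)" shows "loc_integrable S G"
proof -
  have "G x = (\<Sum>k\<in>UNIV. G x $ k *\<^sub>R axis k 1)" for x
    using basis_expansion[of "G x"] by (simp add: scalar_mult_eq_scaleR)
  then have *: "G = (\<lambda>x. \<Sum>k\<in>UNIV. G x $ k *\<^sub>R axis k 1)" by auto
  have "loc_integrable S (\<lambda>x. G x $ k *\<^sub>R axis k 1)" for k
    using assms[of k] unfolding loc_integrable_def by auto
  then show ?thesis by (subst *) (rule loc_integrable_sum)
qed

lemma loc_integrable_continuous:
  fixes f :: "real ^ 'n::finite \<Rightarrow> real"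
  assumes "continuous_on S f" shows "loc_integrable S f"
  unfolding loc_integrable_iff
proof (intro allI impI)
  fix K assume K: "compact K \<and> K \<subseteq> S"
  then have "integrable lborel (\<lambda>x. indicator K x *\<^sub>R f x)"
    by (intro borel_integrable_compact) (use assms continuous_on_subset in blast)+
  then show "integrable lebesgue (\<lambda>x. indicator K x * f x)"
    by (subst integrable_completion) auto
qed

lemma loc_integrable_mult_continuous:
  fixes f w :: "real ^ 'n::finite \<Rightarrow> real"
  assumes w: "loc_integrable S w" and f: "continuous_on S f"
  shows "loc_integrable S (\<lambda>x. f x * w x)"
  unfolding loc_integrable_iff
proof (intro allI impI)
  fix K assume K: "compact K \<and> K \<subseteq> S"
  then have cK: "continuous_on K f" using f continuous_on_subset by blast
  then have "compact (f ` K)" using K compact_continuous_image by blast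
  then obtain C where C: "\<And>x. x \<in> K \<Longrightarrow> \<bar>f x\<bar> \<le> C"
    using compact_imp_bounded bounded_iff by (metis imageI real_norm_def)
  have w': "integrable lebesgue (\<lambda>x. indicator K x * w x)" using w K unfolding loc_integrable_iff by blast
  have m: "(\<lambda>x. indicator K x * f x) \<in> borel_measurable lebesgue"
    using borel_integrable_compact[of K f] K cK
    by (intro measurable_completion) (simp add: borel_measurable_integrable)
  show "integrable lebesgue (\<lambda>x. indicator K x * (f x * w x))"
  proof (rule Bochner_Integration.integrable_bound)
    show "integrable lebesgue (\<lambda>x. C * (indicator K x * w x))" using w' by simp
    have "(\<lambda>x. (indicator K x * f x) * (indicator K x * w x)) \<in> borel_measurable lebesgue"
      by (intro borel_measurable_times m borel_measurable_integrable[OF w'])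
    moreover have "(indicator K x * f x) * (indicator K x * w x) = indicator K x * (f x * w x)" for x
      by (simp add: indicator_def)
    ultimately show "(\<lambda>x. indicator K x * (f x * w x)) \<in> borel_measurable lebesgue" by simp
    have "norm (indicator K x * (f x * w x)) \<le> norm (C * (indicator K x * w x))" for x
    proof (cases "x \<in> K")
      case True
      have "\<bar>f x\<bar> * \<bar>w x\<bar> \<le> \<bar>C\<bar> * \<bar>w x\<bar>" using C[OF True] by (intro mult_right_mono) auto
      then show ?thesis using True by (simp add: abs_mult)
    qed simp
    then show "AE x in lebesgue. norm (indicator K x * (f x * w x)) \<le> norm (C * (indicator K x * w x))" by simp
  qed
qed

lemma loc_integrable_times_compact_supp:
  fixes f w :: "real ^ 'n::finite \<Rightarrow> real"
  assumes w: "loc_integrable S w" and f: "continuous_on S f" and K: "compact K" "K \<subseteq> S" "\<And>x. x \<notin> K \<Longrightarrow> f x = 0"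
  shows "integrable lebesgue (\<lambda>x. w x * f x)"
proof -
  have "integrable lebesgue (\<lambda>x. indicator K x * (f x * w x))"
    using loc_integrable_mult_continuous[OF w f] K unfolding loc_integrable_iff by blast
  moreover have "indicator K x * (f x * w x) = w x * f x" for x
    using K(3)[of x] by (cases "x \<in> K") auto
  ultimately show ?thesis by (simp only:)
qed

lemma integral_lebesgue_on_eq:
  fixes F :: "'a::euclidean_space \<Rightarrow> real"
  assumes "S \<in> sets lebesgue" "\<And>x. x \<notin> S \<Longrightarrow> F x = 0"
  shows "(\<integral>x. F x \<partial>lebesgue_on S) = (\<integral>x. F x \<partial>lebesgue)"
    and "integrable (lebesgue_on S) F \<longleftrightarrow> integrable lebesgue F"
proof -
  have *: "(\<lambda>x. indicator S x *\<^sub>R F x) = F"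
  proof
    show "indicator S x *\<^sub>R F x = F x" for x using assms(2)[of x] by (cases "x \<in> S") auto
  qed
  show "(\<integral>x. F x \<partial>lebesgue_on S) = (\<integral>x. F x \<partial>lebesgue)"
    using assms(1) by (subst integral_restrict_space) (auto simp del: real_scaleR_def simp: *)
  show "integrable (lebesgue_on S) F \<longleftrightarrow> integrable lebesgue F"
    using assms(1) by (subst integrable_restrict_space) (auto simp del: real_scaleR_def simp: *)
qed

lemma open_lebesgue: "open S \<Longrightarrow> S \<in> sets lebesgue"
  by simp

lemma AE_zero_if_test_integrals_zero:
  fixes f :: "real ^ 'n::finite \<Rightarrow> real"
  assumes S: "open S" and f: "loc_integrable S f"
    and test: "\<And>\<psi>. test_function S \<psi> \<Longrightarrow> (\<integral>x. f x * \<psi> x \<partial>lebesgue) = 0"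
  shows "AE x in lebesgue. x \<in> S \<longrightarrow> f x = 0"
proof -
  obtain C where C: "\<And>n::nat. compact (C n)" "\<And>n. C n \<subseteq> S" "\<Union>(range C) = S"
    "\<And>K. compact K \<Longrightarrow> K \<subseteq> S \<Longrightarrow> \<exists>N. \<forall>n\<ge>N. K \<subseteq> C n"
    using open_Union_compact_subsets[OF S] by metis
  have "(\<lambda>x. indicator S x * f x) \<in> borel_measurable lebesgue"
  proof (rule borel_measurable_LIMSEQ_real)
    show "(\<lambda>x. indicator (C n) x * f x) \<in> borel_measurable lebesgue" for n
      using f C unfolding loc_integrable_iff by (meson borel_measurable_integrable)
    fix x
    show "(\<lambda>n. indicator (C n) x * f x) \<longlonglongrightarrow> indicator S x * f x"
    proof (cases "x \<in> S")
      case True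
      then obtain N where "\<forall>n\<ge>N. {x} \<subseteq> C n" using C(4)[of "{x}"] by auto
      then have "\<forall>\<^sub>F n in sequentially. indicator S x * f x = indicator (C n) x * f x"
        using True by (auto simp: eventually_sequentially intro!: exI[of _ N])
      then show ?thesis by (rule Lim_transform_eventually[OF tendsto_const])
    next
      case False
      then have "x \<notin> C n" for n using C(2) by blast
      then show ?thesis using False by simp
    qed
  qed
  then obtain g where g: "g \<in> borel_measurable lborel" "AE x in lborel. indicator S x * f x = g x"
    using completion_ex_borel_measurable_real by blast
  have g': "AE x in lebesgue. indicator S x * f x = g x" using g(2) by (rule AE_completion)
  have "AE x in lborel. x \<in> S \<longrightarrow> g x = 0"
  proof (rule AE_zero_if_test_integrals_zero_borel[OF _ S])
    fix K assume K: "compact K" "K \<subseteq> S"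
    have "integrable lebesgue (\<lambda>x. indicator K x * g x)"
    proof (rule integrable_cong_AE_imp)
      show "integrable lebesgue (\<lambda>x. indicator K x * f x)" using f K unfolding loc_integrable_iff by blast
      show "(\<lambda>x. indicator K x * g x) \<in> borel_measurable lebesgue"
        using g(1) borel_compact[OF K(1)] by (intro measurable_completion borel_measurable_times borel_measurable_indicator) auto
      show "AE x in lebesgue. indicator K x * f x = indicator K x * g x"
        using g' by eventually_elim (use K in \<open>auto simp: indicator_def split: if_splits\<close>)
    qed
    moreover have "(\<lambda>x. indicator K x * g x) \<in> borel_measurable lborel"
      using g(1) borel_compact[OF K(1)] by (intro borel_measurable_times borel_measurable_indicator) auto
    ultimately show "integrable lborel (\<lambda>x. indicator K x * g x)"
      by (simp add: integrable_completion)
  next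
    fix \<psi> assume \<psi>: "test_function S \<psi>"
    have c: "continuous_on UNIV \<psi>" using test_functionD[OF \<psi>] smooth_on_imp_continuous by blast
    have i: "integrable lebesgue (\<lambda>x. f x * \<psi> x)"
      by (rule loc_integrable_times_compact_supp[OF f _ test_functionD(2,3)[OF \<psi>]])
        (use c continuous_on_subset in blast, rule not_in_supp)
    have m: "(\<lambda>x. g x * \<psi> x) \<in> borel_measurable lborel"
      using g(1) borel_measurable_continuous_onI[OF c] by simp
    have "(\<integral>x. g x * \<psi> x \<partial>lborel) = (\<integral>x. g x * \<psi> x \<partial>lebesgue)"
      using m by (rule integral_completion[symmetric])
    also have "\<dots> = (\<integral>x. f x * \<psi> x \<partial>lebesgue)"
    proof (rule integral_cong_AE)
      show "AE x in lebesgue. g x * \<psi> x = f x * \<psi> x"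
        using g'
      proof eventually_elim
        case (elim x)
        show ?case
        proof (cases "x \<in> S")
          case False
          then have "\<psi> x = 0" using test_functionD(3)[OF \<psi>] not_in_supp[of x \<psi>] by blast
          then show ?thesis by simp
        qed (use elim in simp)
      qed
    qed (use m i in \<open>auto intro: measurable_completion\<close>)
    also have "\<dots> = 0" by (rule test[OF \<psi>])
    finally show "(\<integral>x. g x * \<psi> x \<partial>lborel) = 0" .
  qed simp
  then have "AE x in lebesgue. x \<in> S \<longrightarrow> g x = 0" by (rule AE_completion)
  with g' show ?thesis by eventually_elim auto
qed

lemma is_weak_gradD:
  assumes "is_weak_grad S u G"
  shows "loc_integrable S u" "loc_integrable S G" "loc_integrable S (\<lambda>x. G x $ k)"
  using assms loc_integrable_nth unfolding is_weak_grad_def by blast+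

lemma is_weak_grad_test:
  assumes G: "is_weak_grad S u G" and S: "open S" and \<psi>: "test_function S \<psi>"
  shows "(\<integral>x. u x * partial k \<psi> x \<partial>lebesgue) = - (\<integral>x. G x $ k * \<psi> x \<partial>lebesgue)"
    and "integrable lebesgue (\<lambda>x. u x * partial k \<psi> x)" "integrable lebesgue (\<lambda>x. G x $ k * \<psi> x)"
proof -
  have out: "\<psi> x = 0" "partial k \<psi> x = 0" if "x \<notin> S" for x
    using that test_functionD(3)[OF \<psi>] not_in_supp[of x \<psi>] partial_not_in_supp[of x \<psi>] by blast+
  have c: "continuous_on S \<psi>" "continuous_on S (partial k \<psi>)"
    using \<psi> test_functionD(4) test_function_partial smooth_on_imp_continuous continuous_on_subset by blast+
  show "(\<integral>x. u x * partial k \<psi> x \<partial>lebesgue) = - (\<integral>x. G x $ k * \<psi> x \<partial>lebesgue)"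
    using G \<psi> out unfolding is_weak_grad_def
    by (subst (1 2) integral_lebesgue_on_eq(1)[symmetric, OF open_lebesgue[OF S]]) auto
  show "integrable lebesgue (\<lambda>x. u x * partial k \<psi> x)" "integrable lebesgue (\<lambda>x. G x $ k * \<psi> x)"
    using loc_integrable_times_compact_supp[OF is_weak_gradD(1)[OF G] c(2) test_functionD(2,3)[OF \<psi>]]
      loc_integrable_times_compact_supp[OF is_weak_gradD(3)[OF G] c(1) test_functionD(2,3)[OF \<psi>]]
      not_in_supp[of _ \<psi>] partial_not_in_supp[of _ \<psi>] by blast+
qed

text \<open>Stated for two different domains: the weak gradient is local, so it can be compared on any open
  set \<open>W\<close> on which the functions agree.\<close>

lemma is_weak_grad_AE_unique:
  fixes u u' :: "real ^ 'n::finite \<Rightarrow> real"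
  assumes G: "is_weak_grad S u G" "open S" and G': "is_weak_grad S' u' G'" "open S'"
    and W: "open W" "W \<subseteq> S" "W \<subseteq> S'" and eq: "AE x in lebesgue. x \<in> W \<longrightarrow> u x = u' x"
  shows "AE x in lebesgue. x \<in> W \<longrightarrow> G x = G' x"
proof -
  have "AE x in lebesgue. x \<in> W \<longrightarrow> G x $ k - G' x $ k = 0" for k
  proof (rule AE_zero_if_test_integrals_zero[OF W(1)])
    show "loc_integrable W (\<lambda>x. G x $ k - G' x $ k)"
      by (rule loc_integrable_diff[OF loc_integrable_subset[OF is_weak_gradD(3)[OF G(1)] W(2)]
            loc_integrable_subset[OF is_weak_gradD(3)[OF G'(1)] W(3)]])
    fix \<psi> assume \<psi>: "test_function W \<psi>"
    note i = is_weak_grad_test[OF G test_function_mono[OF \<psi> W(2)], of k]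
    note i' = is_weak_grad_test[OF G' test_function_mono[OF \<psi> W(3)], of k]
    have "(\<integral>x. u x * partial k \<psi> x \<partial>lebesgue) = (\<integral>x. u' x * partial k \<psi> x \<partial>lebesgue)"
    proof (rule integral_cong_AE)
      show "AE x in lebesgue. u x * partial k \<psi> x = u' x * partial k \<psi> x"
        using eq
      proof eventually_elim
        case (elim x)
        then show ?case
          using test_functionD(3)[OF \<psi>] partial_not_in_supp[of x \<psi> k] by (cases "x \<in> W") auto
      qed
    qed (fact borel_measurable_integrable[OF i(2)] borel_measurable_integrable[OF i'(2)])+
    then show "(\<integral>x. (G x $ k - G' x $ k) * \<psi> x \<partial>lebesgue) = 0"
      unfolding left_diff_distrib using i i' by simp
  qed
  then have "AE x in lebesgue. \<forall>k\<in>UNIV. x \<in> W \<longrightarrow> G x $ k - G' x $ k = 0"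
    by (subst AE_ball_countable) (auto simp: countable_finite)
  then show ?thesis by eventually_elim (auto simp: vec_eq_iff)
qed

lemma Ck_is_weak_grad:
  fixes f :: "real ^ 'n::finite \<Rightarrow> real"
  assumes S: "open S" and f: "Ck_on 1 S f"
  shows "is_weak_grad S f (grad f)"
  unfolding is_weak_grad_def
proof (intro conjI allI impI)
  show "loc_integrable S f" using loc_integrable_continuous Ck_on_imp_continuous[OF f] by blast
  show "loc_integrable S (grad f)"
    by (rule loc_integrable_vec) (use f in \<open>auto simp: grad_def intro!: loc_integrable_continuous\<close>)
  fix \<psi> k assume \<psi>: "test_function S \<psi>"
  have out: "\<psi> x = 0" "partial k \<psi> x = 0" if "x \<notin> S" for x
    using that test_functionD(3)[OF \<psi>] not_in_supp[of x \<psi>] partial_not_in_supp[of x \<psi>] by blast+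
  show "(\<integral>x. f x * partial k \<psi> x \<partial>lebesgue_on S) = - (\<integral>x. grad f x $ k * \<psi> x \<partial>lebesgue_on S)"
    using integration_by_parts(1)[OF S f test_functionD(1,2,3)[OF \<psi>]] out
    by (subst (1 2) integral_lebesgue_on_eq(1)[OF open_lebesgue[OF S]]) (auto simp: grad_def)
qed

lemma wgrad_is_weak_grad: "weakly_diff S u \<Longrightarrow> is_weak_grad S u (wgrad S u)"
  unfolding weakly_diff_def wgrad_def by (metis someI_ex)

lemma wgrad_AE_eq_grad:
  fixes f :: "real ^ 'n::finite \<Rightarrow> real"
  assumes S: "open S" and f: "Ck_on 1 S f"
  shows "AE x in lebesgue. x \<in> S \<longrightarrow> wgrad S f x = grad f x"
proof -
  have "weakly_diff S f" unfolding weakly_diff_def using Ck_is_weak_grad[OF assms] by blast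
  from is_weak_grad_AE_unique[OF wgrad_is_weak_grad[OF this] S Ck_is_weak_grad[OF assms] S S] show ?thesis by simp
qed

text \<open>The weak equations are stated for smooth test functions, but have to be tested with functions such
  as \<open>\<eta> / s\<close>, where \<open>s\<close> is only $C^2$.\<close>

lemma test_identity_extends:
  fixes w0 :: "real ^ 'n::finite \<Rightarrow> real" and w :: "'n \<Rightarrow> real ^ 'n \<Rightarrow> real"
  assumes w0: "loc_integrable UNIV w0" and w: "\<And>k. loc_integrable UNIV (w k)"
    and test: "\<And>\<psi>. test_function UNIV \<psi> \<Longrightarrow> (\<integral>x. w0 x * \<psi> x + (\<Sum>k\<in>UNIV. w k x * partial k \<psi> x) \<partial>lebesgue) = 0"
    and \<psi>: "Ck_on 1 UNIV \<psi>" "compact (supp \<psi>)"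
  shows "(\<integral>x. w0 x * \<psi> x + (\<Sum>k\<in>UNIV. w k x * partial k \<psi> x) \<partial>lebesgue) = 0"
proof -
  obtain \<Psi> R C where \<Psi>: "\<And>n. test_function UNIV (\<Psi> n)" "\<And>n x. x \<notin> cball 0 R \<Longrightarrow> \<Psi> n x = 0"
    "\<And>n x. \<bar>\<Psi> n x\<bar> \<le> C" "\<And>n k x. \<bar>partial k (\<Psi> n) x\<bar> \<le> C"
    "\<And>x. (\<lambda>n. \<Psi> n x) \<longlonglongrightarrow> \<psi> x" "\<And>k x. (\<lambda>n. partial k (\<Psi> n) x) \<longlonglongrightarrow> partial k \<psi> x"
    by (rule test_function_approximation[OF \<psi>]) (rule that; assumption)
  have far: "\<Psi> n x = 0" "partial k (\<Psi> n) x = 0" if "x \<notin> cball 0 R" for n k x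
  proof -
    show "\<Psi> n x = 0" by (rule \<Psi>(2)[OF that])
    have "supp (\<Psi> n) \<subseteq> cball 0 R" by (rule supp_subset_closed[OF closed_cball \<Psi>(2)])
    then show "partial k (\<Psi> n) x = 0" using that partial_not_in_supp[of x "\<Psi> n"] by blast
  qed
  have c: "continuous_on UNIV (\<Psi> n)" "continuous_on UNIV (partial k (\<Psi> n))" for n k
    using \<Psi>(1) test_functionD(4) test_function_partial smooth_on_imp_continuous by blast+
  have c': "continuous_on UNIV \<psi>" "continuous_on UNIV (partial k \<psi>)" for k
    using \<psi>(1) Ck_on_imp_continuous[OF \<psi>(1)] by simp_all
  have i0: "integrable lebesgue (\<lambda>x. indicator (cball 0 R) x * w0 x)"
    using w0 compact_cball unfolding loc_integrable_iff by blast
  have i: "integrable lebesgue (\<lambda>x. indicator (cball 0 R) x * w k x)" for k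
    using w[of k] compact_cball unfolding loc_integrable_iff by blast
  have "(\<lambda>n. \<integral>x. w0 x * \<Psi> n x + (\<Sum>k\<in>UNIV. w k x * partial k (\<Psi> n) x) \<partial>lebesgue) \<longlonglongrightarrow>
        (\<integral>x. w0 x * \<psi> x + (\<Sum>k\<in>UNIV. w k x * partial k \<psi> x) \<partial>lebesgue)"
  proof (rule integral_dominated_convergence[where
        w = "\<lambda>x. C * \<bar>indicator (cball 0 R) x * w0 x\<bar> + (\<Sum>k\<in>UNIV. C * \<bar>indicator (cball 0 R) x * w k x\<bar>)"])
    show "integrable lebesgue (\<lambda>x. C * \<bar>indicator (cball 0 R) x * w0 x\<bar> + (\<Sum>k\<in>UNIV. C * \<bar>indicator (cball 0 R) x * w k x\<bar>))"
      using i0 i by (intro Bochner_Integration.integrable_add Bochner_Integration.integrable_sum integrable_mult_right integrable_abs) auto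
    show "AE x in lebesgue. (\<lambda>n. w0 x * \<Psi> n x + (\<Sum>k\<in>UNIV. w k x * partial k (\<Psi> n) x)) \<longlonglongrightarrow>
        w0 x * \<psi> x + (\<Sum>k\<in>UNIV. w k x * partial k \<psi> x)"
      by (intro AE_I2 tendsto_intros \<Psi>)
    show "AE x in lebesgue. norm (w0 x * \<Psi> n x + (\<Sum>k\<in>UNIV. w k x * partial k (\<Psi> n) x)) \<le>
        C * \<bar>indicator (cball 0 R) x * w0 x\<bar> + (\<Sum>k\<in>UNIV. C * \<bar>indicator (cball 0 R) x * w k x\<bar>)" for n
    proof (rule AE_I2)
      fix x
      show "norm (w0 x * \<Psi> n x + (\<Sum>k\<in>UNIV. w k x * partial k (\<Psi> n) x)) \<le>
        C * \<bar>indicator (cball 0 R) x * w0 x\<bar> + (\<Sum>k\<in>UNIV. C * \<bar>indicator (cball 0 R) x * w k x\<bar>)"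
      proof (cases "x \<in> cball 0 R")
        case True
        have "\<bar>w0 x * \<Psi> n x\<bar> \<le> C * \<bar>w0 x\<bar>"
          using mult_left_mono[OF \<Psi>(3)[of n x] abs_ge_zero[of "w0 x"]] by (simp add: abs_mult mult.commute)
        moreover have "\<bar>\<Sum>k\<in>UNIV. w k x * partial k (\<Psi> n) x\<bar> \<le> (\<Sum>k\<in>UNIV. C * \<bar>w k x\<bar>)"
        proof (rule order_trans[OF sum_abs], rule sum_mono)
          show "\<bar>w k x * partial k (\<Psi> n) x\<bar> \<le> C * \<bar>w k x\<bar>" for k
            using mult_left_mono[OF \<Psi>(4)[of k n x] abs_ge_zero[of "w k x"]] by (simp add: abs_mult mult.commute)
        qed
        ultimately show ?thesis using True by simp
      qed (simp add: far)
    qed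
    have m: "(\<lambda>x. u x * f x) \<in> borel_measurable lebesgue"
      if "loc_integrable UNIV u" "continuous_on UNIV f" "\<And>x. x \<notin> cball 0 R' \<Longrightarrow> f x = 0" for u f :: "real ^ 'n \<Rightarrow> real" and R'
      by (rule borel_measurable_integrable, rule loc_integrable_times_compact_supp[where K = "cball 0 R'", OF that(1,2) compact_cball])
        (simp, rule that(3))
    show "(\<lambda>x. w0 x * \<Psi> n x + (\<Sum>k\<in>UNIV. w k x * partial k (\<Psi> n) x)) \<in> borel_measurable lebesgue" for n
      by (intro borel_measurable_add borel_measurable_sum m[where R' = R] w0 w c far)
    obtain R' where R': "supp \<psi> \<subseteq> cball 0 R'" using compact_imp_bounded[OF \<psi>(2)] unfolding bounded_pos by (auto simp: subset_eq)
    show "(\<lambda>x. w0 x * \<psi> x + (\<Sum>k\<in>UNIV. w k x * partial k \<psi> x)) \<in> borel_measurable lebesgue"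
      by (intro borel_measurable_add borel_measurable_sum m[where R' = R'] w0 w c')
        (use R' not_in_supp[of _ \<psi>] partial_not_in_supp[of _ \<psi>] in blast)+
  qed
  then show ?thesis by (simp add: test[OF \<Psi>(1)] LIMSEQ_const_iff)
qed

lemma is_weak_grad_C1:
  fixes u \<psi> :: "real ^ 'n::finite \<Rightarrow> real"
  assumes G: "is_weak_grad UNIV u G" and \<psi>: "Ck_on 1 UNIV \<psi>" "compact (supp \<psi>)"
  shows "(\<integral>x. u x * partial k \<psi> x \<partial>lebesgue) = - (\<integral>x. G x $ k * \<psi> x \<partial>lebesgue)"
    and "integrable lebesgue (\<lambda>x. u x * partial k \<psi> x)" "integrable lebesgue (\<lambda>x. G x $ k * \<psi> x)"
proof -
  have c: "continuous_on UNIV \<psi>" "continuous_on UNIV (partial k \<psi>)"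
    using \<psi>(1) Ck_on_imp_continuous[OF \<psi>(1)] by simp_all
  show i: "integrable lebesgue (\<lambda>x. u x * partial k \<psi> x)" "integrable lebesgue (\<lambda>x. G x $ k * \<psi> x)"
    using loc_integrable_times_compact_supp[OF is_weak_gradD(1)[OF G] c(2) \<psi>(2)]
      loc_integrable_times_compact_supp[OF is_weak_gradD(3)[OF G] c(1) \<psi>(2)]
      not_in_supp[of _ \<psi>] partial_not_in_supp[of _ \<psi>] by blast+
  have "(\<integral>x. G x $ k * \<psi> x + (\<Sum>l\<in>UNIV. (if l = k then u x else 0) * partial l \<psi> x) \<partial>lebesgue) = 0"
  proof (rule test_identity_extends[OF is_weak_gradD(3)[OF G] _ _ \<psi>])
    show "loc_integrable UNIV (\<lambda>x. if l = k then u x else 0)" for l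
      using is_weak_gradD(1)[OF G] by (cases "l = k") (auto simp: loc_integrable_def)
    fix \<psi> :: "real ^ 'n \<Rightarrow> real" assume "test_function UNIV \<psi>"
    from is_weak_grad_test[OF G open_UNIV this, of k]
    show "(\<integral>x. G x $ k * \<psi> x + (\<Sum>l\<in>UNIV. (if l = k then u x else 0) * partial l \<psi> x) \<partial>lebesgue) = 0"
      by (simp add: if_distrib[of "\<lambda>a. a * _"] cong: if_cong)
  qed
  then show "(\<integral>x. u x * partial k \<psi> x \<partial>lebesgue) = - (\<integral>x. G x $ k * \<psi> x \<partial>lebesgue)"
    using i by (simp add: if_distrib[of "\<lambda>a. a * _"] cong: if_cong)
qed

section \<open>Radial integrals\<close>

text \<open>Both measures give the volume of a ball of radius \<open>r\<close> to the half-line up to \<open>r\<close>. This is all that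
  is used of polar coordinates.\<close>

lemma distr_norm_lborel:
  "distr (lborel :: (real ^ 'n::finite) measure) borel norm =
     density lborel (\<lambda>r. ennreal (real CARD('n) * unit_ball_vol (real CARD('n)) * r ^ (CARD('n) - 1)) * indicator {0..} r)"
  (is "?L = ?R")
proof (rule measure_eqI_generator_eq[where E = "range atMost" and \<Omega> = UNIV and A = "\<lambda>n. {..real n}"])
  let ?d = "CARD('n)" and ?w = "unit_ball_vol (real CARD('n))"
  have w: "?w \<ge> 0" by simp
  have d: "?d > 0" by simp
  show "Int_stable (range (atMost :: real \<Rightarrow> _))"
    by (auto simp: Int_stable_def)
  have L: "emeasure ?L {..a} = (if a \<ge> 0 then ennreal (?w * a ^ ?d) else 0)" for a
  proof -
    have "emeasure ?L {..a} = emeasure lborel (cball (0 :: real^'n) a)"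
      by (subst emeasure_distr) (auto intro!: arg_cong[where f = "emeasure lborel"])
    then show ?thesis by (simp add: emeasure_cball)
  qed
  show "emeasure ?L X = emeasure ?R X" if X: "X \<in> range atMost" for X
  proof -
    obtain a where a: "X = {..a}" using X by auto
    show ?thesis
    proof (cases "a \<ge> 0")
      case False
      have "emeasure ?R X = nn_integral lborel (\<lambda>r :: real. 0)"
        unfolding a
      proof (subst emeasure_density)
        show "(\<integral>\<^sup>+r. ennreal (real ?d * ?w * r ^ (?d - 1)) * indicator {0..} r * indicator {..a} r \<partial>lborel) = nn_integral lborel (\<lambda>r :: real. 0)"
          by (rule nn_integral_cong) (use False in \<open>auto simp: indicator_def\<close>)
      qed auto
      then show ?thesis unfolding a L using False by simp
    next
      case True
      have "emeasure ?R X = (\<integral>\<^sup>+r. ennreal (real ?d * ?w * r ^ (?d - 1)) * indicator {0..a} r \<partial>lborel)"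
        unfolding a by (subst emeasure_density) (auto intro!: nn_integral_cong simp: indicator_def)
      also have "\<dots> = ennreal (?w * a ^ ?d - ?w * 0 ^ ?d)"
      proof (rule nn_integral_FTC_Icc[where F = "\<lambda>r. ?w * r ^ ?d"])
        show "((\<lambda>r. ?w * r ^ ?d) has_real_derivative real ?d * ?w * x ^ (?d - 1)) (at x)" if "x \<in> {0..a}" for x
          using d by (auto intro!: derivative_eq_intros)
        show "0 \<le> real ?d * ?w * x ^ (?d - 1)" if "x \<in> {0..a}" for x using that by simp
      qed (use True in auto)
      finally show ?thesis unfolding a L using True d by simp
    qed
  qed
  show "sets ?L = sigma_sets UNIV (range atMost)" "sets ?R = sigma_sets UNIV (range atMost)"
    by (simp_all add: borel_eq_atMost)
  show "(\<Union>n. {..real n}) = (UNIV :: real set)" using real_arch_simple by auto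
  show "emeasure ?L {..real n} \<noteq> \<infinity>" for n unfolding L by simp
qed auto

lemma nn_integral_radial:
  fixes f :: "real \<Rightarrow> ennreal"
  assumes [measurable]: "f \<in> borel_measurable borel"
  shows "(\<integral>\<^sup>+x. f (norm (x :: real ^ 'n::finite)) \<partial>lborel) =
    (\<integral>\<^sup>+r. ennreal (real CARD('n) * unit_ball_vol (real CARD('n)) * r ^ (CARD('n) - 1)) * indicator {0..} r * f r \<partial>lborel)"
proof -
  have "(\<integral>\<^sup>+x. f (norm (x :: real ^ 'n)) \<partial>lborel) = (\<integral>\<^sup>+r. f r \<partial>distr (lborel :: (real ^ 'n) measure) borel norm)"
    by (subst nn_integral_distr) auto
  then show ?thesis unfolding distr_norm_lborel by (subst (asm) nn_integral_density) auto
qed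

text \<open>The weight decays like \<open>|x|\<^bsup>- 3 / 2\<^esup>\<close>. Any rate strictly between \<open>|x|\<^sup>-\<^sup>1\<close> and \<open>|x|\<^sup>-\<^sup>2\<close> would do: functions of
  size \<open>|x|\<^bsup>1 - d\<^esup>\<close> are to be integrable against it, and it is to dominate \<open>|x|\<^sup>-\<^sup>2\<close> times a logarithm, which
  occurs for the fundamental solution in dimension two.\<close>

definition decay_weight :: "'a::real_normed_vector \<Rightarrow> real" where
  "decay_weight x = (1 + (norm x)\<^sup>2) powr (- 3 / 4)"

lemma decay_weight_pos: "decay_weight x > 0"
proof -
  have "1 + (norm x)\<^sup>2 \<noteq> 0" using zero_le_power2[of "norm x"] by linarith
  then show ?thesis by (simp add: decay_weight_def)
qed

lemma decay_weight_measurable [measurable]: "decay_weight \<in> borel_measurable borel"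
  unfolding decay_weight_def[abs_def] by measurable

lemma decay_weight_le_1: "decay_weight x \<le> 1"
  using powr_mono2'[of "-3/4" 1 "1 + (norm x)\<^sup>2"] by (simp add: decay_weight_def)

lemma decay_weight_shift:
  "decay_weight (x - y) \<le> (2 * (1 + (norm y)\<^sup>2)) powr (3 / 4) * decay_weight x"
proof -
  have pos: "0 < 1 + (norm u)\<^sup>2" for u :: 'a using zero_le_power2[of "norm u"] by linarith
  have "(norm x)\<^sup>2 \<le> (norm (x - y) + norm y)\<^sup>2"
    using norm_triangle_ineq[of "x - y" y] by (intro power_mono) simp_all
  also have "\<dots> \<le> 2 * (norm (x - y))\<^sup>2 + 2 * (norm y)\<^sup>2"
    using zero_le_power2[of "norm (x - y) - norm y"] by (simp add: power2_eq_square algebra_simps)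
  finally have "1 + (norm x)\<^sup>2 \<le> 2 * (1 + (norm y)\<^sup>2) * (1 + (norm (x - y))\<^sup>2)"
  proof -
    define A B where "A = (norm (x - y))\<^sup>2" and "B = (norm y)\<^sup>2"
    have "A * B \<ge> 0" by (simp add: A_def B_def)
    moreover have "2 * (1 + B) * (1 + A) = 2 + 2 * A + 2 * B + 2 * (A * B)" by (simp add: algebra_simps)
    moreover assume "(norm x)\<^sup>2 \<le> 2 * (norm (x - y))\<^sup>2 + 2 * (norm y)\<^sup>2"
    then have "(norm x)\<^sup>2 \<le> 2 * A + 2 * B" by (simp add: A_def B_def)
    ultimately show "1 + (norm x)\<^sup>2 \<le> 2 * (1 + (norm y)\<^sup>2) * (1 + (norm (x - y))\<^sup>2)"
      unfolding A_def[symmetric] B_def[symmetric] by linarith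
  qed
  then have "(1 + (norm x)\<^sup>2) powr (3/4) \<le> (2 * (1 + (norm y)\<^sup>2)) powr (3/4) * (1 + (norm (x - y))\<^sup>2) powr (3/4)"
    using powr_mono2[of "3/4" "1 + (norm x)\<^sup>2"] pos[of x] by (simp add: powr_mult[symmetric] less_imp_le)
  then show ?thesis using pos[of x] pos[of "x - y"]
    by (simp add: decay_weight_def powr_minus divide_simps mult_ac)
qed

lemma radial_weight_integrable:
  "integrable lborel (\<lambda>x :: real ^ 'n::finite. norm x powr (1 - real CARD('n)) * decay_weight x)"
proof (rule integrableI_nonneg)
  let ?c = "real CARD('n) * unit_ball_vol (real CARD('n))"
  define h where "h r = r powr (1 - real CARD('n)) * (1 + r\<^sup>2) powr (- 3 / 4)" for r :: real
  have [measurable]: "h \<in> borel_measurable borel" unfolding h_def[abs_def] by measurable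
  have "(\<integral>\<^sup>+x. ennreal (norm (x::real^'n) powr (1 - real CARD('n)) * decay_weight x) \<partial>lborel) = (\<integral>\<^sup>+x. ennreal (h (norm (x::real^'n))) \<partial>lborel)"
    by (simp add: h_def decay_weight_def)
  also have "\<dots> = (\<integral>\<^sup>+r. ennreal (?c * r ^ (CARD('n) - 1)) * indicator {0..} r * ennreal (h r) \<partial>lborel)"
    by (rule nn_integral_radial) measurable
  also have "\<dots> \<le> (\<integral>\<^sup>+r. ennreal (2 * ?c * (1 + r) powr (- 3 / 2)) * indicator {0..} r \<partial>lborel)"
  proof (rule nn_integral_mono)
    fix r :: real
    show "ennreal (?c * r ^ (CARD('n) - 1)) * indicator {0..} r * ennreal (h r) \<le> ennreal (2 * ?c * (1 + r) powr (- 3 / 2)) * indicator {0..} r"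
    proof (cases "r > 0")
      case True
      have "r ^ (CARD('n) - 1) = r powr (real CARD('n) - 1)"
        using True by (simp add: powr_realpow[symmetric] of_nat_diff Suc_le_eq)
      then have "r ^ (CARD('n) - 1) * h r = (1 + r\<^sup>2) powr (- 3 / 4)"
        using True by (simp add: h_def powr_add[symmetric] mult.assoc[symmetric])
      also have "\<dots> \<le> ((1 + r)\<^sup>2 / 2) powr (- 3 / 4)"
        by (rule powr_mono2') (use True zero_le_power2[of "r - 1"] in \<open>auto simp: power2_eq_square algebra_simps\<close>)
      also have "\<dots> = (1 + r) powr (- 3 / 2) * 2 powr (3 / 4)"
      proof -
        have "((1 + r)\<^sup>2) powr (- 3 / 4) = (1 + r) powr (- 3 / 2)"
          using True powr_powr[of "1 + r" 2 "-3/4"] by (simp add: powr_numeral)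
        then show ?thesis using True by (simp add: powr_divide powr_minus divide_simps)
      qed
      also have "\<dots> \<le> (1 + r) powr (- 3 / 2) * 2"
      proof (rule mult_left_mono)
        show "2 powr (3 / 4) \<le> (2 :: real)" using powr_mono[of "3/4" 1 "2::real"] by simp
      qed simp
      finally have "?c * (r ^ (CARD('n) - 1) * h r) \<le> ?c * ((1 + r) powr (- 3 / 2) * 2)"
        by (rule mult_left_mono) simp
      then show ?thesis using True by (simp add: ennreal_mult'[symmetric] h_def mult_ac ennreal_leI)
    next
      case False
      then show ?thesis by (cases "r = 0") (auto simp: h_def)
    qed
  qed
  also have "\<dots> = ennreal (0 - (- 4 * ?c * (1 + 0) powr (- 1 / 2)))"
  proof (rule nn_integral_FTC_atLeast[where F = "\<lambda>r. - 4 * ?c * (1 + r) powr (- 1 / 2)"])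
    show "((\<lambda>r. - 4 * ?c * (1 + r) powr (- 1 / 2)) has_real_derivative 2 * ?c * (1 + x) powr (- 3 / 2)) (at x)" if "0 \<le> x" for x
      using that by (auto intro!: derivative_eq_intros)
    have "((\<lambda>r. (1 + r) powr (- 1 / 2)) \<longlongrightarrow> (0::real)) at_top"
      by (rule tendsto_neg_powr) (auto intro!: filterlim_tendsto_add_at_top filterlim_ident)
    from tendsto_mult_left[OF this, of "- 4 * ?c"]
    show "((\<lambda>r. - 4 * ?c * (1 + r) powr (- 1 / 2)) \<longlongrightarrow> 0) at_top" by simp
  qed (auto)
  finally show "(\<integral>\<^sup>+x. ennreal (norm (x::real^'n) powr (1 - real CARD('n)) * decay_weight x) \<partial>lborel) < \<infinity>"
    by (simp add: le_less_trans)
qed (auto simp: less_imp_le[OF decay_weight_pos])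

section \<open>An approximate identity\<close>

text \<open>This is minus the Laplacian of the fundamental solution in which \<open>|x|\<^sup>2\<close> is replaced by
  \<open>|x|\<^sup>2 + \<delta>\<^sup>2\<close>.\<close>

definition approx_identity :: "real \<Rightarrow> real ^ 'n::finite \<Rightarrow> real" where
  "approx_identity \<delta> x = \<delta>\<^sup>2 / unit_ball_vol (real CARD('n)) * ((norm x)\<^sup>2 + \<delta>\<^sup>2) powr (- real CARD('n) / 2 - 1)"

lemma approx_identity_nonneg: "approx_identity \<delta> x \<ge> 0"
  by (simp add: approx_identity_def)

lemma approx_identity_measurable [measurable]: "approx_identity \<delta> \<in> borel_measurable borel"
  unfolding approx_identity_def[abs_def] by measurable

text \<open>The radial density has the explicit primitive \<open>(r / \<surd>(r\<^sup>2 + 1))\<^sup>d\<close>.\<close>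

lemma approx_identity_nn_integral_1: "(\<integral>\<^sup>+x. ennreal (approx_identity 1 (x :: real ^ 'n::finite)) \<partial>lborel) = 1"
proof -
  let ?d = "CARD('n)" and ?w = "unit_ball_vol (real CARD('n))"
  have w: "?w > 0" by simp
  have d: "?d > 0" by simp
  define h where "h r = 1 / ?w * (r\<^sup>2 + 1) powr (- real ?d / 2 - 1)" for r :: real
  have [measurable]: "h \<in> borel_measurable borel" unfolding h_def[abs_def] by measurable
  have "(\<integral>\<^sup>+x. ennreal (approx_identity 1 (x::real^'n)) \<partial>lborel) = (\<integral>\<^sup>+x. ennreal (h (norm (x::real^'n))) \<partial>lborel)"
    by (simp add: h_def approx_identity_def)
  also have "\<dots> = (\<integral>\<^sup>+r. ennreal (real ?d * ?w * r ^ (?d - 1)) * indicator {0..} r * ennreal (h r) \<partial>lborel)"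
    by (rule nn_integral_radial) measurable
  also have "\<dots> = (\<integral>\<^sup>+r. ennreal (real ?d * ?w * r ^ (?d - 1) * h r) * indicator {0..} r \<partial>lborel)"
  proof (rule nn_integral_cong)
    fix r
    show "ennreal (real ?d * ?w * r ^ (?d - 1)) * indicator {0..} r * ennreal (h r) =
      ennreal (real ?d * ?w * r ^ (?d - 1) * h r) * indicator {0..} r"
    proof (cases "r \<ge> 0")
      case True
      have "h r \<ge> 0" using w by (simp add: h_def)
      then show ?thesis using True by (simp add: ennreal_mult'')
    qed simp
  qed
  also have "\<dots> = ennreal (1 - (0 / sqrt (0\<^sup>2 + 1)) ^ ?d)"
  proof (rule nn_integral_FTC_atLeast[where F = "\<lambda>r. (r / sqrt (r\<^sup>2 + 1)) ^ ?d"])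
    fix r :: real assume r: "0 \<le> r"
    have p: "r\<^sup>2 + 1 > 0" using zero_le_power2[of r] by linarith
    have s: "sqrt (r\<^sup>2 + 1) = (r\<^sup>2 + 1) powr (1/2)" using p by (simp add: powr_half_sqrt)
    have "((\<lambda>r. r * (r\<^sup>2 + 1) powr (- 1 / 2)) has_real_derivative
        (r\<^sup>2 + 1) powr (- 1 / 2) + r * (- 1 / 2 * (r\<^sup>2 + 1) powr (- 1 / 2 - 1) * (2 * r))) (at r)"
      using p by (auto intro!: derivative_eq_intros)
    moreover have "(r\<^sup>2 + 1) powr (- 1 / 2) = (r\<^sup>2 + 1) powr (- 3 / 2) * (r\<^sup>2 + 1)"
      using p powr_add[of "r\<^sup>2 + 1" "-3/2" 1] by simp
    ultimately have g: "((\<lambda>r. r * (r\<^sup>2 + 1) powr (- 1 / 2)) has_real_derivative (r\<^sup>2 + 1) powr (- 3 / 2)) (at r)"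
      by (simp add: algebra_simps power2_eq_square)
    have e: "r / sqrt (r\<^sup>2 + 1) = r * (r\<^sup>2 + 1) powr (- 1 / 2)" for r :: real
    proof -
      have "(r\<^sup>2 + 1) powr (- 1 / 2) = inverse ((r\<^sup>2 + 1) powr (1 / 2))"
        using powr_minus[of "r\<^sup>2 + 1" "1/2"] by simp
      moreover have "(r\<^sup>2 + 1) powr (1 / 2) = sqrt (r\<^sup>2 + 1)"
        by (rule powr_half_sqrt) (use zero_le_power2[of r] in linarith)
      ultimately show ?thesis by (simp only: divide_inverse)
    qed
    have "((\<lambda>r. (r / sqrt (r\<^sup>2 + 1)) ^ ?d) has_real_derivative
        real ?d * (r * (r\<^sup>2 + 1) powr (- 1 / 2)) ^ (?d - 1) * (r\<^sup>2 + 1) powr (- 3 / 2)) (at r)"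
      unfolding e using DERIV_power[OF g, of ?d] by (simp add: mult_ac)
    moreover have "real ?d * (r * (r\<^sup>2 + 1) powr (- 1 / 2)) ^ (?d - 1) * (r\<^sup>2 + 1) powr (- 3 / 2) = real ?d * ?w * r ^ (?d - 1) * h r" (is "?X = ?Y")
    proof -
      have "((r\<^sup>2 + 1) powr (- 1 / 2)) ^ (?d - 1) = (r\<^sup>2 + 1) powr (- 1 / 2 * real (?d - 1))"
        by (subst powr_realpow[symmetric]) (use p in simp, rule powr_powr)
      also have "- 1 / 2 * real (?d - 1) = - real ?d / 2 - 1 + 3 / 2" using d by (simp add: of_nat_diff Suc_le_eq field_simps)
      finally have q: "((r\<^sup>2 + 1) powr (- 1 / 2)) ^ (?d - 1) = (r\<^sup>2 + 1) powr (- real ?d / 2 - 1 + 3 / 2)" .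
      have "(r\<^sup>2 + 1) powr (- real ?d / 2 - 1 + 3 / 2) * (r\<^sup>2 + 1) powr (- 3 / 2) = (r\<^sup>2 + 1) powr (- real ?d / 2 - 1)"
        by (subst powr_add[symmetric]) (rule arg_cong[where f = "\<lambda>a. (r\<^sup>2 + 1) powr a"], simp)
      then have "r ^ (?d - 1) * (r\<^sup>2 + 1) powr (- real ?d / 2 - 1 + 3 / 2) * (r\<^sup>2 + 1) powr (- 3 / 2) = ?w * r ^ (?d - 1) * h r"
        using less_imp_neq[OF w, symmetric] unfolding h_def by (simp only: mult.assoc) simp
      then show ?thesis unfolding power_mult_distrib q by (simp only: mult.assoc)
    qed
    ultimately show "((\<lambda>r. (r / sqrt (r\<^sup>2 + 1)) ^ ?d) has_real_derivative real ?d * ?w * r ^ (?d - 1) * h r) (at r)"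
      by (simp only:)
    show "0 \<le> real ?d * ?w * r ^ (?d - 1) * h r" using r w by (simp add: h_def)
  next
    have "((\<lambda>r. r / sqrt (r\<^sup>2 + 1)) \<longlongrightarrow> (1::real)) at_top" by real_asymp
    from tendsto_power[OF this, of ?d]
    show "((\<lambda>r::real. (r / sqrt (r\<^sup>2 + 1)) ^ ?d) \<longlongrightarrow> 1) at_top" by simp
  qed auto
  finally show ?thesis using d by simp
qed

lemma approx_identity_scale:
  assumes "\<delta> > 0"
  shows "\<delta> ^ CARD('n) * approx_identity \<delta> (\<delta> *\<^sub>R (x :: real ^ 'n::finite)) = approx_identity 1 x"
proof -
  have p: "(norm x)\<^sup>2 + 1 > 0" using zero_le_power2[of "norm x"] by linarith
  have "(norm (\<delta> *\<^sub>R x))\<^sup>2 + \<delta>\<^sup>2 = \<delta>\<^sup>2 * ((norm x)\<^sup>2 + 1)"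
    by (simp add: power_mult_distrib algebra_simps)
  moreover have "\<delta> ^ CARD('n) * (\<delta>\<^sup>2 * (\<delta>\<^sup>2) powr (- real CARD('n) / 2 - 1)) = 1"
  proof -
    have "(\<delta>\<^sup>2) powr (- real CARD('n) / 2 - 1) = \<delta> powr (- real CARD('n) - 2)"
      using assms powr_powr[of \<delta> 2 "- real CARD('n) / 2 - 1"] by (simp add: powr_numeral algebra_simps)
    moreover have "\<delta> ^ CARD('n) = \<delta> powr real CARD('n)" "\<delta>\<^sup>2 = \<delta> powr 2" using assms by (simp_all add: powr_realpow powr_numeral)
    ultimately have "\<delta> ^ CARD('n) * (\<delta>\<^sup>2 * (\<delta>\<^sup>2) powr (- real CARD('n) / 2 - 1)) =
      \<delta> powr (real CARD('n) + (2 + (- real CARD('n) - 2)))" by (simp only: powr_add)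
    then show ?thesis using assms by simp
  qed
  ultimately show ?thesis using assms p
    by (simp add: approx_identity_def powr_mult)
qed

section \<open>The regularised fundamental solution and its derivatives\<close>

text \<open>The fundamental solution as a function of \<open>t = |x|\<^sup>2\<close>, with \<open>t\<close> replaced by \<open>t + \<delta>\<^sup>2\<close>; for \<open>\<delta> > 0\<close> it
  is smooth up to \<open>t = 0\<close>. Its first two derivatives with respect to \<open>t\<close> follow.\<close>

definition newton_kernel :: "nat \<Rightarrow> real \<Rightarrow> real \<Rightarrow> real" where
  "newton_kernel d \<delta> t = (if d = 2 then - ln (t + \<delta>\<^sup>2) / (4 * pi)
     else (t + \<delta>\<^sup>2) powr ((2 - real d) / 2) / ((real d - 2) * (real d * unit_ball_vol (real d))))"

definition newton_kernel1 :: "nat \<Rightarrow> real \<Rightarrow> real \<Rightarrow> real" where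
  "newton_kernel1 d \<delta> t = - ((t + \<delta>\<^sup>2) powr (- real d / 2)) / (2 * real d * unit_ball_vol (real d))"

definition newton_kernel2 :: "nat \<Rightarrow> real \<Rightarrow> real \<Rightarrow> real" where
  "newton_kernel2 d \<delta> t = (t + \<delta>\<^sup>2) powr (- real d / 2 - 1) / (4 * unit_ball_vol (real d))"

lemma unit_ball_vol_neq_0: "unit_ball_vol (real d) \<noteq> 0"
  by (rule less_imp_neq[OF unit_ball_vol_pos, symmetric]) simp

lemma powr_of_square: "s > 0 \<Longrightarrow> (s\<^sup>2) powr (a / 2) = s powr (a :: real)"
  using powr_powr[of s 2 "a / 2"] by (simp add: powr_numeral)

lemma DERIV_powr_shift:
  assumes "t + c > 0"
  shows "((\<lambda>t. (t + c) powr a) has_real_derivative a * (t + c) powr (a - 1)) (at t)"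
  using assms by (auto intro!: derivative_eq_intros)

lemma DERIV_newton_kernel:
  assumes "d \<ge> 2" "t + \<delta>\<^sup>2 > 0"
  shows "(newton_kernel d \<delta> has_real_derivative newton_kernel1 d \<delta> t) (at t)"
proof (cases "d = 2")
  case True
  have "((\<lambda>t. - ln (t + \<delta>\<^sup>2) / (4 * pi)) has_real_derivative - (1 / (t + \<delta>\<^sup>2)) / (4 * pi)) (at t)"
    using assms by (auto intro!: derivative_eq_intros)
  moreover have "- (1 / (t + \<delta>\<^sup>2)) / (4 * pi) = newton_kernel1 d \<delta> t"
    using assms True by (simp add: newton_kernel1_def unit_ball_vol_2 powr_minus divide_simps)
  ultimately show ?thesis using True by (simp add: newton_kernel_def[abs_def])
next
  case False
  then have d: "real d - 2 \<noteq> 0" "real d > 0" using assms by auto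
  from DERIV_cdivide[OF DERIV_powr_shift[OF assms(2), of "(2 - real d) / 2"], of "(real d - 2) * (real d * unit_ball_vol (real d))"]
  have *: "(newton_kernel d \<delta> has_real_derivative
     (2 - real d) / 2 * (t + \<delta>\<^sup>2) powr ((2 - real d) / 2 - 1) / ((real d - 2) * (real d * unit_ball_vol (real d)))) (at t)"
    using False by (simp add: newton_kernel_def[abs_def])
  have e: "(2 - real d) / 2 - 1 = - real d / 2" by (simp add: field_simps)
  have "(2 - real d) / 2 * P / ((real d - 2) * (real d * w)) = - P / (2 * real d * w)" if "w \<noteq> 0" for P w
    using d that by (simp add: divide_simps) (simp add: algebra_simps)
  from this[OF unit_ball_vol_neq_0] * show ?thesis unfolding e newton_kernel1_def by simp
qed

lemma DERIV_newton_kernel1: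
  assumes "d \<ge> 2" "t + \<delta>\<^sup>2 > 0"
  shows "(newton_kernel1 d \<delta> has_real_derivative newton_kernel2 d \<delta> t) (at t)"
proof -
  from DERIV_cdivide[OF DERIV_powr_shift[OF assms(2), of "- real d / 2"], of "- (2 * real d * unit_ball_vol (real d))"]
  have *: "(newton_kernel1 d \<delta> has_real_derivative
     - real d / 2 * (t + \<delta>\<^sup>2) powr (- real d / 2 - 1) / (- (2 * real d * unit_ball_vol (real d)))) (at t)"
    by (simp add: newton_kernel1_def[abs_def])
  have "- real d / 2 * P / (- (2 * real d * w)) = P / (4 * w)" if "w \<noteq> 0" for P w
    using assms that by (simp add: divide_simps)
  from this[OF unit_ball_vol_neq_0] * show ?thesis unfolding newton_kernel2_def by simp
qed

lemma newton_kernel_0: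
  fixes z :: "real ^ 'n::finite"
  assumes z: "z \<noteq> 0"
  shows "newton_kernel CARD('n) 0 ((norm z)\<^sup>2) = fundamental_solution z"
proof (cases "CARD('n) = 2")
  case True
  then show ?thesis using z by (simp add: newton_kernel_def fundamental_solution_def ln_realpow)
next
  case False
  have "((norm z)\<^sup>2) powr ((2 - real CARD('n)) / 2) = norm z powr (2 - real CARD('n))"
    using z by (intro powr_of_square) simp
  then show ?thesis using False by (simp add: newton_kernel_def fundamental_solution_def)
qed

lemma newton_kernel_laplace:
  "4 * t * newton_kernel2 CARD('n) \<delta> t + 2 * real CARD('n::finite) * newton_kernel1 CARD('n) \<delta> t
     = - (\<delta>\<^sup>2 / unit_ball_vol (real CARD('n)) * (t + \<delta>\<^sup>2) powr (- real CARD('n) / 2 - 1))" if "t + \<delta>\<^sup>2 > 0"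
proof -
  let ?P = "(t + \<delta>\<^sup>2) powr (- real CARD('n) / 2 - 1)"
  have e: "(t + \<delta>\<^sup>2) powr (- real CARD('n) / 2) = (t + \<delta>\<^sup>2) * ?P"
    using that powr_add[of "t + \<delta>\<^sup>2" 1 "- real CARD('n) / 2 - 1"] by simp
  have "4 * t * (P / (4 * w)) + 2 * D * (- ((t + \<delta>\<^sup>2) * P) / (2 * D * w)) = - (\<delta>\<^sup>2 / w * P)" if "w \<noteq> 0" "D \<noteq> 0" for w D P
    using that by (simp add: divide_simps) (simp add: algebra_simps)
  from this[OF unit_ball_vol_neq_0[of "CARD('n)"], of "real CARD('n)" ?P]
  show ?thesis unfolding newton_kernel1_def newton_kernel2_def e by simp
qed

text \<open>The power \<open>1/4\<close> leaves room for the logarithm in dimension two. Divided by \<open>1 + t\<close>, where \<open>t = |x|\<^sup>2\<close>,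
  it becomes the decay weight.\<close>

lemma newton_kernel_growth:
  assumes d: "d \<ge> 2" and \<delta>: "\<delta> > 0"
  shows "\<exists>C\<ge>0. \<forall>t\<ge>0. \<bar>newton_kernel d \<delta> t\<bar> \<le> C * (1 + t) powr (1 / 4) \<and>
                      \<bar>t * newton_kernel1 d \<delta> t\<bar> \<le> C * (1 + t) powr (1 / 4)"
proof -
  have ge1: "(1 + t) powr (1 / 4) \<ge> 1" if "t \<ge> 0" for t :: real
    using that by (simp add: ge_one_powr_ge_zero)
  have \<delta>2: "\<delta>\<^sup>2 > 0" using \<delta> by simp
  have "\<exists>C\<ge>0. \<forall>t\<ge>0. \<bar>newton_kernel d \<delta> t\<bar> \<le> C * (1 + t) powr (1 / 4)"
  proof (cases "d = 2")
    case True
    define C where "C = \<bar>ln (\<delta>\<^sup>2)\<bar> + 4 * (1 + \<delta>\<^sup>2)"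
    have "\<bar>ln (t + \<delta>\<^sup>2)\<bar> \<le> C * (1 + t) powr (1 / 4)" if t: "t \<ge> 0" for t
    proof -
      have pos: "t + \<delta>\<^sup>2 > 0" using t \<delta>2 by linarith
      have C1: "C \<le> C * (1 + t) powr (1 / 4)"
        using mult_left_mono[OF ge1[OF t], of C] by (simp add: C_def)
      have "ln (\<delta>\<^sup>2) \<le> ln (t + \<delta>\<^sup>2)" by (subst ln_le_cancel_iff) (use t pos \<delta>2 in linarith)+
      moreover have "- ln (\<delta>\<^sup>2) \<le> C"
        using zero_le_power2[of \<delta>] abs_ge_minus_self[of "ln (\<delta>\<^sup>2)"] unfolding C_def distrib_left by linarith
      ultimately have 1: "- ln (t + \<delta>\<^sup>2) \<le> C" by linarith
      have "t + \<delta>\<^sup>2 \<le> (1 + \<delta>\<^sup>2) * (1 + t)" using t by (simp add: algebra_simps)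
      then have "ln (t + \<delta>\<^sup>2) \<le> ln ((1 + \<delta>\<^sup>2) * (1 + t))" using pos by (subst ln_le_cancel_iff) linarith+
      also have "\<dots> = ln (1 + \<delta>\<^sup>2) + ln (1 + t)"
        by (subst ln_mult_pos) (use t \<delta>2 in linarith)+
      also have "ln (1 + \<delta>\<^sup>2) \<le> \<delta>\<^sup>2 * (1 + t) powr (1/4)"
        using ln_add_one_self_le_self[of "\<delta>\<^sup>2"] mult_left_mono[OF ge1[OF t], of "\<delta>\<^sup>2"] by simp
      also have "ln (1 + t) \<le> 4 * (1 + t) powr (1 / 4)"
        using ln_powr_bound[of "1 + t" "1/4"] t by simp
      finally have "ln (t + \<delta>\<^sup>2) \<le> (4 + \<delta>\<^sup>2) * (1 + t) powr (1 / 4)" by (simp add: algebra_simps)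
      also have "\<dots> \<le> C * (1 + t) powr (1 / 4)" using \<delta>2 by (intro mult_right_mono) (auto simp: C_def)
      finally show ?thesis using 1 C1 by linarith
    qed
    then have "\<bar>newton_kernel d \<delta> t\<bar> \<le> C / (4 * pi) * (1 + t) powr (1 / 4)" if "t \<ge> 0" for t
      using that True by (simp add: newton_kernel_def abs_mult divide_right_mono)
    moreover have "C / (4 * pi) \<ge> 0" unfolding C_def using \<delta>2 by simp
    ultimately show ?thesis by blast
  next
    case False
    define c where "c = (real d - 2) * (real d * unit_ball_vol (real d))"
    define C where "C = (\<delta>\<^sup>2) powr ((2 - real d) / 2) / c"
    have pos: "c > 0" unfolding c_def using d False by simp
    then have C0: "C \<ge> 0" unfolding C_def by (intro divide_nonneg_pos) auto
    have "\<bar>newton_kernel d \<delta> t\<bar> \<le> C * (1 + t) powr (1 / 4)" if t: "t \<ge> 0" for t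
    proof -
      have "(t + \<delta>\<^sup>2) powr ((2 - real d) / 2) \<le> (\<delta>\<^sup>2) powr ((2 - real d) / 2)"
        by (rule powr_mono2') (use t \<delta>2 d False in auto)
      then have "\<bar>newton_kernel d \<delta> t\<bar> \<le> C"
        using pos False unfolding newton_kernel_def C_def c_def[symmetric] by (simp add: divide_right_mono)
      also have "C \<le> C * (1 + t) powr (1 / 4)" using mult_left_mono[OF ge1[OF t] C0] by simp
      finally show ?thesis .
    qed
    with C0 show ?thesis by blast
  qed
  then obtain C where C: "C \<ge> 0" "\<And>t. t \<ge> 0 \<Longrightarrow> \<bar>newton_kernel d \<delta> t\<bar> \<le> C * (1 + t) powr (1 / 4)" by blast
  define C' where "C' = (\<delta>\<^sup>2) powr (1 - real d / 2) / (2 * real d * unit_ball_vol (real d))"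
  have pos: "2 * real d * unit_ball_vol (real d) > 0" using d by simp
  have C'0: "C' \<ge> 0" unfolding C'_def using pos by (intro divide_nonneg_pos) auto
  have "\<bar>t * newton_kernel1 d \<delta> t\<bar> \<le> C' * (1 + t) powr (1 / 4)" if t: "t \<ge> 0" for t
  proof -
    have "t * (t + \<delta>\<^sup>2) powr (- real d / 2) \<le> (t + \<delta>\<^sup>2) * (t + \<delta>\<^sup>2) powr (- real d / 2)"
      by (rule mult_right_mono) (use \<delta>2 in auto)
    also have "\<dots> = (t + \<delta>\<^sup>2) powr (1 - real d / 2)"
      using t \<delta>2 powr_add[of "t + \<delta>\<^sup>2" 1 "- real d / 2"] by simp
    also have "\<dots> \<le> (\<delta>\<^sup>2) powr (1 - real d / 2)"
      by (rule powr_mono2') (use t \<delta>2 d in auto)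
    finally have "\<bar>t * newton_kernel1 d \<delta> t\<bar> \<le> C'"
      using pos t unfolding newton_kernel1_def C'_def by (simp add: abs_mult abs_of_pos divide_right_mono)
    also have "C' \<le> C' * (1 + t) powr (1 / 4)" using mult_left_mono[OF ge1[OF t] C'0] by simp
    finally show ?thesis .
  qed
  note C' = this
  show ?thesis
  proof (intro exI[of _ "C + C'"] conjI allI impI)
    fix t :: real assume t: "0 \<le> t"
    have "0 \<le> C * (1 + t) powr (1 / 4)" "0 \<le> C' * (1 + t) powr (1 / 4)" using C(1) C'0 by simp_all
    then show "\<bar>newton_kernel d \<delta> t\<bar> \<le> (C + C') * (1 + t) powr (1 / 4)"
      "\<bar>t * newton_kernel1 d \<delta> t\<bar> \<le> (C + C') * (1 + t) powr (1 / 4)"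
      using C(2)[OF t] C'[OF t] unfolding distrib_right by linarith+
  qed (use C(1) C'0 in simp)
qed

text \<open>A bound uniform in \<open>\<delta>\<close>, for passing to the limit \<open>\<delta> \<rightarrow> 0\<close>; the case \<open>\<delta> = 0\<close> is the fundamental
  solution. In dimension two the singularity is only logarithmic, and \<open>s\<^sup>-\<^sup>1\<close> is a generous bound.\<close>

lemma newton_kernel_bound:
  assumes d: "d \<ge> 2"
  shows "\<exists>C\<ge>0. \<forall>\<delta> s. 0 \<le> \<delta> \<and> \<delta> \<le> 1 \<and> s > 0 \<longrightarrow> \<bar>newton_kernel d \<delta> (s\<^sup>2)\<bar> \<le> C * (s powr (1 - real d) + s + 1)"
proof (cases "d = 2")
  case True
  have "\<bar>newton_kernel d \<delta> (s\<^sup>2)\<bar> \<le> 2 / (4 * pi) * (s powr (1 - real d) + s + 1)"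
    if \<delta>: "0 \<le> \<delta>" "\<delta> \<le> 1" and s: "s > 0" for \<delta> s
  proof -
    have pos: "s\<^sup>2 + \<delta>\<^sup>2 > 0" using s by (simp add: add_pos_nonneg)
    have "s\<^sup>2 + \<delta>\<^sup>2 \<le> (1 + s)\<^sup>2"
      using power_le_one[OF \<delta>, of 2] s by (simp add: power2_eq_square algebra_simps)
    then have "ln (s\<^sup>2 + \<delta>\<^sup>2) \<le> ln ((1 + s)\<^sup>2)" using pos by (subst ln_le_cancel_iff) (use s in auto)
    also have "\<dots> \<le> 2 * s" using s ln_add_one_self_le_self[of s] by (simp add: ln_realpow)
    finally have 1: "ln (s\<^sup>2 + \<delta>\<^sup>2) \<le> 2 * s" .
    have "ln (inverse s) \<le> inverse s - 1" using s by (intro ln_le_minus_one) simp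
    then have "- (2 * ln s) \<le> 2 * inverse s" using s by (simp add: ln_inverse)
    moreover have "2 * ln s = ln (s\<^sup>2)" using s by (simp add: ln_realpow)
    moreover have "ln (s\<^sup>2) \<le> ln (s\<^sup>2 + \<delta>\<^sup>2)" using pos s by (subst ln_le_cancel_iff) auto
    ultimately have 2: "- ln (s\<^sup>2 + \<delta>\<^sup>2) \<le> 2 * inverse s" by linarith
    have "s powr (1 - real d) = inverse s" using True s by (simp add: powr_minus)
    then have "\<bar>ln (s\<^sup>2 + \<delta>\<^sup>2)\<bar> \<le> 2 * (s powr (1 - real d) + s + 1)"
    proof (intro abs_leI)
      assume e: "s powr (1 - real d) = inverse s"
      have P: "s powr (1 - real d) \<ge> 0" by simp
      show "ln (s\<^sup>2 + \<delta>\<^sup>2) \<le> 2 * (s powr (1 - real d) + s + 1)"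
        using 1 P unfolding distrib_left by linarith
      show "- ln (s\<^sup>2 + \<delta>\<^sup>2) \<le> 2 * (s powr (1 - real d) + s + 1)"
        using 2 s unfolding e[symmetric] distrib_left by linarith
    qed
    then have "\<bar>ln (s\<^sup>2 + \<delta>\<^sup>2)\<bar> / (4 * pi) \<le> 2 * (s powr (1 - real d) + s + 1) / (4 * pi)"
      by (rule divide_right_mono) simp
    moreover have "\<bar>newton_kernel d \<delta> (s\<^sup>2)\<bar> = \<bar>ln (s\<^sup>2 + \<delta>\<^sup>2)\<bar> / (4 * pi)"
      using True by (simp add: newton_kernel_def)
    ultimately show ?thesis by (simp only: times_divide_eq_left)
  qed
  then show ?thesis by (intro exI[of _ "2 / (4 * pi)"]) auto
next
  case False
  define c where "c = (real d - 2) * (real d * unit_ball_vol (real d))"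
  have c: "c > 0" using d False by (simp add: c_def)
  have "\<bar>newton_kernel d \<delta> (s\<^sup>2)\<bar> \<le> 1 / c * (s powr (1 - real d) + s + 1)"
    if \<delta>: "0 \<le> \<delta>" "\<delta> \<le> 1" and s: "s > 0" for \<delta> s
  proof -
    have "(s\<^sup>2 + \<delta>\<^sup>2) powr ((2 - real d) / 2) \<le> (s\<^sup>2) powr ((2 - real d) / 2)"
      by (rule powr_mono2') (use s d in auto)
    also have "\<dots> = s powr (2 - real d)"
      by (rule powr_of_square[OF s])
    also have "\<dots> \<le> s powr (1 - real d) + s + 1"
    proof (cases "s \<le> 1")
      case True
      then have "s powr (2 - real d) \<le> s powr (1 - real d)" using s by (intro powr_mono') auto
      then show ?thesis using s by linarith
    next
      case False
      then have "s powr (2 - real d) \<le> s powr 0" using s d by (intro powr_mono) auto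
      then have "s powr (2 - real d) \<le> 1" using s by simp
      then show ?thesis using s powr_ge_zero[of s "1 - real d"] by linarith
    qed
    finally have "(s\<^sup>2 + \<delta>\<^sup>2) powr ((2 - real d) / 2) / c \<le> (s powr (1 - real d) + s + 1) / c"
      by (rule divide_right_mono) (use c in simp)
    then show ?thesis using False c unfolding newton_kernel_def c_def[symmetric] by simp
  qed
  then show ?thesis using c by (intro exI[of _ "1 / c"]) auto
qed

lemma approx_identity_le_decay_weight:
  assumes \<delta>: "\<delta> > 0"
  shows "\<exists>C. \<forall>z :: real ^ 'n::finite. approx_identity \<delta> z \<le> C * decay_weight z"
proof -
  define m where "m = min 1 (\<delta>\<^sup>2)"
  have m: "m > 0" using \<delta> by (simp add: m_def)
  let ?a = "- real CARD('n) / 2 - 1"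
  have "approx_identity \<delta> z \<le> \<delta>\<^sup>2 / unit_ball_vol (real CARD('n)) * m powr ?a * decay_weight z" for z :: "real ^ 'n"
  proof -
    have "m * (1 + (norm z)\<^sup>2) \<le> (norm z)\<^sup>2 + \<delta>\<^sup>2"
      using mult_right_mono[of m 1 "(norm z)\<^sup>2"] by (simp add: m_def algebra_simps)
    moreover have p: "1 + (norm z)\<^sup>2 > 0" using zero_le_power2[of "norm z"] by linarith
    ultimately have "((norm z)\<^sup>2 + \<delta>\<^sup>2) powr ?a \<le> (m * (1 + (norm z)\<^sup>2)) powr ?a"
      using m by (intro powr_mono2') auto
    also have "\<dots> = m powr ?a * (1 + (norm z)\<^sup>2) powr ?a" using m p by (simp add: powr_mult)
    also have "\<dots> \<le> m powr ?a * decay_weight z"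
      unfolding decay_weight_def by (intro mult_left_mono powr_mono) auto
    finally have "\<delta>\<^sup>2 / unit_ball_vol (real CARD('n)) * ((norm z)\<^sup>2 + \<delta>\<^sup>2) powr ?a \<le>
      \<delta>\<^sup>2 / unit_ball_vol (real CARD('n)) * (m powr ?a * decay_weight z)"
      by (rule mult_left_mono) simp
    then show ?thesis by (simp add: approx_identity_def mult_ac)
  qed
  then show ?thesis by blast
qed

lemma partial_norm_power2: "partial k (\<lambda>x. (norm (x - y))\<^sup>2) x = 2 * (x - y) $ k"
proof -
  have "partial k (\<lambda>x. (norm x)\<^sup>2) z = 2 * z $ k" for z :: "real ^ 'a"
  proof -
    have d: "(\<lambda>x::real^'a. x $ l) differentiable (at z)" for l
      using Ck_on_differentiable[OF Ck_on_coord[of 1 UNIV l] _ open_UNIV] by simp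
    have "partial k (\<lambda>x. (norm x)\<^sup>2) z = (\<Sum>l\<in>UNIV. partial k (\<lambda>x. x $ l * x $ l) z)"
      unfolding norm_power2_eq_sum unfolding power2_eq_square
      by (rule partial_sum) (auto intro: differentiable_mult d)
    also have "\<dots> = (\<Sum>l\<in>UNIV. if k = l then 2 * z $ l else 0)"
      by (rule sum.cong) (auto simp: partial_mult[OF d d])
    finally show ?thesis by simp
  qed
  then show ?thesis by (simp add: partial_shift[of k "\<lambda>x. (norm x)\<^sup>2"])
qed

lemma laplacian_radial:
  fixes x y :: "real ^ 'n::finite"
  assumes "a > 0" and K: "\<And>t. t > - a \<Longrightarrow> (K has_real_derivative K1 t) (at t)"
    and K1: "\<And>t. t > - a \<Longrightarrow> (K1 has_real_derivative K2 t) (at t)"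
  shows "laplacian (\<lambda>x. K ((norm (x - y))\<^sup>2)) x =
    4 * (norm (x - y))\<^sup>2 * K2 ((norm (x - y))\<^sup>2) + 2 * real CARD('n) * K1 ((norm (x - y))\<^sup>2)"
proof -
  have t: "(norm (z - y))\<^sup>2 > - a" for z using assms(1) zero_le_power2[of "norm (z - y)"] by linarith
  have d: "(\<lambda>x. (norm (x - y))\<^sup>2) differentiable (at z)" for z
    using Ck_on_differentiable[OF Ck_on_shift[OF Ck_on_norm_power2[of 1 UNIV]] _ open_UNIV] by simp
  have dc: "(\<lambda>z. 2 * (z - y) $ k) differentiable (at z)" for k z
    by (rule Ck_on_differentiable[OF Ck_on_cmult[OF open_UNIV Ck_on_shift[of 1 "\<lambda>x. x $ k", OF Ck_on_coord]] _ open_UNIV UNIV_I]) simp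
  have p: "partial k (\<lambda>x. K ((norm (x - y))\<^sup>2)) = (\<lambda>z. K1 ((norm (z - y))\<^sup>2) * (2 * (z - y) $ k))" for k
    by (rule ext) (simp only: partial_comp[OF d K[OF t]] partial_norm_power2)
  have d1: "(\<lambda>z. K1 ((norm (z - y))\<^sup>2)) differentiable (at z)" for z
    using differentiable_chain_at[OF d[of z], of K1] K1[OF t[of z]] real_differentiable_def by (auto simp: o_def)
  have pk: "partial k (\<lambda>z. 2 * (z - y) $ k) x = 2" for k
  proof -
    have "(\<lambda>z. (z - y) $ k) differentiable (at x)"
      by (rule Ck_on_differentiable[OF Ck_on_shift[of 1 "\<lambda>x. x $ k", OF Ck_on_coord] _ open_UNIV UNIV_I]) simp
    from partial_cmult[OF this, of k 2] show ?thesis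
      unfolding partial_shift[of k "\<lambda>x. x $ k"] by simp
  qed
  have "partial k (partial k (\<lambda>x. K ((norm (x - y))\<^sup>2))) x =
    4 * K2 ((norm (x - y))\<^sup>2) * ((x - y) $ k)\<^sup>2 + 2 * K1 ((norm (x - y))\<^sup>2)" for k
    unfolding p partial_mult[OF d1 dc] partial_comp[OF d K1[OF t]] partial_norm_power2 pk
    by (simp add: power2_eq_square algebra_simps)
  then have "laplacian (\<lambda>x. K ((norm (x - y))\<^sup>2)) x =
    4 * K2 ((norm (x - y))\<^sup>2) * (\<Sum>k\<in>UNIV. ((x - y) $ k)\<^sup>2) + real CARD('n) * (2 * K1 ((norm (x - y))\<^sup>2))"
    by (simp add: laplacian_def sum.distrib sum_distrib_left)
  then show ?thesis unfolding norm_power2_eq_sum[symmetric] by simp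
qed

section \<open>Representation by Newtonian potentials\<close>

text \<open>For \<open>i = 0\<close> this is a smooth cutoff in \<open>t = |x|\<^sup>2\<close> that vanishes for \<open>t \<ge> R\<^sup>2\<close>, normalised to be \<open>1\<close> at
  \<open>t = 0\<close>; up to sign and powers of \<open>R\<close> the others are its derivatives.\<close>

definition cutoff :: "nat \<Rightarrow> real \<Rightarrow> real \<Rightarrow> real" where
  "cutoff i R t = exp 1 * bump_fn i (1 - t / R\<^sup>2)"

lemma DERIV_cutoff:
  assumes "R > 0"
  shows "(cutoff i R has_real_derivative - cutoff (Suc i) R t / R\<^sup>2) (at t)"
proof -
  have "((\<lambda>t. 1 - t / R\<^sup>2) has_real_derivative 0 - 1 / R\<^sup>2) (at t)"
    by (intro DERIV_diff DERIV_cdivide DERIV_ident DERIV_const)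
  from DERIV_cmult[OF DERIV_chain2[OF DERIV_bump_fn this], of "exp 1" i]
  show ?thesis by (simp add: cutoff_def[abs_def])
qed

lemma cutoff_eq_0: "R > 0 \<Longrightarrow> t \<ge> R\<^sup>2 \<Longrightarrow> cutoff i R t = 0"
  by (simp add: cutoff_def bump_fn_def divide_less_eq)

lemma bump_fn_bounded:
  obtains H where "H \<ge> 0" "\<And>s. s \<le> 1 \<Longrightarrow> \<bar>bump_fn i s\<bar> \<le> H"
proof -
  have "continuous_on {0..1} (bump_fn i)"
    by (rule DERIV_continuous_on) (use DERIV_bump_fn has_field_derivative_at_within in blast)
  then have "compact (bump_fn i ` {0..1})" by (intro compact_continuous_image) auto
  then obtain H where H: "\<forall>x\<in>bump_fn i ` {0..1}. norm x \<le> H" using compact_imp_bounded bounded_iff by blast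
  have "\<bar>bump_fn i s\<bar> \<le> max H 0" if "s \<le> 1" for s
  proof (cases "s > 0")
    case True
    then have "norm (bump_fn i s) \<le> H" using H that by auto
    then show ?thesis by simp
  qed (simp add: bump_fn_def)
  then show ?thesis using that[of "max H 0"] by simp
qed

lemma cutoff_bounded:
  obtains H where "H \<ge> 0" "\<And>i R t. i \<le> 2 \<Longrightarrow> t \<ge> 0 \<Longrightarrow> \<bar>cutoff i R t\<bar> \<le> H"
proof -
  have "\<exists>H\<ge>0. \<forall>s\<le>1. \<bar>bump_fn i s\<bar> \<le> H" for i
    by (rule bump_fn_bounded[of i]) blast
  then obtain H where H: "\<And>i. H i \<ge> 0" "\<And>i s. s \<le> 1 \<Longrightarrow> \<bar>bump_fn i s\<bar> \<le> H i"
    by metis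
  have "\<bar>cutoff i R t\<bar> \<le> exp 1 * (H 0 + H 1 + H 2)" if "i \<le> 2" "t \<ge> 0" for i R t
  proof -
    have "i = 0 \<or> i = 1 \<or> i = 2" using that by auto
    then have "\<bar>bump_fn i (1 - t / R\<^sup>2)\<bar> \<le> H 0 + H 1 + H 2"
      using H(2)[of "1 - t / R\<^sup>2" i] H(1)[of 0] H(1)[of 1] H(1)[of 2] that by auto
    then show ?thesis by (simp add: cutoff_def abs_mult)
  qed
  moreover have "exp 1 * (H 0 + H 1 + H 2) \<ge> 0" using H(1) by simp
  ultimately show ?thesis using that by blast
qed

lemma cutoff_tendsto:
  "(\<lambda>n. cutoff i (real (Suc n)) t) \<longlonglongrightarrow> exp 1 * bump_fn i 1"
proof -
  have "(\<lambda>n. 1 - t * (inverse (real (Suc n)) * inverse (real (Suc n)))) \<longlonglongrightarrow> 1 - t * (0 * 0)"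
    by (intro tendsto_intros LIMSEQ_inverse_real_of_nat)
  then have 1: "(\<lambda>n. 1 - t / (real (Suc n))\<^sup>2) \<longlonglongrightarrow> 1"
    by (simp add: divide_inverse power2_eq_square)
  have "isCont (bump_fn i) 1" using DERIV_bump_fn by (rule DERIV_isCont)
  from isCont_tendsto_compose[OF this 1] show ?thesis
    unfolding cutoff_def by (intro tendsto_intros)
qed

text \<open>The test function is the regularised fundamental solution centred at \<open>y\<close>, cut off at radius \<open>R\<close>.
  As \<open>R\<close> tends to infinity the derivatives that fall on the cutoff disappear by dominated convergence:
  they are bounded by the decay weight, and \<open>\<Phi>\<close> is integrable against that weight.\<close>

lemma regularised_identity:
  fixes \<Phi> f :: "real ^ 'n::finite \<Rightarrow> real"
  assumes d: "2 \<le> CARD('n)" and \<Phi>[measurable]: "\<Phi> \<in> borel_measurable borel" and f[measurable]: "f \<in> borel_measurable borel"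
    and \<Phi>i: "integrable lborel (\<lambda>x. \<Phi> x * decay_weight x)" and fi: "integrable lborel f"
    and fr: "\<And>x. norm x > r \<Longrightarrow> f x = 0"
    and test: "\<And>\<eta>. test_function UNIV \<eta> \<Longrightarrow> (\<integral>x. \<Phi> x * laplacian \<eta> x \<partial>lborel) = (\<integral>x. f x * \<eta> x \<partial>lborel)"
    and \<delta>: "\<delta> > 0"
  shows "(\<integral>x. \<Phi> x * approx_identity \<delta> (x - y) \<partial>lborel) = - (\<integral>x. f x * newton_kernel CARD('n) \<delta> ((norm (x - y))\<^sup>2) \<partial>lborel)"
proof -
  let ?d = "CARD('n)"
  define t where "t x = (norm (x - y))\<^sup>2" for x
  have t0: "t x \<ge> 0" for x by (simp add: t_def)
  have [measurable]: "t \<in> borel_measurable borel" unfolding t_def[abs_def] by measurable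
  have \<delta>2: "\<delta>\<^sup>2 > 0" using \<delta> by simp
  define R where "R n = real (Suc n)" for n
  have R: "R n > 0" "R n \<ge> 1" for n by (simp_all add: R_def)
  let ?G = "newton_kernel ?d \<delta>" and ?G1 = "newton_kernel1 ?d \<delta>" and ?G2 = "newton_kernel2 ?d \<delta>"
  define K where "K n s = ?G s * cutoff 0 (R n) s" for n s
  define K1 where "K1 n s = ?G1 s * cutoff 0 (R n) s - ?G s * cutoff 1 (R n) s / (R n)\<^sup>2" for n s
  define K2 where "K2 n s = ?G2 s * cutoff 0 (R n) s - 2 * ?G1 s * cutoff 1 (R n) s / (R n)\<^sup>2
      + ?G s * cutoff 2 (R n) s / (R n)\<^sup>2 / (R n)\<^sup>2" for n s
  have DK: "(K n has_real_derivative K1 n s) (at s)" "(K1 n has_real_derivative K2 n s) (at s)" if "s > - \<delta>\<^sup>2" for n s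
  proof -
    have p: "s + \<delta>\<^sup>2 > 0" using that by linarith
    note D = DERIV_newton_kernel[OF d p] DERIV_newton_kernel1[OF d p] DERIV_cutoff[OF R(1)[of n], of 0 s]
      DERIV_cutoff[OF R(1)[of n], of 1 s]
    show "(K n has_real_derivative K1 n s) (at s)"
      unfolding K_def K1_def by (rule derivative_eq_intros D refl)+ simp
    show "(K1 n has_real_derivative K2 n s) (at s)"
    proof -
      have "(K1 n has_real_derivative (?G2 s * cutoff 0 (R n) s + - cutoff (Suc 0) (R n) s / (R n)\<^sup>2 * ?G1 s)
        - (?G1 s * cutoff 1 (R n) s + - cutoff (Suc 1) (R n) s / (R n)\<^sup>2 * ?G s) / (R n)\<^sup>2) (at s)"
        unfolding K1_def by (intro DERIV_diff DERIV_mult DERIV_cdivide D)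
      moreover have "(?G2 s * cutoff 0 (R n) s + - cutoff (Suc 0) (R n) s / (R n)\<^sup>2 * ?G1 s)
        - (?G1 s * cutoff 1 (R n) s + - cutoff (Suc 1) (R n) s / (R n)\<^sup>2 * ?G s) / (R n)\<^sup>2 = K2 n s"
        unfolding K2_def One_nat_def
        by (simp add: diff_divide_distrib add_divide_distrib numeral_2_eq_2 mult_ac)
      ultimately show ?thesis by (simp only:)
    qed
  qed
  define \<eta> where "\<eta> n x = K n (t x)" for n x
  have lap: "laplacian (\<eta> n) x = 4 * t x * K2 n (t x) + 2 * real ?d * K1 n (t x)" for n x
    unfolding \<eta>_def t_def by (rule laplacian_radial[OF \<delta>2 DK])
  have Ckt: "Ck_on m UNIV t" for m unfolding t_def[abs_def] by (rule Ck_on_shift[OF Ck_on_norm_power2])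
  have CkG: "Ck_on m UNIV (\<lambda>x. ?G (t x))" for m
  proof -
    have c: "Ck_on m UNIV (\<lambda>x. t x + \<delta>\<^sup>2)" by (intro Ck_on_add Ckt Ck_on_const open_UNIV)
    have p: "t x + \<delta>\<^sup>2 > 0" for x using t0[of x] \<delta>2 by linarith
    show ?thesis
    proof (cases "?d = 2")
      case True
      have "Ck_on m UNIV (\<lambda>x. (- 1 / (4 * pi)) * ln (t x + \<delta>\<^sup>2))"
        by (intro Ck_on_cmult Ck_on_ln c p open_UNIV)
      then show ?thesis using True by (simp add: newton_kernel_def)
    next
      case False
      have "Ck_on m UNIV (\<lambda>x. (1 / ((real ?d - 2) * (real ?d * unit_ball_vol (real ?d)))) * (t x + \<delta>\<^sup>2) powr ((2 - real ?d) / 2))"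
        by (intro Ck_on_cmult Ck_on_powr c p open_UNIV)
      then show ?thesis using False by (simp add: newton_kernel_def)
    qed
  qed
  have Ckc: "Ck_on m UNIV (\<lambda>x. cutoff i (R n) (t x))" for m i n
  proof -
    have "Ck_on m UNIV (\<lambda>x. 1 - (1 / (R n)\<^sup>2) * t x)"
      by (intro Ck_on_diff Ck_on_cmult Ckt Ck_on_const open_UNIV)
    then have "Ck_on m UNIV (\<lambda>x. exp 1 * bump_fn i (1 - (1 / (R n)\<^sup>2) * t x))"
      by (intro Ck_on_cmult Ck_on_bump_fn open_UNIV)
    then show ?thesis by (simp add: cutoff_def)
  qed
  have \<eta>0: "\<eta> n x = 0" if "x \<notin> cball y (R n)" for n x
  proof -
    have "R n \<le> norm (x - y)" using that by (simp add: dist_norm norm_minus_commute)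
    then have "(R n)\<^sup>2 \<le> t x" unfolding t_def by (rule power_mono) (use R in \<open>simp add: less_imp_le\<close>)
    then show ?thesis by (simp add: \<eta>_def K_def cutoff_eq_0[OF R(1)])
  qed
  have \<eta>test: "test_function UNIV (\<eta> n)" for n
    unfolding test_function_def smooth_on_def
  proof (intro conjI allI subset_UNIV)
    show "Ck_on m UNIV (\<eta> n)" for m
      unfolding \<eta>_def K_def by (intro Ck_on_mult CkG Ckc open_UNIV)
    show "compact (supp (\<eta> n))" by (rule compact_suppI[OF compact_cball \<eta>0])
  qed
  have Gm[measurable]: "(\<lambda>x. ?G (t x)) \<in> borel_measurable borel"
    by (rule borel_measurable_continuous_onI[OF Ck_on_imp_continuous[OF CkG[of 0]]])
  obtain H where H: "H \<ge> 0" "\<And>i R t. i \<le> 2 \<Longrightarrow> t \<ge> 0 \<Longrightarrow> \<bar>cutoff i R t\<bar> \<le> H"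
    by (rule cutoff_bounded) blast
  obtain C where C: "C \<ge> 0" "\<And>s. s \<ge> 0 \<Longrightarrow> \<bar>?G s\<bar> \<le> C * (1 + s) powr (1 / 4)"
     "\<And>s. s \<ge> 0 \<Longrightarrow> \<bar>s * ?G1 s\<bar> \<le> C * (1 + s) powr (1 / 4)"
    using newton_kernel_growth[OF d \<delta>] by blast
  obtain C2 where C2: "\<And>z :: real^'n. approx_identity \<delta> z \<le> C2 * decay_weight z"
    using approx_identity_le_decay_weight[OF \<delta>] by blast
  \<comment> \<open>the part of the Laplacian in which a derivative falls on the cutoff\<close>
  define E where "E n s = - 8 * (s * ?G1 s) * cutoff 1 (R n) s / (R n)\<^sup>2 + 4 * (s / (R n)\<^sup>2) * ?G s * cutoff 2 (R n) s / (R n)\<^sup>2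
      - 2 * real ?d * ?G s * cutoff 1 (R n) s / (R n)\<^sup>2" for n s
  have lapE: "laplacian (\<eta> n) x = - approx_identity \<delta> (x - y) * cutoff 0 (R n) (t x) + E n (t x)" for n x
  proof -
    have p: "t x + \<delta>\<^sup>2 > 0" using t0[of x] \<delta>2 by linarith
    have "4 * s * (g2 * c0 - 2 * g1 * c1 / Q + g * c2 / Q / Q) + 2 * D * (g1 * c0 - g * c1 / Q)
      = (4 * s * g2 + 2 * D * g1) * c0 + (- 8 * (s * g1) * c1 / Q + 4 * (s / Q) * g * c2 / Q - 2 * D * g * c1 / Q)"
      for s g g1 g2 c0 c1 c2 Q D :: real
      by (simp add: diff_divide_distrib add_divide_distrib algebra_simps)
    from this[of "t x"] show ?thesis
      unfolding lap K1_def K2_def E_def newton_kernel_laplace[where 'n = 'n, OF p, symmetric] approx_identity_def t_def[symmetric]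
      by (simp only: newton_kernel_laplace[where 'n = 'n, OF p] minus_minus)
  qed
  define M where "M = H * C2 + H * C * (24 + 4 * real ?d)"
  have Ebound: "\<bar>E n (t x)\<bar> \<le> H * C * (24 + 4 * real ?d) * decay_weight (x - y)" for n x
  proof (cases "t x \<ge> (R n)\<^sup>2")
    case True
    then have "E n (t x) = 0" by (simp add: E_def cutoff_eq_0[OF R(1)])
    moreover have "0 \<le> H * C * (24 + 4 * real ?d) * decay_weight (x - y)"
      by (intro mult_nonneg_nonneg H(1) C(1) less_imp_le[OF decay_weight_pos]) simp
    ultimately show ?thesis by simp
  next
    case False
    define s where "s = t x"
    have s: "s \<ge> 0" "s < (R n)\<^sup>2" using False t0 by (simp_all add: s_def)
    have R2: "(R n)\<^sup>2 \<ge> 1" using R(2)[of n] by simp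
    define B where "B = C * (1 + s) powr (1 / 4) * H"
    have B0: "B \<ge> 0" unfolding B_def using C(1) H(1) by simp
    have b1: "\<bar>(s * ?G1 s) * cutoff 1 (R n) s\<bar> \<le> B"
      unfolding B_def abs_mult[of _ "cutoff 1 (R n) s"] by (intro mult_mono C H s) (use C(1) in auto)
    have b2: "\<bar>?G s * cutoff i (R n) s\<bar> \<le> B" if "i \<le> 2" for i
      unfolding B_def abs_mult by (intro mult_mono C H s that) (use C(1) in auto)
    have b3: "\<bar>(s / (R n)\<^sup>2) * (?G s * cutoff 2 (R n) s)\<bar> \<le> 1 * B"
      unfolding abs_mult[of "s / (R n)\<^sup>2"] using s R2 by (intro mult_mono b2) (auto simp: divide_le_eq)
    have "E n s = (- 8 * ((s * ?G1 s) * cutoff 1 (R n) s) + 4 * ((s / (R n)\<^sup>2) * (?G s * cutoff 2 (R n) s))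
       - 2 * real ?d * (?G s * cutoff 1 (R n) s)) / (R n)\<^sup>2"
      unfolding E_def by (simp add: add_divide_distrib diff_divide_distrib mult.assoc)
    moreover have "\<bar>- 8 * ((s * ?G1 s) * cutoff 1 (R n) s) + 4 * ((s / (R n)\<^sup>2) * (?G s * cutoff 2 (R n) s))
       - 2 * real ?d * (?G s * cutoff 1 (R n) s)\<bar> \<le> (12 + 2 * real ?d) * B"
    proof -
      have "\<bar>2 * real ?d * (?G s * cutoff 1 (R n) s)\<bar> \<le> 2 * real ?d * B"
        using mult_left_mono[OF b2[of 1], of "2 * real ?d"] by (simp add: abs_mult)
      moreover have "\<bar>- 8 * a + 4 * b - c\<bar> \<le> 12 * B + e" if "\<bar>a\<bar> \<le> B" "\<bar>b\<bar> \<le> 1 * B" "\<bar>c\<bar> \<le> e" for a b c e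
        using that by linarith
      ultimately show ?thesis using b1 b3 unfolding distrib_right by blast
    qed
    ultimately have "\<bar>E n s\<bar> \<le> (12 + 2 * real ?d) * B / (R n)\<^sup>2"
      using R2 by (simp add: divide_right_mono)
    also have "\<dots> \<le> (12 + 2 * real ?d) * B * (2 / (1 + s))"
    proof -
      \<comment> \<open>only \<open>s < R\<^sup>2\<close> matters, where the cutoff does not vanish\<close>
      have "1 / (R n)\<^sup>2 \<le> 2 / (1 + s)" using s R2 by (simp add: divide_simps)
      from mult_left_mono[OF this, of "(12 + 2 * real ?d) * B"] B0 show ?thesis by simp
    qed
    also have "(12 + 2 * real ?d) * B * (2 / (1 + s)) = H * C * (24 + 4 * real ?d) * ((1 + s) powr (1 / 4) / (1 + s))"
      unfolding B_def by (simp add: algebra_simps)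
    also have "(1 + s) powr (1 / 4) / (1 + s) = decay_weight (x - y)"
      using s powr_diff[of "1 + s" "1/4" 1] by (simp add: decay_weight_def s_def t_def)
    finally show ?thesis by (simp add: s_def)
  qed
  have lapB: "\<bar>laplacian (\<eta> n) x\<bar> \<le> M * decay_weight (x - y)" for n x
  proof -
    have "\<bar>approx_identity \<delta> (x - y) * cutoff 0 (R n) (t x)\<bar> \<le> (C2 * decay_weight (x - y)) * H"
      unfolding abs_mult
    proof (intro mult_mono H)
      show "\<bar>approx_identity \<delta> (x - y)\<bar> \<le> C2 * decay_weight (x - y)"
        using C2[of "x - y"] approx_identity_nonneg[of \<delta> "x - y"] by simp
      then show "0 \<le> C2 * decay_weight (x - y)" by linarith
    qed (use t0 in auto)
    then show ?thesis using Ebound[of n x] unfolding lapE M_def by (simp add: algebra_simps)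
  qed
  have \<Phi>iy: "integrable lborel (\<lambda>x. \<Phi> x * decay_weight (x - y))"
  proof (rule Bochner_Integration.integrable_bound)
    show "integrable lborel (\<lambda>x. (2 * (1 + (norm y)\<^sup>2)) powr (3 / 4) * (\<Phi> x * decay_weight x))" using \<Phi>i by simp
    show "AE x in lborel. norm (\<Phi> x * decay_weight (x - y)) \<le> norm ((2 * (1 + (norm y)\<^sup>2)) powr (3 / 4) * (\<Phi> x * decay_weight x))"
    proof (rule AE_I2)
      fix x
      show "norm (\<Phi> x * decay_weight (x - y)) \<le> norm ((2 * (1 + (norm y)\<^sup>2)) powr (3 / 4) * (\<Phi> x * decay_weight x))"
        using mult_left_mono[OF decay_weight_shift[of x y] abs_ge_zero[of "\<Phi> x"]]
        by (simp add: abs_mult abs_of_pos[OF decay_weight_pos] mult_ac)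
    qed
  qed measurable
  have one: "exp 1 * bump_fn 0 1 = 1" by (simp add: bump_fn_0 exp_minus)
  have invR: "(\<lambda>n. inverse ((R n)\<^sup>2)) \<longlonglongrightarrow> 0"
    using tendsto_mult[OF LIMSEQ_inverse_real_of_nat LIMSEQ_inverse_real_of_nat] by (simp add: R_def power2_eq_square)
  have c_lim: "(\<lambda>n. cutoff i (R n) s) \<longlonglongrightarrow> exp 1 * bump_fn i 1" for i s unfolding R_def by (rule cutoff_tendsto)
  have lim0: "(\<lambda>n. cutoff 0 (R n) s) \<longlonglongrightarrow> 1" for s using c_lim[of 0 s] unfolding one .
  have limE: "(\<lambda>n. E n s) \<longlonglongrightarrow> 0" for s
  proof -
    have "(\<lambda>n. - 8 * (s * ?G1 s) * cutoff 1 (R n) s * inverse ((R n)\<^sup>2)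
        + 4 * (s * inverse ((R n)\<^sup>2)) * ?G s * cutoff 2 (R n) s * inverse ((R n)\<^sup>2)
        - 2 * real ?d * ?G s * cutoff 1 (R n) s * inverse ((R n)\<^sup>2)) \<longlonglongrightarrow>
        - 8 * (s * ?G1 s) * (exp 1 * bump_fn 1 1) * 0
        + 4 * (s * 0) * ?G s * (exp 1 * bump_fn 2 1) * 0
        - 2 * real ?d * ?G s * (exp 1 * bump_fn 1 1) * 0"
      by (intro tendsto_intros c_lim invR)
    then show ?thesis by (simp add: E_def divide_inverse)
  qed
  have lapm[measurable]: "laplacian (\<eta> n) \<in> borel_measurable borel" for n
  proof -
    have "Ck_on 0 UNIV (laplacian (\<eta> n))"
      unfolding laplacian_def[abs_def]
      by (intro Ck_on_sum open_UNIV Ck_on_partial[of 0] Ck_on_partial[of "Suc 0"] test_functionD(1)[OF \<eta>test])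
    then show ?thesis using borel_measurable_continuous_onI by simp
  qed
  have L: "(\<lambda>n. \<integral>x. \<Phi> x * laplacian (\<eta> n) x \<partial>lborel) \<longlonglongrightarrow> (\<integral>x. - (\<Phi> x * approx_identity \<delta> (x - y)) \<partial>lborel)"
  proof (rule integral_dominated_convergence[where w = "\<lambda>x. M * \<bar>\<Phi> x * decay_weight (x - y)\<bar>"])
    show "integrable lborel (\<lambda>x. M * \<bar>\<Phi> x * decay_weight (x - y)\<bar>)" using \<Phi>iy by simp
    have "(\<lambda>n. \<Phi> x * laplacian (\<eta> n) x) \<longlonglongrightarrow> \<Phi> x * (- approx_identity \<delta> (x - y) * 1 + 0)" for x
      unfolding lapE by (intro tendsto_intros lim0 limE)
    then show "AE x in lborel. (\<lambda>n. \<Phi> x * laplacian (\<eta> n) x) \<longlonglongrightarrow> - (\<Phi> x * approx_identity \<delta> (x - y))" by simp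
    show "AE x in lborel. norm (\<Phi> x * laplacian (\<eta> n) x) \<le> M * \<bar>\<Phi> x * decay_weight (x - y)\<bar>" for n
    proof (rule AE_I2)
      fix x show "norm (\<Phi> x * laplacian (\<eta> n) x) \<le> M * \<bar>\<Phi> x * decay_weight (x - y)\<bar>"
        using mult_left_mono[OF lapB[of n x] abs_ge_zero[of "\<Phi> x"]]
        by (simp add: abs_mult abs_of_pos[OF decay_weight_pos] mult_ac)
    qed
  qed measurable
  have Gb: "\<bar>f x * ?G (t x)\<bar> \<le> C * (1 + (\<bar>r\<bar> + norm y)\<^sup>2) powr (1/4) * \<bar>f x\<bar>" for x
  proof (cases "norm x > r")
    case False
    have "norm (x - y) \<le> \<bar>r\<bar> + norm y" using norm_triangle_ineq4[of x y] False by linarith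
    then have "t x \<le> (\<bar>r\<bar> + norm y)\<^sup>2" unfolding t_def by (rule power_mono) simp
    then have "(1 + t x) powr (1/4) \<le> (1 + (\<bar>r\<bar> + norm y)\<^sup>2) powr (1/4)" using t0[of x] by (intro powr_mono2) auto
    from mult_left_mono[OF this C(1)] C(2)[OF t0[of x]]
    have "\<bar>?G (t x)\<bar> \<le> C * (1 + (\<bar>r\<bar> + norm y)\<^sup>2) powr (1/4)" by linarith
    from mult_right_mono[OF this abs_ge_zero[of "f x"]] show ?thesis by (simp add: abs_mult mult.commute)
  qed (simp add: fr)
  have \<eta>m[measurable]: "\<eta> n \<in> borel_measurable borel" for n
    using smooth_on_imp_continuous[OF test_functionD(4)[OF \<eta>test]] by (rule borel_measurable_continuous_onI)
  have Rr: "(\<lambda>n. \<integral>x. f x * \<eta> n x \<partial>lborel) \<longlonglongrightarrow> (\<integral>x. f x * ?G (t x) \<partial>lborel)"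
  proof (rule integral_dominated_convergence[where w = "\<lambda>x. H * (C * (1 + (\<bar>r\<bar> + norm y)\<^sup>2) powr (1/4) * \<bar>f x\<bar>)"])
    show "integrable lborel (\<lambda>x. H * (C * (1 + (\<bar>r\<bar> + norm y)\<^sup>2) powr (1/4) * \<bar>f x\<bar>))" using fi by simp
    have "(\<lambda>n. f x * \<eta> n x) \<longlonglongrightarrow> f x * (?G (t x) * 1)" for x
      unfolding \<eta>_def K_def by (intro tendsto_intros lim0)
    then show "AE x in lborel. (\<lambda>n. f x * \<eta> n x) \<longlonglongrightarrow> f x * ?G (t x)" by simp
    show "AE x in lborel. norm (f x * \<eta> n x) \<le> H * (C * (1 + (\<bar>r\<bar> + norm y)\<^sup>2) powr (1/4) * \<bar>f x\<bar>)" for n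
    proof (rule AE_I2)
      fix x
      have "\<bar>cutoff 0 (R n) (t x)\<bar> * \<bar>f x * ?G (t x)\<bar> \<le> H * (C * (1 + (\<bar>r\<bar> + norm y)\<^sup>2) powr (1/4) * \<bar>f x\<bar>)"
        by (intro mult_mono H Gb t0) (use H(1) in auto)
      then show "norm (f x * \<eta> n x) \<le> H * (C * (1 + (\<bar>r\<bar> + norm y)\<^sup>2) powr (1/4) * \<bar>f x\<bar>)"
        by (simp add: \<eta>_def K_def abs_mult mult_ac)
    qed
  qed measurable
  have "(\<integral>x. - (\<Phi> x * approx_identity \<delta> (x - y)) \<partial>lborel) = (\<integral>x. f x * ?G (t x) \<partial>lborel)"
    using LIMSEQ_unique[OF L] Rr unfolding test[OF \<eta>test] by blast
  then show ?thesis by (simp add: t_def)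
qed

definition singular_weight :: "real ^ 'n::finite \<Rightarrow> real" where
  "singular_weight z = norm z powr (1 - real CARD('n)) + norm z + 1"

lemma singular_weight_measurable [measurable]: "singular_weight \<in> borel_measurable borel"
  unfolding singular_weight_def[abs_def] by measurable

lemma singular_weight_pos: "singular_weight z > 0"
proof -
  have "norm z powr (1 - real CARD('a)) \<ge> 0" "norm z \<ge> 0" by simp_all
  then show ?thesis unfolding singular_weight_def by linarith
qed

lemma decay_weight_lower: "norm x \<le> \<rho> \<Longrightarrow> (1 + \<rho>\<^sup>2) powr (- 3 / 4) \<le> decay_weight x"
  unfolding decay_weight_def
  by (rule powr_mono2') (auto intro: power_mono add_pos_nonneg)

lemma singular_weight_integrable:
  "integrable lborel (\<lambda>z :: real ^ 'n::finite. indicator (cball 0 \<rho>) z * singular_weight z)"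
proof -
  let ?c = "(1 + \<rho>\<^sup>2) powr (- 3 / 4)"
  have [measurable]: "cball 0 \<rho> \<in> sets (borel :: (real ^ 'n) measure)" by simp
  have c: "?c > 0" using zero_le_power2[of \<rho>] by (simp add: add_pos_nonneg less_imp_neq[symmetric])
  have 1: "integrable lborel (\<lambda>z :: real ^ 'n. indicator (cball 0 \<rho>) z * norm z powr (1 - real CARD('n)))"
  proof (rule Bochner_Integration.integrable_bound)
    show "integrable lborel (\<lambda>z :: real ^ 'n. (1 / ?c) * (norm z powr (1 - real CARD('n)) * decay_weight z))"
      using radial_weight_integrable by (rule integrable_mult_right)
    have "norm (indicator (cball 0 \<rho>) z * norm z powr (1 - real CARD('n)))
      \<le> norm ((1 / ?c) * (norm z powr (1 - real CARD('n)) * decay_weight z))" for z :: "real ^ 'n"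
    proof (cases "z \<in> cball 0 \<rho>")
      case True
      have "1 \<le> decay_weight z / ?c" using decay_weight_lower[of z \<rho>] True c by (simp add: le_divide_eq)
      from mult_left_mono[OF this, of "norm z powr (1 - real CARD('n))"]
      have "norm z powr (1 - real CARD('n)) \<le> (1 / ?c) * (norm z powr (1 - real CARD('n)) * decay_weight z)" by simp
      moreover have "0 \<le> norm z powr (1 - real CARD('n))" by simp
      ultimately show ?thesis using True by (simp only: indicator_simps mult_1 real_norm_def)
    qed simp
    then show "AE z in (lborel :: (real ^ 'n) measure). norm (indicator (cball 0 \<rho>) z * norm z powr (1 - real CARD('n)))
      \<le> norm ((1 / ?c) * (norm z powr (1 - real CARD('n)) * decay_weight z))" by (intro AE_I2)
  qed measurable
  have 2: "integrable lborel (\<lambda>z :: real ^ 'n. indicator (cball 0 \<rho>) z *\<^sub>R (norm z + 1))"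
    by (rule borel_integrable_compact) (auto intro!: continuous_intros)
  have "indicator (cball 0 \<rho>) z * singular_weight z = indicator (cball 0 \<rho>) z * norm z powr (1 - real CARD('n)) +
      indicator (cball 0 \<rho>) z *\<^sub>R (norm z + 1)" for z :: "real ^ 'n"
    by (simp add: singular_weight_def algebra_simps)
  then show ?thesis using Bochner_Integration.integrable_add[OF 1 2] by simp
qed

lemma AE_lborel_neq: "AE y in lborel. y \<noteq> (x :: 'a::euclidean_space)"
  using AE_lborel_singleton[of x] by simp

text \<open>A kernel bounded by \<open>|z|\<^bsup>1 - d\<^esup>\<close> near the origin is locally integrable, so Fubini's theorem applies
  to its convolution with a compactly supported integrable function. The bounds are uniform in the
  kernel, which is what the limit \<open>\<delta> \<rightarrow> 0\<close> of the regularised kernels needs.\<close>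

lemma weakly_singular_potential:
  fixes f K :: "real ^ 'n::finite \<Rightarrow> real"
  assumes [measurable]: "f \<in> borel_measurable borel" "K \<in> borel_measurable borel"
    and fi: "integrable lborel f" and fr: "\<And>x. norm x > r \<Longrightarrow> f x = 0"
    and C: "C \<ge> 0" "\<And>z. z \<noteq> 0 \<Longrightarrow> \<bar>K z\<bar> \<le> C * singular_weight z"
    and b0: "\<And>y. y \<in> box a b \<Longrightarrow> norm y \<le> b0"
  defines "M \<equiv> (\<integral>z. indicator (cball 0 (r + b0)) z * singular_weight (z :: real ^ 'n) \<partial>lborel)"
  shows "integrable (lborel \<Otimes>\<^sub>M lborel) (\<lambda>(x, y). f x * (indicator (box a b) y * K (x - y)))" (is ?A)
    and "norm x \<le> r \<Longrightarrow> integrable lborel (\<lambda>y. C * (indicator (box a b) y * singular_weight (x - y)))"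
    and "norm x \<le> r \<Longrightarrow> \<bar>\<integral>y. indicator (box a b) y * K (x - y) \<partial>lborel\<bar> \<le> C * M"
proof -
  define v where "v z = indicator (cball 0 (r + b0)) z * singular_weight z" for z :: "real ^ 'n"
  have [measurable]: "cball 0 (r + b0) \<in> sets (borel :: (real ^ 'n) measure)" by simp
  have [measurable]: "v \<in> borel_measurable borel" unfolding v_def[abs_def] by measurable
  have vi: "integrable lborel v" unfolding v_def by (rule singular_weight_integrable)
  have vx: "integrable lborel (\<lambda>y. v (x - y))" "(\<integral>y. v (x - y) \<partial>lborel) = M" for x
    using integrable_lborel_affine[of v "-1" x] integral_lborel_affine[of v "-1" x] vi by (simp_all add: M_def v_def)
  have le: "indicator (box a b) y * singular_weight (x - y) \<le> v (x - y)" if "norm x \<le> r" for x y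
  proof (cases "y \<in> box a b")
    case True
    have "norm (x - y) \<le> r + b0" using norm_triangle_ineq4[of x y] b0[OF True] that by linarith
    then show ?thesis using True by (simp add: v_def)
  qed (simp add: v_def less_imp_le[OF singular_weight_pos])
  show si: "integrable lborel (\<lambda>y. C * (indicator (box a b) y * singular_weight (x - y)))" if "norm x \<le> r" for x
  proof (rule integrable_mult_right, rule Bochner_Integration.integrable_bound[OF vx(1)])
    show "AE y in lborel. norm (indicator (box a b) y * singular_weight (x - y)) \<le> norm (v (x - y))"
    proof (rule AE_I2)
      fix y
      have "0 \<le> indicator (box a b) y * singular_weight (x - y)"
        by (intro mult_nonneg_nonneg less_imp_le[OF singular_weight_pos]) simp
      then show "norm (indicator (box a b) y * singular_weight (x - y)) \<le> norm (v (x - y))"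
        using le[OF that, of y] unfolding real_norm_def by linarith
    qed
  qed measurable
  have Kle: "AE y in lborel. \<bar>indicator (box a b) y * K (x - y)\<bar> \<le> C * (indicator (box a b) y * singular_weight (x - y))" for x
    using AE_lborel_neq[of x]
  proof eventually_elim
    case (elim y)
    then show ?case using C(2)[of "x - y"] by (auto simp: indicator_def)
  qed
  have Ki: "integrable lborel (\<lambda>y. indicator (box a b) y * K (x - y))" if "norm x \<le> r" for x
  proof (rule Bochner_Integration.integrable_bound[OF si[OF that]])
    show "AE y in lborel. norm (indicator (box a b) y * K (x - y)) \<le> norm (C * (indicator (box a b) y * singular_weight (x - y)))"
      using Kle[of x] by eventually_elim simp
  qed measurable
  have absb: "(\<integral>y. \<bar>indicator (box a b) y * K (x - y)\<bar> \<partial>lborel) \<le> C * M" if "norm x \<le> r" for x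
  proof -
    have "(\<integral>y. \<bar>indicator (box a b) y * K (x - y)\<bar> \<partial>lborel) \<le> (\<integral>y. C * v (x - y) \<partial>lborel)"
    proof (rule integral_mono_AE)
      show "AE y in lborel. \<bar>indicator (box a b) y * K (x - y)\<bar> \<le> C * v (x - y)"
        using Kle[of x]
      proof eventually_elim
        case (elim y)
        then show ?case using mult_left_mono[OF le[OF that, of y] C(1)] by linarith
      qed
    qed (use Ki[OF that] vx in auto)
    then show ?thesis using vx by simp
  qed
  show "\<bar>\<integral>y. indicator (box a b) y * K (x - y) \<partial>lborel\<bar> \<le> C * M" if "norm x \<le> r" for x
    using integral_abs_bound[of lborel "\<lambda>y. indicator (box a b) y * K (x - y)"] absb[OF that] by linarith
  show ?A
  proof (rule lborel_pair.Fubini_integrable)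
    show "(\<lambda>(x, y). f x * (indicator (box a b) y * K (x - y))) \<in> borel_measurable (lborel \<Otimes>\<^sub>M lborel)"
      by measurable
    show "AE x in lborel. integrable lborel (\<lambda>y. case (x, y) of (x, y) \<Rightarrow> f x * (indicator (box a b) y * K (x - y)))"
    proof (rule AE_I2)
      fix x show "integrable lborel (\<lambda>y. case (x, y) of (x, y) \<Rightarrow> f x * (indicator (box a b) y * K (x - y)))"
        using Ki[of x] fr[of x] by (cases "norm x \<le> r") auto
    qed
    show "integrable lborel (\<lambda>x. \<integral>y. norm (case (x, y) of (x, y) \<Rightarrow> f x * (indicator (box a b) y * K (x - y))) \<partial>lborel)"
    proof (rule Bochner_Integration.integrable_bound)
      show "integrable lborel (\<lambda>x. C * M * f x)" using fi by simp
      show "AE x in lborel. norm (\<integral>y. norm (case (x, y) of (x, y) \<Rightarrow> f x * (indicator (box a b) y * K (x - y))) \<partial>lborel) \<le> norm (C * M * f x)"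
      proof (rule AE_I2)
        fix x
        have nn: "(\<integral>y. \<bar>indicator (box a b) y * K (x - y)\<bar> \<partial>lborel) \<ge> 0" by simp
        have "(\<integral>y. norm (case (x, y) of (x, y) \<Rightarrow> f x * (indicator (box a b) y * K (x - y))) \<partial>lborel) =
           \<bar>f x\<bar> * (\<integral>y. \<bar>indicator (box a b) y * K (x - y)\<bar> \<partial>lborel)"
          by (simp add: abs_mult)
        also have "norm \<dots> \<le> norm (C * M * f x)"
        proof (cases "norm x \<le> r")
          case True
          have "\<bar>f x\<bar> * (\<integral>y. \<bar>indicator (box a b) y * K (x - y)\<bar> \<partial>lborel) \<le> \<bar>f x\<bar> * \<bar>C * M\<bar>"
            using absb[OF True] by (intro mult_left_mono) auto
          then show ?thesis using nn by (simp add: abs_mult mult_ac)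
        qed (simp add: fr)
        finally show "norm (\<integral>y. norm (case (x, y) of (x, y) \<Rightarrow> f x * (indicator (box a b) y * K (x - y))) \<partial>lborel) \<le> norm (C * M * f x)" .
      qed
    qed measurable
  qed
qed

lemma approx_identity_integral_box:
  fixes x :: "real ^ 'n::finite"
  assumes "\<delta> > 0"
  shows "(\<integral>y. indicator (box a b) y * approx_identity \<delta> (x - y) \<partial>lborel) =
    (\<integral>z. indicator (box a b) (x - \<delta> *\<^sub>R z) * approx_identity 1 z \<partial>lborel)"
proof -
  have "(\<integral>y. indicator (box a b) y * approx_identity \<delta> (x - y) \<partial>lborel) =
    \<delta> ^ CARD('n) * (\<integral>z. indicator (box a b) (x - \<delta> *\<^sub>R z) * approx_identity \<delta> (\<delta> *\<^sub>R z) \<partial>lborel)"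
    using integral_lborel_affine[of "\<lambda>y. indicator (box a b) y * approx_identity \<delta> (x - y)" "- \<delta>" x] assms by simp
  also have "\<dots> = (\<integral>z. indicator (box a b) (x - \<delta> *\<^sub>R z) * (\<delta> ^ CARD('n) * approx_identity \<delta> (\<delta> *\<^sub>R z)) \<partial>lborel)"
    by (simp add: mult_ac flip: integral_mult_right_zero)
  finally show ?thesis by (simp only: approx_identity_scale[OF assms])
qed

lemma approx_identity_integrable_1: "integrable lborel (approx_identity 1 :: real ^ 'n::finite \<Rightarrow> real)"
  and approx_identity_integral_1: "(\<integral>z. approx_identity 1 (z :: real ^ 'n::finite) \<partial>lborel) = 1"
proof -
  show "integrable lborel (approx_identity 1 :: real ^ 'n::finite \<Rightarrow> real)"
    by (rule integrableI_nonneg) (auto simp: approx_identity_nonneg approx_identity_nn_integral_1)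
  show "(\<integral>z. approx_identity 1 (z :: real ^ 'n::finite) \<partial>lborel) = 1"
    by (subst integral_eq_nn_integral) (auto simp: approx_identity_nonneg approx_identity_nn_integral_1)
qed

lemma approx_identity_box_le_1:
  fixes x :: "real ^ 'n::finite"
  assumes "\<delta> > 0"
  shows "(\<integral>y. indicator (box a b) y * approx_identity \<delta> (x - y) \<partial>lborel) \<le> 1"
proof -
  have "(\<integral>z. indicator (box a b) (x - \<delta> *\<^sub>R z) * approx_identity 1 z \<partial>lborel) \<le> (\<integral>z. approx_identity 1 (z :: real ^ 'n) \<partial>lborel)"
  proof (rule integral_mono)
    show "integrable lborel (\<lambda>z. indicator (box a b) (x - \<delta> *\<^sub>R z) * approx_identity 1 z)"
      by (rule Bochner_Integration.integrable_bound[OF approx_identity_integrable_1])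
        (measurable, auto simp: indicator_def)
    show "integrable lborel (approx_identity 1 :: real ^ 'n \<Rightarrow> real)" by (rule approx_identity_integrable_1)
  qed (auto simp: indicator_def approx_identity_nonneg)
  then show ?thesis unfolding approx_identity_integral_box[OF assms] approx_identity_integral_1 .
qed

lemma approx_identity_box_tendsto:
  fixes x :: "real ^ 'n::finite"
  assumes x: "x \<notin> frontier (box a b)" and \<delta>: "\<And>n. \<delta> n > 0" "\<delta> \<longlonglongrightarrow> 0"
  shows "(\<lambda>n. \<integral>y. indicator (box a b) y * approx_identity (\<delta> n) (x - y) \<partial>lborel) \<longlonglongrightarrow> indicator (box a b) x"
proof -
  have lim: "(\<lambda>n. indicator (box a b) (x - \<delta> n *\<^sub>R z)) \<longlonglongrightarrow> (indicator (box a b) x :: real)" for z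
  proof -
    have s: "(\<lambda>n. x - \<delta> n *\<^sub>R z) \<longlonglongrightarrow> x - 0 *\<^sub>R z" by (intro tendsto_intros \<delta>)
    show ?thesis
    proof (cases "x \<in> box a b")
      case True
      have "\<forall>\<^sub>F n in sequentially. x - \<delta> n *\<^sub>R z \<in> box a b"
        by (rule topological_tendstoD[OF s]) (use True in auto)
      then have "\<forall>\<^sub>F n in sequentially. indicator (box a b) x = (indicator (box a b) (x - \<delta> n *\<^sub>R z) :: real)"
        by eventually_elim (use True in simp)
      then show ?thesis by (rule Lim_transform_eventually[OF tendsto_const])
    next
      case False
      then have out: "x \<in> - closure (box a b)" using x by (simp add: frontier_def interior_open[OF open_box])
      have "\<forall>\<^sub>F n in sequentially. x - \<delta> n *\<^sub>R z \<in> - closure (box a b)"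
        by (rule topological_tendstoD[OF s]) (use out in \<open>simp_all add: open_Compl\<close>)
      then have "\<forall>\<^sub>F n in sequentially. indicator (box a b) x = (indicator (box a b) (x - \<delta> n *\<^sub>R z) :: real)"
      proof eventually_elim
        case (elim n)
        then have "x - \<delta> n *\<^sub>R z \<notin> box a b" using closure_subset by blast
        then show ?case using False by simp
      qed
      then show ?thesis by (rule Lim_transform_eventually[OF tendsto_const])
    qed
  qed
  have "(\<lambda>n. \<integral>z. indicator (box a b) (x - \<delta> n *\<^sub>R z) * approx_identity 1 z \<partial>lborel) \<longlonglongrightarrow>
     (\<integral>z. indicator (box a b) x * approx_identity 1 (z :: real ^ 'n) \<partial>lborel)"
  proof (rule integral_dominated_convergence[OF _ _ approx_identity_integrable_1])
    show "AE z in lborel. (\<lambda>n. indicator (box a b) (x - \<delta> n *\<^sub>R z) * approx_identity 1 z) \<longlonglongrightarrow> indicator (box a b) x * approx_identity 1 z"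
      by (intro AE_I2 tendsto_intros lim)
    show "AE z in lborel. norm (indicator (box a b) (x - \<delta> n *\<^sub>R z) * approx_identity 1 z) \<le> approx_identity 1 z" for n
      by (intro AE_I2) (auto simp: indicator_def approx_identity_nonneg)
  qed measurable
  then show ?thesis
    unfolding approx_identity_integral_box[OF \<delta>(1)] by (simp add: approx_identity_integral_1)
qed

text \<open>Near the box the bound is the total mass \<open>1\<close>; away from it \<open>|x - y|\<close> is bounded below, and the
  tail of the approximate identity is bounded by the decay weight uniformly in \<open>\<delta>\<close>.\<close>

lemma approx_identity_box_le_decay_weight:
  assumes b0: "b0 \<ge> 0" "\<And>y. y \<in> box a b \<Longrightarrow> norm (y :: real ^ 'n::finite) \<le> b0"
  shows "\<exists>C. \<forall>\<delta> x. 0 < \<delta> \<and> \<delta> \<le> 1 \<longrightarrow> (\<integral>y. indicator (box a b) y * approx_identity \<delta> (x - y) \<partial>lborel) \<le> C * decay_weight x"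
proof -
  let ?e = "- real CARD('n) / 2 - 1"
  let ?c = "(1 + (b0 + 1)\<^sup>2) powr (- 3 / 4)"
  have c: "?c > 0" using zero_le_power2[of "b0 + 1"] by (simp add: add_pos_nonneg less_imp_neq[symmetric])
  define C1 where "C1 = 1 / unit_ball_vol (real CARD('n)) * (1 / 2) powr ?e"
  have C1: "C1 \<ge> 0" by (simp add: C1_def)
  define C2 where "C2 = C1 * (2 * (1 + b0\<^sup>2)) powr (3 / 4) * measure lborel (box a b)"
  have C2: "C2 \<ge> 0" using C1 by (simp add: C2_def)
  have "(\<integral>y. indicator (box a b) y * approx_identity \<delta> (x - y) \<partial>lborel) \<le> (1 / ?c + C2) * decay_weight x"
    if \<delta>: "0 < \<delta>" "\<delta> \<le> 1" for \<delta> x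
  proof (cases "norm x \<le> b0 + 1")
    case True
    have "1 \<le> 1 / ?c * decay_weight x" using decay_weight_lower[OF True] c by (simp add: le_divide_eq)
    moreover have "0 \<le> C2 * decay_weight x" using C2 less_imp_le[OF decay_weight_pos[of x]] by (rule mult_nonneg_nonneg)
    ultimately show ?thesis using approx_identity_box_le_1[OF \<delta>(1), of a b x] unfolding distrib_right by linarith
  next
    case False
    have bd: "indicator (box a b) y * approx_identity \<delta> (x - y) \<le> indicator (box a b) y * (C1 * (2 * (1 + b0\<^sup>2)) powr (3 / 4) * decay_weight x)" for y
    proof (cases "y \<in> box a b")
      case True
      define z where "z = x - y"
      have "norm x \<le> norm z + norm y" using norm_triangle_ineq[of z y] by (simp add: z_def)
      then have z1: "norm z \<ge> 1" using False b0(2)[OF True] by linarith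
      then have z2: "(norm z)\<^sup>2 \<ge> 1" by simp
      have "((norm z)\<^sup>2 + \<delta>\<^sup>2) powr ?e \<le> (1 / 2 * (1 + (norm z)\<^sup>2)) powr ?e"
      proof (rule powr_mono2')
        have *: "1 / 2 * (1 + A) \<le> A + D" "0 < 1 / 2 * (1 + A)" if "1 \<le> A" "0 \<le> D" for A D :: real
          using that by (auto simp: field_simps)
        show "1 / 2 * (1 + (norm z)\<^sup>2) \<le> (norm z)\<^sup>2 + \<delta>\<^sup>2" "0 < 1 / 2 * (1 + (norm z)\<^sup>2)"
          using *[OF z2 zero_le_power2[of \<delta>]] by blast+
      qed simp
      also have "\<dots> = (1 / 2) powr ?e * (1 + (norm z)\<^sup>2) powr ?e" by (rule powr_mult)
      also have "\<dots> \<le> (1 / 2) powr ?e * decay_weight z"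
        unfolding decay_weight_def by (intro mult_left_mono powr_mono) auto
      finally have p: "((norm z)\<^sup>2 + \<delta>\<^sup>2) powr ?e \<le> (1 / 2) powr ?e * decay_weight z" .
      have "\<delta>\<^sup>2 / unit_ball_vol (real CARD('n)) \<le> 1 / unit_ball_vol (real CARD('n))"
        using \<delta> by (intro divide_right_mono power_le_one) auto
      from mult_mono[OF this p] have "approx_identity \<delta> z \<le> C1 * decay_weight z"
        by (simp add: approx_identity_def C1_def)
      also have "\<dots> \<le> C1 * ((2 * (1 + (norm y)\<^sup>2)) powr (3 / 4) * decay_weight x)"
        unfolding z_def by (intro mult_left_mono decay_weight_shift C1)
      also have "\<dots> \<le> C1 * ((2 * (1 + b0\<^sup>2)) powr (3 / 4) * decay_weight x)"
        using b0(2)[OF True] less_imp_le[OF decay_weight_pos[of x]]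
        by (intro mult_left_mono mult_right_mono powr_mono2 C1) (auto intro: power_mono)
      finally show ?thesis using True by (simp add: z_def mult.assoc)
    qed simp
    have fin: "emeasure lborel (box a b) < \<infinity>" by (rule emeasure_bounded_finite) (rule bounded_box)
    have "(\<integral>y. indicator (box a b) y * approx_identity \<delta> (x - y) \<partial>lborel) \<le>
      (\<integral>y. indicator (box a b) y * (C1 * (2 * (1 + b0\<^sup>2)) powr (3 / 4) * decay_weight x) \<partial>lborel)"
    proof (rule integral_mono)
      show i: "integrable lborel (\<lambda>y. indicator (box a b) y * (C1 * (2 * (1 + b0\<^sup>2)) powr (3 / 4) * decay_weight x))"
        using fin by (intro integrable_mult_left integrable_real_indicator) auto
      show "integrable lborel (\<lambda>y. indicator (box a b) y * approx_identity \<delta> (x - y))"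
      proof (rule Bochner_Integration.integrable_bound[OF i])
        show "AE y in lborel. norm (indicator (box a b) y * approx_identity \<delta> (x - y)) \<le>
          norm (indicator (box a b) y * (C1 * (2 * (1 + b0\<^sup>2)) powr (3 / 4) * decay_weight x))"
        proof (rule AE_I2)
          fix y
          have "0 \<le> indicator (box a b) y * approx_identity \<delta> (x - y)" by (simp add: approx_identity_nonneg)
          then show "norm (indicator (box a b) y * approx_identity \<delta> (x - y)) \<le>
            norm (indicator (box a b) y * (C1 * (2 * (1 + b0\<^sup>2)) powr (3 / 4) * decay_weight x))"
            using bd[of y] unfolding real_norm_def by linarith
        qed
      qed measurable
    qed (rule bd)
    also have "\<dots> = C2 * decay_weight x" by (simp add: C2_def mult_ac)
    also have "\<dots> \<le> (1 / ?c + C2) * decay_weight x"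
      using c less_imp_le[OF decay_weight_pos[of x]] by (intro mult_right_mono) auto
    finally show ?thesis .
  qed
  then show ?thesis by blast
qed

lemma convolution_decay_integrable:
  fixes \<Phi> :: "real ^ 'n::finite \<Rightarrow> real"
  assumes [measurable]: "\<Phi> \<in> borel_measurable borel" and \<Phi>i: "integrable lborel (\<lambda>x. \<Phi> x * decay_weight x)"
    and \<delta>: "0 < \<delta>" and C: "\<And>x. (\<integral>y. indicator (box a b) y * approx_identity \<delta> (x - y) \<partial>lborel) \<le> C * decay_weight x"
  shows "integrable (lborel \<Otimes>\<^sub>M lborel) (\<lambda>(x, y). \<Phi> x * (indicator (box a b) y * approx_identity \<delta> (x - y)))"
proof (rule lborel_pair.Fubini_integrable)
  show "(\<lambda>(x, y). \<Phi> x * (indicator (box a b) y * approx_identity \<delta> (x - y))) \<in> borel_measurable (lborel \<Otimes>\<^sub>M lborel)"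
    by measurable
  have nn: "0 \<le> indicator (box a b) y * approx_identity \<delta> (x - y)" for x y by (simp add: approx_identity_nonneg)
  show "AE x in lborel. integrable lborel (\<lambda>y. case (x, y) of (x, y) \<Rightarrow> \<Phi> x * (indicator (box a b) y * approx_identity \<delta> (x - y)))"
  proof (rule AE_I2)
    fix x
    obtain C2 where C2: "\<And>z :: real^'n. approx_identity \<delta> z \<le> C2 * decay_weight z"
      using approx_identity_le_decay_weight[OF \<delta>] by blast
    have "approx_identity \<delta> z \<le> \<bar>C2\<bar>" for z :: "real ^ 'n"
    proof -
      have "C2 * decay_weight z \<le> \<bar>C2\<bar> * 1"
        using decay_weight_le_1[of z] decay_weight_pos[of z] by (intro mult_mono) auto
      then show ?thesis using C2[of z] by linarith
    qed
    then have b: "norm (indicator (box a b) y * approx_identity \<delta> (x - y)) \<le> norm (indicator (box a b) y * \<bar>C2\<bar>)" for y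
      by (auto simp: indicator_def approx_identity_nonneg)
    have fin: "emeasure lborel (box a b) < \<infinity>" by (rule emeasure_bounded_finite) (rule bounded_box)
    have "integrable lborel (\<lambda>y. indicator (box a b) y * approx_identity \<delta> (x - y))"
    proof (rule Bochner_Integration.integrable_bound)
      show "integrable lborel (\<lambda>y. indicator (box a b) y * \<bar>C2\<bar>)"
        using fin by (intro integrable_mult_left integrable_real_indicator) auto
      show "AE y in lborel. norm (indicator (box a b) y * approx_identity \<delta> (x - y)) \<le> norm (indicator (box a b) y * \<bar>C2\<bar>)"
        by (intro AE_I2 b)
    qed measurable
    then show "integrable lborel (\<lambda>y. case (x, y) of (x, y) \<Rightarrow> \<Phi> x * (indicator (box a b) y * approx_identity \<delta> (x - y)))"
      by simp
  qed
  show "integrable lborel (\<lambda>x. \<integral>y. norm (case (x, y) of (x, y) \<Rightarrow> \<Phi> x * (indicator (box a b) y * approx_identity \<delta> (x - y))) \<partial>lborel)"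
  proof (rule Bochner_Integration.integrable_bound)
    show "integrable lborel (\<lambda>x. C * (\<Phi> x * decay_weight x))" using \<Phi>i by simp
    show "AE x in lborel. norm (\<integral>y. norm (case (x, y) of (x, y) \<Rightarrow> \<Phi> x * (indicator (box a b) y * approx_identity \<delta> (x - y))) \<partial>lborel)
       \<le> norm (C * (\<Phi> x * decay_weight x))"
    proof (rule AE_I2)
      fix x
      have "(\<integral>y. norm (case (x, y) of (x, y) \<Rightarrow> \<Phi> x * (indicator (box a b) y * approx_identity \<delta> (x - y))) \<partial>lborel)
        = \<bar>\<Phi> x\<bar> * (\<integral>y. indicator (box a b) y * approx_identity \<delta> (x - y) \<partial>lborel)"
        by (simp add: abs_mult abs_of_nonneg[OF approx_identity_nonneg])
      moreover have "\<bar>\<Phi> x\<bar> * (\<integral>y. indicator (box a b) y * approx_identity \<delta> (x - y) \<partial>lborel) \<le> \<bar>\<Phi> x\<bar> * (C * decay_weight x)"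
        by (intro mult_left_mono C) simp
      moreover have "0 \<le> \<bar>\<Phi> x\<bar> * (\<integral>y. indicator (box a b) y * approx_identity \<delta> (x - y) \<partial>lborel)"
        using nn by (intro mult_nonneg_nonneg integral_nonneg_AE) auto
      moreover have "\<bar>\<Phi> x\<bar> * (C * decay_weight x) \<le> norm (C * (\<Phi> x * decay_weight x))"
        using mult_left_mono[OF abs_ge_self[of C], of "\<bar>\<Phi> x\<bar> * decay_weight x"] decay_weight_pos[of x]
        by (simp add: abs_mult mult_ac)
      ultimately show "norm (\<integral>y. norm (case (x, y) of (x, y) \<Rightarrow> \<Phi> x * (indicator (box a b) y * approx_identity \<delta> (x - y))) \<partial>lborel)
       \<le> norm (C * (\<Phi> x * decay_weight x))"
        by simp
    qed
  qed measurable
qed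

lemma fundamental_solution_measurable [measurable]:
  "fundamental_solution \<in> borel_measurable (borel :: (real ^ 'n::finite) measure)"
  unfolding fundamental_solution_def[abs_def] by (cases "CARD('n) = 2") simp_all

lemma newton_kernel_measurable [measurable]:
  "(\<lambda>z :: real ^ 'n::finite. newton_kernel d \<delta> ((norm z)\<^sup>2)) \<in> borel_measurable borel"
  unfolding newton_kernel_def[abs_def] by (cases "d = 2") simp_all

lemma newton_kernel_tendsto:
  assumes t: "t > 0" and \<delta>: "\<delta> \<longlonglongrightarrow> 0"
  shows "(\<lambda>n. newton_kernel d (\<delta> n) t) \<longlonglongrightarrow> newton_kernel d 0 t"
proof -
  have l: "(\<lambda>n. t + (\<delta> n)\<^sup>2) \<longlonglongrightarrow> t + 0\<^sup>2" by (intro tendsto_intros \<delta>)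
  show ?thesis
  proof (cases "d = 2")
    case True
    have "(\<lambda>n. - ln (t + (\<delta> n)\<^sup>2) / (4 * pi)) \<longlonglongrightarrow> - ln (t + 0\<^sup>2) / (4 * pi)"
      by (intro tendsto_intros l) (use t in auto)
    then show ?thesis using True by (simp add: newton_kernel_def)
  next
    case False
    define c where "c = (real d - 2) * (real d * unit_ball_vol (real d))"
    have "(\<lambda>n. (t + (\<delta> n)\<^sup>2) powr ((2 - real d) / 2) * inverse c) \<longlonglongrightarrow> (t + 0\<^sup>2) powr ((2 - real d) / 2) * inverse c"
      by (intro tendsto_mult tendsto_powr tendsto_const l) (use t in auto)
    moreover have "newton_kernel d s t = (t + s\<^sup>2) powr ((2 - real d) / 2) * inverse c" for s
      unfolding newton_kernel_def c_def[symmetric] if_not_P[OF False] by (rule divide_inverse)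
    ultimately show ?thesis by (simp only:)
  qed
qed

lemma fundamental_solution_bound:
  assumes "2 \<le> CARD('n::finite)"
  obtains C where "C \<ge> 0" "\<And>z :: real ^ 'n. z \<noteq> 0 \<Longrightarrow> \<bar>fundamental_solution z\<bar> \<le> C * singular_weight z"
    "\<And>(z :: real ^ 'n) \<delta>. z \<noteq> 0 \<Longrightarrow> 0 \<le> \<delta> \<Longrightarrow> \<delta> \<le> 1 \<Longrightarrow> \<bar>newton_kernel CARD('n) \<delta> ((norm z)\<^sup>2)\<bar> \<le> C * singular_weight z"
proof -
  obtain C where C: "C \<ge> 0" "\<forall>\<delta> s. 0 \<le> \<delta> \<and> \<delta> \<le> 1 \<and> s > 0 \<longrightarrow> \<bar>newton_kernel CARD('n) \<delta> (s\<^sup>2)\<bar> \<le> C * (s powr (1 - real CARD('n)) + s + 1)"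
    using newton_kernel_bound[OF assms] by blast
  have *: "\<bar>newton_kernel CARD('n) \<delta> ((norm z)\<^sup>2)\<bar> \<le> C * singular_weight z" if "z \<noteq> 0" "0 \<le> \<delta>" "\<delta> \<le> 1" for z :: "real ^ 'n" and \<delta>
  proof -
    have "norm z > 0" using that(1) by simp
    with C(2) that(2,3) show ?thesis unfolding singular_weight_def add.assoc[symmetric] by blast
  qed
  have "\<bar>fundamental_solution z\<bar> \<le> C * singular_weight z" if "z \<noteq> 0" for z :: "real ^ 'n"
    using *[OF that, of 0] unfolding newton_kernel_0[OF that] by simp
  from that[OF C(1) this *] show ?thesis by blast
qed

text \<open>A function that decays at infinity and whose distributional Laplacian \<open>f\<close> has compact support
  is the Newtonian potential of \<open>- f\<close>: the regularised identities are integrated over a box, where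
  both sides converge.\<close>

lemma newtonian_potential_box:
  fixes \<Phi> f :: "real ^ 'n::finite \<Rightarrow> real"
  assumes d: "2 \<le> CARD('n)" and \<Phi>[measurable]: "\<Phi> \<in> borel_measurable borel" and f[measurable]: "f \<in> borel_measurable borel"
    and \<Phi>i: "integrable lborel (\<lambda>x. \<Phi> x * decay_weight x)" and fi: "integrable lborel f"
    and fr: "\<And>x. norm x > r \<Longrightarrow> f x = 0"
    and test: "\<And>\<eta>. test_function UNIV \<eta> \<Longrightarrow> (\<integral>x. \<Phi> x * laplacian \<eta> x \<partial>lborel) = (\<integral>x. f x * \<eta> x \<partial>lborel)"
  shows "(\<integral>y. indicator (box a b) y * \<Phi> y \<partial>lborel) =
      - (\<integral>y. indicator (box a b) y * (\<integral>x. f x * fundamental_solution (x - y) \<partial>lborel) \<partial>lborel)"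
    and "integrable lborel (\<lambda>y. indicator (box a b) y * (\<integral>x. f x * fundamental_solution (x - y) \<partial>lborel))"
    and "integrable lborel (\<lambda>y. indicator (box a b) y * \<Phi> y)"
    and "AE y in lborel. y \<in> box a b \<longrightarrow> integrable lborel (\<lambda>x. f x * fundamental_solution (x - y))"
proof -
  let ?\<Gamma> = "fundamental_solution :: real ^ 'n \<Rightarrow> real"
  obtain b1 where b1: "b1 > 0" "\<And>y. y \<in> box a b \<Longrightarrow> norm y \<le> b1"
    using bounded_box[of a b] unfolding bounded_pos by blast
  obtain C where C: "C \<ge> 0" "\<And>z :: real ^ 'n. z \<noteq> 0 \<Longrightarrow> \<bar>?\<Gamma> z\<bar> \<le> C * singular_weight z"
    "\<And>(z :: real ^ 'n) \<delta>. z \<noteq> 0 \<Longrightarrow> 0 \<le> \<delta> \<Longrightarrow> \<delta> \<le> 1 \<Longrightarrow> \<bar>newton_kernel CARD('n) \<delta> ((norm z)\<^sup>2)\<bar> \<le> C * singular_weight z"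
    using fundamental_solution_bound[OF d] by blast
  obtain C3 where C3: "\<And>\<delta> x. 0 < \<delta> \<Longrightarrow> \<delta> \<le> 1 \<Longrightarrow> (\<integral>y. indicator (box a b) y * approx_identity \<delta> (x - y) \<partial>lborel) \<le> C3 * decay_weight x"
    using approx_identity_box_le_decay_weight[OF less_imp_le[OF b1(1)] b1(2)] by blast
  define \<delta> where "\<delta> n = inverse (real (Suc n))" for n
  have \<delta>: "0 < \<delta> n" "\<delta> n \<le> 1" "0 \<le> \<delta> n" for n by (simp_all add: \<delta>_def inverse_le_1_iff del: of_nat_Suc)
  have \<delta>0: "\<delta> \<longlonglongrightarrow> 0" unfolding \<delta>_def[abs_def] by (rule LIMSEQ_inverse_real_of_nat)
  let ?G = "\<lambda>n z. newton_kernel CARD('n) (\<delta> n) ((norm (z :: real ^ 'n))\<^sup>2)"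
  define M where "M = (\<integral>z. indicator (cball 0 (r + b1)) z * singular_weight (z :: real ^ 'n) \<partial>lborel)"
  have wsp: "integrable (lborel \<Otimes>\<^sub>M lborel) (\<lambda>(x, y). f x * (indicator (box a b) y * K (x - y)))"
    "norm x \<le> r \<Longrightarrow> integrable lborel (\<lambda>y. C * (indicator (box a b) y * singular_weight (x - y)))"
    "norm x \<le> r \<Longrightarrow> \<bar>\<integral>y. indicator (box a b) y * K (x - y) \<partial>lborel\<bar> \<le> C * M"
    if K: "K \<in> borel_measurable borel" "\<And>z. z \<noteq> 0 \<Longrightarrow> \<bar>K z\<bar> \<le> C * singular_weight z" for K :: "real ^ 'n \<Rightarrow> real" and x
  proof -
    note * = weakly_singular_potential[OF f K(1) fi _ C(1) _]
    show "integrable (lborel \<Otimes>\<^sub>M lborel) (\<lambda>(x, y). f x * (indicator (box a b) y * K (x - y)))"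
      by (rule *(1)) (fact fr, fact K(2), fact b1(2))
    show "integrable lborel (\<lambda>y. C * (indicator (box a b) y * singular_weight (x - y)))" if "norm x \<le> r"
      by (rule *(2)[OF _ _ _ that]) (fact fr, fact K(2), fact b1(2))
    show "\<bar>\<integral>y. indicator (box a b) y * K (x - y) \<partial>lborel\<bar> \<le> C * M" if "norm x \<le> r"
      unfolding M_def by (rule *(3)[OF _ _ _ that]) (fact fr, fact K(2), fact b1(2))
  qed
  have GK: "?G n \<in> borel_measurable borel" "z \<noteq> 0 \<Longrightarrow> \<bar>?G n z\<bar> \<le> C * singular_weight z" for n z
    by (rule newton_kernel_measurable) (rule C(3)[OF _ \<delta>(3) \<delta>(2)])
  note wG = wsp[OF GK]
  note w\<Gamma> = wsp[OF fundamental_solution_measurable C(2)]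
  have reg: "(\<integral>x. \<Phi> x * approx_identity (\<delta> n) (x - y) \<partial>lborel) = - (\<integral>x. f x * ?G n (x - y) \<partial>lborel)" for n y
    by (rule regularised_identity[OF d \<Phi> f \<Phi>i fi _ _ \<delta>(1)]) (fact fr, fact test)
  define P where "P n x = (\<integral>y. indicator (box a b) y * approx_identity (\<delta> n) (x - y) \<partial>lborel)" for n and x :: "real ^ 'n"
  have P0: "0 \<le> P n x" for n x unfolding P_def by (intro integral_nonneg_AE) (simp add: approx_identity_nonneg)
  have [measurable]: "P n \<in> borel_measurable lborel" for n unfolding P_def[abs_def] by measurable
  \<comment> \<open>Fubini moves the box to the approximate identity, where it becomes a mollified indicator
    function, and dominated convergence applies with the decay weight\<close>
  have lhs: "(\<integral>y. indicator (box a b) y * (\<integral>x. \<Phi> x * approx_identity (\<delta> n) (x - y) \<partial>lborel) \<partial>lborel) = (\<integral>x. \<Phi> x * P n x \<partial>lborel)" for n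
  proof -
    have "(\<integral>y. \<integral>x. \<Phi> x * (indicator (box a b) y * approx_identity (\<delta> n) (x - y)) \<partial>lborel \<partial>lborel) =
      (\<integral>x. \<integral>y. \<Phi> x * (indicator (box a b) y * approx_identity (\<delta> n) (x - y)) \<partial>lborel \<partial>lborel)"
      by (rule lborel_pair.Fubini_integral, rule convolution_decay_integrable[OF \<Phi> \<Phi>i \<delta>(1) C3[OF \<delta>(1,2)]])
    moreover have "(\<integral>x. \<Phi> x * (indicator (box a b) y * approx_identity (\<delta> n) (x - y)) \<partial>lborel) =
       indicator (box a b) y * (\<integral>x. \<Phi> x * approx_identity (\<delta> n) (x - y) \<partial>lborel)" for y
      by (simp add: mult.left_commute flip: integral_mult_right_zero)
    ultimately show ?thesis by (simp add: P_def)
  qed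
  have fr0: "AE x in lborel. x \<notin> frontier (box a b)"
  proof -
    have "negligible (frontier (box a b))" by (rule negligible_convex_frontier) simp
    then have "AE x in lebesgue. x \<notin> frontier (box a b)"
      by (intro AE_not_in) (simp add: negligible_iff_null_sets)
    then show ?thesis by (simp add: AE_completion_iff)
  qed
  have iD: "integrable lborel (\<lambda>x. C3 * \<bar>\<Phi> x * decay_weight x\<bar>)" using \<Phi>i by simp
  have PD: "norm (\<Phi> x * P n x) \<le> C3 * \<bar>\<Phi> x * decay_weight x\<bar>" for n x
    using mult_left_mono[OF C3[OF \<delta>(1,2), of n x, folded P_def] abs_ge_zero[of "\<Phi> x"]] P0[of n x]
    by (simp add: abs_mult abs_of_pos[OF decay_weight_pos] mult_ac)
  have limP: "AE x in lborel. (\<lambda>n. \<Phi> x * P n x) \<longlonglongrightarrow> indicator (box a b) x * \<Phi> x"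
    using fr0
  proof eventually_elim
    case (elim x)
    have "(\<lambda>n. \<Phi> x * P n x) \<longlonglongrightarrow> \<Phi> x * indicator (box a b) x"
      unfolding P_def by (intro tendsto_intros approx_identity_box_tendsto[OF elim \<delta>(1) \<delta>0])
    then show ?case by (simp only: mult.commute)
  qed
  have m1: "(\<lambda>x. indicator (box a b) x * \<Phi> x) \<in> borel_measurable lborel" by measurable
  have m2: "(\<lambda>x. \<Phi> x * P n x) \<in> borel_measurable lborel" for n by measurable
  have L: "(\<lambda>n. \<integral>x. \<Phi> x * P n x \<partial>lborel) \<longlonglongrightarrow> (\<integral>x. indicator (box a b) x * \<Phi> x \<partial>lborel)"
    by (rule integral_dominated_convergence[OF m1 m2 iD limP]) (intro AE_I2 PD)
  show "integrable lborel (\<lambda>y. indicator (box a b) y * \<Phi> y)"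
    by (rule integrable_dominated_convergence[OF m1 m2 iD limP]) (intro AE_I2 PD)
  \<comment> \<open>integrating the kernels over the box first removes their singularity\<close>
  define I where "I n x = (\<integral>y. indicator (box a b) y * ?G n (x - y) \<partial>lborel)" for n and x :: "real ^ 'n"
  define J where "J x = (\<integral>y. indicator (box a b) y * ?\<Gamma> (x - y) \<partial>lborel)" for x :: "real ^ 'n"
  have [measurable]: "I n \<in> borel_measurable lborel" for n unfolding I_def[abs_def] by measurable
  have [measurable]: "J \<in> borel_measurable lborel" unfolding J_def[abs_def] by measurable
  have swap: "(\<integral>y. indicator (box a b) y * (\<integral>x. f x * K (x - y) \<partial>lborel) \<partial>lborel) =
      (\<integral>x. f x * (\<integral>y. indicator (box a b) y * K (x - y) \<partial>lborel) \<partial>lborel)"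
    if "integrable (lborel \<Otimes>\<^sub>M lborel) (\<lambda>(x, y). f x * (indicator (box a b) y * K (x - y)))" for K
  proof -
    have "(\<integral>y. \<integral>x. f x * (indicator (box a b) y * K (x - y)) \<partial>lborel \<partial>lborel) =
      (\<integral>x. \<integral>y. f x * (indicator (box a b) y * K (x - y)) \<partial>lborel \<partial>lborel)"
      by (rule lborel_pair.Fubini_integral) (rule that)
    moreover have "(\<integral>x. f x * (indicator (box a b) y * K (x - y)) \<partial>lborel) =
       indicator (box a b) y * (\<integral>x. f x * K (x - y) \<partial>lborel)" for y
      by (simp add: mult.left_commute flip: integral_mult_right_zero)
    ultimately show ?thesis by simp
  qed
  have limI: "(\<lambda>n. I n x) \<longlonglongrightarrow> J x" if x: "norm x \<le> r" for x
    unfolding I_def J_def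
  proof (rule integral_dominated_convergence[OF _ _ wG(2)[OF _ x]])
    show "AE y in lborel. (\<lambda>n. indicator (box a b) y * ?G n (x - y)) \<longlonglongrightarrow> indicator (box a b) y * ?\<Gamma> (x - y)"
      using AE_lborel_neq[of x]
    proof eventually_elim
      case (elim y)
      then have "x - y \<noteq> 0" by simp
      then have "(\<lambda>n. ?G n (x - y)) \<longlonglongrightarrow> ?\<Gamma> (x - y)"
        unfolding newton_kernel_0[OF \<open>x - y \<noteq> 0\<close>, symmetric] by (intro newton_kernel_tendsto \<delta>0) simp
      then show ?case by (intro tendsto_intros)
    qed
    show "AE y in lborel. norm (indicator (box a b) y * ?G n (x - y)) \<le> C * (indicator (box a b) y * singular_weight (x - y))" for n
      using AE_lborel_neq[of x]
    proof eventually_elim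
      case (elim y)
      then show ?case using C(3)[OF _ \<delta>(3) \<delta>(2), of "x - y"] by (auto simp: indicator_def)
    qed
  qed (measurable, auto)
  have R: "(\<lambda>n. \<integral>x. f x * I n x \<partial>lborel) \<longlonglongrightarrow> (\<integral>x. f x * J x \<partial>lborel)"
  proof (rule integral_dominated_convergence[where w = "\<lambda>x. C * M * \<bar>f x\<bar>"])
    show "integrable lborel (\<lambda>x. C * M * \<bar>f x\<bar>)" using fi by simp
    show "AE x in lborel. (\<lambda>n. f x * I n x) \<longlonglongrightarrow> f x * J x"
    proof (rule AE_I2)
      fix x show "(\<lambda>n. f x * I n x) \<longlonglongrightarrow> f x * J x"
      proof (cases "norm x \<le> r")
        case True then show ?thesis by (intro tendsto_intros limI)
      qed (simp add: fr)
    qed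
    show "AE x in lborel. norm (f x * I n x) \<le> C * M * \<bar>f x\<bar>" for n
    proof (rule AE_I2)
      fix x show "norm (f x * I n x) \<le> C * M * \<bar>f x\<bar>"
      proof (cases "norm x \<le> r")
        case True
        have "\<bar>I n x\<bar> \<le> C * M" using wG(3)[OF _ True, of n] unfolding I_def by simp
        from mult_left_mono[OF this abs_ge_zero[of "f x"]] show ?thesis by (simp add: abs_mult mult_ac)
      qed (simp add: fr)
    qed
  qed measurable
  have "(\<integral>x. \<Phi> x * P n x \<partial>lborel) = - (\<integral>x. f x * I n x \<partial>lborel)" for n
  proof -
    have "(\<integral>x. \<Phi> x * P n x \<partial>lborel) = (\<integral>y. indicator (box a b) y * (- (\<integral>x. f x * ?G n (x - y) \<partial>lborel)) \<partial>lborel)"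
      unfolding lhs[symmetric] reg ..
    also have "\<dots> = - (\<integral>y. indicator (box a b) y * (\<integral>x. f x * ?G n (x - y) \<partial>lborel) \<partial>lborel)" by simp
    also have "\<dots> = - (\<integral>x. f x * I n x \<partial>lborel)" unfolding I_def using swap[OF wG(1)] by simp
    finally show ?thesis .
  qed
  then have "(\<integral>x. indicator (box a b) x * \<Phi> x \<partial>lborel) = - (\<integral>x. f x * J x \<partial>lborel)"
    using LIMSEQ_unique[OF L] tendsto_minus[OF R] by simp
  then show "(\<integral>y. indicator (box a b) y * \<Phi> y \<partial>lborel) =
      - (\<integral>y. indicator (box a b) y * (\<integral>x. f x * ?\<Gamma> (x - y) \<partial>lborel) \<partial>lborel)"
    unfolding J_def using swap[OF w\<Gamma>(1)] by simp
  have "integrable lborel (\<lambda>y. \<integral>x. f x * (indicator (box a b) y * ?\<Gamma> (x - y)) \<partial>lborel)"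
    by (rule lborel_pair.integrable_snd) (use w\<Gamma>(1) in blast)
  moreover have "(\<integral>x. f x * (indicator (box a b) y * ?\<Gamma> (x - y)) \<partial>lborel) =
       indicator (box a b) y * (\<integral>x. f x * ?\<Gamma> (x - y) \<partial>lborel)" for y
    by (simp add: mult.left_commute flip: integral_mult_right_zero)
  ultimately show "integrable lborel (\<lambda>y. indicator (box a b) y * (\<integral>x. f x * ?\<Gamma> (x - y) \<partial>lborel))" by simp
  have "AE y in lborel. integrable lborel (\<lambda>x. f x * (indicator (box a b) y * ?\<Gamma> (x - y)))"
    by (rule lborel_pair.AE_integrable_snd) (use w\<Gamma>(1) in blast)
  then show "AE y in lborel. y \<in> box a b \<longrightarrow> integrable lborel (\<lambda>x. f x * ?\<Gamma> (x - y))"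
    by eventually_elim auto
qed

lemma newtonian_potential_borel:
  fixes \<Phi> f :: "real ^ 'n::finite \<Rightarrow> real"
  assumes d: "2 \<le> CARD('n)" and \<Phi>: "\<Phi> \<in> borel_measurable borel" and f: "f \<in> borel_measurable borel"
    and \<Phi>i: "integrable lborel (\<lambda>x. \<Phi> x * decay_weight x)" and fi: "integrable lborel f"
    and fr: "\<And>x. norm x > r \<Longrightarrow> f x = 0"
    and test: "\<And>\<eta>. test_function UNIV \<eta> \<Longrightarrow> (\<integral>x. \<Phi> x * laplacian \<eta> x \<partial>lborel) = (\<integral>x. f x * \<eta> x \<partial>lborel)"
  shows "AE y in lborel. integrable lborel (\<lambda>x. f x * fundamental_solution (x - y)) \<and>
      \<Phi> y = - (\<integral>x. f x * fundamental_solution (x - y) \<partial>lborel)"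
proof -
  have npb: "(\<integral>y. indicator (box a b) y * \<Phi> y \<partial>lborel) =
      - (\<integral>y. indicator (box a b) y * (\<integral>x. f x * fundamental_solution (x - y) \<partial>lborel) \<partial>lborel)"
    "integrable lborel (\<lambda>y. indicator (box a b) y * (\<integral>x. f x * fundamental_solution (x - y) \<partial>lborel))"
    "integrable lborel (\<lambda>y. indicator (box a b) y * \<Phi> y)"
    "AE y in lborel. y \<in> box a b \<longrightarrow> integrable lborel (\<lambda>x. f x * fundamental_solution (x - y))" for a b
    by (rule newtonian_potential_box[OF d \<Phi> f \<Phi>i fi], fact fr, fact test)+
  define g where "g y = (\<integral>x. f x * fundamental_solution (x - y) \<partial>lborel)" for y
  let ?D = "\<lambda>n::nat. box (\<chi> i. - real n) (\<chi> i. real n) :: (real ^ 'n) set"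
  have "AE y in lborel. y \<in> ?D n \<longrightarrow> integrable lborel (\<lambda>x. f x * fundamental_solution (x - y)) \<and> \<Phi> y = - g y" for n
  proof -
    have "AE y in lborel. indicator (?D n) y * \<Phi> y + indicator (?D n) y * g y = 0"
    proof (rule AE_zero_if_box_integrals_zero)
      show i: "integrable lborel (\<lambda>y. indicator (?D n) y * \<Phi> y + indicator (?D n) y * g y)"
        unfolding g_def by (intro Bochner_Integration.integrable_add npb)
      fix a b :: "real ^ 'n"
      define a' b' where "a' = (\<chi> k. max (a $ k) (- real n))" and "b' = (\<chi> k. min (b $ k) (real n))"
      have "box a b \<inter> ?D n = box a' b'"
        by (auto simp: mem_box_cart a'_def b'_def)
      then have e: "indicator (box a b) y * (indicator (?D n) y * \<Phi> y + indicator (?D n) y * g y) =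
         indicator (box a' b') y * \<Phi> y + indicator (box a' b') y * g y" for y
        by (auto simp: indicator_def)
      show "(\<integral>y. indicator (box a b) y * (indicator (?D n) y * \<Phi> y + indicator (?D n) y * g y) \<partial>lborel) = 0"
        unfolding e unfolding g_def using npb(1)[of a' b'] npb(2)[of a' b'] npb(3)[of a' b'] by simp
    qed simp
    with npb(4)[of "\<chi> i. - real n" "\<chi> i. real n"] show ?thesis by eventually_elim auto
  qed
  then have "AE y in lborel. \<forall>n. y \<in> ?D n \<longrightarrow> integrable lborel (\<lambda>x. f x * fundamental_solution (x - y)) \<and> \<Phi> y = - g y"
    unfolding AE_all_countable by blast
  then show ?thesis
  proof eventually_elim
    case (elim y)
    then show ?case using exhausting_boxes[where 'n = 'n] unfolding g_def by blast
  qed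
qed

lemma loc_integrable_measurable:
  fixes f :: "real ^ 'n::finite \<Rightarrow> real"
  assumes "loc_integrable UNIV f" shows "f \<in> borel_measurable lebesgue"
proof (rule borel_measurable_LIMSEQ_real)
  show "(\<lambda>x. indicator (cball 0 (real n)) x * f x) \<in> borel_measurable lebesgue" for n
    using assms compact_cball unfolding loc_integrable_iff by (blast intro: borel_measurable_integrable)
  fix x :: "real ^ 'n"
  obtain n0 where n0: "norm x \<le> real n0" using real_arch_simple by blast
  have "f x = indicator (cball 0 (real n)) x * f x" if "n \<ge> n0" for n
    using n0 that by simp
  then have "\<forall>\<^sub>F n in sequentially. f x = indicator (cball 0 (real n)) x * f x"
    by (rule eventually_sequentiallyI)
  then show "(\<lambda>n. indicator (cball 0 (real n)) x * f x) \<longlonglongrightarrow> f x"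
    by (rule Lim_transform_eventually[OF tendsto_const])
qed

lemma integrable_borel_representative:
  fixes f :: "real ^ 'n::finite \<Rightarrow> real"
  assumes f: "integrable lebesgue f" and fr: "\<And>x. norm x > r \<Longrightarrow> f x = 0"
  obtains g where "g \<in> borel_measurable borel" "integrable lborel g" "\<And>x. norm x > r \<Longrightarrow> g x = 0"
    "AE x in lebesgue. f x = g x"
proof -
  obtain h where h: "h \<in> borel_measurable lborel" "AE x in lborel. f x = h x"
    using completion_ex_borel_measurable_real[of f] borel_measurable_integrable[OF f] by blast
  have [measurable]: "cball 0 r \<in> sets (borel :: (real ^ 'n) measure)" by simp
  have [measurable]: "h \<in> borel_measurable borel" using h(1) by simp
  define g where "g x = indicator (cball 0 r) x * h x" for x
  have g: "g \<in> borel_measurable borel" unfolding g_def[abs_def] by measurable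
  have AE: "AE x in lebesgue. f x = g x"
    using AE_completion[OF h(2)]
  proof eventually_elim
    case (elim x)
    then show ?case using fr[of x] by (cases "norm x \<le> r") (auto simp: g_def)
  qed
  have "integrable lebesgue g"
    by (rule integrable_cong_AE_imp[OF f _ AE]) (use g in \<open>simp add: measurable_completion\<close>)
  then have "integrable lborel g" using g by (simp add: integrable_completion)
  moreover have "g x = 0" if "norm x > r" for x using that by (simp add: g_def)
  ultimately show ?thesis using that g AE by blast
qed

lemma fundamental_solution_shift_measurable:
  "(\<lambda>x. fundamental_solution (x - y)) \<in> borel_measurable (borel :: (real ^ 'n::finite) measure)"
  by measurable

lemma potential_AE_integrable:
  fixes f :: "real ^ 'n::finite \<Rightarrow> real"
  assumes d: "2 \<le> CARD('n)" and f: "integrable lebesgue f" and fr: "\<And>x. norm x > r \<Longrightarrow> f x = 0"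
  shows "AE y in lebesgue. integrable lebesgue (\<lambda>x. f x * fundamental_solution (x - y))"
proof -
  obtain g where g: "g \<in> borel_measurable borel" "integrable lborel g" "\<And>x. norm x > r \<Longrightarrow> g x = 0"
    "AE x in lebesgue. f x = g x"
    by (rule integrable_borel_representative[where r = r, OF f]) (rule fr, assumption, blast intro: that)
  obtain C where C: "C \<ge> 0" "\<And>z :: real ^ 'n. z \<noteq> 0 \<Longrightarrow> \<bar>fundamental_solution z\<bar> \<le> C * singular_weight z"
    by (rule fundamental_solution_bound[OF d]) (rule that; assumption)
  let ?D = "\<lambda>n::nat. box (\<chi> i. - real n) (\<chi> i. real n) :: (real ^ 'n) set"
  have "AE y in lborel. y \<in> ?D n \<longrightarrow> integrable lborel (\<lambda>x. g x * fundamental_solution (x - y))" for n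
  proof -
    obtain b1 where b1: "b1 > 0" "\<And>y. y \<in> ?D n \<Longrightarrow> norm y \<le> b1"
      using bounded_box[of "\<chi> i. - real n" "\<chi> i. real n"] unfolding bounded_pos by blast
    have "integrable (lborel \<Otimes>\<^sub>M lborel) (\<lambda>(x, y). g x * (indicator (?D n) y * fundamental_solution (x - y)))"
      by (rule weakly_singular_potential(1)[OF g(1) fundamental_solution_measurable g(2) _ C(1)])
        (fact g(3), fact C(2), fact b1(2))
    then have "AE y in lborel. integrable lborel (\<lambda>x. g x * (indicator (?D n) y * fundamental_solution (x - y)))"
      by (rule lborel_pair.AE_integrable_snd)
    then show ?thesis by eventually_elim auto
  qed
  then have "AE y in lborel. \<forall>n. y \<in> ?D n \<longrightarrow> integrable lborel (\<lambda>x. g x * fundamental_solution (x - y))"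
    unfolding AE_all_countable by blast
  then have "AE y in lborel. integrable lborel (\<lambda>x. g x * fundamental_solution (x - y))"
  proof eventually_elim
    case (elim y)
    then show ?case using exhausting_boxes[where 'n = 'n] by blast
  qed
  then have "AE y in lebesgue. integrable lborel (\<lambda>x. g x * fundamental_solution (x - y))" by (rule AE_completion)
  then show ?thesis
  proof eventually_elim
    case (elim y)
    have m: "(\<lambda>x. g x * fundamental_solution (x - y)) \<in> borel_measurable borel" using g(1) by measurable
    show ?case
    proof (rule integrable_cong_AE_imp)
      show "integrable lebesgue (\<lambda>x. g x * fundamental_solution (x - y))"
        using elim m by (simp add: integrable_completion)
      show "(\<lambda>x. f x * fundamental_solution (x - y)) \<in> borel_measurable lebesgue"
        by (intro borel_measurable_times borel_measurable_integrable[OF f] measurable_completion) (simp add: fundamental_solution_shift_measurable)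
      show "AE x in lebesgue. g x * fundamental_solution (x - y) = f x * fundamental_solution (x - y)"
        using g(4) by eventually_elim simp
    qed
  qed
qed

lemma decaying_function_weight_integrable:
  fixes \<Phi> :: "real ^ 'n::finite \<Rightarrow> real"
  assumes \<Phi>: "loc_integrable UNIV \<Phi>" and C: "\<And>x. norm x \<ge> R \<Longrightarrow> \<bar>\<Phi> x\<bar> \<le> C * norm x powr (1 - real CARD('n))"
  shows "integrable lebesgue (\<lambda>x. \<Phi> x * decay_weight x)"
proof (rule Bochner_Integration.integrable_bound)
  have "integrable lborel (\<lambda>x :: real ^ 'n. C * (norm x powr (1 - real CARD('n)) * decay_weight x))"
    using radial_weight_integrable by (rule integrable_mult_right)
  then have 1: "integrable lebesgue (\<lambda>x :: real ^ 'n. C * (norm x powr (1 - real CARD('n)) * decay_weight x))"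
    by (subst integrable_completion) auto
  have 2: "integrable lebesgue (\<lambda>x. indicator (cball 0 R) x * \<Phi> x)"
    using \<Phi> compact_cball unfolding loc_integrable_iff by blast
  show "integrable lebesgue (\<lambda>x. \<bar>C * (norm x powr (1 - real CARD('n)) * decay_weight x)\<bar> + \<bar>indicator (cball 0 R) x * \<Phi> x\<bar>)"
    by (intro Bochner_Integration.integrable_add integrable_abs 1 2)
  show "(\<lambda>x. \<Phi> x * decay_weight x) \<in> borel_measurable lebesgue"
    by (intro borel_measurable_times loc_integrable_measurable[OF \<Phi>] measurable_completion) simp
  show "AE x in lebesgue. norm (\<Phi> x * decay_weight x) \<le> norm (\<bar>C * (norm x powr (1 - real CARD('n)) * decay_weight x)\<bar> + \<bar>indicator (cball 0 R) x * \<Phi> x\<bar>)"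
  proof (rule AE_I2)
    fix x :: "real ^ 'n"
    have nn: "0 \<le> \<bar>C * (norm x powr (1 - real CARD('n)) * decay_weight x)\<bar>" by simp
    show "norm (\<Phi> x * decay_weight x) \<le> norm (\<bar>C * (norm x powr (1 - real CARD('n)) * decay_weight x)\<bar> + \<bar>indicator (cball 0 R) x * \<Phi> x\<bar>)"
    proof (cases "norm x \<le> R")
      case True
      have "\<bar>\<Phi> x\<bar> * decay_weight x \<le> \<bar>\<Phi> x\<bar> * 1" by (intro mult_left_mono decay_weight_le_1) simp
      then show ?thesis using True nn by (simp add: abs_mult abs_of_pos[OF decay_weight_pos])
    next
      case False
      have "\<bar>\<Phi> x\<bar> * decay_weight x \<le> (C * norm x powr (1 - real CARD('n))) * decay_weight x"
        using C[of x] False less_imp_le[OF decay_weight_pos[of x]] by (intro mult_right_mono) auto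
      also have "\<dots> \<le> \<bar>C * (norm x powr (1 - real CARD('n)) * decay_weight x)\<bar>" by (simp only: mult.assoc abs_ge_self)
      finally show ?thesis using False by (simp add: abs_mult abs_of_pos[OF decay_weight_pos])
    qed
  qed
qed

text \<open>Without the decay condition \<open>\<Phi>\<close> would be determined only up to a harmonic function.\<close>

lemma newtonian_potential:
  fixes \<Phi> f :: "real ^ 'n::finite \<Rightarrow> real"
  assumes d: "2 \<le> CARD('n)" and \<Phi>: "loc_integrable UNIV \<Phi>"
    and C: "\<And>x. norm x \<ge> R \<Longrightarrow> \<bar>\<Phi> x\<bar> \<le> C * norm x powr (1 - real CARD('n))"
    and f: "integrable lebesgue f" and fr: "\<And>x. norm x > r \<Longrightarrow> f x = 0"
    and test: "\<And>\<eta>. test_function UNIV \<eta> \<Longrightarrow> (\<integral>x. \<Phi> x * laplacian \<eta> x \<partial>lebesgue) = (\<integral>x. f x * \<eta> x \<partial>lebesgue)"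
  shows "AE y in lebesgue. \<Phi> y = - (\<integral>x. f x * fundamental_solution (x - y) \<partial>lebesgue)"
proof -
  obtain g where g: "g \<in> borel_measurable borel" "integrable lborel g" "\<And>x. norm x > r \<Longrightarrow> g x = 0"
    "AE x in lebesgue. f x = g x"
    by (rule integrable_borel_representative[where r = r, OF f]) (rule fr, assumption, blast intro: that)
  obtain \<Psi> where \<Psi>: "\<Psi> \<in> borel_measurable lborel" "AE x in lborel. \<Phi> x = \<Psi> x"
    using completion_ex_borel_measurable_real[of \<Phi>] loc_integrable_measurable[OF \<Phi>] by blast
  have [measurable]: "\<Psi> \<in> borel_measurable borel" "g \<in> borel_measurable borel" using \<Psi>(1) g(1) by simp_all
  have \<Psi>': "AE x in lebesgue. \<Phi> x = \<Psi> x" using \<Psi>(2) by (rule AE_completion)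
  have fm: "f \<in> borel_measurable lebesgue" and \<Phi>m: "\<Phi> \<in> borel_measurable lebesgue"
    using f loc_integrable_measurable[OF \<Phi>] by simp_all
  have eq: "(\<integral>x. u x * h x \<partial>lebesgue) = (\<integral>x. w x * h x \<partial>lborel)"
    if "u \<in> borel_measurable lebesgue" "w \<in> borel_measurable borel" "AE x in lebesgue. u x = w x" "h \<in> borel_measurable borel"
    for u w h :: "real ^ 'n \<Rightarrow> real"
  proof -
    have [measurable]: "w \<in> borel_measurable borel" "h \<in> borel_measurable borel" by fact+
    have "(\<integral>x. u x * h x \<partial>lebesgue) = (\<integral>x. w x * h x \<partial>lebesgue)"
    proof (rule integral_cong_AE)
      show "AE x in lebesgue. u x * h x = w x * h x" using that(3) by eventually_elim simp
    qed (intro borel_measurable_times that(1) measurable_completion; simp)+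
    then show ?thesis by (subst (asm) integral_completion) auto
  qed
  have "integrable lebesgue (\<lambda>x. \<Psi> x * decay_weight x)"
  proof (rule integrable_cong_AE_imp)
    show "integrable lebesgue (\<lambda>x. \<Phi> x * decay_weight x)" by (rule decaying_function_weight_integrable[OF \<Phi>]) (fact C)
    show "AE x in lebesgue. \<Phi> x * decay_weight x = \<Psi> x * decay_weight x" using \<Psi>' by eventually_elim simp
  qed (intro measurable_completion, simp)
  then have \<Psi>i: "integrable lborel (\<lambda>x. \<Psi> x * decay_weight x)" by (simp add: integrable_completion)
  have "(\<integral>x. \<Psi> x * laplacian \<eta> x \<partial>lborel) = (\<integral>x. g x * \<eta> x \<partial>lborel)" if \<eta>: "test_function UNIV \<eta>" for \<eta>
  proof -
    have "Ck_on 0 UNIV (laplacian \<eta>)"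
      unfolding laplacian_def[abs_def]
      by (intro Ck_on_sum open_UNIV Ck_on_partial[of 0] Ck_on_partial[of "Suc 0"] test_functionD(1)[OF \<eta>])
    then have m: "laplacian \<eta> \<in> borel_measurable borel" using borel_measurable_continuous_onI by simp
    have m': "\<eta> \<in> borel_measurable borel"
      using smooth_on_imp_continuous[OF test_functionD(4)[OF \<eta>]] by (rule borel_measurable_continuous_onI)
    show ?thesis
      using test[OF \<eta>] eq[OF \<Phi>m _ \<Psi>' m] eq[OF fm g(1) g(4) m'] by simp
  qed
  note test' = this
  have "AE y in lborel. integrable lborel (\<lambda>x. g x * fundamental_solution (x - y)) \<and>
      \<Psi> y = - (\<integral>x. g x * fundamental_solution (x - y) \<partial>lborel)"
    by (rule newtonian_potential_borel[OF d _ g(1) \<Psi>i g(2)]) (simp, fact g(3), fact test')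
  from AE_completion[OF this] \<Psi>' show ?thesis
  proof eventually_elim
    case (elim y)
    then show ?case using eq[OF fm g(1) g(4) fundamental_solution_shift_measurable[of y]] by simp
  qed
qed

section \<open>Square integrable functions\<close>

lemma L2_imp_integrable:
  fixes f :: "'a \<Rightarrow> real"
  assumes "finite_measure M" "L2 M f" shows "integrable M f"
proof -
  interpret finite_measure M by fact
  have f: "f \<in> borel_measurable M" "integrable M (\<lambda>x. (f x)\<^sup>2)" using assms(2) by (auto simp: L2_def)
  show ?thesis
  proof (rule Bochner_Integration.integrable_bound[OF _ f(1)])
    show "integrable M (\<lambda>x. 1 + (f x)\<^sup>2)" using f by simp
    have "\<bar>t\<bar> \<le> 1 + t\<^sup>2" for t :: real
      using zero_le_power2[of "\<bar>t\<bar> - 1"] zero_le_power2[of t] by (simp add: power2_eq_square algebra_simps)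
    then show "AE x in M. norm (f x) \<le> norm (1 + (f x)\<^sup>2)" by (auto intro!: AE_I2 simp: abs_of_nonneg)
  qed
qed

lemma L2_add:
  fixes f g :: "'a \<Rightarrow> 'b::euclidean_space"
  assumes "L2 M f" "L2 M g" shows "L2 M (\<lambda>x. f x + g x)"
  unfolding L2_def
proof (intro conjI)
  have m: "f \<in> borel_measurable M" "g \<in> borel_measurable M" using assms by (auto simp: L2_def)
  then show "(\<lambda>x. f x + g x) \<in> borel_measurable M" by simp
  show "integrable M (\<lambda>x. (norm (f x + g x))\<^sup>2)"
  proof (rule Bochner_Integration.integrable_bound)
    show "integrable M (\<lambda>x. 2 * (norm (f x))\<^sup>2 + 2 * (norm (g x))\<^sup>2)" using assms by (auto simp: L2_def)
    have "(norm (u + v))\<^sup>2 \<le> 2 * (norm u)\<^sup>2 + 2 * (norm v)\<^sup>2" for u v :: 'b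
    proof -
      have "(norm (u + v))\<^sup>2 \<le> (norm u + norm v)\<^sup>2" by (intro power_mono norm_triangle_ineq) simp
      also have "\<dots> \<le> 2 * (norm u)\<^sup>2 + 2 * (norm v)\<^sup>2"
        using zero_le_power2[of "norm u - norm v"] by (simp add: power2_eq_square algebra_simps)
      finally show ?thesis .
    qed
    then show "AE x in M. norm ((norm (f x + g x))\<^sup>2) \<le> norm (2 * (norm (f x))\<^sup>2 + 2 * (norm (g x))\<^sup>2)" by simp
  qed (use m in measurable)
qed

lemma L2_cmult:
  fixes f :: "'a \<Rightarrow> real"
  shows "L2 M f \<Longrightarrow> L2 M (\<lambda>x. c * f x)"
  by (auto simp: L2_def power_mult_distrib)

lemma L2_uminus: "L2 M f \<Longrightarrow> L2 M (\<lambda>x. - f x)"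
  for f :: "'a \<Rightarrow> 'b::euclidean_space"
  by (auto simp: L2_def)

lemma L2_diff: "L2 M f \<Longrightarrow> L2 M g \<Longrightarrow> L2 M (\<lambda>x. f x - g x)"
  for f :: "'a \<Rightarrow> 'b::euclidean_space"
  using L2_add[OF _ L2_uminus, of M f g] by simp

lemma L2_zero: "L2 M (\<lambda>x. 0 :: real)"
  by (simp add: L2_def)

lemma L2_sum:
  fixes f :: "'i \<Rightarrow> 'a \<Rightarrow> real"
  shows "(\<And>i. i \<in> I \<Longrightarrow> L2 M (f i)) \<Longrightarrow> L2 M (\<lambda>x. \<Sum>i\<in>I. f i x)"
  by (induction I rule: infinite_finite_induct) (auto intro: L2_add L2_zero)

lemma L2_mult_bounded:
  fixes f h :: "'a \<Rightarrow> real"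
  assumes f: "L2 M f" and h: "h \<in> borel_measurable M" "\<And>x. x \<in> space M \<Longrightarrow> \<bar>h x\<bar> \<le> C"
  shows "L2 M (\<lambda>x. h x * f x)"
  unfolding L2_def
proof (intro conjI)
  have m: "f \<in> borel_measurable M" and i: "integrable M (\<lambda>x. (f x)\<^sup>2)" using f by (auto simp: L2_def)
  show "(\<lambda>x. h x * f x) \<in> borel_measurable M" using m h by simp
  show "integrable M (\<lambda>x. (norm (h x * f x))\<^sup>2)"
  proof (rule Bochner_Integration.integrable_bound)
    show "integrable M (\<lambda>x. C\<^sup>2 * (f x)\<^sup>2)" using i by simp
    show "AE x in M. norm ((norm (h x * f x))\<^sup>2) \<le> norm (C\<^sup>2 * (f x)\<^sup>2)"
    proof (rule AE_I2)
      fix x assume "x \<in> space M"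
      then have "(h x)\<^sup>2 \<le> C\<^sup>2" using h(2)[of x] by (metis abs_ge_zero power2_abs power_mono)
      then show "norm ((norm (h x * f x))\<^sup>2) \<le> norm (C\<^sup>2 * (f x)\<^sup>2)"
        by (simp add: power_mult_distrib mult_right_mono)
    qed
  qed (use m h in measurable)
qed

lemma L2_const: "finite_measure M \<Longrightarrow> L2 M (\<lambda>x. c :: real)"
  by (simp add: L2_def finite_measure.integrable_const)

lemma finite_measure_lebesgue_on_bounded:
  fixes S :: "'a::euclidean_space set"
  assumes "bounded S" "S \<in> sets lebesgue"
  shows "finite_measure (lebesgue_on S)"
  using bounded_set_imp_lmeasurable[OF assms] by (rule finite_measure_lebesgue_on)

lemma continuous_bounded_on_bounded:
  fixes f :: "real ^ 'n::finite \<Rightarrow> real"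
  assumes "continuous_on UNIV f" "bounded S"
  obtains C where "C \<ge> 0" "\<And>x. x \<in> S \<Longrightarrow> \<bar>f x\<bar> \<le> C"
proof -
  have "compact (f ` closure S)"
    using assms continuous_on_subset by (intro compact_continuous_image) auto
  then obtain C where C: "\<forall>y\<in>f ` closure S. norm y \<le> C" using compact_imp_bounded bounded_iff by blast
  have "\<bar>f x\<bar> \<le> max C 0" if "x \<in> S" for x
  proof -
    have "norm (f x) \<le> C" using C that closure_subset by blast
    then show ?thesis by simp
  qed
  then show ?thesis using that[of "max C 0"] by simp
qed

lemma continuous_measurable_lebesgue_on:
  fixes f :: "real ^ 'n::finite \<Rightarrow> real"
  assumes "continuous_on UNIV f"
  shows "f \<in> borel_measurable (lebesgue_on S)"
proof -
  have "f \<in> borel_measurable lebesgue"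
    using borel_measurable_continuous_onI[OF assms] by (intro measurable_completion) simp
  then show ?thesis by (rule measurable_restrict_space1)
qed

lemma L2_mult_continuous:
  fixes f h :: "real ^ 'n::finite \<Rightarrow> real"
  assumes f: "L2 (lebesgue_on S) f" and h: "continuous_on UNIV h" and S: "bounded S"
  shows "L2 (lebesgue_on S) (\<lambda>x. h x * f x)"
proof -
  obtain C where "C \<ge> 0" "\<And>x. x \<in> S \<Longrightarrow> \<bar>h x\<bar> \<le> C" using continuous_bounded_on_bounded[OF h S] by blast
  then show ?thesis by (intro L2_mult_bounded[OF f continuous_measurable_lebesgue_on[OF h], of C]) simp
qed

lemma L2_continuous:
  fixes h :: "real ^ 'n::finite \<Rightarrow> real"
  assumes h: "continuous_on UNIV h" and S: "bounded S" "S \<in> sets lebesgue"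
  shows "L2 (lebesgue_on S) h"
  using L2_mult_continuous[OF L2_const[OF finite_measure_lebesgue_on_bounded[OF S], of 1] h S(1)] by simp

lemma L2_lebesgue_on_subset:
  fixes f :: "real ^ 'n::finite \<Rightarrow> real"
  assumes f: "L2 (lebesgue_on T) f" and S: "S \<subseteq> T" "S \<in> sets lebesgue" "T \<in> sets lebesgue"
  shows "L2 (lebesgue_on S) f"
proof -
  have m: "f \<in> borel_measurable (lebesgue_on T)" and i: "integrable (lebesgue_on T) (\<lambda>x. (f x)\<^sup>2)"
    using f by (auto simp: L2_def)
  have "f \<in> borel_measurable (lebesgue_on S)" using measurable_restrict_mono[OF m S(1)] .
  moreover have "integrable (lebesgue_on S) (\<lambda>x. (f x)\<^sup>2)"
    using i set_integrable_subset[of lebesgue T "\<lambda>x. (f x)\<^sup>2" S] S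
    unfolding set_integrable_def by (simp add: integrable_restrict_space)
  ultimately show ?thesis by (simp add: L2_def)
qed

section \<open>The Liouville transformation\<close>

lemma Ck_on_2D:
  fixes f :: "real ^ 'n::finite \<Rightarrow> real"
  assumes f: "Ck_on 2 UNIV f"
  shows "Ck_on 1 UNIV f" "Ck_on 1 UNIV (partial k f)" "f differentiable (at x)" "partial k f differentiable (at x)"
    "continuous_on UNIV f" "continuous_on UNIV (partial k f)" "continuous_on UNIV (laplacian f)"
proof -
  show 1: "Ck_on 1 UNIV f" by (rule Ck_on_mono[OF f]) simp
  have f': "Ck_on (Suc (Suc 0)) UNIV f" using f by (simp add: numeral_2_eq_2)
  then show 2: "Ck_on 1 UNIV (partial k f)" for k by (simp only: One_nat_def Ck_on_partial)
  show "f differentiable (at x)" by (rule Ck_on_differentiable[OF 1]) auto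
  show "partial k f differentiable (at x)" by (rule Ck_on_differentiable[OF 2]) auto
  show "continuous_on UNIV f" using 1 by (rule Ck_on_imp_continuous)
  show "continuous_on UNIV (partial k f)" using 2 by (rule Ck_on_imp_continuous)
  show "continuous_on UNIV (laplacian f)"
    unfolding laplacian_def[abs_def] using 2 by (intro continuous_on_sum) simp
qed

lemma inner_grad: "G \<bullet> grad f x = (\<Sum>k\<in>UNIV. G $ k * partial k f x)"
  by (simp add: inner_vec_def grad_def)

lemma inner_grad_grad: "grad f x \<bullet> grad g x = (\<Sum>k\<in>UNIV. partial k f x * partial k g x)"
  by (simp add: inner_vec_def grad_def)

lemma grad_grad_integral:
  fixes v \<psi> :: "real ^ 'n::finite \<Rightarrow> real"
  assumes v: "Ck_on 2 UNIV v" and \<psi>: "Ck_on 1 UNIV \<psi>" "compact (supp \<psi>)"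
  shows "(\<integral>x. grad v x \<bullet> grad \<psi> x \<partial>lebesgue) = - (\<integral>x. laplacian v x * \<psi> x \<partial>lebesgue)"
proof -
  note i = integration_by_parts[OF open_UNIV Ck_on_2D(2)[OF v] \<psi> subset_UNIV]
  have "(\<integral>x. grad v x \<bullet> grad \<psi> x \<partial>lebesgue) = (\<Sum>k\<in>UNIV. \<integral>x. partial k v x * partial k \<psi> x \<partial>lebesgue)"
    unfolding inner_grad_grad by (rule Bochner_Integration.integral_sum) (rule i(2))
  also have "\<dots> = - (\<Sum>k\<in>UNIV. \<integral>x. partial k (partial k v) x * \<psi> x \<partial>lebesgue)"
    by (simp add: i(1) sum_negf)
  also have "(\<Sum>k\<in>UNIV. \<integral>x. partial k (partial k v) x * \<psi> x \<partial>lebesgue) = (\<integral>x. laplacian v x * \<psi> x \<partial>lebesgue)"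
    unfolding laplacian_def sum_distrib_right by (rule Bochner_Integration.integral_sum[symmetric]) (rule i(3))
  finally show ?thesis .
qed

lemma laplacian_symmetric:
  fixes v \<eta> :: "real ^ 'n::finite \<Rightarrow> real"
  assumes v: "Ck_on 2 UNIV v" and \<eta>: "Ck_on 2 UNIV \<eta>" "compact (supp \<eta>)"
  shows "(\<integral>x. v x * laplacian \<eta> x \<partial>lebesgue) = (\<integral>x. laplacian v x * \<eta> x \<partial>lebesgue)"
proof -
  have i: "(\<integral>x. v x * partial k (partial k \<eta>) x \<partial>lebesgue) = - (\<integral>x. partial k v x * partial k \<eta> x \<partial>lebesgue)"
    "integrable lebesgue (\<lambda>x. v x * partial k (partial k \<eta>) x)" "integrable lebesgue (\<lambda>x. partial k v x * partial k \<eta> x)" for k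
    using integration_by_parts[OF open_UNIV Ck_on_2D(1)[OF v] Ck_on_2D(2)[OF \<eta>(1)] compact_subset_supp[OF \<eta>(2) supp_partial] subset_UNIV]
    by blast+
  have "(\<integral>x. v x * laplacian \<eta> x \<partial>lebesgue) = (\<Sum>k\<in>UNIV. \<integral>x. v x * partial k (partial k \<eta>) x \<partial>lebesgue)"
    unfolding laplacian_def sum_distrib_left by (rule Bochner_Integration.integral_sum) (rule i(2))
  also have "\<dots> = - (\<Sum>k\<in>UNIV. \<integral>x. partial k v x * partial k \<eta> x \<partial>lebesgue)" by (simp add: i(1) sum_negf)
  also have "(\<Sum>k\<in>UNIV. \<integral>x. partial k v x * partial k \<eta> x \<partial>lebesgue) = (\<integral>x. grad v x \<bullet> grad \<eta> x \<partial>lebesgue)"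
    unfolding inner_grad_grad by (rule Bochner_Integration.integral_sum[symmetric]) (rule i(3))
  finally show ?thesis using grad_grad_integral[OF v Ck_on_2D(1)[OF \<eta>(1)] \<eta>(2)] by simp
qed

lemma weak_divergence:
  fixes U :: "real ^ 'n::finite \<Rightarrow> real"
  assumes G: "is_weak_grad UNIV U G" and F: "\<And>k. Ck_on 1 UNIV (F k)" "\<And>k. compact (supp (F k))"
  shows "(\<integral>x. (\<Sum>k\<in>UNIV. G x $ k * F k x) \<partial>lebesgue) = - (\<integral>x. U x * (\<Sum>k\<in>UNIV. partial k (F k) x) \<partial>lebesgue)"
proof -
  note i = is_weak_grad_C1[OF G F]
  have "(\<integral>x. (\<Sum>k\<in>UNIV. G x $ k * F k x) \<partial>lebesgue) = (\<Sum>k\<in>UNIV. \<integral>x. G x $ k * F k x \<partial>lebesgue)"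
    by (rule Bochner_Integration.integral_sum) (rule i(3))
  also have "\<dots> = - (\<Sum>k\<in>UNIV. \<integral>x. U x * partial k (F k) x \<partial>lebesgue)" by (simp add: i(1) sum_negf)
  also have "(\<Sum>k\<in>UNIV. \<integral>x. U x * partial k (F k) x \<partial>lebesgue) = (\<integral>x. U x * (\<Sum>k\<in>UNIV. partial k (F k) x) \<partial>lebesgue)"
    unfolding sum_distrib_left by (rule Bochner_Integration.integral_sum[symmetric]) (rule i(2))
  finally show ?thesis .
qed

lemma is_weak_grad_add:
  assumes \<Omega>: "open \<Omega>" and G: "is_weak_grad \<Omega> u G" and G': "is_weak_grad \<Omega> u' G'"
  shows "is_weak_grad \<Omega> (\<lambda>x. u x + u' x) (\<lambda>x. G x + G' x)"
  unfolding is_weak_grad_def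
proof (intro conjI allI impI)
  show "loc_integrable \<Omega> (\<lambda>x. u x + u' x)" "loc_integrable \<Omega> (\<lambda>x. G x + G' x)"
    by (intro loc_integrable_add is_weak_gradD[OF G] is_weak_gradD[OF G'])+
  fix \<psi> k assume \<psi>: "test_function \<Omega> \<psi>"
  have out: "\<psi> x = 0" "partial k \<psi> x = 0" if "x \<notin> \<Omega>" for x
    using that test_functionD(3)[OF \<psi>] not_in_supp[of x \<psi>] partial_not_in_supp[of x \<psi>] by blast+
  note a = is_weak_grad_test[OF G \<Omega> \<psi>, of k] is_weak_grad_test[OF G' \<Omega> \<psi>, of k]
  show "(\<integral>x. (u x + u' x) * partial k \<psi> x \<partial>lebesgue_on \<Omega>) = - (\<integral>x. (G x + G' x) $ k * \<psi> x \<partial>lebesgue_on \<Omega>)"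
    using out a by (subst (1 2) integral_lebesgue_on_eq(1)[OF open_lebesgue[OF \<Omega>]]) (auto simp: distrib_right)
qed

lemma flux_integrable:
  fixes G :: "real ^ 'n::finite \<Rightarrow> real ^ 'n"
  assumes G: "loc_integrable UNIV G" and w: "continuous_on UNIV w" and \<psi>: "Ck_on 1 UNIV \<psi>"
    and K: "compact K" "\<And>x. x \<notin> K \<Longrightarrow> w x = 0 \<or> grad \<psi> x = 0"
  shows "integrable lebesgue (\<lambda>x. w x * (G x \<bullet> grad \<psi> x))"
proof -
  have "integrable lebesgue (\<lambda>x. G x $ k * (w x * partial k \<psi> x))" for k
  proof (rule loc_integrable_times_compact_supp[OF loc_integrable_nth[OF G] _ K(1) subset_UNIV])
    show "continuous_on UNIV (\<lambda>x. w x * partial k \<psi> x)"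
      using \<psi> by (intro continuous_on_mult w) simp
    fix x assume "x \<notin> K"
    from K(2)[OF this] show "w x * partial k \<psi> x = 0" by (auto simp: grad_def vec_eq_iff)
  qed
  then have "integrable lebesgue (\<lambda>x. \<Sum>k\<in>UNIV. G x $ k * (w x * partial k \<psi> x))" by (rule Bochner_Integration.integrable_sum)
  then show ?thesis by (simp add: inner_grad sum_distrib_left mult_ac)
qed

locale liouville_setting =
  fixes B :: "(real ^ 'n::finite) set" and D0 :: real and D1 :: "real ^ 'n \<Rightarrow> real"
  assumes dim: "2 \<le> CARD('n)" and B: "open B" "bounded B"
    and D0: "D0 > 0" and D1: "Ck_on 2 UNIV D1" "supp D1 \<subseteq> B" and D_pos: "\<And>x. D0 + D1 x > 0"
begin

definition s :: "real ^ 'n \<Rightarrow> real" where "s x = sqrt (D0 + D1 x)"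
definition s0 :: real where "s0 = sqrt D0"
definition q :: "real ^ 'n \<Rightarrow> real" where "q = liouville_potential D0 D1"

lemma s_pos: "s x > 0" and s0_pos: "s0 > 0"
  using D_pos[of x] D0 by (simp_all add: s_def s0_def)

lemma s_square: "(s x)\<^sup>2 = D0 + D1 x" and s0_square: "s0\<^sup>2 = D0"
  using D_pos[of x] D0 by (simp_all add: s_def s0_def)

lemma Ck_s: "Ck_on 2 UNIV s" and Ck_inverse_s: "Ck_on 2 UNIV (\<lambda>x. inverse (s x))"
proof -
  have D: "Ck_on 2 UNIV (\<lambda>x. D0 + D1 x)" by (intro Ck_on_add Ck_on_const D1(1) open_UNIV)
  have "s x = (D0 + D1 x) powr (1 / 2)" for x
    using D_pos[of x] by (simp add: s_def powr_half_sqrt less_imp_le)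
  then have *: "s = (\<lambda>x. (D0 + D1 x) powr (1 / 2))" by (rule ext)
  show "Ck_on 2 UNIV s" unfolding * by (intro Ck_on_powr D D_pos open_UNIV)
  have "(\<lambda>x. inverse (s x)) = (\<lambda>x. (D0 + D1 x) powr (- 1 / 2))"
    unfolding * by (simp add: powr_minus[symmetric])
  then show "Ck_on 2 UNIV (\<lambda>x. inverse (s x))"
    by (simp only:) (intro Ck_on_powr D D_pos open_UNIV)
qed

lemma compact_supp_D1: "compact (supp D1)"
  using D1(2) B(2) bounded_subset by (auto simp: compact_eq_bounded_closed)

lemma s_out: "x \<notin> supp D1 \<Longrightarrow> s x = s0"
  by (simp add: s_def s0_def not_in_supp[of x D1])

lemma partial_s_out: "x \<notin> supp D1 \<Longrightarrow> partial k s x = 0"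
  using partial_cong_open[of "- supp D1" x s "\<lambda>_. s0" k] s_out by (simp add: open_Compl)

lemma laplacian_s_out: "x \<notin> supp D1 \<Longrightarrow> laplacian s x = 0"
  using partial_cong_open[of "- supp D1" x "partial _ s" "\<lambda>_. 0"] partial_s_out by (simp add: open_Compl laplacian_def)

lemma q_s: "q x * s x = laplacian s x"
  using s_pos[of x] by (simp add: q_def liouville_potential_def s_def[abs_def])

lemma q_eq: "q x = laplacian s x * inverse (s x)"
  by (simp add: q_def liouville_potential_def s_def[abs_def] divide_inverse)

lemma q_out: "x \<notin> supp D1 \<Longrightarrow> q x = 0"
  by (simp add: q_eq laplacian_s_out)

lemma q_out_B: "x \<notin> B \<Longrightarrow> q x = 0"
  using q_out D1(2) by blast

lemma continuous_q: "continuous_on UNIV q"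
proof -
  have "q = (\<lambda>x. laplacian s x * inverse (s x))" by (rule ext) (rule q_eq)
  then show ?thesis
    by (simp only:) (intro continuous_on_mult Ck_on_2D(7)[OF Ck_s] Ck_on_2D(5)[OF Ck_inverse_s])
qed

lemma partial_inverse_s: "partial k (\<lambda>x. inverse (s x)) x = - partial k s x * (inverse (s x))\<^sup>2"
  using partial_comp[OF Ck_on_2D(3)[OF Ck_s] DERIV_inverse, of x k] s_pos[of x]
  by (simp add: power2_eq_square)

text \<open>\<open>weak_flux G\<close> says that \<open>(D\<^sub>0 + D\<^sub>1) G\<close> is divergence free.\<close>

definition weak_flux :: "(real ^ 'n \<Rightarrow> real ^ 'n) \<Rightarrow> bool" where
  "weak_flux G \<longleftrightarrow> loc_integrable UNIV G \<and>
     (\<forall>\<psi>. test_function UNIV \<psi> \<longrightarrow> (\<integral>x. (D0 + D1 x) * (G x \<bullet> grad \<psi> x) \<partial>lebesgue) = 0)"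

lemma weak_flux_C1:
  assumes G: "weak_flux G" and \<psi>: "Ck_on 1 UNIV \<psi>" "compact (supp \<psi>)"
  shows "(\<integral>x. (\<Sum>k\<in>UNIV. G x $ k * ((s x)\<^sup>2 * partial k \<psi> x)) \<partial>lebesgue) = 0"
proof -
  have "(\<integral>x. 0 * \<psi> x + (\<Sum>k\<in>UNIV. ((s x)\<^sup>2 * G x $ k) * partial k \<psi> x) \<partial>lebesgue) = 0"
  proof (rule test_identity_extends[OF _ _ _ \<psi>])
    show "loc_integrable UNIV (\<lambda>x. 0 :: real)" by (simp add: loc_integrable_def)
    show "loc_integrable UNIV (\<lambda>x. (s x)\<^sup>2 * G x $ k)" for k
      using G Ck_on_2D(5)[OF Ck_s] unfolding weak_flux_def
      by (intro loc_integrable_mult_continuous loc_integrable_nth continuous_on_power) auto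
    fix \<psi> :: "real ^ 'n \<Rightarrow> real" assume "test_function UNIV \<psi>"
    then have "(\<integral>x. (D0 + D1 x) * (G x \<bullet> grad \<psi> x) \<partial>lebesgue) = 0" using G by (simp add: weak_flux_def)
    then show "(\<integral>x. 0 * \<psi> x + (\<Sum>k\<in>UNIV. ((s x)\<^sup>2 * G x $ k) * partial k \<psi> x) \<partial>lebesgue) = 0"
      unfolding inner_grad sum_distrib_left s_square by (simp add: mult.assoc)
  qed
  then show ?thesis by (simp add: mult_ac)
qed

text \<open>Liouville's substitution. Since \<open>s\<^sup>2 \<nabla>(\<eta> / s) = s \<nabla>\<eta> - \<eta> \<nabla>s\<close>, testing the equation in divergence form
  with \<open>\<eta> / s\<close> gives the Schroedinger equation \<open>\<Delta>(s U) = (\<Delta>s / s) s U\<close>.\<close>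

lemma liouville_identity:
  assumes U: "is_weak_grad UNIV U G" and G: "weak_flux G" and \<eta>: "Ck_on 2 UNIV \<eta>" "compact (supp \<eta>)"
  shows "(\<integral>x. U x * (s x * laplacian \<eta> x - \<eta> x * laplacian s x) \<partial>lebesgue) = 0"
proof -
  define F where "F k x = s x * partial k \<eta> x - \<eta> x * partial k s x" for k x
  define \<psi> where "\<psi> x = \<eta> x * inverse (s x)" for x
  have \<psi>: "Ck_on 1 UNIV \<psi>" "compact (supp \<psi>)"
    unfolding \<psi>_def[abs_def]
    by (intro Ck_on_mult Ck_on_2D(1) \<eta> Ck_inverse_s open_UNIV, rule compact_subset_supp[OF \<eta>(2) supp_mult_left])
  have F: "Ck_on 1 UNIV (F k)" for k
    unfolding F_def[abs_def] by (intro Ck_on_diff Ck_on_mult Ck_on_2D(1,2) \<eta> Ck_s open_UNIV)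
  have cF: "compact (supp (F k))" for k
    by (rule compact_suppI[OF \<eta>(2)]) (simp add: F_def not_in_supp[of _ \<eta>] partial_not_in_supp[of _ \<eta>])
  have "(s x)\<^sup>2 * partial k \<psi> x = F k x" for k x
    unfolding \<psi>_def[abs_def] partial_mult[OF Ck_on_2D(3)[OF \<eta>(1)] Ck_on_2D(3)[OF Ck_inverse_s]] partial_inverse_s F_def
    using s_pos[of x] by (simp add: power2_eq_square field_simps)
  then have "(\<integral>x. (\<Sum>k\<in>UNIV. G x $ k * F k x) \<partial>lebesgue) = 0"
    using weak_flux_C1[OF G \<psi>] by simp
  then have "(\<integral>x. U x * (\<Sum>k\<in>UNIV. partial k (F k) x) \<partial>lebesgue) = 0"
    using weak_divergence[OF U F cF] by simp
  moreover have "partial k (F k) x = s x * partial k (partial k \<eta>) x - \<eta> x * partial k (partial k s) x" for k x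
  proof -
    note d = Ck_on_2D(3,4)[OF \<eta>(1)] Ck_on_2D(3,4)[OF Ck_s]
    show ?thesis unfolding F_def[abs_def]
      by (subst partial_diff) (auto intro!: differentiable_mult d simp: partial_mult d)
  qed
  ultimately show ?thesis
    by (simp add: laplacian_def sum_subtractf sum_distrib_left)
qed

text \<open>The test function is \<open>n (s\<^sub>0 / s - 1)\<close>. It has compact support, being \<open>0\<close> where \<open>D\<^sub>1\<close> vanishes, and
  \<open>s\<^sup>2\<close> times its gradient is \<open>s\<^sub>0 F - D\<^sub>1 \<nabla>n\<close> with \<open>F = (s - s\<^sub>0) \<nabla>n - n \<nabla>s\<close>, a field whose divergence
  \<open>- n \<Delta>s\<close> no longer contains derivatives of \<open>n\<close>.\<close>

lemma diffusion_tensor_identity: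
  assumes U: "is_weak_grad UNIV U G" and G: "weak_flux G" and n: "Ck_on 2 UNIV n" "\<And>x. laplacian n x = 0"
  shows "(\<integral>x. D1 x * (G x \<bullet> grad n x) \<partial>lebesgue) = s0 * (\<integral>x. U x * (n x * laplacian s x) \<partial>lebesgue)"
proof -
  define F where "F k x = (s x - s0) * partial k n x - n x * partial k s x" for k x
  define \<psi> where "\<psi> x = n x * (s0 * inverse (s x) - 1)" for x
  have \<psi>0: "\<psi> x = 0" if "x \<notin> supp D1" for x using s_out[OF that] s0_pos by (simp add: \<psi>_def)
  have C: "Ck_on 2 UNIV (\<lambda>x. s0 * inverse (s x) - 1)"
    by (intro Ck_on_diff Ck_on_cmult Ck_inverse_s Ck_on_const open_UNIV)
  have \<psi>: "Ck_on 1 UNIV \<psi>" "compact (supp \<psi>)"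
    unfolding \<psi>_def[abs_def]
    by (intro Ck_on_mult Ck_on_2D(1) n C open_UNIV, rule compact_suppI[OF compact_supp_D1 \<psi>0[unfolded \<psi>_def]])
  have F: "Ck_on 1 UNIV (F k)" for k
    unfolding F_def[abs_def] by (intro Ck_on_diff Ck_on_mult Ck_on_2D(1,2) Ck_on_const n Ck_s open_UNIV)
  have cF: "compact (supp (F k))" for k
    by (rule compact_suppI[OF compact_supp_D1]) (simp add: F_def s_out partial_s_out)
  have D1s: "D1 x = (s x)\<^sup>2 - s0\<^sup>2" for x by (simp add: s_square s0_square)
  have eq: "(s x)\<^sup>2 * partial k \<psi> x = s0 * F k x - D1 x * partial k n x" for k x
  proof -
    have "partial k (\<lambda>x. s0 * inverse (s x) - 1) x = s0 * (- partial k s x * (inverse (s x))\<^sup>2)"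
      using partial_diff[of "\<lambda>x. s0 * inverse (s x)" x "\<lambda>_. 1" k] partial_cmult[OF Ck_on_2D(3)[OF Ck_inverse_s], of k s0 x]
        Ck_on_2D(3)[OF Ck_inverse_s, of x] by (simp add: partial_inverse_s)
    then have "partial k \<psi> x = partial k n x * (s0 * inverse (s x) - 1) + n x * (s0 * (- partial k s x * (inverse (s x))\<^sup>2))"
      unfolding \<psi>_def[abs_def] by (simp only: partial_mult[OF Ck_on_2D(3)[OF n(1)] Ck_on_2D(3)[OF C]])
    moreover have "a\<^sup>2 * (dn * (s0 * inverse a - 1) + m * (s0 * (- ds * (inverse a)\<^sup>2))) =
      s0 * ((a - s0) * dn - m * ds) - (a\<^sup>2 - s0\<^sup>2) * dn" if "a > 0" for a dn ds m :: real
    proof -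
      have "a\<^sup>2 * (dn * (s0 * i - 1) + m * (s0 * (- ds * i\<^sup>2))) =
        (a * i) * (s0 * a * dn) - a\<^sup>2 * dn - (a * i) * ((a * i) * (m * s0 * ds))" for i
        by (simp add: power2_eq_square algebra_simps)
      from this[of "inverse a"] show ?thesis using that by (simp add: power2_eq_square algebra_simps)
    qed
    ultimately have A: "(s x)\<^sup>2 * partial k \<psi> x = s0 * ((s x - s0) * partial k n x - n x * partial k s x) - ((s x)\<^sup>2 - s0\<^sup>2) * partial k n x"
      using s_pos[of x] by (simp only:)
    show ?thesis by (subst D1s) (simp only: A F_def)
  qed
  have lG: "loc_integrable UNIV (\<lambda>x. G x $ k)" for k by (rule is_weak_gradD(3)[OF U])
  have i1: "integrable lebesgue (\<lambda>x. G x $ k * F k x)" for k by (rule is_weak_grad_C1(3)[OF U F cF])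
  have i2: "integrable lebesgue (\<lambda>x. G x $ k * (D1 x * partial k n x))" for k
    by (rule loc_integrable_times_compact_supp[OF lG _ compact_supp_D1 subset_UNIV])
      (intro continuous_on_mult Ck_on_2D(5)[OF D1(1)] Ck_on_2D(6)[OF n(1)], simp add: not_in_supp[of _ D1])
  have "0 = (\<integral>x. (\<Sum>k\<in>UNIV. G x $ k * (s0 * F k x - D1 x * partial k n x)) \<partial>lebesgue)"
    using weak_flux_C1[OF G \<psi>] unfolding eq by simp
  also have "\<dots> = (\<integral>x. s0 * (\<Sum>k\<in>UNIV. G x $ k * F k x) - (\<Sum>k\<in>UNIV. G x $ k * (D1 x * partial k n x)) \<partial>lebesgue)"
    by (simp add: sum_subtractf sum_distrib_left right_diff_distrib mult_ac)
  also have "\<dots> = s0 * (\<integral>x. (\<Sum>k\<in>UNIV. G x $ k * F k x) \<partial>lebesgue) - (\<integral>x. (\<Sum>k\<in>UNIV. G x $ k * (D1 x * partial k n x)) \<partial>lebesgue)"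
    using i1 i2 by simp
  finally have "(\<integral>x. (\<Sum>k\<in>UNIV. G x $ k * (D1 x * partial k n x)) \<partial>lebesgue) = s0 * (\<integral>x. (\<Sum>k\<in>UNIV. G x $ k * F k x) \<partial>lebesgue)"
    by simp
  also have "(\<integral>x. (\<Sum>k\<in>UNIV. G x $ k * F k x) \<partial>lebesgue) = - (\<integral>x. U x * (\<Sum>k\<in>UNIV. partial k (F k) x) \<partial>lebesgue)"
    by (rule weak_divergence[OF U F cF])
  finally have tested: "(\<integral>x. (\<Sum>k\<in>UNIV. G x $ k * (D1 x * partial k n x)) \<partial>lebesgue) =
      s0 * - (\<integral>x. U x * (\<Sum>k\<in>UNIV. partial k (F k) x) \<partial>lebesgue)" .
  have "(\<Sum>k\<in>UNIV. partial k (F k) x) = - (n x * laplacian s x)" for x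
  proof -
    note d = Ck_on_2D(3,4)[OF n(1)] Ck_on_2D(3,4)[OF Ck_s]
    have ds: "(\<lambda>x. s x - s0) differentiable (at x)" "partial k (\<lambda>x. s x - s0) x = partial k s x" for k x
      using partial_diff[of s x "\<lambda>_. s0" k] d by (auto intro: differentiable_diff)
    have "partial k (F k) x = (s x - s0) * partial k (partial k n) x - n x * partial k (partial k s) x" for k
      unfolding F_def[abs_def]
      by (subst partial_diff) (auto intro!: differentiable_mult d ds simp: partial_mult d ds)
    then have "(\<Sum>k\<in>UNIV. partial k (F k) x) = (s x - s0) * laplacian n x - n x * laplacian s x"
      by (simp add: laplacian_def sum_subtractf sum_distrib_left)
    then show ?thesis using n(2) by simp
  qed
  with tested show ?thesis by (simp add: inner_grad sum_distrib_left mult_ac)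
qed

text \<open>The equation of the corrector together with \<open>\<Delta>v = 0\<close>.\<close>

lemma corrector_weak_flux:
  assumes v: "Ck_on 2 UNIV v" "\<And>x. laplacian v x = 0" and G0: "loc_integrable UNIV G0"
    and corr: "\<And>\<psi>. test_function UNIV \<psi> \<Longrightarrow> (\<integral>x. (D0 + D1 x) * (G0 x \<bullet> grad \<psi> x) \<partial>lebesgue) =
          - (\<integral>x. D1 x * (grad v x \<bullet> grad \<psi> x) \<partial>lebesgue)"
  shows "weak_flux (\<lambda>x. grad v x + G0 x)"
  unfolding weak_flux_def
proof (intro conjI allI impI)
  have lv: "loc_integrable UNIV (grad v)"
    by (rule is_weak_gradD(2)[OF Ck_is_weak_grad[OF open_UNIV Ck_on_2D(1)[OF v(1)]]])
  then show "loc_integrable UNIV (\<lambda>x. grad v x + G0 x)" using G0 by (rule loc_integrable_add)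
  fix \<psi> :: "real ^ 'n \<Rightarrow> real" assume \<psi>: "test_function UNIV \<psi>"
  have out: "a = 0 \<or> grad \<psi> x = 0" if "x \<notin> supp \<psi>" for x and a :: real
    using partial_not_in_supp[OF that] by (simp add: grad_def vec_eq_iff)
  have i: "integrable lebesgue (\<lambda>x. a x * (G x \<bullet> grad \<psi> x))"
    if "loc_integrable UNIV G" "continuous_on UNIV a" for G :: "real ^ 'n \<Rightarrow> real ^ 'n" and a
    by (rule flux_integrable[OF that test_functionD(1,2)[OF \<psi>] out])
  have iv: "integrable lebesgue (\<lambda>x. grad v x \<bullet> grad \<psi> x)" using i[OF lv continuous_on_const[of UNIV 1]] by simp
  have i1: "integrable lebesgue (\<lambda>x. D1 x * (grad v x \<bullet> grad \<psi> x))" by (rule i[OF lv Ck_on_2D(5)[OF D1(1)]])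
  have i0: "integrable lebesgue (\<lambda>x. (D0 + D1 x) * (G0 x \<bullet> grad \<psi> x))"
    by (rule i[OF G0]) (intro continuous_on_add continuous_on_const Ck_on_2D(5)[OF D1(1)])
  have "(\<integral>x. (D0 + D1 x) * ((grad v x + G0 x) \<bullet> grad \<psi> x) \<partial>lebesgue) =
    (\<integral>x. D0 * (grad v x \<bullet> grad \<psi> x) + D1 x * (grad v x \<bullet> grad \<psi> x) + (D0 + D1 x) * (G0 x \<bullet> grad \<psi> x) \<partial>lebesgue)"
    by (rule Bochner_Integration.integral_cong) (simp_all add: inner_add_left algebra_simps)
  also have "\<dots> = D0 * (\<integral>x. grad v x \<bullet> grad \<psi> x \<partial>lebesgue)"
    using iv i1 i0 corr[OF \<psi>] by simp
  also have "\<dots> = 0"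
    using grad_grad_integral[OF v(1) test_functionD(1,2)[OF \<psi>]] v(2) by simp
  finally show "(\<integral>x. (D0 + D1 x) * ((grad v x + G0 x) \<bullet> grad \<psi> x) \<partial>lebesgue) = 0" .
qed

text \<open>If \<open>U = v + \<phi>\<^sub>0\<close> solves the diffusion problem, then \<open>\<Phi> = (s / s\<^sub>0) U - v\<close> is the Helmholtz corrector
  of \<open>v\<close>: Liouville's substitution gives \<open>\<Delta>\<Phi> = q (v + \<Phi>)\<close>, and \<open>\<Phi>\<close> coincides with \<open>\<phi>\<^sub>0\<close> away from the
  support of \<open>D\<^sub>1\<close>, so it decays and is a Newtonian potential.\<close>

lemma corrector_potential:
  assumes v: "Ck_on 2 UNIV v" "\<And>x. laplacian v x = 0" and U: "is_weak_grad UNIV U G" and G: "weak_flux G"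
    and C: "\<And>x. norm x \<ge> R \<Longrightarrow> \<bar>U x - v x\<bar> \<le> C * norm x powr (1 - real CARD('n))"
  defines "\<Phi> \<equiv> \<lambda>x. s x / s0 * U x - v x"
  shows "loc_integrable UNIV \<Phi>" "integrable lebesgue (\<lambda>x. q x * (v x + \<Phi> x))"
    "AE y in lebesgue. \<Phi> y = - (\<integral>x. (q x * (v x + \<Phi> x)) * fundamental_solution (x - y) \<partial>lebesgue)"
proof -
  have lU: "loc_integrable UNIV U" by (rule is_weak_gradD(1)[OF U])
  have cs: "continuous_on UNIV (\<lambda>x. s x / s0)" using Ck_on_2D(5)[OF Ck_s] s0_pos by (intro continuous_on_divide continuous_on_const) auto
  show l\<Phi>: "loc_integrable UNIV \<Phi>"
    unfolding \<Phi>_def by (intro loc_integrable_diff loc_integrable_mult_continuous lU cs loc_integrable_continuous Ck_on_2D(5)[OF v(1)])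
  have q0: "q x = 0" if "x \<notin> supp D1" for x using q_out[OF that] .
  have lv\<Phi>: "loc_integrable UNIV (\<lambda>x. v x + \<Phi> x)"
    by (intro loc_integrable_add l\<Phi> loc_integrable_continuous Ck_on_2D(5)[OF v(1)])
  have "integrable lebesgue (\<lambda>x. (v x + \<Phi> x) * q x)"
    by (rule loc_integrable_times_compact_supp[OF lv\<Phi> continuous_q compact_supp_D1 subset_UNIV q0])
  then show qi: "integrable lebesgue (\<lambda>x. q x * (v x + \<Phi> x))" by (simp add: mult.commute)
  obtain r where r: "r > 0" "\<And>x. x \<in> supp D1 \<Longrightarrow> norm x \<le> r"
    using compact_imp_bounded[OF compact_supp_D1] unfolding bounded_pos by blast
  have far: "x \<notin> supp D1" if "norm x > r" for x using r(2)[of x] that by linarith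
  show "AE y in lebesgue. \<Phi> y = - (\<integral>x. (q x * (v x + \<Phi> x)) * fundamental_solution (x - y) \<partial>lebesgue)"
  proof (rule newtonian_potential[OF dim l\<Phi> _ qi])
    show "\<bar>\<Phi> x\<bar> \<le> C * norm x powr (1 - real CARD('n))" if "norm x \<ge> max R (r + 1)" for x
    proof -
      have "\<Phi> x = U x - v x" using s_out[OF far, of x] s0_pos that by (simp add: \<Phi>_def)
      then show ?thesis using C[of x] that by simp
    qed
    show "q x * (v x + \<Phi> x) = 0" if "norm x > r" for x using q0[OF far[OF that]] by simp
    fix \<eta> :: "real ^ 'n \<Rightarrow> real" assume \<eta>: "test_function UNIV \<eta>"
    note e = test_functionD(1)[OF \<eta>, of 2] test_functionD(2)[OF \<eta>]
    have c\<eta>: "compact (supp (laplacian \<eta>))"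
    proof (rule compact_suppI[OF e(2)])
      fix x assume "x \<notin> supp \<eta>"
      then have "x \<notin> supp (partial k \<eta>)" for k using supp_partial by blast
      then show "laplacian \<eta> x = 0" by (simp add: laplacian_def partial_not_in_supp)
    qed
    have vx: "v x + \<Phi> x = s x / s0 * U x" for x by (simp add: \<Phi>_def)
    have i1: "integrable lebesgue (\<lambda>x. (v x + \<Phi> x) * laplacian \<eta> x)"
      by (rule loc_integrable_times_compact_supp[OF lv\<Phi> Ck_on_2D(7)[OF e(1)] c\<eta> subset_UNIV]) (rule not_in_supp)
    have i2: "integrable lebesgue (\<lambda>x. v x * laplacian \<eta> x)"
      by (rule loc_integrable_times_compact_supp[OF loc_integrable_continuous[OF Ck_on_2D(5)[OF v(1)]] Ck_on_2D(7)[OF e(1)] c\<eta> subset_UNIV])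
        (rule not_in_supp)
    have i3: "integrable lebesgue (\<lambda>x. (v x + \<Phi> x) * (q x * \<eta> x))"
      by (rule loc_integrable_times_compact_supp[OF lv\<Phi> _ compact_supp_D1 subset_UNIV])
        (intro continuous_on_mult continuous_q Ck_on_2D(5)[OF e(1)], simp add: q0)
    have "(\<integral>x. (1 / s0) * (U x * (s x * laplacian \<eta> x - \<eta> x * laplacian s x)) \<partial>lebesgue) = 0"
      using liouville_identity[OF U G e] by simp
    moreover have "(1 / s0) * (U x * (s x * laplacian \<eta> x - \<eta> x * laplacian s x)) =
      (v x + \<Phi> x) * laplacian \<eta> x - (v x + \<Phi> x) * (q x * \<eta> x)" for x
      unfolding vx q_s[symmetric] by (simp add: algebra_simps)
    ultimately have "(\<integral>x. (v x + \<Phi> x) * laplacian \<eta> x - (v x + \<Phi> x) * (q x * \<eta> x) \<partial>lebesgue) = 0"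
      by (simp only:)
    then have "(\<integral>x. (v x + \<Phi> x) * laplacian \<eta> x \<partial>lebesgue) = (\<integral>x. (v x + \<Phi> x) * (q x * \<eta> x) \<partial>lebesgue)"
      using i1 i3 by simp
    moreover have "(\<integral>x. \<Phi> x * laplacian \<eta> x \<partial>lebesgue) = (\<integral>x. (v x + \<Phi> x) * laplacian \<eta> x \<partial>lebesgue)"
    proof -
      have "(\<integral>x. v x * laplacian \<eta> x \<partial>lebesgue) = 0"
        using laplacian_symmetric[OF v(1) e] v(2) by simp
      moreover have "(\<integral>x. \<Phi> x * laplacian \<eta> x \<partial>lebesgue) = (\<integral>x. (v x + \<Phi> x) * laplacian \<eta> x - v x * laplacian \<eta> x \<partial>lebesgue)"
        by (simp add: algebra_simps)
      ultimately show ?thesis using i1 i2 by simp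
    qed
    ultimately show "(\<integral>x. \<Phi> x * laplacian \<eta> x \<partial>lebesgue) = (\<integral>x. q x * (v x + \<Phi> x) * \<eta> x \<partial>lebesgue)"
      by (simp add: mult_ac)
  qed
qed

lemma q_times_integrable:
  assumes "L2 (lebesgue_on B) f"
  shows "integrable lebesgue (\<lambda>x. q x * f x)"
proof -
  have fm: "finite_measure (lebesgue_on B)" using B by (intro finite_measure_lebesgue_on_bounded) auto
  have "integrable (lebesgue_on B) (\<lambda>x. q x * f x)"
    by (rule L2_imp_integrable[OF fm L2_mult_continuous[OF assms continuous_q B(2)]])
  then show ?thesis
    using integral_lebesgue_on_eq(2)[of B "\<lambda>x. q x * f x"] B(1) q_out_B by simp
qed

lemma T_op_eq: "T_op B q f y = (\<integral>x. (q x * f x) * fundamental_solution (x - y) \<partial>lebesgue)"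
  unfolding T_op_def by (rule integral_lebesgue_on_eq(1)) (use B(1) q_out_B in auto)

lemma T_op_AE_integrable:
  assumes "L2 (lebesgue_on B) f"
  shows "AE y in lebesgue. integrable lebesgue (\<lambda>x. (q x * f x) * fundamental_solution (x - y))"
proof -
  obtain r where r: "r > 0" "\<And>x. x \<in> B \<Longrightarrow> norm x \<le> r"
    using B(2) unfolding bounded_pos by blast
  have "q x * f x = 0" if "norm x > r" for x using q_out_B[of x] r(2)[of x] that by fastforce
  then show ?thesis by (rule potential_AE_integrable[OF dim q_times_integrable[OF assms]])
qed

lemma AE_B_iff: "(AE x in lebesgue_on B. P x) \<longleftrightarrow> (AE x in lebesgue. x \<in> B \<longrightarrow> P x)"
  using B(1) by (subst AE_restrict_space_iff) auto

text \<open>As \<open>-1\<close> is not an eigenvalue of \<open>T\<close>, the Helmholtz corrector \<open>\<phi>\<close> of \<open>v\<close> is the function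
  \<open>\<Phi> = (s / s\<^sub>0) U - v\<close> built from the diffusion corrector. Then \<open>D\<^sub>0 q (v + \<phi>) n = s\<^sub>0 U n \<Delta>s\<close>, the right-hand side of
  the tested diffusion equation.\<close>

theorem polarization_tensors_agree:
  assumes T: "\<not> eigenvalue_T B q (- 1)"
    and v: "Ck_on 2 UNIV v" "\<And>x. laplacian v x = 0" and n: "Ck_on 2 UNIV n" "\<And>x. laplacian n x = 0"
    and \<phi>: "L2 (lebesgue_on B) \<phi>" "AE y in lebesgue_on B. \<phi> y + T_op B q \<phi> y = - T_op B q v y"
    and \<phi>0: "is_weak_grad UNIV \<phi>0 G0" "L2 (lebesgue_on B) \<phi>0"
      "\<And>\<psi>. test_function UNIV \<psi> \<Longrightarrow> (\<integral>x. (D0 + D1 x) * (G0 x \<bullet> grad \<psi> x) \<partial>lebesgue) =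
          - (\<integral>x. D1 x * (grad v x \<bullet> grad \<psi> x) \<partial>lebesgue)"
      "\<And>x. norm x \<ge> R \<Longrightarrow> \<bar>\<phi>0 x\<bar> \<le> C * norm x powr (1 - real CARD('n))"
  shows "(\<integral>x. D1 x * ((grad v x + G0 x) \<bullet> grad n x) \<partial>lebesgue_on B) =
    D0 * (\<integral>x. q x * (v x + \<phi> x) * n x \<partial>lebesgue_on B)"
proof -
  define U where "U x = v x + \<phi>0 x" for x
  define G where "G x = grad v x + G0 x" for x
  have flux: "weak_flux G"
    unfolding G_def[abs_def] by (rule corrector_weak_flux[OF v is_weak_gradD(2)[OF \<phi>0(1)]]) (fact \<phi>0(3))
  have U: "is_weak_grad UNIV U G"
    unfolding U_def[abs_def] G_def[abs_def]
    by (rule is_weak_grad_add[OF open_UNIV Ck_is_weak_grad[OF open_UNIV Ck_on_2D(1)[OF v(1)]] \<phi>0(1)])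
  define \<Phi> where "\<Phi> = (\<lambda>x. s x / s0 * U x - v x)"
  have grow: "\<bar>U x - v x\<bar> \<le> C * norm x powr (1 - real CARD('n))" if "norm x \<ge> R" for x
    using \<phi>0(4)[OF that] by (simp add: U_def)
  have pot: "integrable lebesgue (\<lambda>x. q x * (v x + \<Phi> x))"
    "AE y in lebesgue. \<Phi> y = - (\<integral>x. (q x * (v x + \<Phi> x)) * fundamental_solution (x - y) \<partial>lebesgue)"
    unfolding \<Phi>_def by (rule corrector_potential[OF v U flux], fact grow)+
  have L2v: "L2 (lebesgue_on B) v" by (rule L2_continuous[OF Ck_on_2D(5)[OF v(1)] B(2)]) (use B(1) in simp)
  have L2\<Phi>: "L2 (lebesgue_on B) \<Phi>"
    unfolding \<Phi>_def U_def using s0_pos Ck_on_2D(5)[OF Ck_s]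
    by (intro L2_diff L2_mult_continuous L2_add L2v \<phi>0(2) B(2) continuous_on_divide continuous_on_const) auto
  have L2d: "L2 (lebesgue_on B) (\<lambda>x. \<phi> x - \<Phi> x)" by (intro L2_diff \<phi> L2\<Phi>)
  have "AE y in lebesgue. y \<in> B \<longrightarrow> T_op B q (\<lambda>x. \<phi> x - \<Phi> x) y = - 1 * (\<phi> y - \<Phi> y)"
    using pot(2) \<phi>(2)[unfolded AE_B_iff] T_op_AE_integrable[OF L2v] T_op_AE_integrable[OF L2\<Phi>] T_op_AE_integrable[OF \<phi>(1)]
  proof eventually_elim
    case (elim y)
    have 1: "T_op B q (\<lambda>x. \<phi> x - \<Phi> x) y = T_op B q \<phi> y - T_op B q \<Phi> y"
      unfolding T_op_eq right_diff_distrib left_diff_distrib using elim(4,5) by simp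
    have 2: "\<Phi> y = - (T_op B q v y + T_op B q \<Phi> y)"
      using elim(1) elim(3,4) unfolding T_op_eq distrib_left distrib_right by simp
    show ?case
    proof
      assume "y \<in> B"
      then show "T_op B q (\<lambda>x. \<phi> x - \<Phi> x) y = - 1 * (\<phi> y - \<Phi> y)" using elim(2) 1 2 by simp
    qed
  qed
  then have "AE y in lebesgue_on B. \<phi> y - \<Phi> y = 0"
    using T L2d unfolding eigenvalue_T_def AE_B_iff[symmetric] by blast
  then have eq: "AE y in lebesgue_on B. \<phi> y = \<Phi> y" by eventually_elim simp
  have lU: "loc_integrable UNIV U" by (rule is_weak_gradD(1)[OF U])
  have "D0 * (\<integral>x. q x * (v x + \<phi> x) * n x \<partial>lebesgue_on B) = D0 * (\<integral>x. q x * (v x + \<Phi> x) * n x \<partial>lebesgue_on B)"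
  proof (rule arg_cong[where f = "(*) D0"], rule integral_cong_AE)
    have m: "(\<lambda>x. q x * (v x + w x) * n x) \<in> borel_measurable (lebesgue_on B)" if "L2 (lebesgue_on B) w" for w
      using continuous_measurable_lebesgue_on[OF continuous_q, of B] continuous_measurable_lebesgue_on[OF Ck_on_2D(5)[OF v(1)], of B]
        continuous_measurable_lebesgue_on[OF Ck_on_2D(5)[OF n(1)], of B] that unfolding L2_def
      by (intro borel_measurable_times borel_measurable_add) auto
    show "(\<lambda>x. q x * (v x + \<phi> x) * n x) \<in> borel_measurable (lebesgue_on B)"
      "(\<lambda>x. q x * (v x + \<Phi> x) * n x) \<in> borel_measurable (lebesgue_on B)" using m[OF \<phi>(1)] m[OF L2\<Phi>] .
    show "AE x in lebesgue_on B. q x * (v x + \<phi> x) * n x = q x * (v x + \<Phi> x) * n x" using eq by eventually_elim simp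
  qed
  also have "\<dots> = D0 * (\<integral>x. q x * (v x + \<Phi> x) * n x \<partial>lebesgue)"
    using integral_lebesgue_on_eq(1)[of B "\<lambda>x. q x * (v x + \<Phi> x) * n x"] B(1) q_out_B by simp
  also have "\<dots> = (\<integral>x. D0 * (q x * (v x + \<Phi> x) * n x) \<partial>lebesgue)" by simp
  also have "\<dots> = (\<integral>x. s0 * (U x * (n x * laplacian s x)) \<partial>lebesgue)"
  proof (intro Bochner_Integration.integral_cong refl)
    fix x
    have "D0 * (q x * (v x + \<Phi> x) * n x) = (s0\<^sup>2 / s0) * (U x * (n x * (q x * s x)))"
      by (simp add: \<Phi>_def s0_square)
    also have "s0\<^sup>2 / s0 = s0" using s0_pos by (simp add: power2_eq_square)
    finally show "D0 * (q x * (v x + \<Phi> x) * n x) = s0 * (U x * (n x * laplacian s x))" by (simp only: q_s)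
  qed
  also have "\<dots> = (\<integral>x. D1 x * (G x \<bullet> grad n x) \<partial>lebesgue)"
    using diffusion_tensor_identity[OF U flux n] by simp
  also have "\<dots> = (\<integral>x. D1 x * (G x \<bullet> grad n x) \<partial>lebesgue_on B)"
    by (rule integral_lebesgue_on_eq(1)[symmetric]) (use B(1) D1(2) not_in_supp[of _ D1] in auto)
  finally show ?thesis by (simp add: G_def)
qed

end

section \<open>Weakly harmonic functions\<close>

lemma continuous_AE_zero:
  fixes f :: "real ^ 'n::finite \<Rightarrow> real"
  assumes W: "open W" and f: "continuous_on W f" and ae: "AE x in lebesgue. x \<in> W \<longrightarrow> f x = 0" and x: "x \<in> W"
  shows "f x = 0"
proof (rule ccontr)
  assume nz: "f x \<noteq> 0"
  define U where "U = W \<inter> f -` (- {0})"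
  have U: "open U" unfolding U_def by (rule continuous_open_preimage[OF f W]) (simp add: open_Compl)
  have "AE x in lebesgue. x \<notin> U" using ae by eventually_elim (auto simp: U_def)
  then have "U \<in> null_sets lebesgue"
    using U AE_iff_null_sets[of U lebesgue] by simp
  then have "negligible U" by (simp add: negligible_iff_null_sets)
  moreover have "x \<in> U" using x nz by (simp add: U_def)
  ultimately show False using open_not_negligible[OF U] by blast
qed

lemma smooth_laplacian_continuous:
  fixes f :: "real ^ 'n::finite \<Rightarrow> real"
  assumes "smooth_on W f" shows "continuous_on W (laplacian f)"
  unfolding laplacian_def[abs_def]
  by (intro continuous_on_sum smooth_on_imp_continuous smooth_on_partial assms)

text \<open>The function is tested only on an open subset \<open>W\<close> of the domain of its weak gradient: for the
  Neumann function, \<open>W\<close> leaves out the pole.\<close>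

lemma weakly_harmonic:
  fixes f :: "real ^ 'n::finite \<Rightarrow> real"
  assumes W: "open W" and f: "smooth_on W f" and G: "is_weak_grad \<Omega> f G" and \<Omega>: "open \<Omega>" "W \<subseteq> \<Omega>"
    and test: "\<And>\<psi>. test_function W \<psi> \<Longrightarrow> (\<integral>x. G x \<bullet> grad \<psi> x \<partial>lebesgue_on \<Omega>) = 0"
    and x: "x \<in> W"
  shows "laplacian f x = 0"
proof (rule continuous_AE_zero[OF W smooth_laplacian_continuous[OF f] _ x])
  show "AE x in lebesgue. x \<in> W \<longrightarrow> laplacian f x = 0"
  proof (rule AE_zero_if_test_integrals_zero[OF W])
    show "loc_integrable W (laplacian f)" by (rule loc_integrable_continuous[OF smooth_laplacian_continuous[OF f]])
    fix \<psi> :: "real ^ 'n \<Rightarrow> real" assume \<psi>: "test_function W \<psi>"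
    have out: "partial k \<psi> x = 0" if "x \<notin> \<Omega>" for k x
      using that test_functionD(3)[OF \<psi>] \<Omega>(2) partial_not_in_supp[of x \<psi>] by blast
    have \<psi>k: "test_function W (partial k \<psi>)" for k by (rule test_function_partial[OF \<psi>])
    note w = is_weak_grad_test[OF G \<Omega>(1) test_function_mono[OF \<psi>k \<Omega>(2)]]
    have f1: "Ck_on 1 W f" "Ck_on 1 W (partial k f)" for k
      using smooth_onD[OF f] smooth_onD[OF smooth_on_partial[OF f]] by blast+
    note i1 = integration_by_parts[OF W f1(1) test_functionD(1,2,3)[OF \<psi>k]]
    note i2 = integration_by_parts[OF W f1(2) test_functionD(1,2,3)[OF \<psi>]]
    have "0 = (\<integral>x. G x \<bullet> grad \<psi> x \<partial>lebesgue)"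
      using test[OF \<psi>] integral_lebesgue_on_eq(1)[OF open_lebesgue[OF \<Omega>(1)], of "\<lambda>x. G x \<bullet> grad \<psi> x"] out
      by (simp add: inner_grad)
    also have "\<dots> = (\<Sum>k\<in>UNIV. \<integral>x. G x $ k * partial k \<psi> x \<partial>lebesgue)"
      unfolding inner_grad by (rule Bochner_Integration.integral_sum) (rule w(3))
    also have "\<dots> = (\<Sum>k\<in>UNIV. - (\<integral>x. f x * partial k (partial k \<psi>) x \<partial>lebesgue))"
      by (simp add: w(1))
    also have "\<dots> = (\<Sum>k\<in>UNIV. - (\<integral>x. partial k (partial k f) x * \<psi> x \<partial>lebesgue))"
      by (simp add: i1(1) i2(1))
    also have "\<dots> = - (\<integral>x. laplacian f x * \<psi> x \<partial>lebesgue)"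
      unfolding laplacian_def sum_distrib_right sum_negf
      by (subst Bochner_Integration.integral_sum) (simp_all add: i2(3))
    finally show "(\<integral>x. laplacian f x * \<psi> x \<partial>lebesgue) = 0" by simp
  qed
qed

section \<open>The surface measure\<close>

lemma sets_surface_measure: "sets (hausdorff_measure s :: 'a::metric_space measure) = sets borel"
  "space (hausdorff_measure s :: 'a measure) = UNIV"
  using sets.sigma_sets_eq[of "borel :: 'a measure"]
  by (simp_all add: hausdorff_measure_def sets_measure_of_conv space_measure_of_conv)

lemma frontier_surface:
  fixes S :: "(real ^ 'n::finite) set"
  shows "frontier S \<inter> space (hausdorff_measure (real CARD('n) - 1) :: (real ^ 'n) measure) \<in> sets (hausdorff_measure (real CARD('n) - 1))"
  by (simp add: sets_surface_measure frontier_closed)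

lemma space_surface_measure: "space (surface_measure S) = frontier S"
  by (simp add: surface_measure_def space_restrict_space sets_surface_measure)

lemma continuous_measurable_surface:
  fixes f :: "real ^ 'n::finite \<Rightarrow> real"
  assumes "continuous_on UNIV f" shows "f \<in> borel_measurable (surface_measure S)"
  unfolding surface_measure_def
  using borel_measurable_continuous_onI[OF assms]
  by (intro measurable_restrict_space1) (simp add: measurable_cong_sets[OF sets_surface_measure(1) refl])

lemma L2_surface_continuous:
  fixes f :: "real ^ 'n::finite \<Rightarrow> real"
  assumes f: "continuous_on UNIV f" and fm: "finite_measure (surface_measure S)" and S: "bounded S"
  shows "L2 (surface_measure S) f"
proof -
  obtain C where C: "C \<ge> 0" "\<And>x. x \<in> frontier S \<Longrightarrow> \<bar>f x\<bar> \<le> C"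
    using continuous_bounded_on_bounded[OF f bounded_subset[OF bounded_closure[OF S]], of "frontier S"]
    by (auto simp: frontier_def)
  have "L2 (surface_measure S) (\<lambda>x. f x * 1)"
    by (rule L2_mult_bounded[OF L2_const[OF fm] continuous_measurable_surface[OF f], of C]) (simp add: space_surface_measure C)
  then show ?thesis by simp
qed

lemma smooth_on_const: "smooth_on S (\<lambda>x. c)"
  by (simp add: smooth_on_def Ck_on_const)

text \<open>The normalisation in the definition of the Neumann function forces the boundary to have finite
  positive measure: otherwise testing with the constant function one would give \<open>0 = 1\<close>.\<close>

lemma neumann_function_finite_surface:
  fixes \<Omega> :: "(real ^ 'n::finite) set"
  assumes N: "neumann_function \<Omega> N" and y: "y \<in> \<Omega>"
  shows "finite_measure (surface_measure \<Omega>)" "measure (surface_measure \<Omega>) (frontier \<Omega>) > 0"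
proof -
  let ?m = "measure (surface_measure \<Omega>) (frontier \<Omega>)"
  have g: "grad (\<lambda>x. 1) x = 0" for x :: "real ^ 'n" by (simp add: grad_def vec_eq_iff)
  have "(\<integral>x. wgrad \<Omega> (\<lambda>x. N x y) x \<bullet> grad (\<lambda>x. 1) x \<partial>lebesgue_on \<Omega>) = 1 - (\<integral>x. 1 \<partial>surface_measure \<Omega>) / ?m"
    using N y smooth_on_const[of UNIV 1] unfolding neumann_function_def by blast
  then have "?m \<noteq> 0" unfolding g by auto
  then show "?m > 0" by (simp add: zero_less_measure_iff)
  then have "emeasure (surface_measure \<Omega>) (frontier \<Omega>) \<noteq> \<infinity>" by (auto simp: measure_def)
  then show "finite_measure (surface_measure \<Omega>)" by (intro finite_measureI) (simp add: space_surface_measure)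
qed

section \<open>Traces\<close>

lemma continuous_grad: "smooth_on UNIV v \<Longrightarrow> continuous_on UNIV (partial k v)"
  by (intro smooth_on_imp_continuous smooth_on_partial)

lemma L2_vec:
  fixes F :: "'a \<Rightarrow> real ^ 'n::finite"
  assumes "\<And>k. L2 M (\<lambda>x. F x $ k)" shows "L2 M F"
proof -
  have F: "F = (\<lambda>x. \<Sum>k\<in>UNIV. F x $ k *\<^sub>R axis k 1)"
  proof
    show "F x = (\<Sum>k\<in>UNIV. F x $ k *\<^sub>R axis k 1)" for x
      using basis_expansion[of "F x"] by (simp add: scalar_mult_eq_scaleR)
  qed
  have "L2 M (\<lambda>x. F x $ k *\<^sub>R axis k 1 :: real ^ 'n)" for k
    using assms[of k] by (auto simp: L2_def)
  moreover have "L2 M (\<lambda>x. 0 :: real ^ 'n)" by (simp add: L2_def)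
  ultimately have "L2 M (\<lambda>x. \<Sum>k\<in>I. F x $ k *\<^sub>R axis k 1 :: real ^ 'n)" for I :: "'n set"
    by (induction I rule: infinite_finite_induct) (auto intro: L2_add)
  then show ?thesis by (subst F)
qed

lemma L2_grad_smooth:
  fixes v :: "real ^ 'n::finite \<Rightarrow> real"
  assumes v: "smooth_on UNIV v" and \<Omega>: "open \<Omega>" "bounded \<Omega>"
  shows "L2 (lebesgue_on \<Omega>) v" "L2 (lebesgue_on \<Omega>) (grad v)"
  using \<Omega> by (auto intro!: L2_vec L2_continuous smooth_on_imp_continuous[OF v] continuous_grad[OF v] simp: grad_def)

text \<open>The trace relation, with an explicit gradient and in a form that is evidently additive.\<close>

definition trace_pair ::
    "(real ^ 'n::finite) set \<Rightarrow> (real ^ 'n \<Rightarrow> real) \<Rightarrow> (real ^ 'n \<Rightarrow> real ^ 'n) \<Rightarrow> (real ^ 'n \<Rightarrow> real) \<Rightarrow> bool" where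
  "trace_pair \<Omega> u G h \<longleftrightarrow> is_weak_grad \<Omega> u G \<and> L2 (lebesgue_on \<Omega>) u \<and> L2 (lebesgue_on \<Omega>) G \<and> L2 (surface_measure \<Omega>) h \<and>
     (\<exists>v :: nat \<Rightarrow> real ^ 'n \<Rightarrow> real. (\<forall>n. smooth_on UNIV (v n)) \<and>
        (\<lambda>n. \<integral>x. (norm (v n x - u x))\<^sup>2 \<partial>lebesgue_on \<Omega>) \<longlonglongrightarrow> 0 \<and>
        (\<lambda>n. \<integral>x. (norm (grad (v n) x - G x))\<^sup>2 \<partial>lebesgue_on \<Omega>) \<longlonglongrightarrow> 0 \<and>
        (\<lambda>n. \<integral>x. (norm (v n x - h x))\<^sup>2 \<partial>surface_measure \<Omega>) \<longlonglongrightarrow> 0)"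

lemma L2_norm_tendsto_0:
  assumes "(\<lambda>n. L2_norm M (f n)) \<longlonglongrightarrow> 0"
  shows "(\<lambda>n. \<integral>x. (norm (f n x))\<^sup>2 \<partial>M) \<longlonglongrightarrow> 0"
proof -
  have "(\<lambda>n. (L2_norm M (f n))\<^sup>2) \<longlonglongrightarrow> 0\<^sup>2" by (intro tendsto_intros assms)
  then show ?thesis by (simp add: L2_norm_def)
qed

lemma has_trace_imp_trace_pair:
  assumes "has_trace \<Omega> u h" shows "trace_pair \<Omega> u (wgrad \<Omega> u) h"
  using assms unfolding has_trace_def H1_def trace_pair_def
  by (auto intro: wgrad_is_weak_grad dest!: L2_norm_tendsto_0)

lemma L2_tendsto_add:
  fixes f g :: "nat \<Rightarrow> 'a \<Rightarrow> 'b::euclidean_space"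
  assumes f: "\<And>n. L2 M (f n)" "(\<lambda>n. \<integral>x. (norm (f n x))\<^sup>2 \<partial>M) \<longlonglongrightarrow> 0"
    and g: "\<And>n. L2 M (g n)" "(\<lambda>n. \<integral>x. (norm (g n x))\<^sup>2 \<partial>M) \<longlonglongrightarrow> 0"
  shows "(\<lambda>n. \<integral>x. (norm (f n x + g n x))\<^sup>2 \<partial>M) \<longlonglongrightarrow> 0"
proof (rule tendsto_sandwich[OF always_eventually always_eventually tendsto_const])
  have "(\<lambda>n. 2 * (\<integral>x. (norm (f n x))\<^sup>2 \<partial>M) + 2 * (\<integral>x. (norm (g n x))\<^sup>2 \<partial>M)) \<longlonglongrightarrow> 2 * 0 + 2 * 0"
    by (intro tendsto_intros f g)
  then show "(\<lambda>n. 2 * (\<integral>x. (norm (f n x))\<^sup>2 \<partial>M) + 2 * (\<integral>x. (norm (g n x))\<^sup>2 \<partial>M)) \<longlonglongrightarrow> 0" by simp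
  show "\<forall>n. 0 \<le> (\<integral>x. (norm (f n x + g n x))\<^sup>2 \<partial>M)" by simp
  show "\<forall>n. (\<integral>x. (norm (f n x + g n x))\<^sup>2 \<partial>M) \<le> 2 * (\<integral>x. (norm (f n x))\<^sup>2 \<partial>M) + 2 * (\<integral>x. (norm (g n x))\<^sup>2 \<partial>M)"
  proof
    fix n
    have i: "integrable M (\<lambda>x. (norm (f n x))\<^sup>2)" "integrable M (\<lambda>x. (norm (g n x))\<^sup>2)"
      "integrable M (\<lambda>x. (norm (f n x + g n x))\<^sup>2)"
      using f(1)[of n] g(1)[of n] L2_add[OF f(1)[of n] g(1)[of n]] by (simp_all add: L2_def)
    have "(norm (u + v))\<^sup>2 \<le> 2 * (norm u)\<^sup>2 + 2 * (norm v)\<^sup>2" for u v :: 'b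
    proof -
      have "(norm (u + v))\<^sup>2 \<le> (norm u + norm v)\<^sup>2" by (intro power_mono norm_triangle_ineq) simp
      also have "\<dots> \<le> 2 * (norm u)\<^sup>2 + 2 * (norm v)\<^sup>2"
        using zero_le_power2[of "norm u - norm v"] by (simp add: power2_eq_square algebra_simps)
      finally show ?thesis .
    qed
    then have "(\<integral>x. (norm (f n x + g n x))\<^sup>2 \<partial>M) \<le> (\<integral>x. 2 * (norm (f n x))\<^sup>2 + 2 * (norm (g n x))\<^sup>2 \<partial>M)"
      using i by (intro integral_mono) auto
    then show "(\<integral>x. (norm (f n x + g n x))\<^sup>2 \<partial>M) \<le> 2 * (\<integral>x. (norm (f n x))\<^sup>2 \<partial>M) + 2 * (\<integral>x. (norm (g n x))\<^sup>2 \<partial>M)"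
      using i by simp
  qed
qed

lemma grad_add:
  assumes "smooth_on UNIV v" "smooth_on UNIV w"
  shows "grad (\<lambda>x. v x + w x) x = grad v x + grad w x"
  using smooth_on_differentiable[OF assms(1) open_UNIV UNIV_I] smooth_on_differentiable[OF assms(2) open_UNIV UNIV_I]
  by (simp add: grad_def vec_eq_iff partial_add)

lemma smooth_on_add: "open S \<Longrightarrow> smooth_on S v \<Longrightarrow> smooth_on S w \<Longrightarrow> smooth_on S (\<lambda>x. v x + w x)"
  by (simp add: smooth_on_def Ck_on_add)

lemma smooth_on_mult: "open S \<Longrightarrow> smooth_on S v \<Longrightarrow> smooth_on S w \<Longrightarrow> smooth_on S (\<lambda>x. v x * w x)"
  by (simp add: smooth_on_def Ck_on_mult)

lemma trace_pair_add:
  assumes \<Omega>: "open \<Omega>" "bounded \<Omega>" and fm: "finite_measure (surface_measure \<Omega>)"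
    and t: "trace_pair \<Omega> u G h" and t': "trace_pair \<Omega> u' G' h'"
  shows "trace_pair \<Omega> (\<lambda>x. u x + u' x) (\<lambda>x. G x + G' x) (\<lambda>x. h x + h' x)"
proof -
  have T: "is_weak_grad \<Omega> u G" "L2 (lebesgue_on \<Omega>) u" "L2 (lebesgue_on \<Omega>) G" "L2 (surface_measure \<Omega>) h"
    "is_weak_grad \<Omega> u' G'" "L2 (lebesgue_on \<Omega>) u'" "L2 (lebesgue_on \<Omega>) G'" "L2 (surface_measure \<Omega>) h'"
    using t t' unfolding trace_pair_def by simp_all
  obtain v where v: "\<And>n. smooth_on UNIV (v n)"
    "(\<lambda>n. \<integral>x. (norm (v n x - u x))\<^sup>2 \<partial>lebesgue_on \<Omega>) \<longlonglongrightarrow> 0"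
    "(\<lambda>n. \<integral>x. (norm (grad (v n) x - G x))\<^sup>2 \<partial>lebesgue_on \<Omega>) \<longlonglongrightarrow> 0"
    "(\<lambda>n. \<integral>x. (norm (v n x - h x))\<^sup>2 \<partial>surface_measure \<Omega>) \<longlonglongrightarrow> 0"
    using t unfolding trace_pair_def by blast
  obtain w where w: "\<And>n. smooth_on UNIV (w n)"
    "(\<lambda>n. \<integral>x. (norm (w n x - u' x))\<^sup>2 \<partial>lebesgue_on \<Omega>) \<longlonglongrightarrow> 0"
    "(\<lambda>n. \<integral>x. (norm (grad (w n) x - G' x))\<^sup>2 \<partial>lebesgue_on \<Omega>) \<longlonglongrightarrow> 0"
    "(\<lambda>n. \<integral>x. (norm (w n x - h' x))\<^sup>2 \<partial>surface_measure \<Omega>) \<longlonglongrightarrow> 0"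
    using t' unfolding trace_pair_def by blast
  note d = L2_diff[OF L2_grad_smooth(1)[OF _ \<Omega>]] L2_diff[OF L2_grad_smooth(2)[OF _ \<Omega>]]
    L2_diff[OF L2_surface_continuous[OF smooth_on_imp_continuous fm \<Omega>(2)]]
  have e: "(v n x - u x) + (w n x - u' x) = (v n x + w n x) - (u x + u' x)"
    "(grad (v n) x - G x) + (grad (w n) x - G' x) = grad (\<lambda>x. v n x + w n x) x - (G x + G' x)"
    "(v n x - h x) + (w n x - h' x) = (v n x + w n x) - (h x + h' x)" for n x
    by (simp_all add: grad_add[OF v(1) w(1)])
  note l = L2_tendsto_add[OF d(1)[OF v(1) T(2)] v(2) d(1)[OF w(1) T(6)] w(2)]
    L2_tendsto_add[OF d(2)[OF v(1) T(3)] v(3) d(2)[OF w(1) T(7)] w(3)]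
    L2_tendsto_add[OF d(3)[OF v(1) T(4)] v(4) d(3)[OF w(1) T(8)] w(4)]
  show ?thesis
    unfolding trace_pair_def
    by (intro conjI is_weak_grad_add[OF \<Omega>(1)] L2_add T exI[of _ "\<lambda>n x. v n x + w n x"] allI smooth_on_add open_UNIV v(1) w(1)
        l[unfolded e])
qed

lemma trace_pair_zero: "trace_pair \<Omega> (\<lambda>x. 0) (\<lambda>x. 0) (\<lambda>x. 0)"
proof -
  have g: "grad (\<lambda>x. 0) x = 0" for x :: "real ^ 'a" by (simp add: grad_def vec_eq_iff)
  have "is_weak_grad \<Omega> (\<lambda>x. 0) (\<lambda>x. 0)"
    by (simp add: is_weak_grad_def loc_integrable_def)
  then show ?thesis unfolding trace_pair_def
    by (auto simp: L2_def g smooth_on_const intro!: exI[of _ "\<lambda>n x. 0"])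
qed

lemma trace_pair_sum:
  assumes \<Omega>: "open \<Omega>" "bounded \<Omega>" and fm: "finite_measure (surface_measure \<Omega>)"
    and t: "\<And>i. i \<in> I \<Longrightarrow> trace_pair \<Omega> (u i) (G i) (h i)"
  shows "trace_pair \<Omega> (\<lambda>x. \<Sum>i\<in>I. u i x) (\<lambda>x. \<Sum>i\<in>I. G i x) (\<lambda>x. \<Sum>i\<in>I. h i x)"
  using t by (induction I rule: infinite_finite_induct) (auto intro: trace_pair_zero trace_pair_add[OF \<Omega> fm])

text \<open>Young's inequality with a parameter, which is chosen small before \<open>n\<close> is chosen large.\<close>

lemma L2_tendsto_pairing:
  fixes f :: "'a \<Rightarrow> 'b::euclidean_space" and g :: "nat \<Rightarrow> 'a \<Rightarrow> 'c::euclidean_space"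
  assumes f: "L2 M f" and g: "\<And>n. L2 M (g n)" "(\<lambda>n. \<integral>x. (norm (g n x))\<^sup>2 \<partial>M) \<longlonglongrightarrow> 0"
  shows "integrable M (\<lambda>x. norm (f x) * norm (g n x))" "(\<lambda>n. \<integral>x. norm (f x) * norm (g n x) \<partial>M) \<longlonglongrightarrow> 0"
proof -
  have fi: "integrable M (\<lambda>x. (norm (f x))\<^sup>2)" "f \<in> borel_measurable M" using f by (auto simp: L2_def)
  have gi: "integrable M (\<lambda>x. (norm (g n x))\<^sup>2)" "g n \<in> borel_measurable M" for n using g(1)[of n] by (auto simp: L2_def)
  have young: "a * b \<le> (e * a\<^sup>2 + b\<^sup>2 / e) / 2" if "e > 0" for a b e :: real
  proof -
    have "0 \<le> (e * a - b)\<^sup>2 / e" using that by simp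
    also have "\<dots> = e * a\<^sup>2 + b\<^sup>2 / e - 2 * (a * b)"
      using that by (simp add: power2_eq_square field_simps)
    finally show ?thesis by simp
  qed
  show ip: "integrable M (\<lambda>x. norm (f x) * norm (g n x))" for n
  proof (rule Bochner_Integration.integrable_bound)
    show "integrable M (\<lambda>x. (1 * (norm (f x))\<^sup>2 + (norm (g n x))\<^sup>2 / 1) / 2)" using fi gi by simp
    show "AE x in M. norm (norm (f x) * norm (g n x)) \<le> norm ((1 * (norm (f x))\<^sup>2 + (norm (g n x))\<^sup>2 / 1) / 2)"
      using young[of 1] by (auto intro!: AE_I2 simp: abs_of_nonneg)
  qed (use fi gi in simp)
  define F where "F = (\<integral>x. (norm (f x))\<^sup>2 \<partial>M)"
  have F: "F \<ge> 0" by (simp add: F_def)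
  have bound: "(\<integral>x. norm (f x) * norm (g n x) \<partial>M) \<le> (e * F + (\<integral>x. (norm (g n x))\<^sup>2 \<partial>M) / e) / 2" if "e > 0" for e n
  proof -
    have "(\<integral>x. norm (f x) * norm (g n x) \<partial>M) \<le> (\<integral>x. (e * (norm (f x))\<^sup>2 + (norm (g n x))\<^sup>2 / e) / 2 \<partial>M)"
      using fi gi ip young[OF that] by (intro integral_mono) auto
    then show ?thesis using fi gi by (simp add: F_def)
  qed
  show "(\<lambda>n. \<integral>x. norm (f x) * norm (g n x) \<partial>M) \<longlonglongrightarrow> 0"
  proof (rule LIMSEQ_I)
    fix r :: real assume r: "r > 0"
    define e where "e = r / (F + 1)"
    have e: "e > 0" "e * F < r" using r F by (simp_all add: e_def field_simps)
    have "r * e > 0" using r e by simp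
    from LIMSEQ_D[OF g(2) this] obtain n0 where n0: "\<And>n. n \<ge> n0 \<Longrightarrow> \<bar>\<integral>x. (norm (g n x))\<^sup>2 \<partial>M\<bar> < r * e" by auto
    have "norm ((\<integral>x. norm (f x) * norm (g n x) \<partial>M) - 0) < r" if "n \<ge> n0" for n
    proof -
      have "(\<integral>x. (norm (g n x))\<^sup>2 \<partial>M) / e < r"
        using n0[OF that] e by (simp add: divide_less_eq)
      then have "(e * F + (\<integral>x. (norm (g n x))\<^sup>2 \<partial>M) / e) / 2 < r" using e(2) by simp
      then have "(\<integral>x. norm (f x) * norm (g n x) \<partial>M) < r" using bound[OF e(1), of n] by linarith
      then show ?thesis by simp
    qed
    then show "\<exists>no. \<forall>n\<ge>no. norm ((\<integral>x. norm (f x) * norm (g n x) \<partial>M) - 0) < r" by blast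
  qed
qed

text \<open>An \<open>H\<^sup>1\<close> function that vanishes near the boundary has trace zero. The proof uses the Neumann
  function in place of a trace inequality: testing its variational equation with \<open>b v\<^sub>n\<close>, where \<open>b\<close> is
  a test function supported near the boundary and \<open>v\<^sub>n\<close> converges to the given function, shows that
  the trace is orthogonal to all such \<open>b\<close>.\<close>

lemma trace_of_zero:
  fixes \<Omega> :: "(real ^ 'n::finite) set"
  assumes \<Omega>: "open \<Omega>" "bounded \<Omega>" and N: "neumann_function \<Omega> N" and y: "y \<in> \<Omega>"
    and t: "trace_pair \<Omega> u G h" and K: "compact K" "K \<subseteq> \<Omega>" and u0: "AE x in lebesgue. x \<in> \<Omega> - K \<longrightarrow> u x = 0"
  shows "AE x in surface_measure \<Omega>. h x = 0"
proof -
  let ?\<sigma> = "surface_measure \<Omega>"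
  note fm = neumann_function_finite_surface(1)[OF N y]
  let ?m = "measure ?\<sigma> (frontier \<Omega>)"
  have m: "?m > 0" by (rule neumann_function_finite_surface(2)[OF N y])
  have T: "is_weak_grad \<Omega> u G" "L2 (lebesgue_on \<Omega>) u" "L2 (lebesgue_on \<Omega>) G" "L2 ?\<sigma> h"
    using t unfolding trace_pair_def by simp_all
  obtain v where v: "\<And>n. smooth_on UNIV (v n)"
    "(\<lambda>n. \<integral>x. (norm (v n x - u x))\<^sup>2 \<partial>lebesgue_on \<Omega>) \<longlonglongrightarrow> 0"
    "(\<lambda>n. \<integral>x. (norm (grad (v n) x - G x))\<^sup>2 \<partial>lebesgue_on \<Omega>) \<longlonglongrightarrow> 0"
    "(\<lambda>n. \<integral>x. (norm (v n x - h x))\<^sup>2 \<partial>?\<sigma>) \<longlonglongrightarrow> 0"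
    using t unfolding trace_pair_def by blast
  define P where "P = wgrad \<Omega> (\<lambda>x. N x y)"
  have wdN: "weakly_diff \<Omega> (\<lambda>x. N x y)" and PI: "integrable (lebesgue_on \<Omega>) P"
    using N y unfolding neumann_function_def W11_def P_def by blast+
  obtain hN where "has_boundary_trace \<Omega> (\<lambda>x. N x y) hN"
    using N y unfolding neumann_function_def by blast
  then obtain uN KN where KN: "compact KN" "KN \<subseteq> \<Omega>" "AE x in lebesgue_on (\<Omega> - KN). N x y = uN x" "has_trace \<Omega> uN hN"
    unfolding has_boundary_trace_def by blast
  have HN: "weakly_diff \<Omega> uN" "L2 (lebesgue_on \<Omega>) (wgrad \<Omega> uN)"
    using KN(4) unfolding has_trace_def H1_def by simp_all
  have oK: "open (\<Omega> - K)" "open (\<Omega> - KN)" using \<Omega> K KN by (auto intro!: open_Diff compact_imp_closed)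
  have PN: "AE x in lebesgue. x \<in> \<Omega> - KN \<longrightarrow> P x = wgrad \<Omega> uN x"
    unfolding P_def
  proof (rule is_weak_grad_AE_unique[OF wgrad_is_weak_grad[OF wdN] \<Omega>(1) wgrad_is_weak_grad[OF HN(1)] \<Omega>(1) oK(2)])
    show "AE x in lebesgue. x \<in> \<Omega> - KN \<longrightarrow> N x y = uN x"
      using KN(3) oK(2) by (subst (asm) AE_restrict_space_iff) auto
  qed auto
  have G0: "AE x in lebesgue. x \<in> \<Omega> - K \<longrightarrow> G x = 0"
  proof (rule is_weak_grad_AE_unique[OF T(1) \<Omega>(1) _ open_UNIV oK(1)])
    show "is_weak_grad UNIV (\<lambda>x. 0) (\<lambda>x :: real ^ 'n. 0 :: real ^ 'n)" by (simp add: is_weak_grad_def loc_integrable_def)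
  qed (use u0 in auto)
  define K' where "K' = K \<union> KN \<union> {y}"
  have K': "compact K'" unfolding K'_def by (intro compact_Un K KN compact_sing)
  have K'_sub: "K' \<subseteq> \<Omega>" using K KN y by (auto simp: K'_def)
  have oK': "open (- K')" using K' by (simp add: compact_imp_closed open_Compl)
  \<comment> \<open>the trace as a function on the whole space, where test functions are available\<close>
  define f where "f x = indicator (frontier \<Omega>) x * h x" for x
  let ?H = "hausdorff_measure (real CARD('n) - 1) :: (real ^ 'n) measure"
  have sH: "sets ?H = sets borel" by (rule sets_surface_measure)
  have int_H: "(\<integral>x. w x \<partial>?\<sigma>) = (\<integral>x. indicator (frontier \<Omega>) x * w x \<partial>?H)" for w :: "real ^ 'n \<Rightarrow> real"
    unfolding surface_measure_def by (subst integral_restrict_space[OF frontier_surface]) simp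
  have intb_H: "integrable ?\<sigma> w \<longleftrightarrow> integrable ?H (\<lambda>x. indicator (frontier \<Omega>) x * w x)" for w :: "real ^ 'n \<Rightarrow> real"
    unfolding surface_measure_def by (subst integrable_restrict_space[OF frontier_surface]) simp
  have hi: "integrable ?\<sigma> h" by (rule L2_imp_integrable[OF fm T(4)])
  have fH: "integrable ?H f" using hi unfolding intb_H f_def .
  have zero: "(\<integral>x. h x * b x \<partial>?\<sigma>) = 0" if b: "test_function (- K') b" for b
  proof -
    have bs: "smooth_on UNIV b" by (rule test_functionD(4)[OF b])
    have b0: "b x = 0" "partial k b x = 0" if "x \<in> K'" for x k
      using that test_functionD(3)[OF b] not_in_supp[of x b] partial_not_in_supp[of x b] by blast+
    have cb: "continuous_on UNIV b" "continuous_on UNIV (partial k b)" for k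
      by (rule smooth_on_imp_continuous[OF bs], rule continuous_grad[OF bs])
    obtain C0 where C0: "\<And>x. x \<in> \<Omega> \<Longrightarrow> \<bar>b x\<bar> \<le> C0" using continuous_bounded_on_bounded[OF cb(1) \<Omega>(2)] by blast
    have L2gb: "continuous_on UNIV (\<lambda>x. norm (grad b x))"
      unfolding grad_def by (intro continuous_intros cb)
    obtain C1 where C1: "\<And>x. x \<in> \<Omega> \<Longrightarrow> \<bar>norm (grad b x)\<bar> \<le> C1" using continuous_bounded_on_bounded[OF L2gb \<Omega>(2)] by blast
    define w where "w n x = b x * v n x" for n x
    have w: "smooth_on UNIV (w n)" for n unfolding w_def[abs_def] by (intro smooth_on_mult open_UNIV bs v(1))
    have "partial k (\<lambda>x. b x * v n x) x = partial k b x * v n x + b x * partial k (v n) x" for k n x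
      by (rule partial_mult) (rule smooth_on_differentiable[OF bs open_UNIV UNIV_I],
        rule smooth_on_differentiable[OF v(1) open_UNIV UNIV_I])
    then have gw: "grad (w n) x = v n x *\<^sub>R grad b x + b x *\<^sub>R grad (v n) x" for n x
      by (simp add: w_def[abs_def] grad_def vec_eq_iff)
    have eq: "(\<integral>x. P x \<bullet> grad (w n) x \<partial>lebesgue_on \<Omega>) = - (\<integral>x. w n x \<partial>?\<sigma>) / ?m" for n
    proof -
      have "w n y = 0" using b0(1)[of y] by (simp add: w_def K'_def)
      moreover have "(\<integral>x. P x \<bullet> grad (w n) x \<partial>lebesgue_on \<Omega>) = w n y - (\<integral>x. w n x \<partial>?\<sigma>) / ?m"
        using N y w unfolding neumann_function_def P_def by blast
      ultimately show ?thesis by simp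
    qed
    define Q where "Q = wgrad \<Omega> uN"
    have L2Q: "L2 (lebesgue_on \<Omega>) Q" using HN(2) by (simp add: Q_def)
    have dv: "L2 (lebesgue_on \<Omega>) (\<lambda>x. v n x - u x)" "L2 (lebesgue_on \<Omega>) (\<lambda>x. grad (v n) x - G x)" for n
      by (intro L2_diff L2_grad_smooth v(1) \<Omega> T)+
    note p1 = L2_tendsto_pairing[OF L2Q dv(1) v(2)]
    note p2 = L2_tendsto_pairing[OF L2Q dv(2) v(3)]
    \<comment> \<open>off \<open>K'\<close> the functions \<open>u\<close> and \<open>G\<close> vanish, so \<open>w n\<close> and its gradient tend to \<open>0\<close> in \<open>L\<^sup>2\<close>, while \<open>P\<close> is
      the square integrable \<open>Q\<close>; on \<open>K'\<close> the function \<open>b\<close> vanishes\<close>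
    define D where "D n x = C1 * (norm (Q x) * norm (v n x - u x)) + C0 * (norm (Q x) * norm (grad (v n) x - G x))" for n x
    have Di: "integrable (lebesgue_on \<Omega>) (D n)" for n unfolding D_def[abs_def] using p1(1) p2(1) by simp
    have Dlim: "(\<lambda>n. \<integral>x. D n x \<partial>lebesgue_on \<Omega>) \<longlonglongrightarrow> 0"
    proof -
      have "(\<integral>x. D n x \<partial>lebesgue_on \<Omega>) = C1 * (\<integral>x. norm (Q x) * norm (v n x - u x) \<partial>lebesgue_on \<Omega>) +
         C0 * (\<integral>x. norm (Q x) * norm (grad (v n) x - G x) \<partial>lebesgue_on \<Omega>)" for n
        unfolding D_def using p1(1)[of n] p2(1)[of n] by simp
      moreover have "(\<lambda>n. C1 * (\<integral>x. norm (Q x) * norm (v n x - u x) \<partial>lebesgue_on \<Omega>) +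
         C0 * (\<integral>x. norm (Q x) * norm (grad (v n) x - G x) \<partial>lebesgue_on \<Omega>)) \<longlonglongrightarrow> C1 * 0 + C0 * 0"
        by (intro tendsto_intros p1(2) p2(2))
      ultimately show ?thesis by simp
    qed
    have point: "AE x in lebesgue_on \<Omega>. \<bar>P x \<bullet> grad (w n) x\<bar> \<le> D n x" for n
    proof -
      have "AE x in lebesgue. x \<in> \<Omega> \<longrightarrow> \<bar>P x \<bullet> grad (w n) x\<bar> \<le> D n x"
        using PN G0 u0
      proof eventually_elim
        case (elim x)
        show ?case
        proof
          assume x: "x \<in> \<Omega>"
          have "0 \<le> C0" "0 \<le> C1"
            by (rule order_trans[OF abs_ge_zero C0[OF x]], rule order_trans[OF abs_ge_zero C1[OF x]])
          then have D0: "0 \<le> D n x" unfolding D_def by (intro add_nonneg_nonneg mult_nonneg_nonneg) simp_all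
          show "\<bar>P x \<bullet> grad (w n) x\<bar> \<le> D n x"
          proof (cases "x \<in> K'")
            case True
            have "grad b x = 0" using b0(2)[OF True] by (simp add: grad_def vec_eq_iff)
            then show ?thesis using b0(1)[OF True] D0 by (simp add: gw)
          next
            case False
            then have e: "P x = Q x" "G x = 0" "u x = 0" using elim x by (auto simp: K'_def Q_def)
            have "norm (grad (w n) x) \<le> \<bar>v n x\<bar> * norm (grad b x) + \<bar>b x\<bar> * norm (grad (v n) x)"
              unfolding gw by (rule norm_triangle_ineq[THEN order_trans]) simp
            also have "\<dots> \<le> \<bar>v n x\<bar> * C1 + C0 * norm (grad (v n) x)"
              using C0[OF x] C1[OF x] by (intro add_mono mult_left_mono mult_right_mono) auto
            finally have "norm (Q x) * norm (grad (w n) x) \<le> norm (Q x) * (\<bar>v n x\<bar> * C1 + C0 * norm (grad (v n) x))"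
              by (rule mult_left_mono) simp
            moreover have "\<bar>P x \<bullet> grad (w n) x\<bar> \<le> norm (Q x) * norm (grad (w n) x)"
              unfolding e(1) by (rule Cauchy_Schwarz_ineq2)
            ultimately show ?thesis unfolding D_def e by (simp add: algebra_simps)
          qed
        qed
      qed
      then show ?thesis using \<Omega>(1) by (subst AE_restrict_space_iff) auto
    qed
    have "(\<lambda>n. \<integral>x. P x \<bullet> grad (w n) x \<partial>lebesgue_on \<Omega>) \<longlonglongrightarrow> 0"
    proof (rule Lim_null_comparison[OF always_eventually Dlim], rule allI)
      fix n
      have "\<bar>\<integral>x. P x \<bullet> grad (w n) x \<partial>lebesgue_on \<Omega>\<bar> \<le> (\<integral>x. \<bar>P x \<bullet> grad (w n) x\<bar> \<partial>lebesgue_on \<Omega>)" by (rule integral_abs_bound)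
      also have "\<dots> \<le> (\<integral>x. D n x \<partial>lebesgue_on \<Omega>)"
      proof (rule integral_mono_AE[OF _ Di point])
        have mg: "grad (w n) \<in> borel_measurable (lebesgue_on \<Omega>)"
          using L2_grad_smooth(2)[OF w \<Omega>] by (simp add: L2_def)
        have "(\<lambda>x. P x \<bullet> grad (w n) x) \<in> borel_measurable (lebesgue_on \<Omega>)"
          using PI mg by (intro borel_measurable_inner) auto
        then have "integrable (lebesgue_on \<Omega>) (\<lambda>x. P x \<bullet> grad (w n) x)"
          by (rule Bochner_Integration.integrable_bound[OF Di[of n]]) (use point[of n] in \<open>eventually_elim, simp\<close>)
        then show "integrable (lebesgue_on \<Omega>) (\<lambda>x. \<bar>P x \<bullet> grad (w n) x\<bar>)" by (rule integrable_abs)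
      qed
      finally show "norm (\<integral>x. P x \<bullet> grad (w n) x \<partial>lebesgue_on \<Omega>) \<le> (\<integral>x. D n x \<partial>lebesgue_on \<Omega>)" by simp
    qed
    from tendsto_mult_left[OF this, of "- ?m"] have lim0: "(\<lambda>n. \<integral>x. w n x \<partial>?\<sigma>) \<longlonglongrightarrow> 0"
      unfolding eq using m by simp
    have L2b: "L2 ?\<sigma> b" by (rule L2_surface_continuous[OF cb(1) fm \<Omega>(2)])
    have L2v: "L2 ?\<sigma> (v n)" for n by (rule L2_surface_continuous[OF smooth_on_imp_continuous[OF v(1)] fm \<Omega>(2)])
    note p3 = L2_tendsto_pairing[OF L2b L2_diff[OF L2v T(4)] v(4)]
    have prod: "integrable ?\<sigma> (\<lambda>x. b x * g x)" if "L2 ?\<sigma> g" for g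
    proof -
      have gm: "g \<in> borel_measurable ?\<sigma>" using that by (simp add: L2_def)
      obtain C where C: "C \<ge> 0" "\<And>x. x \<in> frontier \<Omega> \<Longrightarrow> \<bar>b x\<bar> \<le> C"
        using continuous_bounded_on_bounded[OF cb(1) bounded_subset[OF bounded_closure[OF \<Omega>(2)]], of "frontier \<Omega>"]
        by (auto simp: frontier_def)
      have "L2 ?\<sigma> (\<lambda>x. b x * g x)"
        by (rule L2_mult_bounded[OF that continuous_measurable_surface[OF cb(1)], of C]) (simp add: space_surface_measure C)
      then show ?thesis by (rule L2_imp_integrable[OF fm])
    qed
    have "(\<lambda>n. (\<integral>x. w n x \<partial>?\<sigma>) - (\<integral>x. b x * h x \<partial>?\<sigma>)) \<longlonglongrightarrow> 0"
    proof (rule Lim_null_comparison[OF always_eventually p3(2)], rule allI)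
      fix n
      have "(\<integral>x. w n x \<partial>?\<sigma>) - (\<integral>x. b x * h x \<partial>?\<sigma>) = (\<integral>x. b x * (v n x - h x) \<partial>?\<sigma>)"
        using prod[OF L2v[of n]] prod[OF T(4)] by (simp add: w_def right_diff_distrib)
      also have "norm \<dots> \<le> (\<integral>x. norm (b x * (v n x - h x)) \<partial>?\<sigma>)" by (rule integral_norm_bound)
      finally show "norm ((\<integral>x. w n x \<partial>?\<sigma>) - (\<integral>x. b x * h x \<partial>?\<sigma>)) \<le> (\<integral>x. norm (b x) * norm (v n x - h x) \<partial>?\<sigma>)"
        by (simp add: abs_mult)
    qed
    from tendsto_diff[OF lim0 this] have "(\<lambda>n :: nat. \<integral>x. b x * h x \<partial>?\<sigma>) \<longlonglongrightarrow> 0" by simp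
    then show ?thesis by (simp add: LIMSEQ_const_iff mult.commute)
  qed
  have "AE x in ?H. x \<in> - K' \<longrightarrow> f x = 0"
  proof (rule AE_zero_if_test_integrals_zero_borel[OF sH oK'])
    fix C assume "compact C" "C \<subseteq> - K'"
    then have "C \<in> sets ?H" by (simp add: sH borel_compact)
    from integrable_mult_indicator[OF this fH] show "integrable ?H (\<lambda>x. indicator C x * f x)" by simp
  next
    fix b assume b: "test_function (- K') b"
    show "(\<integral>x. f x * b x \<partial>?H) = 0"
      using zero[OF b] unfolding int_H f_def by (simp add: mult.assoc)
  qed
  then have "AE x in ?H. x \<in> frontier \<Omega> \<longrightarrow> h x = 0"
  proof eventually_elim
    case (elim x)
    show ?case
    proof
      assume x: "x \<in> frontier \<Omega>"
      then have "x \<notin> \<Omega>" using \<Omega>(1) by (simp add: frontier_def interior_open)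
      then show "h x = 0" using elim x K'_sub by (auto simp: f_def)
    qed
  qed
  then show ?thesis unfolding surface_measure_def by (subst AE_restrict_space_iff[OF frontier_surface])
qed

text \<open>Passes a linear relation from the interior to the traces. The \<open>H\<^sup>1\<close> functions that have the traces
  \<open>h i\<close> agree with the functions \<open>F i\<close> only outside compact sets, which is why a function that vanishes
  near the boundary has to be considered.\<close>

lemma boundary_trace_sum_zero:
  fixes \<Omega> :: "(real ^ 'n::finite) set" and F :: "'i \<Rightarrow> real ^ 'n \<Rightarrow> real"
  assumes \<Omega>: "open \<Omega>" "bounded \<Omega>" and N: "neumann_function \<Omega> N" and y: "y \<in> \<Omega>" and I: "finite I"
    and t: "\<And>i. i \<in> I \<Longrightarrow> has_boundary_trace \<Omega> (F i) (h i)"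
    and zero: "\<And>x. x \<in> \<Omega> \<Longrightarrow> x \<noteq> y \<Longrightarrow> (\<Sum>i\<in>I. F i x) = 0"
  shows "AE x in surface_measure \<Omega>. (\<Sum>i\<in>I. h i x) = 0"
proof -
  have "\<exists>u K. compact K \<and> K \<subseteq> \<Omega> \<and> (AE x in lebesgue_on (\<Omega> - K). F i x = u x) \<and> has_trace \<Omega> u (h i)" if "i \<in> I" for i
    using t[OF that] unfolding has_boundary_trace_def .
  then have "\<forall>i\<in>I. \<exists>u K. compact K \<and> K \<subseteq> \<Omega> \<and> (AE x in lebesgue_on (\<Omega> - K). F i x = u x) \<and> has_trace \<Omega> u (h i)" by blast
  from bchoice[OF this] obtain u
    where "\<forall>i\<in>I. \<exists>K. compact K \<and> K \<subseteq> \<Omega> \<and> (AE x in lebesgue_on (\<Omega> - K). F i x = u i x) \<and> has_trace \<Omega> (u i) (h i)" ..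
  from bchoice[OF this] obtain K
    where "\<forall>i\<in>I. compact (K i) \<and> K i \<subseteq> \<Omega> \<and> (AE x in lebesgue_on (\<Omega> - K i). F i x = u i x) \<and> has_trace \<Omega> (u i) (h i)" ..
  then have uK: "compact (K i)" "K i \<subseteq> \<Omega>" "AE x in lebesgue_on (\<Omega> - K i). F i x = u i x" "has_trace \<Omega> (u i) (h i)" if "i \<in> I" for i
    using that by simp_all
  define K' where "K' = insert y (\<Union>i\<in>I. K i)"
  have K': "compact K'" "K' \<subseteq> \<Omega>" unfolding K'_def using uK(1,2) y I by (auto intro!: compact_insert compact_UN)
  have tp: "trace_pair \<Omega> (\<lambda>x. \<Sum>i\<in>I. u i x) (\<lambda>x. \<Sum>i\<in>I. wgrad \<Omega> (u i) x) (\<lambda>x. \<Sum>i\<in>I. h i x)"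
    by (rule trace_pair_sum[OF \<Omega> neumann_function_finite_surface(1)[OF N y] has_trace_imp_trace_pair[OF uK(4)]])
  show ?thesis
  proof (rule trace_of_zero[OF \<Omega> N y tp K'])
    have "AE x in lebesgue. x \<in> \<Omega> - K i \<longrightarrow> F i x = u i x" if "i \<in> I" for i
    proof -
      have "open (\<Omega> - K i)" using \<Omega>(1) uK(1)[OF that] by (auto intro!: open_Diff compact_imp_closed)
      then show ?thesis using uK(3)[OF that] by (subst (asm) AE_restrict_space_iff) auto
    qed
    then have "AE x in lebesgue. \<forall>i\<in>I. x \<in> \<Omega> - K i \<longrightarrow> F i x = u i x"
      using I by (intro AE_finite_allI) auto
    then show "AE x in lebesgue. x \<in> \<Omega> - K' \<longrightarrow> (\<Sum>i\<in>I. u i x) = 0"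
    proof eventually_elim
      case (elim x)
      show ?case
      proof
        assume x: "x \<in> \<Omega> - K'"
        then have "(\<Sum>i\<in>I. u i x) = (\<Sum>i\<in>I. F i x)" using elim by (intro sum.cong) (auto simp: K'_def)
        then show "(\<Sum>i\<in>I. u i x) = 0" using zero[of x] x by (auto simp: K'_def)
      qed
    qed
  qed
qed

section \<open>Harmonicity of the background potential and of the Neumann function\<close>

lemma L2_AE_cong:
  fixes f g :: "real ^ 'n::finite \<Rightarrow> 'b::euclidean_space"
  assumes f: "L2 (lebesgue_on S) f" and ae: "AE x in lebesgue. x \<in> S \<longrightarrow> f x = g x" and S: "S \<in> sets lebesgue"
  shows "L2 (lebesgue_on S) g"
proof -
  have "(\<lambda>x. indicator S x *\<^sub>R f x) \<in> borel_measurable lebesgue"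
    using f S unfolding L2_def by (subst (asm) borel_measurable_restrict_space_iff) auto
  then have "(\<lambda>x. indicator S x *\<^sub>R g x) \<in> borel_measurable lebesgue"
  proof (rule borel_measurable_AE)
    show "AE x in lebesgue. indicator S x *\<^sub>R f x = indicator S x *\<^sub>R g x"
      using ae by eventually_elim (auto simp: indicator_def)
  qed
  then have gm: "g \<in> borel_measurable (lebesgue_on S)" using S by (subst borel_measurable_restrict_space_iff) auto
  have "AE x in lebesgue_on S. (norm (f x))\<^sup>2 = (norm (g x))\<^sup>2"
    using ae S by (subst AE_restrict_space_iff) (auto elim!: eventually_mono)
  then have "integrable (lebesgue_on S) (\<lambda>x. (norm (g x))\<^sup>2)"
  proof (subst integrable_cong_AE[of _ _ "\<lambda>x. (norm (f x))\<^sup>2"])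
    assume "AE x in lebesgue_on S. (norm (f x))\<^sup>2 = (norm (g x))\<^sup>2"
    then show "AE x in lebesgue_on S. (norm (g x))\<^sup>2 = (norm (f x))\<^sup>2" by eventually_elim simp
  next
    show i: "integrable (lebesgue_on S) (\<lambda>x. (norm (f x))\<^sup>2)" using f by (simp add: L2_def)
    then show "(\<lambda>x. (norm (f x))\<^sup>2) \<in> borel_measurable (lebesgue_on S)" by (rule borel_measurable_integrable)
  qed (use gm in simp)
  with gm show ?thesis by (simp add: L2_def)
qed

lemma test_function_has_trace:
  fixes \<Omega> :: "(real ^ 'n::finite) set"
  assumes \<Omega>: "open \<Omega>" "bounded \<Omega>" and \<psi>: "test_function \<Omega> \<psi>"
  shows "has_trace \<Omega> \<psi> (\<lambda>x. 0)"
proof -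
  have s: "smooth_on UNIV \<psi>" by (rule test_functionD(4)[OF \<psi>])
  have c: "Ck_on 1 \<Omega> \<psi>" by (rule Ck_on_subset[OF test_functionD(1)[OF \<psi>]]) simp
  have ae: "AE x in lebesgue. x \<in> \<Omega> \<longrightarrow> grad \<psi> x = wgrad \<Omega> \<psi> x"
    using wgrad_AE_eq_grad[OF \<Omega>(1) c] by eventually_elim auto
  have ae': "AE x in lebesgue_on \<Omega>. grad \<psi> x - wgrad \<Omega> \<psi> x = 0"
    using ae \<Omega>(1) by (subst AE_restrict_space_iff) auto
  have "weakly_diff \<Omega> \<psi>" unfolding weakly_diff_def using Ck_is_weak_grad[OF \<Omega>(1) c] by blast
  moreover have "L2 (lebesgue_on \<Omega>) (wgrad \<Omega> \<psi>)"
    by (rule L2_AE_cong[OF L2_grad_smooth(2)[OF s \<Omega>] ae]) (use \<Omega>(1) in simp)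
  ultimately have H1: "H1 \<Omega> \<psi>" unfolding H1_def using L2_grad_smooth(1)[OF s \<Omega>] by blast
  have f0: "\<psi> x = 0" if "x \<in> frontier \<Omega>" for x
  proof -
    have "x \<notin> \<Omega>" using that \<Omega>(1) by (simp add: frontier_def interior_open)
    then show ?thesis using test_functionD(3)[OF \<psi>] not_in_supp[of x \<psi>] by blast
  qed
  have "(\<integral>x. (norm (\<psi> x - 0))\<^sup>2 \<partial>surface_measure \<Omega>) = (\<integral>x. 0 \<partial>surface_measure \<Omega>)"
    by (rule Bochner_Integration.integral_cong) (simp_all add: space_surface_measure f0)
  then have n1: "L2_norm (surface_measure \<Omega>) (\<lambda>x. \<psi> x - 0) = 0" by (simp add: L2_norm_def)
  have "(\<integral>x. (norm (grad \<psi> x - wgrad \<Omega> \<psi> x))\<^sup>2 \<partial>lebesgue_on \<Omega>) = 0"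
    by (rule integral_eq_zero_AE) (use ae' in \<open>eventually_elim, simp\<close>)
  then have n2: "L2_norm (lebesgue_on \<Omega>) (\<lambda>x. grad \<psi> x - wgrad \<Omega> \<psi> x) = 0" by (simp add: L2_norm_def)
  have n3: "L2_norm (lebesgue_on \<Omega>) (\<lambda>x. \<psi> x - \<psi> x) = 0" by (simp add: L2_norm_def)
  show ?thesis
    unfolding has_trace_def using H1 s n1 n2 n3
    by (auto simp: L2_zero intro!: exI[of _ "\<lambda>n. \<psi>"])
qed

text \<open>Test functions have trace zero, so the boundary term of the variational equation disappears.\<close>

lemma neumann_solution_harmonic:
  fixes \<Omega> :: "(real ^ 'n::finite) set"
  assumes \<Omega>: "open \<Omega>" "bounded \<Omega>" and V: "neumann_solution \<Omega> g V" and x: "x \<in> \<Omega>"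
  shows "laplacian V x = 0"
proof -
  have s: "smooth_on \<Omega> V" and H: "H1 \<Omega> V" and eq: "\<And>w h. has_trace \<Omega> w h \<Longrightarrow>
        (\<integral>x. wgrad \<Omega> V x \<bullet> wgrad \<Omega> w x \<partial>lebesgue_on \<Omega>) = (\<integral>x. g x * h x \<partial>surface_measure \<Omega>)"
    using V unfolding neumann_solution_def by blast+
  have wd: "is_weak_grad \<Omega> V (wgrad \<Omega> V)" and L: "L2 (lebesgue_on \<Omega>) (wgrad \<Omega> V)"
    using H by (auto simp: H1_def intro: wgrad_is_weak_grad)
  show ?thesis
  proof (rule weakly_harmonic[OF \<Omega>(1) s wd \<Omega>(1) subset_refl _ x])
    fix \<psi> assume \<psi>: "test_function \<Omega> \<psi>"
    have c: "Ck_on 1 \<Omega> \<psi>" by (rule Ck_on_subset[OF test_functionD(1)[OF \<psi>]]) simp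
    have tr: "has_trace \<Omega> \<psi> (\<lambda>x. 0)" by (rule test_function_has_trace[OF \<Omega> \<psi>])
    have m: "wgrad \<Omega> V \<in> borel_measurable (lebesgue_on \<Omega>)" "wgrad \<Omega> \<psi> \<in> borel_measurable (lebesgue_on \<Omega>)"
      "grad \<psi> \<in> borel_measurable (lebesgue_on \<Omega>)"
      using L tr L2_grad_smooth(2)[OF test_functionD(4)[OF \<psi>] \<Omega>] by (auto simp: L2_def has_trace_def H1_def)
    have "(\<integral>x. wgrad \<Omega> V x \<bullet> grad \<psi> x \<partial>lebesgue_on \<Omega>) = (\<integral>x. wgrad \<Omega> V x \<bullet> wgrad \<Omega> \<psi> x \<partial>lebesgue_on \<Omega>)"
    proof (rule integral_cong_AE)
      have "AE x in lebesgue_on \<Omega>. wgrad \<Omega> \<psi> x = grad \<psi> x"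
        using wgrad_AE_eq_grad[OF \<Omega>(1) c] \<Omega>(1) by (subst AE_restrict_space_iff) auto
      then show "AE x in lebesgue_on \<Omega>. wgrad \<Omega> V x \<bullet> grad \<psi> x = wgrad \<Omega> V x \<bullet> wgrad \<Omega> \<psi> x"
        by eventually_elim simp
    qed (intro borel_measurable_inner m)+
    also have "\<dots> = 0" using eq[OF tr] by simp
    finally show "(\<integral>x. wgrad \<Omega> V x \<bullet> grad \<psi> x \<partial>lebesgue_on \<Omega>) = 0" .
  qed
qed

text \<open>A test function supported away from \<open>y\<close> vanishes at \<open>y\<close> and on the boundary.\<close>

lemma neumann_function_harmonic:
  fixes \<Omega> :: "(real ^ 'n::finite) set"
  assumes \<Omega>: "open \<Omega>" and N: "neumann_function \<Omega> N" and y: "y \<in> \<Omega>" and x: "x \<in> \<Omega> - {y}"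
  shows "laplacian (\<lambda>x. N x y) x = 0"
proof -
  have s: "smooth_on (\<Omega> - {y}) (\<lambda>x. N x y)" and W: "W11 \<Omega> (\<lambda>x. N x y)" and eq: "\<And>w. smooth_on UNIV w \<Longrightarrow>
     (\<integral>x. wgrad \<Omega> (\<lambda>x. N x y) x \<bullet> grad w x \<partial>lebesgue_on \<Omega>) =
             w y - (\<integral>x. w x \<partial>surface_measure \<Omega>) / measure (surface_measure \<Omega>) (frontier \<Omega>)"
    using N y unfolding neumann_function_def by blast+
  have wd: "is_weak_grad \<Omega> (\<lambda>x. N x y) (wgrad \<Omega> (\<lambda>x. N x y))" using W by (auto simp: W11_def intro: wgrad_is_weak_grad)
  have o: "open (\<Omega> - {y})" using \<Omega> by (simp add: open_Diff)
  show ?thesis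
  proof (rule weakly_harmonic[OF o s wd \<Omega> _ _ x])
    show "\<Omega> - {y} \<subseteq> \<Omega>" by blast
    fix \<psi> assume \<psi>: "test_function (\<Omega> - {y}) \<psi>"
    have out: "\<psi> z = 0" if "z \<notin> \<Omega> - {y}" for z
      using that test_functionD(3)[OF \<psi>] not_in_supp[of z \<psi>] by blast
    have "(\<integral>x. \<psi> x \<partial>surface_measure \<Omega>) = (\<integral>x. 0 \<partial>surface_measure \<Omega>)"
    proof (rule Bochner_Integration.integral_cong[OF refl])
      fix z assume "z \<in> space (surface_measure \<Omega>)"
      then have "z \<notin> \<Omega>" using \<Omega> by (simp add: space_surface_measure frontier_def interior_open)
      then show "\<psi> z = 0" using out by blast
    qed
    then show "(\<integral>x. wgrad \<Omega> (\<lambda>x. N x y) x \<bullet> grad \<psi> x \<partial>lebesgue_on \<Omega>) = 0"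
      using eq[OF test_functionD(4)[OF \<psi>]] out[of y] by simp
  qed
qed

section \<open>Iterated derivatives and harmonic polynomials\<close>

lemma coords: "distinct (coords :: 'n::finite list)" "set (coords :: 'n list) = UNIV"
proof -
  obtain ks :: "'n list" where "set ks = UNIV" "distinct ks"
    using finite_distinct_list[of "UNIV :: 'n set"] by auto
  then have "\<exists>ks :: 'n list. distinct ks \<and> set ks = UNIV" by blast
  from someI_ex[OF this] show "distinct (coords :: 'n list)" "set (coords :: 'n list) = UNIV"
    unfolding coords_def by auto
qed

lemma smooth_on_funpow_partial:
  assumes "open S" "smooth_on S f"
  shows "smooth_on S ((partial k ^^ n) f)"
  by (induction n) (simp_all add: assms smooth_on_partial)

lemma smooth_on_foldr_partial:
  assumes "open S" "smooth_on S f"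
  shows "smooth_on S (foldr (\<lambda>k. partial k ^^ i k) ks f)"
  by (induction ks) (simp_all add: assms smooth_on_funpow_partial)

lemma funpow_partial_cong:
  assumes "open S" "\<And>x. x \<in> S \<Longrightarrow> f x = g x" "x \<in> S"
  shows "(partial k ^^ n) f x = (partial k ^^ n) g x"
  using assms(3)
proof (induction n arbitrary: x)
  case (Suc n)
  then show ?case using partial_cong_open[OF assms(1) Suc.prems Suc.IH] by simp
qed (simp add: assms)

lemma foldr_partial_cong:
  assumes "open S" "\<And>x. x \<in> S \<Longrightarrow> f x = g x" "x \<in> S"
  shows "foldr (\<lambda>k. partial k ^^ i k) ks f x = foldr (\<lambda>k. partial k ^^ i k) ks g x"
  using assms(3)
proof (induction ks arbitrary: x)
  case (Cons k ks)
  show ?case using funpow_partial_cong[OF assms(1) Cons.IH Cons.prems] by simp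
qed (simp add: assms)

lemma partial_funpow_commute:
  assumes S: "open S" "smooth_on S f" "x \<in> S"
  shows "(partial l ^^ n) (partial k f) x = partial k ((partial l ^^ n) f) x"
  using S(3)
proof (induction n arbitrary: x)
  case (Suc n)
  have "partial l ((partial l ^^ n) (partial k f)) x = partial l (partial k ((partial l ^^ n) f)) x"
    by (rule partial_cong_open[OF S(1) Suc.prems Suc.IH])
  also have "\<dots> = partial k (partial l ((partial l ^^ n) f)) x"
    by (rule partial_commute[OF S(1) Suc.prems]) (rule smooth_onD[OF smooth_on_funpow_partial[OF S(1,2)]])
  finally show ?case by simp
qed simp

lemma foldr_partial_commute:
  assumes S: "open S" "smooth_on S f" "x \<in> S"
  shows "foldr (\<lambda>k. partial k ^^ i k) ks (partial k f) x = partial k (foldr (\<lambda>k. partial k ^^ i k) ks f) x"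
  using S(3)
proof (induction ks arbitrary: x)
  case (Cons l ks)
  let ?F = "foldr (\<lambda>k. partial k ^^ i k) ks f"
  have "(partial l ^^ i l) (foldr (\<lambda>k. partial k ^^ i k) ks (partial k f)) x = (partial l ^^ i l) (partial k ?F) x"
    by (rule funpow_partial_cong[OF S(1) Cons.IH Cons.prems])
  also have "\<dots> = partial k ((partial l ^^ i l) ?F) x"
    by (rule partial_funpow_commute[OF S(1) smooth_on_foldr_partial[OF S(1,2)] Cons.prems])
  finally show ?case by simp
qed simp

text \<open>The two additional derivatives are applied in the middle of the enumeration of the coordinates and
  have to be moved past the earlier ones.\<close>

lemma foldr_partial_incr:
  assumes S: "open S" "smooth_on S f" "x \<in> S" and ks: "distinct ks"
  shows "foldr (\<lambda>l. partial l ^^ (i(k := i k + 2)) l) ks f x =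
    (if k \<in> set ks then foldr (\<lambda>l. partial l ^^ i l) ks (partial k (partial k f)) x
     else foldr (\<lambda>l. partial l ^^ i l) ks f x)"
  using S(3) ks
proof (induction ks arbitrary: x)
  case (Cons l ks)
  let ?F = "foldr (\<lambda>l. partial l ^^ i l) ks"
  have IH: "foldr (\<lambda>l. partial l ^^ (i(k := i k + 2)) l) ks f x = (if k \<in> set ks then ?F (partial k (partial k f)) x else ?F f x)"
    if "x \<in> S" for x using Cons.IH[OF that] Cons.prems(2) by simp
  show ?case
  proof (cases "l = k")
    case True
    then have k: "k \<notin> set ks" using Cons.prems(2) by simp
    have s: "smooth_on S (partial k f)" by (rule smooth_on_partial[OF S(2)])
    have "foldr (\<lambda>l. partial l ^^ (i(k := i k + 2)) l) (l # ks) f x =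
        (partial k ^^ (i k + 2)) (foldr (\<lambda>l. partial l ^^ (i(k := i k + 2)) l) ks f) x"
      using True by simp
    also have "\<dots> = (partial k ^^ (i k + 2)) (?F f) x"
      by (rule funpow_partial_cong[OF S(1) _ Cons.prems(1)]) (simp only: IH k if_False)
    also have "\<dots> = (partial k ^^ i k) (partial k (partial k (?F f))) x"
      by (simp only: funpow_add o_apply numeral_2_eq_2 funpow.simps id_apply)
    also have "\<dots> = (partial k ^^ i k) (?F (partial k (partial k f))) x"
    proof (rule funpow_partial_cong[OF S(1) _ Cons.prems(1)])
      fix z assume z: "z \<in> S"
      have "?F (partial k (partial k f)) z = partial k (?F (partial k f)) z"
        by (rule foldr_partial_commute[OF S(1) s z])
      also have "\<dots> = partial k (partial k (?F f)) z"
        by (rule partial_cong_open[OF S(1) z]) (rule foldr_partial_commute[OF S(1,2)])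
      finally show "partial k (partial k (?F f)) z = ?F (partial k (partial k f)) z" ..
    qed
    finally show ?thesis using True by simp
  next
    case False
    have "foldr (\<lambda>l. partial l ^^ (i(k := i k + 2)) l) (l # ks) f x =
        (partial l ^^ i l) (foldr (\<lambda>l. partial l ^^ (i(k := i k + 2)) l) ks f) x"
      using False by simp
    also have "\<dots> = (partial l ^^ i l) (if k \<in> set ks then ?F (partial k (partial k f)) else ?F f) x"
      by (rule funpow_partial_cong[OF S(1) _ Cons.prems(1)]) (simp only: IH split: if_split, simp)
    finally show ?thesis using False by simp
  qed
qed simp

lemma mpartial_incr:
  assumes "open S" "smooth_on S f" "x \<in> S"
  shows "mpartial (i(k := i k + 2)) f x = mpartial i (partial k (partial k f)) x"
  unfolding mpartial_def using foldr_partial_incr[OF assms coords(1)] by (simp add: coords(2))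

lemma funpow_partial_sum:
  assumes S: "open S" "\<And>j. j \<in> J \<Longrightarrow> smooth_on S (f j)" "x \<in> S" and J: "finite J"
  shows "(partial k ^^ n) (\<lambda>x. \<Sum>j\<in>J. f j x) x = (\<Sum>j\<in>J. (partial k ^^ n) (f j) x)"
  using S(3)
proof (induction n arbitrary: x)
  case (Suc n)
  have "partial k ((partial k ^^ n) (\<lambda>x. \<Sum>j\<in>J. f j x)) x = partial k (\<lambda>x. \<Sum>j\<in>J. (partial k ^^ n) (f j) x) x"
    by (rule partial_cong_open[OF S(1) Suc.prems Suc.IH])
  also have "\<dots> = (\<Sum>j\<in>J. partial k ((partial k ^^ n) (f j)) x)"
    by (rule partial_sum[OF J]) (rule smooth_on_differentiable[OF smooth_on_funpow_partial[OF S(1,2)] S(1) Suc.prems])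
  finally show ?case by simp
qed simp

lemma mpartial_sum:
  assumes S: "open S" "\<And>j. j \<in> J \<Longrightarrow> smooth_on S (f j)" "x \<in> S" and J: "finite J"
  shows "mpartial i (\<lambda>x. \<Sum>j\<in>J. f j x) x = (\<Sum>j\<in>J. mpartial i (f j) x)"
proof -
  have "foldr (\<lambda>k. partial k ^^ i k) ks (\<lambda>x. \<Sum>j\<in>J. f j x) x = (\<Sum>j\<in>J. foldr (\<lambda>k. partial k ^^ i k) ks (f j) x)" for ks
    using S(3)
  proof (induction ks arbitrary: x)
    case (Cons k ks)
    have "(partial k ^^ i k) (foldr (\<lambda>k. partial k ^^ i k) ks (\<lambda>x. \<Sum>j\<in>J. f j x)) x =
      (partial k ^^ i k) (\<lambda>x. \<Sum>j\<in>J. foldr (\<lambda>k. partial k ^^ i k) ks (f j) x) x"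
      by (rule funpow_partial_cong[OF S(1) Cons.IH Cons.prems])
    also have "\<dots> = (\<Sum>j\<in>J. (partial k ^^ i k) (foldr (\<lambda>k. partial k ^^ i k) ks (f j)) x)"
      by (rule funpow_partial_sum[OF S(1) smooth_on_foldr_partial[OF S(1,2)] Cons.prems J])
    finally show ?case by simp
  qed simp
  then show ?thesis unfolding mpartial_def .
qed

lemma mpartial_zero: "mpartial i (\<lambda>x. 0) x = 0"
proof -
  have f: "(partial k ^^ n) (\<lambda>x. 0) = (\<lambda>x. 0)" for k n by (induction n) (simp_all add: partial_const[abs_def])
  have "foldr (\<lambda>k. partial k ^^ i k) ks (\<lambda>x. 0) = (\<lambda>x. 0)" for ks by (induction ks) (simp_all add: f)
  then show ?thesis unfolding mpartial_def by metis
qed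

text \<open>The sum is \<open>\<partial>\<^sup>i \<Delta>f\<close>, because the partial derivatives of a smooth function commute.\<close>

lemma mpartial_harmonic:
  fixes f :: "real ^ 'n::finite \<Rightarrow> real"
  assumes S: "open S" "smooth_on S f" "x \<in> S" and h: "\<And>z. z \<in> S \<Longrightarrow> laplacian f z = 0"
  shows "(\<Sum>k\<in>UNIV. mpartial (i(k := i k + 2)) f x) = 0"
proof -
  have "(\<Sum>k\<in>UNIV. mpartial (i(k := i k + 2)) f x) = (\<Sum>k\<in>UNIV. mpartial i (partial k (partial k f)) x)"
    by (simp only: mpartial_incr[OF S])
  also have "\<dots> = mpartial i (\<lambda>x. \<Sum>k\<in>UNIV. partial k (partial k f) x) x"
    by (rule mpartial_sum[symmetric, OF S(1) _ S(3)]) (simp_all add: smooth_on_partial S)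
  also have "\<dots> = mpartial i (\<lambda>x. 0) x"
    unfolding mpartial_def by (rule foldr_partial_cong[OF S(1) _ S(3)]) (use h in \<open>simp add: laplacian_def\<close>)
  finally show ?thesis by (simp add: mpartial_zero)
qed

lemma msize_upd: "msize (i(k := n)) + i k = msize i + n" for i :: "'n::finite mindex"
proof -
  have "msize (i(k := n)) = n + (\<Sum>l\<in>UNIV - {k}. i l)" for n
    unfolding msize_def by (subst sum.remove[of UNIV k]) (auto intro!: sum.cong)
  from this[of n] this[of "i k"] show ?thesis by simp
qed

lemma mfact_upd: "mfact (i(k := n)) * fact (i k) = mfact i * fact n" for i :: "'n::finite mindex"
proof -
  have "mfact (i(k := n)) = fact n * (\<Prod>l\<in>UNIV - {k}. fact (i l))" for n
    unfolding mfact_def by (subst prod.remove[of UNIV k]) (auto intro!: prod.cong)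
  from this[of n] this[of "i k"] show ?thesis by simp
qed

lemma mpow_upd: "mpow (i(k := n)) x = (x $ k) ^ n * (\<Prod>l\<in>UNIV - {k}. (x $ l) ^ i l)"
  unfolding mpow_def by (subst prod.remove[of UNIV k]) (auto intro!: prod.cong)

lemma finite_msize_le: "finite {i :: 'n::finite mindex. msize i \<le> m}"
proof (rule finite_subset)
  show "{i :: 'n mindex. msize i \<le> m} \<subseteq> (UNIV :: 'n set) \<rightarrow>\<^sub>E {..m}"
  proof
    fix i :: "'n mindex" assume "i \<in> {i. msize i \<le> m}"
    then have "i k \<le> m" for k using member_le_sum[of k UNIV i] by (simp add: msize_def)
    then show "i \<in> (UNIV :: 'n set) \<rightarrow>\<^sub>E {..m}" by auto
  qed
qed (rule finite_PiE, simp_all)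

lemma mpow_mzero: "mpow mzero = (\<lambda>x. 1)" by (simp add: fun_eq_iff mpow_def mzero_def)

lemma partial_mpow: "partial k (mpow j) x = real (j k) * mpow (j(k := j k - 1)) x" for x :: "real ^ 'n::finite"
proof -
  have e: "mpow j (x + t *\<^sub>R axis k 1) = (x $ k + t) ^ j k * (\<Prod>l\<in>UNIV - {k}. (x $ l) ^ j l)" for t
  proof -
    have "(\<Prod>l\<in>UNIV - {k}. ((x + t *\<^sub>R axis k 1) $ l) ^ j l) = (\<Prod>l\<in>UNIV - {k}. (x $ l) ^ j l)"
      by (rule prod.cong) (auto simp: axis_def)
    then show ?thesis using mpow_upd[of j k "j k" "x + t *\<^sub>R axis k 1"] by (simp add: axis_def)
  qed
  show ?thesis unfolding partial_def e
    by (rule DERIV_imp_deriv) (auto intro!: derivative_eq_intros simp: mpow_upd)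
qed

lemma partial2_mpow: "partial k (partial k (mpow j)) x = real (j k) * real (j k - 1) * mpow (j(k := j k - 2)) x"
  for x :: "real ^ 'n::finite"
proof -
  have "partial k (partial k (mpow j)) x = partial k (\<lambda>x. real (j k) * mpow (j(k := j k - 1)) x) x"
    by (simp add: partial_mpow[abs_def])
  also have "\<dots> = real (j k) * partial k (mpow (j(k := j k - 1))) x"
    by (rule partial_cmult) (rule Ck_on_differentiable[OF Ck_on_mpow[of 1 UNIV]], simp_all)
  also have "\<dots> = real (j k) * real (j k - 1) * mpow (j(k := j k - 2)) x"
    by (simp add: partial_mpow numeral_2_eq_2)
  finally show ?thesis .
qed

text \<open>A Taylor polynomial is harmonic when its coefficients satisfy these relations: the coefficient
  of \<open>x\<^sup>i\<close> in its Laplacian is \<open>\<Sum>\<^sub>k a (i + 2 e\<^sub>k) / i!\<close>.\<close>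

lemma harmonic_taylor_polynomial:
  fixes a :: "'n::finite mindex \<Rightarrow> real"
  assumes a: "\<And>i. msize i + 2 \<le> m \<Longrightarrow> (\<Sum>k\<in>UNIV. a (i(k := i k + 2))) = 0"
  shows "laplacian (\<lambda>x. \<Sum>j | msize j \<le> m. t ^ msize j / mfact j * a j * mpow j x) x = 0"
proof -
  define J where "J = {j :: 'n mindex. msize j \<le> m}"
  define I where "I = {i :: 'n mindex. msize i + 2 \<le> m}"
  have fJ: "finite J" unfolding J_def by (rule finite_msize_le)
  define c where "c j = t ^ msize j / mfact j * a j" for j
  have Ck: "Ck_on n UNIV (mpow j)" for n and j :: "'n mindex" by (rule Ck_on_mpow)
  have d1: "mpow j differentiable (at x)" for j :: "'n mindex" and x :: "real ^ 'n"
    by (rule Ck_on_differentiable[OF Ck[of 1]]) simp_all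
  have d2: "partial k (mpow j) differentiable (at x)" for k and j :: "'n mindex" and x :: "real ^ 'n"
    by (rule Ck_on_differentiable[of 1 UNIV]) (use Ck[of "Suc 1" j] in simp_all)
  have p1: "partial k (\<lambda>x. \<Sum>j\<in>J. c j * mpow j x) = (\<lambda>x. \<Sum>j\<in>J. c j * partial k (mpow j) x)" for k
  proof
    fix x
    have "partial k (\<lambda>x. \<Sum>j\<in>J. c j * mpow j x) x = (\<Sum>j\<in>J. partial k (\<lambda>x. c j * mpow j x) x)"
      by (rule partial_sum[OF fJ]) (intro derivative_intros d1)
    then show "partial k (\<lambda>x. \<Sum>j\<in>J. c j * mpow j x) x = (\<Sum>j\<in>J. c j * partial k (mpow j) x)"
      by (simp add: partial_cmult[OF d1])
  qed
  have p2: "partial k (partial k (\<lambda>x. \<Sum>j\<in>J. c j * mpow j x)) x = (\<Sum>j\<in>J. c j * partial k (partial k (mpow j)) x)" for k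
  proof -
    have "partial k (\<lambda>x. \<Sum>j\<in>J. c j * partial k (mpow j) x) x = (\<Sum>j\<in>J. partial k (\<lambda>x. c j * partial k (mpow j) x) x)"
      by (rule partial_sum[OF fJ]) (intro derivative_intros d2)
    then show ?thesis by (simp add: p1 partial_cmult[OF d2])
  qed
  have one: "(\<Sum>j\<in>J. c j * partial k (partial k (mpow j)) x) =
     (\<Sum>i\<in>I. t ^ (msize i + 2) / mfact i * a (i(k := i k + 2)) * mpow i x)" for k
  proof -
    have "(\<Sum>j\<in>J. c j * partial k (partial k (mpow j)) x) = (\<Sum>j\<in>{j\<in>J. 2 \<le> j k}. c j * partial k (partial k (mpow j)) x)"
    proof (rule sum.mono_neutral_right[OF fJ])
      show "\<forall>j\<in>J - {j \<in> J. 2 \<le> j k}. c j * partial k (partial k (mpow j)) x = 0"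
      proof
        fix j assume "j \<in> J - {j \<in> J. 2 \<le> j k}"
        then have "j k = 0 \<or> j k = 1" by auto
        then show "c j * partial k (partial k (mpow j)) x = 0" by (auto simp: partial2_mpow)
      qed
    qed auto
    also have "\<dots> = (\<Sum>i\<in>I. t ^ (msize i + 2) / mfact i * a (i(k := i k + 2)) * mpow i x)"
    proof (rule sum.reindex_bij_witness[of _ "\<lambda>i. i(k := i k + 2)" "\<lambda>j. j(k := j k - 2)"])
      fix j assume j: "j \<in> {j \<in> J. 2 \<le> j k}"
      define i where "i = j(k := j k - 2)"
      have ji: "j = i(k := i k + 2)" using j by (auto simp: i_def fun_eq_iff)
      have ms: "msize j = msize i + 2" using msize_upd[of i k "i k + 2"] ji by simp
      have "mfact j * fact (i k) = mfact i * fact (i k + 2)" using mfact_upd[of i k "i k + 2"] ji by simp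
      then have mf: "mfact j = mfact i * (real (i k + 2) * real (i k + 1))"
        by (simp only: fact_Suc add_2_eq_Suc' mult.assoc Suc_eq_plus1[symmetric] of_nat_mult) simp
      show "(j(k := j k - 2))(k := (j(k := j k - 2)) k + 2) = j" using ji unfolding i_def by simp
      show "j(k := j k - 2) \<in> I" using j ms unfolding I_def J_def i_def by simp
      have "c j * partial k (partial k (mpow j)) x = t ^ (msize i + 2) / mfact j * a j * (real (i k + 2) * real (i k + 1) * mpow i x)"
        unfolding c_def partial2_mpow ms using ji by simp
      also have "\<dots> = t ^ (msize i + 2) / mfact i * a j * mpow i x"
      proof -
        have "A / (m * p) * aj * (p * y) = A / m * aj * y" if "p \<noteq> 0" for A m p aj y :: real using that by simp
        moreover have "real (i k + 2) * real (i k + 1) \<noteq> 0" by (simp del: of_nat_add)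
        ultimately show ?thesis unfolding mf by blast
      qed
      finally show "t ^ (msize (j(k := j k - 2)) + 2) / mfact (j(k := j k - 2)) * a ((j(k := j k - 2))(k := (j(k := j k - 2)) k + 2)) *
          mpow (j(k := j k - 2)) x = c j * partial k (partial k (mpow j)) x"
        using ji unfolding i_def by simp
    next
      fix i assume i: "i \<in> I"
      show "(i(k := i k + 2))(k := (i(k := i k + 2)) k - 2) = i" by simp
      show "i(k := i k + 2) \<in> {j \<in> J. 2 \<le> j k}" using i msize_upd[of i k "i k + 2"] by (simp add: I_def J_def)
    qed
    finally show ?thesis .
  qed
  have "laplacian (\<lambda>x. \<Sum>j\<in>J. c j * mpow j x) x = (\<Sum>k\<in>UNIV. \<Sum>i\<in>I. t ^ (msize i + 2) / mfact i * a (i(k := i k + 2)) * mpow i x)"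
    unfolding laplacian_def p2 one ..
  also have "\<dots> = (\<Sum>i\<in>I. \<Sum>k\<in>UNIV. t ^ (msize i + 2) / mfact i * a (i(k := i k + 2)) * mpow i x)" by (rule sum.swap)
  also have "\<dots> = (\<Sum>i\<in>I. t ^ (msize i + 2) / mfact i * (\<Sum>k\<in>UNIV. a (i(k := i k + 2))) * mpow i x)"
    by (simp add: sum_distrib_left sum_distrib_right)
  also have "\<dots> = 0" by (rule sum.neutral) (simp add: I_def a del: add_2_eq_Suc')
  finally show ?thesis unfolding c_def J_def .
qed

section \<open>Linear combinations of the tensors\<close>

text \<open>The constant term can be dropped because the relations only involve coefficients of order at
  least two.\<close>

lemma harmonic_taylor_polynomial_pos:
  fixes a :: "'n::finite mindex \<Rightarrow> real"
  assumes a: "\<And>i. msize i + 2 \<le> m \<Longrightarrow> (\<Sum>k\<in>UNIV. a (i(k := i k + 2))) = 0"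
  shows "laplacian (\<lambda>x. \<Sum>j | 1 \<le> msize j \<and> msize j \<le> m. t ^ msize j / mfact j * a j * mpow j x) x = 0"
proof -
  define a' where "a' j = (if msize j = 0 then 0 else a j)" for j
  have "a' (i(k := i k + 2)) = a (i(k := i k + 2))" for i k
    using msize_upd[of i k "i k + 2"] by (simp add: a'_def)
  then have "(\<Sum>k\<in>UNIV. a' (i(k := i k + 2))) = 0" if "msize i + 2 \<le> m" for i using a[OF that] by simp
  then have "laplacian (\<lambda>x. \<Sum>j | msize j \<le> m. t ^ msize j / mfact j * a' j * mpow j x) x = 0"
    by (rule harmonic_taylor_polynomial)
  moreover have "(\<Sum>j | 1 \<le> msize j \<and> msize j \<le> m. t ^ msize j / mfact j * a j * mpow j x) =
      (\<Sum>j | msize j \<le> m. t ^ msize j / mfact j * a' j * mpow j x)" for x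
    by (rule sum.mono_neutral_cong_left[OF finite_msize_le]) (auto simp: a'_def)
  ultimately show ?thesis by simp
qed

lemma laplacian_mpow_1:
  assumes "msize j = 1" shows "laplacian (mpow j) x = 0"
proof -
  have le: "j k \<le> 1" for k using member_le_sum[of k UNIV j] assms by (simp add: msize_def)
  have "real (j k) * real (j k - 1) = 0" for k using le[of k] by simp
  then show ?thesis by (simp only: laplacian_def partial2_mpow) simp
qed

lemma Ck_on_lincomb_mpow: "finite J \<Longrightarrow> Ck_on m UNIV (\<lambda>x. \<Sum>j\<in>J. c j * mpow j x)"
  by (intro Ck_on_sum Ck_on_cmult Ck_on_mpow open_UNIV)

lemma grad_lincomb_mpow:
  assumes "finite J"
  shows "grad (\<lambda>x. \<Sum>j\<in>J. c j * mpow j x) x = (\<Sum>j\<in>J. c j *\<^sub>R grad (mpow j) x)"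
proof -
  have d: "mpow j differentiable (at x)" for j :: "'a mindex" and x
    by (rule Ck_on_differentiable[OF Ck_on_mpow[of 1 UNIV]]) simp_all
  have "partial k (\<lambda>x. \<Sum>j\<in>J. c j * mpow j x) x = (\<Sum>j\<in>J. c j * partial k (mpow j) x)" for k
    by (subst partial_sum[OF assms]) (intro derivative_intros d, simp add: partial_cmult[OF d])
  then show ?thesis by (simp add: grad_def vec_eq_iff)
qed

lemma flux_integral_lincomb:
  fixes G :: "'i \<Rightarrow> real ^ 'n::finite \<Rightarrow> real ^ 'n"
  assumes G: "\<And>j. j \<in> J \<Longrightarrow> loc_integrable UNIV (G j)" and w: "continuous_on UNIV w" and \<psi>: "Ck_on 1 UNIV \<psi>"
    and K: "compact K" "\<And>x. x \<notin> K \<Longrightarrow> w x = 0 \<or> grad \<psi> x = 0"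
  shows "(\<integral>x. w x * ((\<Sum>j\<in>J. c j *\<^sub>R G j x) \<bullet> grad \<psi> x) \<partial>lebesgue) = (\<Sum>j\<in>J. c j * (\<integral>x. w x * (G j x \<bullet> grad \<psi> x) \<partial>lebesgue))"
proof -
  have "w x * ((\<Sum>j\<in>J. c j *\<^sub>R G j x) \<bullet> grad \<psi> x) = (\<Sum>j\<in>J. c j * (w x * (G j x \<bullet> grad \<psi> x)))" for x
    by (simp add: inner_sum_left sum_distrib_left mult.left_commute)
  then have "(\<integral>x. w x * ((\<Sum>j\<in>J. c j *\<^sub>R G j x) \<bullet> grad \<psi> x) \<partial>lebesgue) = (\<Sum>j\<in>J. \<integral>x. c j * (w x * (G j x \<bullet> grad \<psi> x)) \<partial>lebesgue)"
    using flux_integrable[OF G w \<psi> K] by (simp add: Bochner_Integration.integral_sum)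
  then show ?thesis by simp
qed

lemma loc_integrable_cmult:
  fixes f :: "real ^ 'n::finite \<Rightarrow> real"
  shows "loc_integrable UNIV f \<Longrightarrow> loc_integrable UNIV (\<lambda>x. c * f x)"
  by (rule loc_integrable_mult_continuous) simp_all

lemma is_weak_grad_lincomb:
  fixes u :: "'i \<Rightarrow> real ^ 'n::finite \<Rightarrow> real"
  assumes G: "\<And>j. j \<in> J \<Longrightarrow> is_weak_grad UNIV (u j) (G j)"
  shows "is_weak_grad UNIV (\<lambda>x. \<Sum>j\<in>J. c j * u j x) (\<lambda>x. \<Sum>j\<in>J. c j *\<^sub>R G j x)"
  unfolding is_weak_grad_def lebesgue_on_UNIV_eq
proof (intro conjI allI impI)
  show "loc_integrable UNIV (\<lambda>x. \<Sum>j\<in>J. c j * u j x)"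
    by (intro loc_integrable_sum loc_integrable_cmult is_weak_gradD(1)[OF G])
  show "loc_integrable UNIV (\<lambda>x. \<Sum>j\<in>J. c j *\<^sub>R G j x)"
  proof (rule loc_integrable_vec)
    fix k
    have "loc_integrable UNIV (\<lambda>x. \<Sum>j\<in>J. c j * G j x $ k)"
      by (intro loc_integrable_sum loc_integrable_cmult is_weak_gradD(3)[OF G])
    then show "loc_integrable UNIV (\<lambda>x. (\<Sum>j\<in>J. c j *\<^sub>R G j x) $ k)" by simp
  qed
  fix \<psi> :: "real ^ 'n \<Rightarrow> real" and k assume \<psi>: "test_function UNIV \<psi>"
  note t = is_weak_grad_test[OF G open_UNIV \<psi>]
  have "(\<integral>x. (\<Sum>j\<in>J. c j * u j x) * partial k \<psi> x \<partial>lebesgue) = (\<Sum>j\<in>J. c j * (\<integral>x. u j x * partial k \<psi> x \<partial>lebesgue))"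
    using t(2) by (simp add: sum_distrib_right mult.assoc Bochner_Integration.integral_sum)
  also have "\<dots> = - (\<Sum>j\<in>J. c j * (\<integral>x. G j x $ k * \<psi> x \<partial>lebesgue))"
    using t(1) by (simp add: sum_negf[symmetric])
  also have "(\<Sum>j\<in>J. c j * (\<integral>x. G j x $ k * \<psi> x \<partial>lebesgue)) = (\<integral>x. (\<Sum>j\<in>J. c j *\<^sub>R G j x) $ k * \<psi> x \<partial>lebesgue)"
    using t(3) by (simp add: sum_distrib_right mult.assoc Bochner_Integration.integral_sum)
  finally show "(\<integral>x. (\<Sum>j\<in>J. c j * u j x) * partial k \<psi> x \<partial>lebesgue) = - (\<integral>x. (\<Sum>j\<in>J. c j *\<^sub>R G j x) $ k * \<psi> x \<partial>lebesgue)" .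
qed

context liouville_setting
begin

lemma T_op_lincomb:
  assumes J: "finite J" and f: "\<And>j. j \<in> J \<Longrightarrow> L2 (lebesgue_on B) (f j)"
  shows "AE y in lebesgue. T_op B q (\<lambda>x. \<Sum>j\<in>J. c j * f j x) y = (\<Sum>j\<in>J. c j * T_op B q (f j) y)"
proof -
  have "AE y in lebesgue. \<forall>j\<in>J. integrable lebesgue (\<lambda>x. (q x * f j x) * fundamental_solution (x - y))"
    using T_op_AE_integrable[OF f] J by (intro AE_finite_allI) auto
  then show ?thesis
  proof eventually_elim
    case (elim y)
    have "q x * (\<Sum>j\<in>J. c j * f j x) * fundamental_solution (x - y) =
      (\<Sum>j\<in>J. c j * ((q x * f j x) * fundamental_solution (x - y)))" for x
      by (simp add: sum_distrib_left sum_distrib_right mult_ac)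
    then show ?case unfolding T_op_eq using elim by (simp add: Bochner_Integration.integral_sum)
  qed
qed

lemma L2_mpow: "L2 (lebesgue_on B) (mpow j)"
  by (rule L2_continuous[OF _ B(2)]) (use Ck_on_mpow[of 0 UNIV j] B(1) in simp_all)

lemma q_tensor_expansion:
  assumes \<phi>: "\<And>j. j \<in> J \<Longrightarrow> L2 (lebesgue_on B) (\<phi> j)"
  shows "(\<integral>x. q x * ((\<Sum>j\<in>J. c j * mpow j x) + (\<Sum>j\<in>J. c j * \<phi> j x)) * (\<Sum>i\<in>I. b i * mpow i x) \<partial>lebesgue_on B) =
    (\<Sum>j\<in>J. \<Sum>i\<in>I. c j * b i * (Q_tensor B q i j + Q0_tensor B q \<phi> i j))"
proof -
  have fm: "finite_measure (lebesgue_on B)" using B by (intro finite_measure_lebesgue_on_bounded) auto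
  have cont: "continuous_on UNIV (\<lambda>x. q x * mpow i x)" for i
    using Ck_on_mpow[of 0 UNIV i] by (intro continuous_on_mult continuous_q) simp
  have int: "integrable (lebesgue_on B) (\<lambda>x. q x * f x * mpow i x)" if "L2 (lebesgue_on B) f" for f i
    using L2_imp_integrable[OF fm L2_mult_continuous[OF that cont B(2)], of i] by (simp add: mult_ac)
  have "q x * ((\<Sum>j\<in>J. c j * mpow j x) + (\<Sum>j\<in>J. c j * \<phi> j x)) * (\<Sum>i\<in>I. b i * mpow i x) =
    (\<Sum>j\<in>J. \<Sum>i\<in>I. c j * b i * (q x * mpow j x * mpow i x + q x * \<phi> j x * mpow i x))" for x
    unfolding sum.distrib[symmetric] sum_distrib_left
    by (simp add: sum_distrib_left sum_distrib_right algebra_simps sum.distrib sum.swap[of _ J I])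
  then have "(\<integral>x. q x * ((\<Sum>j\<in>J. c j * mpow j x) + (\<Sum>j\<in>J. c j * \<phi> j x)) * (\<Sum>i\<in>I. b i * mpow i x) \<partial>lebesgue_on B) =
    (\<integral>x. (\<Sum>j\<in>J. \<Sum>i\<in>I. c j * b i * (q x * mpow j x * mpow i x + q x * \<phi> j x * mpow i x)) \<partial>lebesgue_on B)" by simp
  also have "\<dots> = (\<Sum>j\<in>J. \<Sum>i\<in>I. \<integral>x. c j * b i * (q x * mpow j x * mpow i x + q x * \<phi> j x * mpow i x) \<partial>lebesgue_on B)"
  proof -
    have i: "integrable (lebesgue_on B) (\<lambda>x. c j * b i * (q x * mpow j x * mpow i x + q x * \<phi> j x * mpow i x))"
      if "j \<in> J" for i j
      by (intro integrable_mult_right Bochner_Integration.integrable_add int L2_mpow \<phi> that)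
    show ?thesis
      by (subst Bochner_Integration.integral_sum) (intro Bochner_Integration.integrable_sum i,
        assumption, intro sum.cong refl Bochner_Integration.integral_sum i, assumption)
  qed
  also have "\<dots> = (\<Sum>j\<in>J. \<Sum>i\<in>I. c j * b i * (Q_tensor B q i j + Q0_tensor B q \<phi> i j))"
    unfolding Q_tensor_def Q0_tensor_def using int[OF L2_mpow] int[OF \<phi>] by (intro sum.cong refl) simp
  finally show ?thesis .
qed

lemma M_tensor_expansion:
  assumes J: "finite J" "finite I" and \<phi>0: "\<And>j. j \<in> J \<Longrightarrow> loc_integrable UNIV (wgrad UNIV (\<phi>0 j))"
  shows "(\<integral>x. D1 x * ((grad (\<lambda>x. \<Sum>j\<in>J. c j * mpow j x) x + (\<Sum>j\<in>J. c j *\<^sub>R wgrad UNIV (\<phi>0 j) x)) \<bullet>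
      grad (\<lambda>x. \<Sum>i\<in>I. b i * mpow i x) x) \<partial>lebesgue_on B) =
    (\<Sum>j\<in>J. \<Sum>i\<in>I. c j * b i * M_diffusion B D1 \<phi>0 i j)"
proof -
  let ?G = "\<lambda>j x. grad (mpow j) x + wgrad UNIV (\<phi>0 j) x"
  have D1_out: "D1 x = 0" if "x \<notin> supp D1" for x using that by (rule not_in_supp)
  have on_B: "(\<integral>x. D1 x * F x \<partial>lebesgue_on B) = (\<integral>x. D1 x * F x \<partial>lebesgue)" for F
    by (rule integral_lebesgue_on_eq(1)) (use B(1) D1(2) D1_out in auto)
  have lG: "loc_integrable UNIV (?G j)" if "j \<in> J" for j
  proof (intro loc_integrable_add \<phi>0 that)
    have "is_weak_grad UNIV (mpow j) (grad (mpow j))" by (rule Ck_is_weak_grad[OF open_UNIV Ck_on_mpow])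
    then show "loc_integrable UNIV (grad (mpow j))" by (rule is_weak_gradD(2))
  qed
  note k = Ck_on_2D(5)[OF D1(1)] Ck_on_mpow[of 1 UNIV] compact_supp_D1
  have int: "integrable lebesgue (\<lambda>x. D1 x * (?G j x \<bullet> grad (mpow i) x))" if "j \<in> J" for i j
    by (rule flux_integrable[OF lG[OF that] k]) (use D1_out in blast)
  have "D1 x * ((grad (\<lambda>x. \<Sum>j\<in>J. c j * mpow j x) x + (\<Sum>j\<in>J. c j *\<^sub>R wgrad UNIV (\<phi>0 j) x)) \<bullet>
      grad (\<lambda>x. \<Sum>i\<in>I. b i * mpow i x) x) = (\<Sum>j\<in>J. \<Sum>i\<in>I. c j * b i * (D1 x * (?G j x \<bullet> grad (mpow i) x)))" for x
  proof -
    have "(\<Sum>j\<in>J. c j *\<^sub>R grad (mpow j) x) + (\<Sum>j\<in>J. c j *\<^sub>R wgrad UNIV (\<phi>0 j) x) = (\<Sum>j\<in>J. c j *\<^sub>R ?G j x)"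
      by (simp add: scaleR_add_right sum.distrib)
    then have "D1 x * ((grad (\<lambda>x. \<Sum>j\<in>J. c j * mpow j x) x + (\<Sum>j\<in>J. c j *\<^sub>R wgrad UNIV (\<phi>0 j) x)) \<bullet>
      grad (\<lambda>x. \<Sum>i\<in>I. b i * mpow i x) x) = D1 x * ((\<Sum>j\<in>J. c j *\<^sub>R ?G j x) \<bullet> (\<Sum>i\<in>I. b i *\<^sub>R grad (mpow i) x))"
      by (simp only: grad_lincomb_mpow[OF J(1)] grad_lincomb_mpow[OF J(2)])
    also have "\<dots> = (\<Sum>j\<in>J. \<Sum>i\<in>I. c j * b i * (D1 x * (?G j x \<bullet> grad (mpow i) x)))"
      unfolding inner_sum_left unfolding inner_sum_right inner_scaleR_left inner_scaleR_right sum_distrib_left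
      by (simp only: mult_ac)
    finally show ?thesis .
  qed
  then have "(\<integral>x. D1 x * ((grad (\<lambda>x. \<Sum>j\<in>J. c j * mpow j x) x + (\<Sum>j\<in>J. c j *\<^sub>R wgrad UNIV (\<phi>0 j) x)) \<bullet>
      grad (\<lambda>x. \<Sum>i\<in>I. b i * mpow i x) x) \<partial>lebesgue) = (\<integral>x. (\<Sum>j\<in>J. \<Sum>i\<in>I. c j * b i * (D1 x * (?G j x \<bullet> grad (mpow i) x))) \<partial>lebesgue)"
    by simp
  also have "\<dots> = (\<Sum>j\<in>J. \<integral>x. (\<Sum>i\<in>I. c j * b i * (D1 x * (?G j x \<bullet> grad (mpow i) x))) \<partial>lebesgue)"
    by (rule Bochner_Integration.integral_sum) (intro Bochner_Integration.integrable_sum integrable_mult_right int)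
  also have "\<dots> = (\<Sum>j\<in>J. \<Sum>i\<in>I. \<integral>x. c j * b i * (D1 x * (?G j x \<bullet> grad (mpow i) x)) \<partial>lebesgue)"
    by (intro sum.cong refl Bochner_Integration.integral_sum integrable_mult_right int)
  finally show ?thesis unfolding on_B M_diffusion_def by simp
qed

lemma corrector_lincomb:
  assumes J: "finite J" and hc: "\<And>j. j \<in> J \<Longrightarrow> helmholtz_corrector B q j (\<phi> j)"
  shows "L2 (lebesgue_on B) (\<lambda>x. \<Sum>j\<in>J. c j * \<phi> j x)"
    and "AE y in lebesgue_on B. (\<Sum>j\<in>J. c j * \<phi> j y) + T_op B q (\<lambda>x. \<Sum>j\<in>J. c j * \<phi> j x) y =
      - T_op B q (\<lambda>x. \<Sum>j\<in>J. c j * mpow j x) y"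
proof -
  have L: "L2 (lebesgue_on B) (\<phi> j)" if "j \<in> J" for j using hc[OF that] by (simp add: helmholtz_corrector_def H1_def)
  show "L2 (lebesgue_on B) (\<lambda>x. \<Sum>j\<in>J. c j * \<phi> j x)" by (intro L2_sum L2_cmult L)
  have "AE y in lebesgue. \<forall>j\<in>J. y \<in> B \<longrightarrow> \<phi> j y + T_op B q (\<phi> j) y = - T_op B q (mpow j) y"
    using hc J by (intro AE_finite_allI) (auto simp: helmholtz_corrector_def AE_B_iff)
  then have "AE y in lebesgue. y \<in> B \<longrightarrow> (\<Sum>j\<in>J. c j * \<phi> j y) + T_op B q (\<lambda>x. \<Sum>j\<in>J. c j * \<phi> j x) y =
      - T_op B q (\<lambda>x. \<Sum>j\<in>J. c j * mpow j x) y"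
    using T_op_lincomb[of J \<phi> c, OF J L, simplified] T_op_lincomb[of J mpow c, OF J L2_mpow, simplified]
  proof eventually_elim
    case (elim y)
    show ?case
    proof
      assume "y \<in> B"
      then have "(\<Sum>j\<in>J. c j * (\<phi> j y + T_op B q (\<phi> j) y)) = (\<Sum>j\<in>J. c j * (- T_op B q (mpow j) y))"
        using elim(1) by (intro sum.cong) auto
      then show "(\<Sum>j\<in>J. c j * \<phi> j y) + T_op B q (\<lambda>x. \<Sum>j\<in>J. c j * \<phi> j x) y =
        - T_op B q (\<lambda>x. \<Sum>j\<in>J. c j * mpow j x) y"
        unfolding elim(2,3) by (simp add: distrib_left sum.distrib sum_negf)
    qed
  qed
  then show "AE y in lebesgue_on B. (\<Sum>j\<in>J. c j * \<phi> j y) + T_op B q (\<lambda>x. \<Sum>j\<in>J. c j * \<phi> j x) y =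
      - T_op B q (\<lambda>x. \<Sum>j\<in>J. c j * mpow j x) y" unfolding AE_B_iff .
qed

text \<open>The difference of the two tensors is a bilinear form on polynomials; it vanishes on pairs of
  harmonic polynomials, because correctors depend linearly on the polynomial.\<close>

lemma tensor_difference_on_harmonic_polynomials:
  assumes T: "\<not> eigenvalue_T B q (- 1)" and J: "finite J" "finite I"
    and hc: "\<And>j. j \<in> J \<Longrightarrow> helmholtz_corrector B q j (\<phi> j)"
    and dc: "\<And>j. j \<in> J \<Longrightarrow> diffusion_corrector B D0 D1 j (\<phi>0 j)"
    and v: "\<And>x. laplacian (\<lambda>x. \<Sum>j\<in>J. c j * mpow j x) x = 0"
    and n: "\<And>x. laplacian (\<lambda>x. \<Sum>i\<in>I. b i * mpow i x) x = 0"
  shows "(\<Sum>j\<in>J. \<Sum>i\<in>I. c j * b i * (M_diffusion B D1 \<phi>0 i j - M_helmholtz D0 B q \<phi> i j)) = 0"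
proof -
  have wg: "is_weak_grad UNIV (\<phi>0 j) (wgrad UNIV (\<phi>0 j))" if "j \<in> J" for j
    using dc[OF that] by (auto simp: diffusion_corrector_def H1_loc_def intro: wgrad_is_weak_grad)
  have lw: "loc_integrable UNIV (wgrad UNIV (\<phi>0 j))" if "j \<in> J" for j by (rule is_weak_gradD(2)[OF wg[OF that]])
  have L0: "L2 (lebesgue_on B) (\<phi>0 j)" if "j \<in> J" for j
  proof (rule L2_lebesgue_on_subset)
    show "L2 (lebesgue_on (closure B)) (\<phi>0 j)"
      using dc[OF that] B(2) by (simp add: diffusion_corrector_def H1_loc_def)
  qed (use B(1) closure_subset in auto)
  have "(\<lambda>x. \<Sum>j\<in>J. c j * \<phi>0 j x) \<in> O[at_infinity](\<lambda>x. norm x powr (1 - real CARD('n)))"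
  proof (rule big_sum_in_bigo)
    fix j assume "j \<in> J"
    then have "\<phi>0 j \<in> O[at_infinity](\<lambda>x. norm x powr (1 - real CARD('n)))" using dc by (simp add: diffusion_corrector_def)
    then show "(\<lambda>x. c j * \<phi>0 j x) \<in> O[at_infinity](\<lambda>x. norm x powr (1 - real CARD('n)))"
      by (cases "c j = 0") simp_all
  qed
  then obtain C where "eventually (\<lambda>x. norm (\<Sum>j\<in>J. c j * \<phi>0 j x) \<le> C * norm (norm x powr (1 - real CARD('n)))) at_infinity"
    by (elim landau_o.bigE)
  then obtain R where R: "\<And>x. norm x \<ge> R \<Longrightarrow> \<bar>\<Sum>j\<in>J. c j * \<phi>0 j x\<bar> \<le> C * norm x powr (1 - real CARD('n))"
    unfolding eventually_at_infinity by auto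
  have test: "(\<integral>x. (D0 + D1 x) * ((\<Sum>j\<in>J. c j *\<^sub>R wgrad UNIV (\<phi>0 j) x) \<bullet> grad \<psi> x) \<partial>lebesgue) =
      - (\<integral>x. D1 x * (grad (\<lambda>x. \<Sum>j\<in>J. c j * mpow j x) x \<bullet> grad \<psi> x) \<partial>lebesgue)" if \<psi>: "test_function UNIV \<psi>" for \<psi>
  proof -
    have C1: "Ck_on 1 UNIV \<psi>" by (rule test_functionD(1)[OF \<psi>])
    have out: "w = 0 \<or> grad \<psi> x = 0" if "x \<notin> supp \<psi>" for x and w :: real
      using partial_not_in_supp[OF that] by (simp add: grad_def vec_eq_iff)
    have gm: "loc_integrable UNIV (grad (mpow j))" for j :: "'n mindex"
      by (rule is_weak_gradD(2)[OF Ck_is_weak_grad[OF open_UNIV Ck_on_mpow]])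
    have "(\<integral>x. (D0 + D1 x) * ((\<Sum>j\<in>J. c j *\<^sub>R wgrad UNIV (\<phi>0 j) x) \<bullet> grad \<psi> x) \<partial>lebesgue) =
      (\<Sum>j\<in>J. c j * (\<integral>x. (D0 + D1 x) * (wgrad UNIV (\<phi>0 j) x \<bullet> grad \<psi> x) \<partial>lebesgue))"
    proof (rule flux_integral_lincomb[OF _ _ C1 test_functionD(2)[OF \<psi>] out])
      show "continuous_on UNIV (\<lambda>x. D0 + D1 x)" by (rule continuous_on_add[OF continuous_on_const Ck_on_2D(5)[OF D1(1)]])
    qed (rule lw)
    also have "\<dots> = - (\<Sum>j\<in>J. c j * (\<integral>x. D1 x * (grad (mpow j) x \<bullet> grad \<psi> x) \<partial>lebesgue))"
      using dc \<psi> by (simp add: diffusion_corrector_def sum_negf[symmetric])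
    also have "(\<Sum>j\<in>J. c j * (\<integral>x. D1 x * (grad (mpow j) x \<bullet> grad \<psi> x) \<partial>lebesgue)) =
      (\<integral>x. D1 x * ((\<Sum>j\<in>J. c j *\<^sub>R grad (mpow j) x) \<bullet> grad \<psi> x) \<partial>lebesgue)"
      by (rule flux_integral_lincomb[OF gm Ck_on_2D(5)[OF D1(1)] C1 test_functionD(2)[OF \<psi>] out, symmetric])
    finally show ?thesis unfolding grad_lincomb_mpow[OF J(1)] .
  qed
  have L: "L2 (lebesgue_on B) (\<phi> j)" if "j \<in> J" for j using hc[OF that] by (simp add: helmholtz_corrector_def H1_def)
  have eq: "(\<Sum>j\<in>J. \<Sum>i\<in>I. c j * b i * M_diffusion B D1 \<phi>0 i j) =
    D0 * (\<Sum>j\<in>J. \<Sum>i\<in>I. c j * b i * (Q_tensor B q i j + Q0_tensor B q \<phi> i j))"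
  proof -
    have m: "(\<integral>x. D1 x * ((grad (\<lambda>x. \<Sum>j\<in>J. c j * mpow j x) x + (\<Sum>j\<in>J. c j *\<^sub>R wgrad UNIV (\<phi>0 j) x)) \<bullet>
        grad (\<lambda>x. \<Sum>i\<in>I. b i * mpow i x) x) \<partial>lebesgue_on B) = (\<Sum>j\<in>J. \<Sum>i\<in>I. c j * b i * M_diffusion B D1 \<phi>0 i j)"
      by (rule M_tensor_expansion[OF J]) (rule lw)
    have h: "(\<integral>x. q x * ((\<Sum>j\<in>J. c j * mpow j x) + (\<Sum>j\<in>J. c j * \<phi> j x)) * (\<Sum>i\<in>I. b i * mpow i x) \<partial>lebesgue_on B) =
        (\<Sum>j\<in>J. \<Sum>i\<in>I. c j * b i * (Q_tensor B q i j + Q0_tensor B q \<phi> i j))"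
      by (rule q_tensor_expansion) (rule L)
    show ?thesis unfolding m[symmetric] h[symmetric]
    proof (rule polarization_tensors_agree[OF T Ck_on_lincomb_mpow[OF J(1)] v Ck_on_lincomb_mpow[OF J(2)] n _ _ _ _ test R])
      show "L2 (lebesgue_on B) (\<lambda>x. \<Sum>j\<in>J. c j * \<phi> j x)" by (rule corrector_lincomb(1)[OF J(1)]) (rule hc)
      show "AE y in lebesgue_on B. (\<Sum>j\<in>J. c j * \<phi> j y) + T_op B q (\<lambda>x. \<Sum>j\<in>J. c j * \<phi> j x) y =
        - T_op B q (\<lambda>x. \<Sum>j\<in>J. c j * mpow j x) y" by (rule corrector_lincomb(2)[OF J(1)]) (rule hc)
      show "is_weak_grad UNIV (\<lambda>x. \<Sum>j\<in>J. c j * \<phi>0 j x) (\<lambda>x. \<Sum>j\<in>J. c j *\<^sub>R wgrad UNIV (\<phi>0 j) x)"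
        by (rule is_weak_grad_lincomb) (rule wg)
      show "L2 (lebesgue_on B) (\<lambda>x. \<Sum>j\<in>J. c j * \<phi>0 j x)" by (intro L2_sum L2_cmult L0)
    qed
  qed
  then show ?thesis
    by (simp add: M_helmholtz_def right_diff_distrib sum_subtractf sum_distrib_left mult.left_commute)
qed

text \<open>For the harmonic function \<open>v = 1\<close> the zero function is a diffusion corrector, and the diffusion
  side of the identity vanishes with \<open>\<nabla>v\<close>.\<close>

lemma helmholtz_tensor_on_harmonic_polynomials:
  assumes T: "\<not> eigenvalue_T B q (- 1)" and I: "finite I"
    and hc: "helmholtz_corrector B q mzero (\<phi> mzero)"
    and n: "\<And>x. laplacian (\<lambda>x. \<Sum>i\<in>I. b i * mpow i x) x = 0"
  shows "(\<Sum>i\<in>I. b i * (Q_tensor B q i mzero + Q0_tensor B q \<phi> i mzero)) = 0"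
proof -
  let ?J = "{mzero :: 'n mindex}" and ?c = "\<lambda>j :: 'n mindex. 1 :: real"
  have J: "finite ?J" by simp
  have hc': "helmholtz_corrector B q j (\<phi> j)" if "j \<in> ?J" for j using that hc by simp
  have L: "L2 (lebesgue_on B) (\<phi> j)" if "j \<in> ?J" for j using hc'[OF that] by (simp add: helmholtz_corrector_def H1_def)
  have g0: "grad (\<lambda>x. \<Sum>j\<in>?J. ?c j * mpow j x) x = 0" for x :: "real ^ 'n"
    by (simp add: mpow_mzero grad_def vec_eq_iff)
  have v: "laplacian (\<lambda>x. \<Sum>j\<in>?J. ?c j * mpow j x) x = 0" for x :: "real ^ 'n"
    by (simp add: mpow_mzero laplacian_def partial_const[abs_def])
  have wg: "is_weak_grad UNIV (\<lambda>x. 0) (\<lambda>x :: real ^ 'n. 0 :: real ^ 'n)" by (simp add: is_weak_grad_def loc_integrable_def)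
  have "(\<integral>x. D1 x * ((grad (\<lambda>x. \<Sum>j\<in>?J. ?c j * mpow j x) x + 0) \<bullet> grad (\<lambda>x. \<Sum>i\<in>I. b i * mpow i x) x) \<partial>lebesgue_on B) =
     D0 * (\<integral>x. q x * ((\<Sum>j\<in>?J. ?c j * mpow j x) + (\<Sum>j\<in>?J. ?c j * \<phi> j x)) * (\<Sum>i\<in>I. b i * mpow i x) \<partial>lebesgue_on B)"
    by (rule polarization_tensors_agree[OF T Ck_on_lincomb_mpow[OF J] v Ck_on_lincomb_mpow[OF I] n
        corrector_lincomb[OF J hc'] wg L2_zero, where C = 0 and R = 0]) (simp_all only: g0, simp_all)
  moreover have "(\<integral>x. q x * ((\<Sum>j\<in>?J. ?c j * mpow j x) + (\<Sum>j\<in>?J. ?c j * \<phi> j x)) * (\<Sum>i\<in>I. b i * mpow i x) \<partial>lebesgue_on B) =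
      (\<Sum>j\<in>?J. \<Sum>i\<in>I. ?c j * b i * (Q_tensor B q i j + Q0_tensor B q \<phi> i j))"
    by (rule q_tensor_expansion) (rule L)
  ultimately have "D0 * (\<Sum>j\<in>?J. \<Sum>i\<in>I. ?c j * b i * (Q_tensor B q i j + Q0_tensor B q \<phi> i j)) = 0"
    unfolding g0 by (simp only: add_0 inner_zero_left mult_zero_right integral_zero)
  then show ?thesis using D0 by simp
qed

end

lemma bigO_L2_if_AE_zero:
  assumes "\<And>\<epsilon>. L2 M (F \<epsilon>)" "\<And>\<epsilon>. AE y in M. F \<epsilon> y = 0"
  shows "bigO_L2 M F n"
proof -
  have "(\<integral>y. (norm (F \<epsilon> y))\<^sup>2 \<partial>M) = 0" for \<epsilon>
    by (rule integral_eq_zero_AE) (use assms(2)[of \<epsilon>] in \<open>eventually_elim, simp\<close>)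
  then show ?thesis unfolding bigO_L2_def L2_norm_def using assms(1) by (intro exI[of _ 0]) simp
qed

section \<open>The relations between the tensors\<close>

theorem proposition3p4:
  fixes \<Omega> B :: "(real ^ 'n::finite) set"
    and x0 :: "real ^ 'n"
    and d0 D0 :: real
    and D1 g V q1 :: "real ^ 'n \<Rightarrow> real"
    and N :: "real ^ 'n \<Rightarrow> real ^ 'n \<Rightarrow> real"
    and dN :: "'n mindex \<Rightarrow> real ^ 'n \<Rightarrow> real"
    and \<phi> \<phi>0 :: "'n mindex \<Rightarrow> real ^ 'n \<Rightarrow> real"
  assumes dim: "2 \<le> CARD('n)" "CARD('n) \<le> 5"
    and Omega: "bounded_lipschitz_domain \<Omega>" "x0 \<in> \<Omega>"
    and B: "bounded_lipschitz_domain B"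
    and dist: "d0 > 0"
      "\<forall>\<^sub>F \<epsilon> in at_right 0. setdist (frontier \<Omega>) ((\<lambda>x. x0 + \<epsilon> *\<^sub>R x) ` B) > d0"
    and D: "D0 > 0" "Ck_on 2 UNIV D1" "supp D1 \<subseteq> B" "\<And>x. D0 + D1 x > 0"
    and g: "L2 (surface_measure \<Omega>) g" "(\<integral>x. g x \<partial>surface_measure \<Omega>) = 0"
    and V: "neumann_solution \<Omega> g V"
    and N: "neumann_function \<Omega> N"
    and dN: "\<And>i. has_boundary_trace \<Omega> (\<lambda>y. mpartial i (\<lambda>x. N x y) x0) (dN i)"
    and q1: "q1 = liouville_potential D0 D1"
    and T: "\<not> eigenvalue_T B q1 (- 1)"
    and \<phi>: "\<And>j. helmholtz_corrector B q1 j (\<phi> j)"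
    and \<phi>0: "\<And>j. diffusion_corrector B D0 D1 j (\<phi>0 j)"
  shows "(\<lambda>\<epsilon>. \<Sum>j | msize j \<le> CARD('n) + 1. \<epsilon> ^ msize j / mfact j * mpartial j V x0 *
            (Q_tensor B q1 mzero j + Q0_tensor B q1 \<phi> mzero j))
          \<in> O[at_right 0](\<lambda>\<epsilon>. \<epsilon> ^ (CARD('n) + 2))
    \<and> bigO_L2 (surface_measure \<Omega>)
        (\<lambda>\<epsilon> y. \<Sum>i | msize i \<le> CARD('n) + 1. \<epsilon> ^ msize i / mfact i * dN i y *
            (Q_tensor B q1 i mzero + Q0_tensor B q1 \<phi> i mzero))
        (CARD('n) + 2)
    \<and> (\<forall>i j. msize i = 1 \<and> msize j = 1 \<longrightarrow>
          M_diffusion B D1 \<phi>0 i j = M_helmholtz D0 B q1 \<phi> i j)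
    \<and> bigO_L2 (surface_measure \<Omega>)
        (\<lambda>\<epsilon> y. \<Sum>j | 1 \<le> msize j \<and> msize j \<le> CARD('n) + 1.
                \<Sum>i | 1 \<le> msize i \<and> msize i \<le> CARD('n) + 1.
            \<epsilon> ^ (msize i + msize j) / (mfact i * mfact j) * dN i y * mpartial j V x0 *
            (M_diffusion B D1 \<phi>0 i j - M_helmholtz D0 B q1 \<phi> i j))
        (CARD('n) + 2)"
proof -
  have bounded_open: "open \<Omega>" "bounded \<Omega>" "open B" "bounded B"
    using Omega(1) B by (simp_all add: bounded_lipschitz_domain_def)
  interpret liouville_setting B D0 D1
    using dim(1) bounded_open D by unfold_locales
  have q: "q1 = q" unfolding q1 q_def ..
  note T' = T[unfolded q] and \<phi>' = \<phi>[unfolded q]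
  let ?m = "CARD('n) + 1" and ?\<sigma> = "surface_measure \<Omega>"
  define V' where "V' j = mpartial j V x0" for j
  have V_rel: "(\<Sum>k\<in>UNIV. V' (i(k := i k + 2))) = 0" for i
  proof -
    have "smooth_on \<Omega> V" using V by (simp add: neumann_solution_def)
    then show ?thesis
      unfolding V'_def by (rule mpartial_harmonic[OF bounded_open(1) _ Omega(2) neumann_solution_harmonic[OF bounded_open(1,2) V]])
  qed
  have N_rel: "AE y in ?\<sigma>. (\<Sum>k\<in>UNIV. dN (i(k := i k + 2)) y) = 0" for i
  proof (rule boundary_trace_sum_zero[OF bounded_open(1,2) N Omega(2) finite, where F = "\<lambda>k y. mpartial (i(k := i k + 2)) (\<lambda>x. N x y) x0"])
    fix y assume y: "y \<in> \<Omega>" "y \<noteq> x0"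
    have "open (\<Omega> - {y})" "x0 \<in> \<Omega> - {y}" using bounded_open(1) Omega(2) y by (auto simp: open_Diff)
    moreover have "smooth_on (\<Omega> - {y}) (\<lambda>x. N x y)" using N y(1) unfolding neumann_function_def by blast
    ultimately show "(\<Sum>k\<in>UNIV. mpartial (i(k := i k + 2)) (\<lambda>x. N x y) x0) = 0"
      by (intro mpartial_harmonic[of "\<Omega> - {y}"] neumann_function_harmonic[OF bounded_open(1) N y(1)])
  qed (rule dN)
  have N_rels: "AE y in ?\<sigma>. \<forall>i\<in>{i. msize i \<le> ?m}. (\<Sum>k\<in>UNIV. dN (i(k := i k + 2)) y) = 0"
    using N_rel by (intro AE_finite_allI finite_msize_le)
  have L2_dN: "L2 ?\<sigma> (dN i)" for i
    using dN[of i] unfolding has_boundary_trace_def has_trace_def by blast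
  have fin: "finite {j :: 'n mindex. 1 \<le> msize j \<and> msize j \<le> ?m}"
    by (rule finite_subset[OF _ finite_msize_le[of ?m]]) auto
  have lap1: "laplacian (\<lambda>x. \<Sum>j\<in>{i}. 1 * mpow j x) x = 0" if "i = mzero \<or> msize i = 1" for i :: "'n mindex" and x
    using that laplacian_mpow_1[of i x] by (auto simp: mpow_mzero laplacian_def partial_const[abs_def])

  have "(\<Sum>j | msize j \<le> ?m. \<epsilon> ^ msize j / mfact j * V' j * (Q_tensor B q mzero j + Q0_tensor B q \<phi> mzero j)) = 0" for \<epsilon>
  proof -
    \<comment> \<open>\<open>n = 1\<close>: the gradient on the diffusion side is \<open>0\<close>, and \<open>D\<^sub>0 > 0\<close> can be cancelled\<close>
    have "(\<Sum>j | msize j \<le> ?m. \<Sum>i\<in>{mzero}. \<epsilon> ^ msize j / mfact j * V' j * 1 *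
        (M_diffusion B D1 \<phi>0 i j - M_helmholtz D0 B q \<phi> i j)) = 0"
      by (rule tensor_difference_on_harmonic_polynomials[OF T' finite_msize_le _ \<phi>' \<phi>0 harmonic_taylor_polynomial[OF V_rel] lap1]) simp_all
    moreover have "M_diffusion B D1 \<phi>0 mzero j = 0" for j
      by (simp add: M_diffusion_def mpow_mzero grad_def inner_vec_def)
    ultimately have "D0 * (\<Sum>j | msize j \<le> ?m. \<epsilon> ^ msize j / mfact j * V' j * (Q_tensor B q mzero j + Q0_tensor B q \<phi> mzero j)) = 0"
      by (simp add: M_helmholtz_def sum_negf sum_distrib_left mult.left_commute)
    then show ?thesis using D(1) by simp
  qed
  then have 1: "(\<lambda>\<epsilon>. \<Sum>j | msize j \<le> ?m. \<epsilon> ^ msize j / mfact j * mpartial j V x0 *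
            (Q_tensor B q mzero j + Q0_tensor B q \<phi> mzero j)) \<in> O[at_right 0](\<lambda>\<epsilon>. \<epsilon> ^ (CARD('n) + 2))"
    unfolding V'_def by simp

  have 2: "bigO_L2 ?\<sigma> (\<lambda>\<epsilon> y. \<Sum>i | msize i \<le> ?m. \<epsilon> ^ msize i / mfact i * dN i y *
            (Q_tensor B q i mzero + Q0_tensor B q \<phi> i mzero)) (CARD('n) + 2)"
  proof (rule bigO_L2_if_AE_zero)
    fix \<epsilon>
    have "L2 ?\<sigma> (\<lambda>y. \<Sum>i | msize i \<le> ?m. (\<epsilon> ^ msize i / mfact i * (Q_tensor B q i mzero + Q0_tensor B q \<phi> i mzero)) * dN i y)"
      by (intro L2_sum L2_cmult L2_dN)
    then show "L2 ?\<sigma> (\<lambda>y. \<Sum>i | msize i \<le> ?m. \<epsilon> ^ msize i / mfact i * dN i y * (Q_tensor B q i mzero + Q0_tensor B q \<phi> i mzero))"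
      by (simp only: mult_ac)
    show "AE y in ?\<sigma>. (\<Sum>i | msize i \<le> ?m. \<epsilon> ^ msize i / mfact i * dN i y * (Q_tensor B q i mzero + Q0_tensor B q \<phi> i mzero)) = 0"
      using N_rels
    proof eventually_elim
      case (elim y)
      show ?case
      proof (rule helmholtz_tensor_on_harmonic_polynomials[OF T' finite_msize_le])
        show "helmholtz_corrector B q mzero (\<phi> mzero)" by (rule \<phi>')
        show "laplacian (\<lambda>x. \<Sum>i | msize i \<le> ?m. \<epsilon> ^ msize i / mfact i * dN i y * mpow i x) x = 0" for x
          by (rule harmonic_taylor_polynomial) (use elim in auto)
      qed
    qed
  qed

  have 3: "M_diffusion B D1 \<phi>0 i j = M_helmholtz D0 B q \<phi> i j" if "msize i = 1" "msize j = 1" for i j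
  proof -
    have "(\<Sum>j\<in>{j}. \<Sum>i\<in>{i}. 1 * 1 * (M_diffusion B D1 \<phi>0 i j - M_helmholtz D0 B q \<phi> i j)) = 0"
      by (rule tensor_difference_on_harmonic_polynomials[OF T' _ _ \<phi>' \<phi>0 lap1 lap1]) (use that in auto)
    then show ?thesis by simp
  qed

  have 4: "bigO_L2 ?\<sigma> (\<lambda>\<epsilon> y. \<Sum>j | 1 \<le> msize j \<and> msize j \<le> ?m. \<Sum>i | 1 \<le> msize i \<and> msize i \<le> ?m.
            \<epsilon> ^ (msize i + msize j) / (mfact i * mfact j) * dN i y * mpartial j V x0 *
            (M_diffusion B D1 \<phi>0 i j - M_helmholtz D0 B q \<phi> i j)) (CARD('n) + 2)"
  proof (rule bigO_L2_if_AE_zero)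
    fix \<epsilon>
    let ?d = "\<lambda>i j. M_diffusion B D1 \<phi>0 i j - M_helmholtz D0 B q \<phi> i j"
    have "L2 ?\<sigma> (\<lambda>y. \<Sum>j | 1 \<le> msize j \<and> msize j \<le> ?m. \<Sum>i | 1 \<le> msize i \<and> msize i \<le> ?m.
            (\<epsilon> ^ (msize i + msize j) / (mfact i * mfact j) * mpartial j V x0 * ?d i j) * dN i y)"
      by (intro L2_sum L2_cmult L2_dN)
    then show "L2 ?\<sigma> (\<lambda>y. \<Sum>j | 1 \<le> msize j \<and> msize j \<le> ?m. \<Sum>i | 1 \<le> msize i \<and> msize i \<le> ?m.
            \<epsilon> ^ (msize i + msize j) / (mfact i * mfact j) * dN i y * mpartial j V x0 * ?d i j)"
      by (simp only: mult_ac)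
    show "AE y in ?\<sigma>. (\<Sum>j | 1 \<le> msize j \<and> msize j \<le> ?m. \<Sum>i | 1 \<le> msize i \<and> msize i \<le> ?m.
            \<epsilon> ^ (msize i + msize j) / (mfact i * mfact j) * dN i y * mpartial j V x0 * ?d i j) = 0"
      using N_rels
    proof eventually_elim
      case (elim y)
      have N_y: "(\<Sum>k\<in>UNIV. dN (i(k := i k + 2)) y) = 0" if "msize i + 2 \<le> ?m" for i
        using elim that by auto
      have "(\<Sum>j | 1 \<le> msize j \<and> msize j \<le> ?m. \<Sum>i | 1 \<le> msize i \<and> msize i \<le> ?m.
         (\<epsilon> ^ msize j / mfact j * V' j) * (\<epsilon> ^ msize i / mfact i * dN i y) * ?d i j) = 0"
      proof (rule tensor_difference_on_harmonic_polynomials[OF T' fin fin \<phi>' \<phi>0])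
        fix x :: "real ^ 'n"
        show "laplacian (\<lambda>x. \<Sum>j | 1 \<le> msize j \<and> msize j \<le> ?m. \<epsilon> ^ msize j / mfact j * V' j * mpow j x) x = 0"
          by (rule harmonic_taylor_polynomial_pos) (rule V_rel)
        show "laplacian (\<lambda>x. \<Sum>i | 1 \<le> msize i \<and> msize i \<le> ?m. \<epsilon> ^ msize i / mfact i * dN i y * mpow i x) x = 0"
          by (rule harmonic_taylor_polynomial_pos) (rule N_y)
      qed
      moreover have "\<epsilon> ^ (msize i + msize j) / (mfact i * mfact j) * dN i y * mpartial j V x0 * ?d i j =
         (\<epsilon> ^ msize j / mfact j * V' j) * (\<epsilon> ^ msize i / mfact i * dN i y) * ?d i j" for i j
        by (simp add: V'_def power_add mult_ac)
      ultimately show ?case by simp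
    qed
  qed
  show ?thesis unfolding q using 1 2 3 4 by blast
qed

end
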